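(* Let $n$ be a positive integer and let $\mathcal{M}$ be an $n$-cluster tilting subcategory of an exact category $\mathcal{E}$. The following conditions are equivalent. (1) $\mathcal{M}$ is an $n\mathbb{Z}$-cluster tilting subcategory of $\mathcal{E}$. (2) For every $X\in\mathcal{M}$ and every admissible $n$-exact sequence $Y: Y^0\to Y^1\to\cdots\to Y^n\to Y^{n+1}$ in $\mathcal{M}$, the following induced sequence of abelian groups (continuing indefinitely to the right through all degrees $kn$, $k\ge 0$) is exact: $$\begin{aligned}0&\to \mathrm{Hom}_{\mathcal{E}}(X,Y^0)\to \mathrm{Hom}_{\mathcal{E}}(X,Y^1)\to\cdots\to \mathrm{Hom}_{\mathcal{E}}(X,Y^n)\to\mathrm{Hom}_{\mathcal{E}}(X,Y^{n+1})\\ &\to \mathrm{Ext}^n_{\mathcal{E}}(X,Y^0)\to \mathrm{Ext}^n_{\mathcal{E}}(X,Y^1)\to\cdots\to \mathrm{Ext}^n_{\mathcal{E}}(X,Y^n)\to\mathrm{Ext}^n_{\mathcal{E}}(X,Y^{n+1})\\ &\to \mathrm{Ext}^{2n}_{\mathcal{E}}(X,Y^0)\to \mathrm{Ext}^{2n}_{\mathcal{E}}(X,Y^1)\to\cdots\to \mathrm{Ext}^{2n}_{\mathcal{E}}(X,Y^n)\to\mathrm{Ext}^{2n}_{\mathcal{E}}(X,Y^{n+1})\to\cdots\end{aligned}$$ (3) For every $Y\in\mathcal{M}$ and every admissible $n$-exact sequence $X: X^0\to X^1\to\cdots\to X^n\to X^{n+1}$ in $\mathcal{M}$, the following induced sequence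 of abelian groups (continuing indefinitely to the right through all degrees $kn$, $k\ge 0$) is exact: $$\begin{aligned}0&\to \mathrm{Hom}_{\mathcal{E}}(X^{n+1},Y)\to \mathrm{Hom}_{\mathcal{E}}(X^n,Y)\to\cdots\to \mathrm{Hom}_{\mathcal{E}}(X^1,Y)\to\mathrm{Hom}_{\mathcal{E}}(X^0,Y)\\ &\to \mathrm{Ext}^n_{\mathcal{E}}(X^{n+1},Y)\to \mathrm{Ext}^n_{\mathcal{E}}(X^n,Y)\to\cdots\to \mathrm{Ext}^n_{\mathcal{E}}(X^1,Y)\to\mathrm{Ext}^n_{\mathcal{E}}(X^0,Y)\\ &\to \mathrm{Ext}^{2n}_{\mathcal{E}}(X^{n+1},Y)\to \mathrm{Ext}^{2n}_{\mathcal{E}}(X^n,Y)\to\cdots\to \mathrm{Ext}^{2n}_{\mathcal{E}}(X^1,Y)\to\mathrm{Ext}^{2n}_{\mathcal{E}}(X^0,Y)\to\cdots\end{aligned}$$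
   Context: All categories are additive; subcategories are full and closed under isomorphisms. Exact categories are in the sense of Quillen (conflations $A\rightarrowtail B\twoheadrightarrow C$ with inflations/admissible monomorphisms $\rightarrowtail$ and deflations/admissible epimorphisms $\twoheadrightarrow$). A sequence in $\mathcal{E}$ is acyclic if it is obtained by splicing conflations. $\mathrm{Ext}^k_{\mathcal{E}}(C,A)$ ($k\ge1$) is the group of Yoneda equivalence classes of $k$-fold extensions, i.e. acyclic sequences $A\rightarrowtail E_{k-1}\to\cdots\to E_0\twoheadrightarrow C$ in $\mathcal{E}$, where Yoneda equivalence is the equivalence relation generated by chain maps that are the identity on $A$ and on $C$. No existence of enough projectives or injectives is assumed. A left $\mathcal{M}$-approximation of $E\in\mathcal{E}$ is a morphism $E\to M$ with $M\in\mathcal{M}$ such that $\mathrm{Hom}(M,M')\to\mathrm{Hom}(E,M')$ is surjective for all $M'\in\mathcal{M}$; right approximations are defined dually. A subcategory $\mathcal{M}$ of $\mathcal{E}$ is $n$-cluster tilting if: (i) every $E\in\mathcal{E}$ has a left $\mathcal{M}$-approximation that is an inflation $E\rightarrowtail M$; (ii) every $E\in\mathcal{E}$ has a right $\mathcal{M}$-approximation that is a deflation $M'\twoheadrightarrow E$; (iii) $\mathcal{M}=\{E\in\mathcal{E}\mid \mathrm{Ext}^i_{\mathcal{E}}(E,\mathcal{M})=0 \text{ for all } 1\le i\le n-1\}=\{E\in\mathcal{E}\mid \mathrm{Ext}^i_{\mathcal{E}}(\mathcal{M},E)=0\text{ for all } 1\le i\le n-1\}$. It is $n\mathbb{Z}$-cluster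 tilting if moreover: (iv) if $\mathrm{Ext}^k_{\mathcal{E}}(\mathcal{M},\mathcal{M})\ne0$ (i.e. $\mathrm{Ext}^k_{\mathcal{E}}(M,N)\neq 0$ for some $M,N\in\mathcal{M}$) then $k\in n\mathbb{Z}$. An $n$-cluster tilting subcategory $\mathcal{M}$ of $\mathcal{E}$ carries a natural $n$-exact structure whose admissible $n$-exact sequences are the acyclic sequences $0\to Y^0\to Y^1\to\cdots\to Y^n\to Y^{n+1}\to0$ in $\mathcal{E}$ with all terms in $\mathcal{M}$. Such a $Y$ has a class in $\mathrm{Ext}^n_{\mathcal{E}}(Y^{n+1},Y^0)$. In the induced sequences, the maps within one degree are induced by the morphisms of the sequence, and the connecting maps $\mathrm{Ext}^{kn}_{\mathcal{E}}(X,Y^{n+1})\to\mathrm{Ext}^{(k+1)n}_{\mathcal{E}}(X,Y^0)$ (resp. $\mathrm{Ext}^{kn}_{\mathcal{E}}(X^0,Y)\to\mathrm{Ext}^{(k+1)n}_{\mathcal{E}}(X^{n+1},Y)$), $k\ge0$, $\mathrm{Ext}^0=\mathrm{Hom}$, are given by Yoneda product (splicing; pullback, resp. pushout, if $k=0$) with the class of the given $n$-exact sequence. *)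

theory Defs
  imports "HOL-Algebra.Coset"
begin

section \<open>Additive and exact categories\<close>

text \<open>
  The arrows carry their source and target, so Hom sets are disjoint.
  \<open>cmp C g f\<close> is the composite of \<open>f\<close> followed by \<open>g\<close>, and \<open>zero C A B\<close> is the zero
  morphism from \<open>A\<close> to \<open>B\<close>.
\<close>

record ('o, 'm) additive_cat =
  obj :: "'o set"
  arr :: "'m set"
  src :: "'m \<Rightarrow> 'o"
  tgt :: "'m \<Rightarrow> 'o"
  ident :: "'o \<Rightarrow> 'm"
  cmp :: "'m \<Rightarrow> 'm \<Rightarrow> 'm" (infixl \<open>\<cdot>\<index>\<close> 75)
  add :: "'m \<Rightarrow> 'm \<Rightarrow> 'm"
  zero :: "'o \<Rightarrow> 'o \<Rightarrow> 'm"

definition Hom :: "('o, 'm, 'x) additive_cat_scheme \<Rightarrow> 'o \<Rightarrow> 'o \<Rightarrow> 'm set"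
  where "Hom C A B = {f \<in> arr C. src C f = A \<and> tgt C f = B}"

definition hom_group :: "('o, 'm, 'x) additive_cat_scheme \<Rightarrow> 'o \<Rightarrow> 'o \<Rightarrow> 'm monoid"
  where "hom_group C A B = \<lparr>carrier = Hom C A B, monoid.mult = add C, one = zero C A B\<rparr>"

definition iso_arr :: "('o, 'm, 'x) additive_cat_scheme \<Rightarrow> 'o \<Rightarrow> 'o \<Rightarrow> 'm \<Rightarrow> bool"
  where "iso_arr C A B f \<longleftrightarrow> f \<in> Hom C A B \<and>
    (\<exists>g\<in>Hom C B A. cmp C g f = ident C A \<and> cmp C f g = ident C B)"

definition zero_object :: "('o, 'm, 'x) additive_cat_scheme \<Rightarrow> 'o \<Rightarrow> bool"
  where "zero_object C Z \<longleftrightarrow> Z \<in> obj C \<and>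
    (\<forall>A\<in>obj C. (\<exists>!f. f \<in> Hom C A Z) \<and> (\<exists>!f. f \<in> Hom C Z A))"

definition biproduct ::
    "('o, 'm, 'x) additive_cat_scheme \<Rightarrow> 'o \<Rightarrow> 'o \<Rightarrow> 'o \<Rightarrow> 'm \<Rightarrow> 'm \<Rightarrow> 'm \<Rightarrow> 'm \<Rightarrow> bool"
  where "biproduct C A B P i1 i2 p1 p2 \<longleftrightarrow>
    i1 \<in> Hom C A P \<and> i2 \<in> Hom C B P \<and> p1 \<in> Hom C P A \<and> p2 \<in> Hom C P B \<and>
    cmp C p1 i1 = ident C A \<and> cmp C p2 i2 = ident C B \<and>
    cmp C p2 i1 = zero C A B \<and> cmp C p1 i2 = zero C B A \<and>
    add C (cmp C i1 p1) (cmp C i2 p2) = ident C P"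

locale additive_category =
  fixes C :: "('o, 'm, 'x) additive_cat_scheme" (structure)
  assumes src_obj: "f \<in> arr C \<Longrightarrow> src C f \<in> obj C"
    and tgt_obj: "f \<in> arr C \<Longrightarrow> tgt C f \<in> obj C"
    and ident_Hom: "A \<in> obj C \<Longrightarrow> ident C A \<in> Hom C A A"
    and comp_Hom: "\<lbrakk>f \<in> Hom C A B; g \<in> Hom C B D\<rbrakk> \<Longrightarrow> g \<cdot> f \<in> Hom C A D"
    and comp_ident_right: "f \<in> Hom C A B \<Longrightarrow> f \<cdot> ident C A = f"
    and comp_ident_left: "f \<in> Hom C A B \<Longrightarrow> ident C B \<cdot> f = f"
    and comp_assoc: "\<lbrakk>f \<in> Hom C A B; g \<in> Hom C B D; h \<in> Hom C D F\<rbrakk>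
      \<Longrightarrow> h \<cdot> (g \<cdot> f) = h \<cdot> g \<cdot> f"
    and hom_group: "\<lbrakk>A \<in> obj C; B \<in> obj C\<rbrakk> \<Longrightarrow> comm_group (hom_group C A B)"
    and comp_add_left: "\<lbrakk>f \<in> Hom C A B; g \<in> Hom C B D; g' \<in> Hom C B D\<rbrakk>
      \<Longrightarrow> add C g g' \<cdot> f = add C (g \<cdot> f) (g' \<cdot> f)"
    and comp_add_right: "\<lbrakk>f \<in> Hom C A B; f' \<in> Hom C A B; g \<in> Hom C B D\<rbrakk>
      \<Longrightarrow> g \<cdot> add C f f' = add C (g \<cdot> f) (g \<cdot> f')"
    and ex_zero_object: "\<exists>Z. zero_object C Z"
    and ex_biproduct: "\<lbrakk>A \<in> obj C; B \<in> obj C\<rbrakk>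
      \<Longrightarrow> \<exists>P i1 i2 p1 p2. biproduct C A B P i1 i2 p1 p2"

definition is_kernel :: "('o, 'm, 'x) additive_cat_scheme \<Rightarrow> 'm \<Rightarrow> 'm \<Rightarrow> bool"
  where "is_kernel C i p \<longleftrightarrow> (\<exists>A B D. i \<in> Hom C A B \<and> p \<in> Hom C B D \<and>
    cmp C p i = zero C A D \<and>
    (\<forall>T\<in>obj C. \<forall>h\<in>Hom C T B. cmp C p h = zero C T D \<longrightarrow>
      (\<exists>!t. t \<in> Hom C T A \<and> cmp C i t = h)))"

definition is_cokernel :: "('o, 'm, 'x) additive_cat_scheme \<Rightarrow> 'm \<Rightarrow> 'm \<Rightarrow> bool"
  where "is_cokernel C p i \<longleftrightarrow> (\<exists>A B D. i \<in> Hom C A B \<and> p \<in> Hom C B D \<and>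
    cmp C p i = zero C A D \<and>
    (\<forall>T\<in>obj C. \<forall>h\<in>Hom C B T. cmp C h i = zero C A T \<longrightarrow>
      (\<exists>!t. t \<in> Hom C D T \<and> cmp C t p = h)))"

text \<open>
  \<open>is_pushout C i f i' f'\<close>: the span \<open>i : A \<rightarrow> B\<close>, \<open>f : A \<rightarrow> A'\<close> has pushout \<open>B'\<close> with
  \<open>i' : A' \<rightarrow> B'\<close> parallel to \<open>i\<close> and \<open>f' : B \<rightarrow> B'\<close> parallel to \<open>f\<close>. Dually,
  \<open>is_pullback C p f p' f'\<close>: the cospan \<open>p : B \<rightarrow> D\<close>, \<open>f : D' \<rightarrow> D\<close> has pullback \<open>B'\<close> with
  \<open>p' : B' \<rightarrow> D'\<close> and \<open>f' : B' \<rightarrow> B\<close>.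
\<close>

definition is_pushout ::
    "('o, 'm, 'x) additive_cat_scheme \<Rightarrow> 'm \<Rightarrow> 'm \<Rightarrow> 'm \<Rightarrow> 'm \<Rightarrow> bool"
  where "is_pushout C i f i' f' \<longleftrightarrow> (\<exists>A B A' B'.
    i \<in> Hom C A B \<and> f \<in> Hom C A A' \<and> i' \<in> Hom C A' B' \<and> f' \<in> Hom C B B' \<and>
    cmp C f' i = cmp C i' f \<and>
    (\<forall>T\<in>obj C. \<forall>g\<in>Hom C B T. \<forall>h\<in>Hom C A' T. cmp C g i = cmp C h f \<longrightarrow>
      (\<exists>!t. t \<in> Hom C B' T \<and> cmp C t f' = g \<and> cmp C t i' = h)))"

definition is_pullback ::
    "('o, 'm, 'x) additive_cat_scheme \<Rightarrow> 'm \<Rightarrow> 'm \<Rightarrow> 'm \<Rightarrow> 'm \<Rightarrow> bool"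
  where "is_pullback C p f p' f' \<longleftrightarrow> (\<exists>B D B' D'.
    p \<in> Hom C B D \<and> f \<in> Hom C D' D \<and> p' \<in> Hom C B' D' \<and> f' \<in> Hom C B' B \<and>
    cmp C p f' = cmp C f p' \<and>
    (\<forall>T\<in>obj C. \<forall>g\<in>Hom C T B. \<forall>h\<in>Hom C T D'. cmp C p g = cmp C f h \<longrightarrow>
      (\<exists>!t. t \<in> Hom C T B' \<and> cmp C f' t = g \<and> cmp C p' t = h)))"

record ('o, 'm) exact_cat = "('o, 'm) additive_cat" +
  conflations :: "('m \<times> 'm) set"

definition inflation :: "('o, 'm, 'x) exact_cat_scheme \<Rightarrow> 'm \<Rightarrow> bool"
  where "inflation E i \<longleftrightarrow> (\<exists>p. (i, p) \<in> conflations E)"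

definition deflation :: "('o, 'm, 'x) exact_cat_scheme \<Rightarrow> 'm \<Rightarrow> bool"
  where "deflation E p \<longleftrightarrow> (\<exists>i. (i, p) \<in> conflations E)"

text \<open>Quillen's axioms, in the (equivalent) self-dual form used by Keller and Buehler.\<close>

locale exact_category = additive_category E
  for E :: "('o, 'm, 'x) exact_cat_scheme" (structure) +
  assumes conflation_kernel_cokernel:
      "(i, p) \<in> conflations E \<Longrightarrow> is_kernel E i p \<and> is_cokernel E p i"
    and conflation_iso:
      "\<lbrakk>(i, p) \<in> conflations E; i \<in> Hom E A B; p \<in> Hom E B D;
        i' \<in> Hom E A' B'; p' \<in> Hom E B' D';
        iso_arr E A A' a; iso_arr E B B' b; iso_arr E D D' d;
        b \<cdot> i = i' \<cdot> a; d \<cdot> p = p' \<cdot> b\<rbrakk> \<Longrightarrow> (i', p') \<in> conflations E"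
    and ident_inflation: "A \<in> obj E \<Longrightarrow> inflation E (ident E A)"
    and ident_deflation: "A \<in> obj E \<Longrightarrow> deflation E (ident E A)"
    and inflation_comp: "\<lbrakk>inflation E i; inflation E j; tgt E i = src E j\<rbrakk>
      \<Longrightarrow> inflation E (j \<cdot> i)"
    and deflation_comp: "\<lbrakk>deflation E p; deflation E q; tgt E p = src E q\<rbrakk>
      \<Longrightarrow> deflation E (q \<cdot> p)"
    and pushout_inflation: "\<lbrakk>inflation E i; i \<in> Hom E A B; f \<in> Hom E A A'\<rbrakk>
      \<Longrightarrow> \<exists>i' f'. is_pushout E i f i' f' \<and> inflation E i'"
    and pullback_deflation: "\<lbrakk>deflation E p; p \<in> Hom E B D; f \<in> Hom E D' D\<rbrakk>
      \<Longrightarrow> \<exists>p' f'. is_pullback E p f p' f' \<and> deflation E p'"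

section \<open>Acyclic sequences and Yoneda equivalence\<close>

text \<open>
  A sequence \<open>X\<^sup>0 \<rightarrow> X\<^sup>1 \<rightarrow> \<dots> \<rightarrow> X\<^sup>r\<close> is the list of its \<open>r\<close> arrows, and \<open>seq_obj E xs j\<close>
  is \<open>X\<^sup>j\<close> for \<open>j \<le> r\<close>.
\<close>

definition seq_obj :: "('o, 'm, 'x) additive_cat_scheme \<Rightarrow> 'm list \<Rightarrow> nat \<Rightarrow> 'o"
  where "seq_obj C xs j =
    (if j < length xs then src C (xs ! j) else tgt C (last xs))"

definition is_seq :: "('o, 'm, 'x) additive_cat_scheme \<Rightarrow> 'm list \<Rightarrow> bool"
  where "is_seq C xs \<longleftrightarrow> xs \<noteq> [] \<and>
    (\<forall>j<length xs. xs ! j \<in> Hom C (seq_obj C xs j) (seq_obj C xs (Suc j)))"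

text \<open>
  Splicing \<open>A \<rightarrow> \<dots> \<rightarrow> F \<rightarrow> K\<close> with \<open>K \<rightarrow> G \<rightarrow> \<dots> \<rightarrow> D\<close> replaces the two arrows at \<open>K\<close> by
  their composite \<open>F \<rightarrow> G\<close>.
\<close>

definition splice :: "('o, 'm, 'x) additive_cat_scheme \<Rightarrow> 'm list \<Rightarrow> 'm list \<Rightarrow> 'm list"
  where "splice C xs ys = butlast xs @ [cmp C (hd ys) (last xs)] @ tl ys"

text \<open>
  The sequences \<open>0 \<rightarrow> X\<^sup>0 \<rightarrow> \<dots> \<rightarrow> X\<^sup>r \<rightarrow> 0\<close> with \<open>r \<ge> 2\<close> obtained by splicing conflations,
  without the outer zero objects.
\<close>

inductive acyclic_seq :: "('o, 'm, 'x) exact_cat_scheme \<Rightarrow> 'm list \<Rightarrow> bool"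
  for E :: "('o, 'm, 'x) exact_cat_scheme" where
  conflation: "(i, p) \<in> conflations E \<Longrightarrow> acyclic_seq E [i, p]"
| splice: "\<lbrakk>acyclic_seq E xs; (i, p) \<in> conflations E; tgt E (last xs) = src E i\<rbrakk>
    \<Longrightarrow> acyclic_seq E (splice E xs [i, p])"

text \<open>The \<open>k\<close>-fold extensions of \<open>D\<close> by \<open>A\<close>, for \<open>k \<ge> 1\<close>.\<close>

definition extensions ::
    "('o, 'm, 'x) exact_cat_scheme \<Rightarrow> nat \<Rightarrow> 'o \<Rightarrow> 'o \<Rightarrow> 'm list set"
  where "extensions E k D A = {xs. acyclic_seq E xs \<and> length xs = Suc k \<and>
    src E (hd xs) = A \<and> tgt E (last xs) = D}"

definition yoneda_step :: "('o, 'm, 'x) exact_cat_scheme \<Rightarrow> 'm list \<Rightarrow> 'm list \<Rightarrow> bool"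
  where "yoneda_step E xs ys \<longleftrightarrow>
    (\<exists>k A D f. xs \<in> extensions E k D A \<and> ys \<in> extensions E k D A \<and>
      (\<forall>j\<le>Suc k. f j \<in> Hom E (seq_obj E xs j) (seq_obj E ys j)) \<and>
      (\<forall>j<Suc k. cmp E (f (Suc j)) (xs ! j) = cmp E (ys ! j) (f j)) \<and>
      f 0 = ident E A \<and> f (Suc k) = ident E D)"

definition yoneda_rel :: "('o, 'm, 'x) exact_cat_scheme \<Rightarrow> ('m list \<times> 'm list) set"
  where "yoneda_rel E = {(xs, ys). equivclp (yoneda_step E) xs ys}"

definition ext_class :: "('o, 'm, 'x) exact_cat_scheme \<Rightarrow> 'm list \<Rightarrow> 'm list set"
  where "ext_class E xs = yoneda_rel E `` {xs}"

section \<open>The groups Ext and their functoriality\<close>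

text \<open>
  Elements of \<open>Ext\<^sup>k(D,A)\<close> are Yoneda classes of extensions if \<open>k \<ge> 1\<close>. To have a single type
  for all degrees, a morphism \<open>f\<close> in \<open>Ext\<^sup>0(D,A) = Hom(D,A)\<close> is encoded as \<open>{[f]}\<close>.
\<close>

definition hom_elem :: "'m \<Rightarrow> 'm list set"
  where "hom_elem f = {[f]}"

definition elem_hom :: "'m list set \<Rightarrow> 'm"
  where "elem_hom a = hd (the_elem a)"

definition Ext_carrier ::
    "('o, 'm, 'x) exact_cat_scheme \<Rightarrow> nat \<Rightarrow> 'o \<Rightarrow> 'o \<Rightarrow> 'm list set set"
  where "Ext_carrier E k D A =
    (if k = 0 then hom_elem ` Hom E D A else extensions E k D A // yoneda_rel E)"

text \<open>
  The pushout of an extension \<open>A \<rightarrow> F \<rightarrow> F' \<rightarrow> \<dots> \<rightarrow> D\<close> along \<open>f : A \<rightarrow> A'\<close> replaces \<open>F\<close> by the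
  pushout of \<open>A \<rightarrow> F\<close> along \<open>f\<close>, the next arrow being the one induced by \<open>F \<rightarrow> F'\<close> and
  \<open>0 : A' \<rightarrow> F'\<close>. Dually for the pullback along \<open>f : D' \<rightarrow> D\<close>.
\<close>

definition pushout_extension ::
    "('o, 'm, 'x) exact_cat_scheme \<Rightarrow> 'm \<Rightarrow> 'm list \<Rightarrow> 'm list \<Rightarrow> bool"
  where "pushout_extension E f xs ys \<longleftrightarrow> (\<exists>i e zs i' f' e'.
    xs = i # e # zs \<and> ys = i' # e' # zs \<and> is_pushout E i f i' f' \<and>
    e' \<in> Hom E (tgt E i') (tgt E e) \<and>
    cmp E e' f' = e \<and> cmp E e' i' = zero E (tgt E f) (tgt E e))"

definition pullback_extension ::
    "('o, 'm, 'x) exact_cat_scheme \<Rightarrow> 'm \<Rightarrow> 'm list \<Rightarrow> 'm list \<Rightarrow> bool"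
  where "pullback_extension E f xs ys \<longleftrightarrow> (\<exists>p e zs p' f' e'.
    xs = zs @ [e, p] \<and> ys = zs @ [e', p'] \<and> is_pullback E p f p' f' \<and>
    e' \<in> Hom E (src E e) (src E p') \<and>
    cmp E f' e' = e \<and>
    cmp E p' e' = zero E (src E e) (src E f))"

text \<open>
  The maps \<open>Ext\<^sup>k(D,A) \<rightarrow> Ext\<^sup>k(D,A')\<close> and \<open>Ext\<^sup>k(D,A) \<rightarrow> Ext\<^sup>k(D',A)\<close> induced by
  \<open>f : A \<rightarrow> A'\<close>, resp. \<open>f : D' \<rightarrow> D\<close>. Since the Yoneda class of the result depends neither on the
  representative nor on the chosen pushout or pullback, the union below is a single class.
\<close>

definition Ext_push ::
    "('o, 'm, 'x) exact_cat_scheme \<Rightarrow> nat \<Rightarrow> 'm \<Rightarrow> 'm list set \<Rightarrow> 'm list set"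
  where "Ext_push E k f a =
    (if k = 0 then hom_elem (cmp E f (elem_hom a))
     else \<Union>{ext_class E ys |xs ys. xs \<in> a \<and> pushout_extension E f xs ys})"

definition Ext_pull ::
    "('o, 'm, 'x) exact_cat_scheme \<Rightarrow> nat \<Rightarrow> 'm \<Rightarrow> 'm list set \<Rightarrow> 'm list set"
  where "Ext_pull E k f a =
    (if k = 0 then hom_elem (cmp E (elem_hom a) f)
     else \<Union>{ext_class E ys |xs ys. xs \<in> a \<and> pullback_extension E f xs ys})"

text \<open>
  Baer sum: \<open>\<nabla>(\<xi> \<oplus> \<eta>)\<Delta>\<close>, where \<open>\<Delta> : D \<rightarrow> D \<oplus> D\<close> is the sum of the injections and
  \<open>\<nabla> : A \<oplus> A \<rightarrow> A\<close> is the sum of the projections.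
\<close>

definition direct_sum_seq ::
    "('o, 'm, 'x) additive_cat_scheme \<Rightarrow> 'm list \<Rightarrow> 'm list \<Rightarrow> 'm list \<Rightarrow>
      (nat \<Rightarrow> 'm) \<Rightarrow> (nat \<Rightarrow> 'm) \<Rightarrow> (nat \<Rightarrow> 'm) \<Rightarrow> (nat \<Rightarrow> 'm) \<Rightarrow> bool"
  where "direct_sum_seq C xs ys ss i1 i2 p1 p2 \<longleftrightarrow>
    is_seq C ss \<and> length xs = length ss \<and> length ys = length ss \<and>
    (\<forall>j\<le>length ss. biproduct C (seq_obj C xs j) (seq_obj C ys j) (seq_obj C ss j)
      (i1 j) (i2 j) (p1 j) (p2 j)) \<and>
    (\<forall>j<length ss. cmp C (ss ! j) (i1 j) = cmp C (i1 (Suc j)) (xs ! j) \<and>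
      cmp C (ss ! j) (i2 j) = cmp C (i2 (Suc j)) (ys ! j))"

definition Ext_add ::
    "('o, 'm, 'x) exact_cat_scheme \<Rightarrow> nat \<Rightarrow> 'm list set \<Rightarrow> 'm list set \<Rightarrow> 'm list set"
  where "Ext_add E k a b =
    (if k = 0 then hom_elem (add E (elem_hom a) (elem_hom b))
     else \<Union>{Ext_push E k (add E (p1 0) (p2 0))
              (Ext_pull E k (add E (i1 (Suc k)) (i2 (Suc k))) (ext_class E ss))
            |xs ys ss i1 i2 p1 p2. xs \<in> a \<and> ys \<in> b \<and> direct_sum_seq E xs ys ss i1 i2 p1 p2})"

text \<open>
  The trivial extension is \<open>A \<rightarrow> A \<oplus> D \<rightarrow> D\<close> if \<open>k = 1\<close> and
  \<open>A = A \<rightarrow> 0 \<rightarrow> \<dots> \<rightarrow> 0 \<rightarrow> D = D\<close> if \<open>k \<ge> 2\<close>.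
\<close>

definition trivial_extension ::
    "('o, 'm, 'x) exact_cat_scheme \<Rightarrow> nat \<Rightarrow> 'o \<Rightarrow> 'o \<Rightarrow> 'm list \<Rightarrow> bool"
  where "trivial_extension E k D A xs \<longleftrightarrow>
    (if k = 1 then \<exists>P i1 i2 p1 p2. biproduct E A D P i1 i2 p1 p2 \<and> xs = [i1, p2]
     else is_seq E xs \<and> length xs = Suc k \<and> xs ! 0 = ident E A \<and> xs ! k = ident E D \<and>
       (\<forall>j. 1 \<le> j \<and> j < k \<longrightarrow> xs ! j = zero E (seq_obj E xs j) (seq_obj E xs (Suc j))) \<and>
       (\<forall>j. 2 \<le> j \<and> j < k \<longrightarrow> zero_object E (seq_obj E xs j)))"

definition Ext_zero :: "('o, 'm, 'x) exact_cat_scheme \<Rightarrow> nat \<Rightarrow> 'o \<Rightarrow> 'o \<Rightarrow> 'm list set"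
  where "Ext_zero E k D A =
    (if k = 0 then hom_elem (zero E D A)
     else \<Union>{ext_class E xs |xs. trivial_extension E k D A xs})"

definition Ext ::
    "('o, 'm, 'x) exact_cat_scheme \<Rightarrow> nat \<Rightarrow> 'o \<Rightarrow> 'o \<Rightarrow> 'm list set monoid"
  where "Ext E k D A =
    \<lparr>carrier = Ext_carrier E k D A, monoid.mult = Ext_add E k, one = Ext_zero E k D A\<rparr>"

definition Ext_vanishes :: "('o, 'm, 'x) exact_cat_scheme \<Rightarrow> nat \<Rightarrow> 'o \<Rightarrow> 'o \<Rightarrow> bool"
  where "Ext_vanishes E k D A \<longleftrightarrow> carrier (Ext E k D A) = {\<one>\<^bsub>Ext E k D A\<^esub>}"

text \<open>
  Yoneda product of \<open>b \<in> Ext\<^sup>l(K,A)\<close> and \<open>a \<in> Ext\<^sup>k(D,K)\<close>, an element of \<open>Ext\<^sup>k\<^sup>+\<^sup>l(D,A)\<close>.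
\<close>

definition yoneda_product ::
    "('o, 'm, 'x) exact_cat_scheme \<Rightarrow> nat \<Rightarrow> nat \<Rightarrow> 'm list set \<Rightarrow> 'm list set \<Rightarrow> 'm list set"
  where "yoneda_product E l k b a =
    (if k = 0 then Ext_pull E l (elem_hom a) b
     else if l = 0 then Ext_push E k (elem_hom b) a
     else \<Union>{ext_class E (splice E ys xs) |ys xs. ys \<in> b \<and> xs \<in> a})"

section \<open>Cluster tilting subcategories\<close>

text \<open>A full subcategory is given by its set of objects.\<close>

definition additive_subcategory :: "('o, 'm, 'x) additive_cat_scheme \<Rightarrow> 'o set \<Rightarrow> bool"
  where "additive_subcategory C M \<longleftrightarrow> M \<subseteq> obj C \<and>
    (\<forall>A B f. A \<in> M \<and> iso_arr C A B f \<longrightarrow> B \<in> M) \<and>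
    (\<exists>Z\<in>M. zero_object C Z) \<and>
    (\<forall>A B P i1 i2 p1 p2. A \<in> M \<and> B \<in> M \<and> biproduct C A B P i1 i2 p1 p2 \<longrightarrow> P \<in> M)"

definition left_approximation ::
    "('o, 'm, 'x) additive_cat_scheme \<Rightarrow> 'o set \<Rightarrow> 'o \<Rightarrow> 'm \<Rightarrow> bool"
  where "left_approximation C M X f \<longleftrightarrow> (\<exists>N\<in>M. f \<in> Hom C X N \<and>
    (\<forall>N'\<in>M. (\<lambda>h. cmp C h f) ` Hom C N N' = Hom C X N'))"

definition right_approximation ::
    "('o, 'm, 'x) additive_cat_scheme \<Rightarrow> 'o set \<Rightarrow> 'o \<Rightarrow> 'm \<Rightarrow> bool"
  where "right_approximation C M X f \<longleftrightarrow> (\<exists>N\<in>M. f \<in> Hom C N X \<and>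
    (\<forall>N'\<in>M. (\<lambda>h. cmp C f h) ` Hom C N' N = Hom C N' X))"

definition cluster_tilting :: "('o, 'm, 'x) exact_cat_scheme \<Rightarrow> nat \<Rightarrow> 'o set \<Rightarrow> bool"
  where "cluster_tilting E n M \<longleftrightarrow> additive_subcategory E M \<and>
    (\<forall>X\<in>obj E. \<exists>f. left_approximation E M X f \<and> inflation E f) \<and>
    (\<forall>X\<in>obj E. \<exists>f. right_approximation E M X f \<and> deflation E f) \<and>
    M = {X \<in> obj E. \<forall>i. 1 \<le> i \<and> i \<le> n - 1 \<longrightarrow> (\<forall>N\<in>M. Ext_vanishes E i X N)} \<and>
    M = {X \<in> obj E. \<forall>i. 1 \<le> i \<and> i \<le> n - 1 \<longrightarrow> (\<forall>N\<in>M. Ext_vanishes E i N X)}"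

definition Z_cluster_tilting :: "('o, 'm, 'x) exact_cat_scheme \<Rightarrow> nat \<Rightarrow> 'o set \<Rightarrow> bool"
  where "Z_cluster_tilting E n M \<longleftrightarrow> cluster_tilting E n M \<and>
    (\<forall>k. (\<exists>N\<in>M. \<exists>N'\<in>M. \<not> Ext_vanishes E k N N') \<longrightarrow> n dvd k)"

definition admissible_n_exact ::
    "('o, 'm, 'x) exact_cat_scheme \<Rightarrow> nat \<Rightarrow> 'o set \<Rightarrow> 'm list \<Rightarrow> bool"
  where "admissible_n_exact E n M ys \<longleftrightarrow>
    acyclic_seq E ys \<and> length ys = n + 1 \<and> (\<forall>j\<le>n + 1. seq_obj E ys j \<in> M)"

section \<open>The long sequences\<close>

text \<open>Exactness of \<open>0 \<rightarrow> G\<^sub>0 \<rightarrow> G\<^sub>1 \<rightarrow> G\<^sub>2 \<rightarrow> \<dots>\<close>, where \<open>\<phi> m : G\<^sub>m \<rightarrow> G\<^sub>m\<^sub>+\<^sub>1\<close>.\<close>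

definition long_exact :: "(nat \<Rightarrow> 'a monoid) \<Rightarrow> (nat \<Rightarrow> 'a \<Rightarrow> 'a) \<Rightarrow> bool"
  where "long_exact G \<phi> \<longleftrightarrow>
    kernel (G 0) (G 1) (\<phi> 0) = {\<one>\<^bsub>G 0\<^esub>} \<and>
    (\<forall>m. \<phi> m ` carrier (G m) = kernel (G (Suc m)) (G (Suc (Suc m))) (\<phi> (Suc m)))"

text \<open>
  Every row of the long sequence has \<open>n + 2\<close> terms, so position \<open>m = k (n + 2) + j\<close> with
  \<open>0 \<le> j \<le> n + 1\<close> holds \<open>Ext\<^sup>k\<^sup>n(X, Y\<^sup>j)\<close>, resp. \<open>Ext\<^sup>k\<^sup>n(X\<^sup>n\<^sup>+\<^sup>1\<^sup>-\<^sup>j, Y)\<close>, and the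
  connecting maps start at the positions with \<open>j = n + 1\<close>.
\<close>

definition cov_group ::
    "('o, 'm, 'x) exact_cat_scheme \<Rightarrow> nat \<Rightarrow> 'o \<Rightarrow> 'm list \<Rightarrow> nat \<Rightarrow> 'm list set monoid"
  where "cov_group E n X ys m =
    (let k = m div (n + 2); j = m mod (n + 2) in Ext E (k * n) X (seq_obj E ys j))"

definition cov_map ::
    "('o, 'm, 'x) exact_cat_scheme \<Rightarrow> nat \<Rightarrow> 'm list \<Rightarrow> nat \<Rightarrow> 'm list set \<Rightarrow> 'm list set"
  where "cov_map E n ys m =
    (let k = m div (n + 2); j = m mod (n + 2) in
      if j \<le> n then Ext_push E (k * n) (ys ! j)
      else (\<lambda>a. yoneda_product E n (k * n) (ext_class E ys) a))"

definition contra_group ::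
    "('o, 'm, 'x) exact_cat_scheme \<Rightarrow> nat \<Rightarrow> 'm list \<Rightarrow> 'o \<Rightarrow> nat \<Rightarrow> 'm list set monoid"
  where "contra_group E n xs Y m =
    (let k = m div (n + 2); j = m mod (n + 2) in Ext E (k * n) (seq_obj E xs (n + 1 - j)) Y)"

definition contra_map ::
    "('o, 'm, 'x) exact_cat_scheme \<Rightarrow> nat \<Rightarrow> 'm list \<Rightarrow> nat \<Rightarrow> 'm list set \<Rightarrow> 'm list set"
  where "contra_map E n xs m =
    (let k = m div (n + 2); j = m mod (n + 2) in
      if j \<le> n then Ext_pull E (k * n) (xs ! (n - j))
      else (\<lambda>b. yoneda_product E (k * n) n b (ext_class E xs)))"

end

theory Submission
  imports Defs
begin

text \<open>
  An admissible \<open>n\<close>-exact sequence \<open>Y\<close> decomposes into conflations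
  \<open>K\<^sub>j \<rightarrow> Y\<^sup>j\<^sup>+\<^sup>1 \<rightarrow>
  K\<^sub>j\<^sub>+\<^sub>1\<close> with \<open>K\<^sub>0 = Y\<^sup>0\<close> and
  \<open>K\<^sub>n = Y\<^sup>n\<^sup>+\<^sup>1\<close>. Both implications of the theorem are
  dimension shifts along these conflations, by means of the long exact sequence of \<open>Ext(X,
  -)\<close>.

  Suppose that \<open>Ext\<close> vanishes on \<open>M\<close> outside the degrees divisible by
  \<open>n\<close>. Shifting to \<open>K\<^sub>n\<close> shows that \<open>Ext\<^sup>m(X,
  K\<^sub>j) = 0\<close> if the residue of \<open>m\<close> modulo \<open>n\<close> exceeds
  \<open>n - j\<close>, and shifting to \<open>K\<^sub>0\<close> shows the same for nonzero
  residues less than \<open>n - j\<close> (\<open>resolution_vanishes_from_right\<close>,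
  \<open>resolution_vanishes_from_left\<close>). The obstructions to exactness of the spliced
  sequence lie in these groups, and the product with the class of \<open>Y\<close> is a
  composite of \<open>n\<close> connecting maps of which only the first has a kernel and only
  the last a cokernel that matters (\<open>long_exact_cov_if_vanishing\<close>).

  Conversely, let \<open>a \<in> Ext\<^sup>k(X, N)\<close> with \<open>k = q n + r\<close>,
  \<open>q \<ge> 1\<close> and \<open>0 < r < n\<close>. Some inflation from \<open>N\<close> to
  an object of \<open>M\<close> kills \<open>a\<close>, and left approximations continue it to
  an admissible \<open>n\<close>-exact sequence (\<open>cluster_tilting_resolution\<close>). By
  induction on \<open>k\<close>, \<open>a\<close> comes from some \<open>b \<in>
  Ext\<^sup>q\<^sup>n(X, K\<^sub>r)\<close>, and \<open>Ext\<^sup>q\<^sup>n(X, K\<^sub>r)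
  \<rightarrow> Ext\<^sup>q\<^sup>n(X, Y\<^sup>r\<^sup>+\<^sup>1)\<close> is injective.
  Exactness of the long sequence at \<open>Ext\<^sup>q\<^sup>n(X,
  Y\<^sup>r\<^sup>+\<^sup>1)\<close> therefore lifts \<open>b\<close> to
  \<open>Ext\<^sup>q\<^sup>n(X, Y\<^sup>r)\<close>, so that its image \<open>a\<close> is zero
  (\<open>vanishing_if_cov_exact_row\<close>).

  The long exact sequence itself is derived from a description of
  \<open>Ext\<^sup>k\<^sup>+\<^sup>1\<close> in terms of \<open>Ext\<^sup>k\<close>: every
  element of \<open>Ext\<^sup>k\<^sup>+\<^sup>1(X, A)\<close> is a product \<open>\<sigma>
  \<cdot> g\<close> of a conflation \<open>\<sigma>\<close> that starts in \<open>A\<close> with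
  an element \<open>g\<close> of \<open>Ext\<^sup>k(X, -)\<close>, and the equalities between
  such products are generated by \<open>\<sigma> \<cdot> g = \<sigma>' \<cdot> c\<^sub>*
  g\<close> for the morphisms \<open>\<sigma> \<rightarrow> \<sigma>'\<close> with components
  \<open>1, b, c\<close> (\<open>con_eq_invariant\<close>). An induction on \<open>k\<close>
  then shows that \<open>Ext\<^sup>k(X, -)\<close> preserves finite sums
  (\<open>Ext_additive\<close>), so that differences of its elements can be formed, and a second
  one gives the three exactness statements \<open>Ext_exact_middle\<close>,
  \<open>Ext_exact_right\<close> and \<open>Ext_exact_left\<close>.

  The contravariant half of the theorem is the covariant half for the opposite category, in
  which extensions are read backwards (\<open>long_exact_contra_iff_op\<close>).
\<close>

section \<open>Additive categories\<close>

definition neg :: "('o, 'm, 'x) additive_cat_scheme \<Rightarrow> 'm \<Rightarrow> 'm"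
  where "neg C f = m_inv (hom_group C (src C f) (tgt C f)) f"

context additive_category
begin

lemma HomD:
  assumes "f \<in> Hom C A B"
  shows "f \<in> arr C" "src C f = A" "tgt C f = B" "A \<in> obj C" "B \<in> obj C"
  using assms src_obj tgt_obj by (auto simp: Hom_def)

lemma arr_in_Hom: "f \<in> arr C \<Longrightarrow> f \<in> Hom C (src C f) (tgt C f)"
  by (simp add: Hom_def)

lemma comp_arr:
  assumes "f \<in> arr C" "g \<in> arr C" "src C g = tgt C f"
  shows "g \<cdot> f \<in> arr C" "src C (g \<cdot> f) = src C f" "tgt C (g \<cdot> f) = tgt C g"
proof -
  have "g \<cdot> f \<in> Hom C (src C f) (tgt C g)"
    by (rule comp_Hom[of _ _ "tgt C f"]) (use assms in \<open>auto simp: Hom_def\<close>)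
  then show "g \<cdot> f \<in> arr C" "src C (g \<cdot> f) = src C f" "tgt C (g \<cdot> f) = tgt C g"
    by (auto simp: Hom_def)
qed

lemma comp_assoc_right:
  assumes "f \<in> arr C" "g \<in> arr C" "h \<in> arr C" "src C g = tgt C f" "src C h = tgt C g"
  shows "(h \<cdot> g) \<cdot> f = h \<cdot> (g \<cdot> f)"
  by (rule comp_assoc[symmetric]) (use assms in \<open>auto simp: Hom_def\<close>)

text \<open>
  Composites are normalized to be associated to the right. An equation between composites of two
  arrows applies inside a longer composite only in this form.
\<close>

lemma comp_cong_tail:
  assumes "g \<cdot> f = h" "f \<in> arr C" "g \<in> arr C" "src C g = tgt C f" "t \<in> arr C" "tgt C t = src C f"
  shows "g \<cdot> (f \<cdot> t) = h \<cdot> t"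
  using assms comp_assoc_right by metis

lemma ident_arr:
  assumes "A \<in> obj C"
  shows "ident C A \<in> arr C" "src C (ident C A) = A" "tgt C (ident C A) = A"
  using ident_Hom[OF assms] by (auto simp: Hom_def)

lemma ident_comp: "f \<in> arr C \<Longrightarrow> tgt C f = B \<Longrightarrow> ident C B \<cdot> f = f"
  by (rule comp_ident_left) (auto simp: Hom_def)

lemma comp_ident: "f \<in> arr C \<Longrightarrow> src C f = A \<Longrightarrow> f \<cdot> ident C A = f"
  by (rule comp_ident_right) (auto simp: Hom_def)

lemma zero_Hom: "A \<in> obj C \<Longrightarrow> B \<in> obj C \<Longrightarrow> zero C A B \<in> Hom C A B"
  using comm_group.axioms(2)[OF hom_group, of A B] group.is_monoid monoid.one_closed
  by (fastforce simp: hom_group_def)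

lemma zero_arr:
  assumes "A \<in> obj C" "B \<in> obj C"
  shows "zero C A B \<in> arr C" "src C (zero C A B) = A" "tgt C (zero C A B) = B"
  using zero_Hom[OF assms] by (auto simp: Hom_def)

lemma hom_add:
  assumes "A \<in> obj C" "B \<in> obj C"
  shows add_Hom: "f \<in> Hom C A B \<Longrightarrow> g \<in> Hom C A B \<Longrightarrow> add C f g \<in> Hom C A B"
    and add_zero_Hom: "f \<in> Hom C A B \<Longrightarrow> add C f (zero C A B) = f"
    and zero_add_Hom: "f \<in> Hom C A B \<Longrightarrow> add C (zero C A B) f = f"
    and add_comm_Hom: "f \<in> Hom C A B \<Longrightarrow> g \<in> Hom C A B \<Longrightarrow> add C f g = add C g f"
    and add_assoc_Hom: "f \<in> Hom C A B \<Longrightarrow> g \<in> Hom C A B \<Longrightarrow> h \<in> Hom C A B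
      \<Longrightarrow> add C (add C f g) h = add C f (add C g h)"
    and neg_Hom: "f \<in> Hom C A B \<Longrightarrow> neg C f \<in> Hom C A B"
    and add_neg_Hom: "f \<in> Hom C A B \<Longrightarrow> add C f (neg C f) = zero C A B"
    and add_cancel_Hom: "f \<in> Hom C A B \<Longrightarrow> g \<in> Hom C A B \<Longrightarrow> h \<in> Hom C A B
      \<Longrightarrow> add C f g = add C f h \<Longrightarrow> g = h"
proof -
  interpret G: comm_group "hom_group C A B" by (rule hom_group) fact+
  have [simp]: "carrier (hom_group C A B) = Hom C A B" "mult (hom_group C A B) = add C"
      "one (hom_group C A B) = zero C A B"
    by (auto simp: hom_group_def)
  show "f \<in> Hom C A B \<Longrightarrow> g \<in> Hom C A B \<Longrightarrow> add C f g \<in> Hom C A B"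
    using G.m_closed[of f g] by simp
  show "f \<in> Hom C A B \<Longrightarrow> add C f (zero C A B) = f" using G.r_one[of f] by simp
  show "f \<in> Hom C A B \<Longrightarrow> add C (zero C A B) f = f" using G.l_one[of f] by simp
  show "f \<in> Hom C A B \<Longrightarrow> g \<in> Hom C A B \<Longrightarrow> add C f g = add C g f"
    using G.m_comm[of f g] by simp
  show "f \<in> Hom C A B \<Longrightarrow> g \<in> Hom C A B \<Longrightarrow> h \<in> Hom C A B
      \<Longrightarrow> add C (add C f g) h = add C f (add C g h)"
    using G.m_assoc[of f g h] by simp
  show "f \<in> Hom C A B \<Longrightarrow> neg C f \<in> Hom C A B"
    using G.inv_closed[of f] by (auto simp: neg_def dest: HomD)
  show "f \<in> Hom C A B \<Longrightarrow> add C f (neg C f) = zero C A B"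
    using G.r_inv[of f] by (auto simp: neg_def dest: HomD)
  show "f \<in> Hom C A B \<Longrightarrow> g \<in> Hom C A B \<Longrightarrow> h \<in> Hom C A B
      \<Longrightarrow> add C f g = add C f h \<Longrightarrow> g = h"
    using G.Units_l_cancel[of f g h] by simp
qed

lemma add_arr:
  assumes "f \<in> arr C" "g \<in> arr C" "src C g = src C f" "tgt C g = tgt C f"
  shows "add C f g \<in> arr C" "src C (add C f g) = src C f" "tgt C (add C f g) = tgt C f"
proof -
  have "add C f g \<in> Hom C (src C f) (tgt C f)"
    by (rule add_Hom) (use assms in \<open>auto simp: Hom_def src_obj tgt_obj\<close>)
  then show "add C f g \<in> arr C" "src C (add C f g) = src C f" "tgt C (add C f g) = tgt C f"
    by (auto simp: Hom_def)
qed

lemma add_zero: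
  assumes "f \<in> arr C" "src C f = A" "tgt C f = B"
  shows "add C f (zero C A B) = f" "add C (zero C A B) f = f"
  by (rule add_zero_Hom zero_add_Hom;
      use assms in \<open>auto simp: Hom_def dest: src_obj tgt_obj\<close>)+

lemma neg_arr:
  assumes "f \<in> arr C"
  shows "neg C f \<in> arr C" "src C (neg C f) = src C f" "tgt C (neg C f) = tgt C f"
  using neg_Hom[OF src_obj tgt_obj arr_in_Hom] assms by (auto simp: Hom_def)

lemma add_neg:
  assumes "f \<in> arr C"
  shows "add C f (neg C f) = zero C (src C f) (tgt C f)"
    "add C (neg C f) f = zero C (src C f) (tgt C f)"
proof -
  have f: "f \<in> Hom C (src C f) (tgt C f)" and n: "neg C f \<in> Hom C (src C f) (tgt C f)"
    using assms neg_arr by (auto simp: Hom_def)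
  show 1: "add C f (neg C f) = zero C (src C f) (tgt C f)"
    by (rule add_neg_Hom) (use assms f in \<open>auto intro: src_obj tgt_obj\<close>)
  have "add C (neg C f) f = add C f (neg C f)"
    by (rule add_comm_Hom[OF _ _ n f]) (use assms in \<open>auto intro: src_obj tgt_obj\<close>)
  with 1 show "add C (neg C f) f = zero C (src C f) (tgt C f)" by simp
qed

lemma add_comp:
  assumes "f \<in> arr C" "g \<in> arr C" "g' \<in> arr C" "src C g = tgt C f" "src C g' = tgt C f"
    "tgt C g = tgt C g'"
  shows "add C g g' \<cdot> f = add C (g \<cdot> f) (g' \<cdot> f)"
  by (rule comp_add_left) (use assms in \<open>auto simp: Hom_def\<close>)

lemma comp_add:
  assumes "f \<in> arr C" "f' \<in> arr C" "g \<in> arr C" "src C g = tgt C f" "src C g = tgt C f'"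
    "src C f = src C f'"
  shows "g \<cdot> add C f f' = add C (g \<cdot> f) (g \<cdot> f')"
  by (rule comp_add_right) (use assms in \<open>auto simp: Hom_def\<close>)

lemma add_left_cancel:
  assumes "f \<in> arr C" "g \<in> arr C" "h \<in> arr C" "src C f = src C g" "src C f = src C h"
    "tgt C f = tgt C g" "tgt C f = tgt C h" "add C f g = add C f h"
  shows "g = h"
  by (rule add_cancel_Hom[where f = f and A = "src C f" and B = "tgt C f"])
    (use assms in \<open>auto simp: Hom_def src_obj tgt_obj\<close>)

lemma add_idem_zero:
  assumes "f \<in> arr C" "add C f f = f"
  shows "f = zero C (src C f) (tgt C f)"
  by (rule add_left_cancel[of f]) (use assms in \<open>auto simp: zero_arr src_obj tgt_obj add_zero\<close>)

lemma comp_zero: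
  assumes "f \<in> arr C" "src C f = B" "A \<in> obj C"
  shows "f \<cdot> zero C A B = zero C A (tgt C f)"
proof -
  have B: "B \<in> obj C" using assms src_obj by auto
  have "add C (f \<cdot> zero C A B) (f \<cdot> zero C A B) = f \<cdot> add C (zero C A B) (zero C A B)"
    by (rule comp_add[symmetric]) (use assms B in \<open>auto simp: zero_arr\<close>)
  also have "\<dots> = f \<cdot> zero C A B" using assms B by (simp add: add_zero zero_arr)
  finally show ?thesis
    using add_idem_zero[of "f \<cdot> zero C A B"] assms B by (simp add: comp_arr zero_arr)
qed

lemma zero_comp:
  assumes "f \<in> arr C" "tgt C f = B" "D \<in> obj C"
  shows "zero C B D \<cdot> f = zero C (src C f) D"
proof -
  have B: "B \<in> obj C" using assms tgt_obj by auto
  have "add C (zero C B D \<cdot> f) (zero C B D \<cdot> f) = add C (zero C B D) (zero C B D) \<cdot> f"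
    by (rule add_comp[symmetric]) (use assms B in \<open>auto simp: zero_arr\<close>)
  also have "\<dots> = zero C B D \<cdot> f" using assms B by (simp add: add_zero zero_arr)
  finally show ?thesis
    using add_idem_zero[of "zero C B D \<cdot> f"] assms B by (simp add: comp_arr zero_arr)
qed

lemma neg_unique:
  assumes "f \<in> arr C" "g \<in> arr C" "src C f = src C g" "tgt C f = tgt C g"
    "add C f g = zero C (src C f) (tgt C f)"
  shows "g = neg C f"
  by (rule add_left_cancel[of f]) (use assms in \<open>auto simp: neg_arr add_neg\<close>)

lemma comp_neg:
  assumes "f \<in> arr C" "g \<in> arr C" "src C g = tgt C f"
  shows "g \<cdot> neg C f = neg C (g \<cdot> f)" "neg C g \<cdot> f = neg C (g \<cdot> f)"
proof -
  show "g \<cdot> neg C f = neg C (g \<cdot> f)"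
    by (rule neg_unique)
      (use assms in \<open>auto simp: comp_arr neg_arr comp_add[symmetric] add_neg comp_zero src_obj\<close>)
  show "neg C g \<cdot> f = neg C (g \<cdot> f)"
    by (rule neg_unique)
      (use assms in \<open>auto simp: comp_arr neg_arr add_comp[symmetric] add_neg zero_comp tgt_obj\<close>)
qed

lemma neg_neg: "f \<in> arr C \<Longrightarrow> neg C (neg C f) = f"
  using neg_unique[of "neg C f" f] by (simp add: neg_arr add_neg)

lemma neg_zero: "A \<in> obj C \<Longrightarrow> B \<in> obj C \<Longrightarrow> neg C (zero C A B) = zero C A B"
  using neg_unique[of "zero C A B" "zero C A B"] by (simp add: zero_arr add_zero)

lemmas cat = comp_arr comp_assoc_right ident_arr ident_comp comp_ident zero_arr add_arr add_zero
  neg_arr add_neg add_comp comp_add comp_zero zero_comp comp_neg neg_neg neg_zero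

lemma add_diff:
  assumes "f \<in> Hom C A B" "g \<in> Hom C A B"
  shows "add C f (add C g (neg C f)) = g"
proof -
  note H = HomD[OF assms(1)] HomD[OF assms(2)]
  have n: "neg C f \<in> Hom C A B" using H by (simp add: Hom_def cat)
  have "add C f (add C g (neg C f)) = add C f (add C (neg C f) g)"
    using add_comm_Hom[OF H(4,5) assms(2) n] by simp
  also have "\<dots> = add C (add C f (neg C f)) g"
    using add_assoc_Hom[OF H(4,5) assms(1) n assms(2)] by simp
  also have "\<dots> = g" using H by (simp add: cat)
  finally show ?thesis .
qed

lemma diff_zero:
  assumes "f \<in> Hom C A B" "g \<in> Hom C A B" "add C f (neg C g) = zero C A B"
  shows "f = g"
  using add_diff[OF assms(2,1)] HomD[OF assms(2)] assms(3) by (simp add: cat)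

lemma biproductD:
  assumes "biproduct C A B P i1 i2 p1 p2"
  shows "i1 \<in> Hom C A P" "i2 \<in> Hom C B P" "p1 \<in> Hom C P A" "p2 \<in> Hom C P B"
    "p1 \<cdot> i1 = ident C A" "p2 \<cdot> i2 = ident C B" "p2 \<cdot> i1 = zero C A B" "p1 \<cdot> i2 = zero C B A"
    "add C (i1 \<cdot> p1) (i2 \<cdot> p2) = ident C P"
  using assms by (auto simp: biproduct_def)

lemma biproduct_swap:
  assumes "biproduct C A B P i1 i2 p1 p2"
  shows "biproduct C B A P i2 i1 p2 p1"
proof -
  note b = biproductD[OF assms]
  have "add C (i2 \<cdot> p2) (i1 \<cdot> p1) = add C (i1 \<cdot> p1) (i2 \<cdot> p2)"
    by (rule add_comm_Hom[of P P]) (use b in \<open>auto intro: comp_Hom HomD\<close>)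
  with b show ?thesis by (auto simp: biproduct_def)
qed

lemma biproduct_copair:
  assumes "biproduct C A B P i1 i2 p1 p2" "f \<in> Hom C A T" "g \<in> Hom C B T"
  obtains h where "h \<in> Hom C P T" "h \<cdot> i1 = f" "h \<cdot> i2 = g"
proof -
  note b = biproductD[OF assms(1)]
  note T = b(1-4)[THEN HomD(1)] b(1-4)[THEN HomD(2)] b(1-4)[THEN HomD(3)]
    HomD[OF b(1)] HomD[OF b(2)] HomD[OF assms(2)] HomD[OF assms(3)]
  show ?thesis
    by (rule that[of "add C (f \<cdot> p1) (g \<cdot> p2)"]) (simp_all add: Hom_def T cat b(5-8))
qed

lemma biproduct_pair:
  assumes "biproduct C A B P i1 i2 p1 p2" "f \<in> Hom C T A" "g \<in> Hom C T B"
  obtains h where "h \<in> Hom C T P" "p1 \<cdot> h = f" "p2 \<cdot> h = g"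
proof -
  note b = biproductD[OF assms(1)]
  note T = b(1-4)[THEN HomD(1)] b(1-4)[THEN HomD(2)] b(1-4)[THEN HomD(3)]
    HomD[OF b(1)] HomD[OF b(2)] HomD[OF assms(2)] HomD[OF assms(3)]
  note e = b(5-8)[THEN comp_cong_tail]
  show ?thesis
    by (rule that[of "add C (i1 \<cdot> f) (i2 \<cdot> g)"]) (simp_all add: Hom_def T cat e)
qed

lemma biproduct_epi:
  assumes "biproduct C A B P i1 i2 p1 p2" "f \<in> Hom C P T" "g \<in> Hom C P T"
    "f \<cdot> i1 = g \<cdot> i1" "f \<cdot> i2 = g \<cdot> i2"
  shows "f = g"
proof -
  note b = biproductD[OF assms(1)]
  note T = b(1-4)[THEN HomD(1)] b(1-4)[THEN HomD(2)] b(1-4)[THEN HomD(3)]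
    HomD[OF b(1)] HomD[OF b(2)] HomD[OF assms(2)] HomD[OF assms(3)]
  have "f = f \<cdot> add C (i1 \<cdot> p1) (i2 \<cdot> p2)" by (simp add: b(9) T cat)
  also have "\<dots> = add C ((f \<cdot> i1) \<cdot> p1) ((f \<cdot> i2) \<cdot> p2)" by (simp add: T cat)
  also have "\<dots> = add C ((g \<cdot> i1) \<cdot> p1) ((g \<cdot> i2) \<cdot> p2)" by (simp only: assms)
  also have "\<dots> = g \<cdot> add C (i1 \<cdot> p1) (i2 \<cdot> p2)" by (simp add: T cat)
  also have "\<dots> = g" by (simp add: b(9) T cat)
  finally show ?thesis .
qed

lemma biproduct_mono:
  assumes "biproduct C A B P i1 i2 p1 p2" "f \<in> Hom C T P" "g \<in> Hom C T P"
    "p1 \<cdot> f = p1 \<cdot> g" "p2 \<cdot> f = p2 \<cdot> g"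
  shows "f = g"
proof -
  note b = biproductD[OF assms(1)]
  note T = b(1-4)[THEN HomD(1)] b(1-4)[THEN HomD(2)] b(1-4)[THEN HomD(3)]
    HomD[OF b(1)] HomD[OF b(2)] HomD[OF assms(2)] HomD[OF assms(3)]
  have "f = add C (i1 \<cdot> p1) (i2 \<cdot> p2) \<cdot> f" by (simp add: b(9) T cat)
  also have "\<dots> = add C (i1 \<cdot> (p1 \<cdot> f)) (i2 \<cdot> (p2 \<cdot> f))" by (simp add: T cat)
  also have "\<dots> = add C (i1 \<cdot> (p1 \<cdot> g)) (i2 \<cdot> (p2 \<cdot> g))" by (simp only: assms)
  also have "\<dots> = add C (i1 \<cdot> p1) (i2 \<cdot> p2) \<cdot> g" by (simp add: T cat)
  also have "\<dots> = g" by (simp add: b(9) T cat)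
  finally show ?thesis .
qed

lemma zero_object_Hom_from:
  assumes "zero_object C Z" "f \<in> Hom C Z A"
  shows "f = zero C Z A"
  using assms zero_Hom[of Z A] HomD[OF assms(2)] by (auto simp: zero_object_def)

end

section \<open>The opposite of an exact category\<close>

text \<open>
  Arrows keep their names and exchange source and target; the list of the arrows of a sequence
  is therefore reversed when the sequence is read in the opposite category.
\<close>

definition op_cat :: "('o, 'm, 'x) exact_cat_scheme \<Rightarrow> ('o, 'm) exact_cat"
  where "op_cat E = \<lparr>obj = obj E, arr = arr E, src = tgt E, tgt = src E, ident = ident E,
    cmp = (\<lambda>g f. cmp E f g), add = add E, zero = (\<lambda>A B. zero E B A),
    conflations = (conflations E)\<inverse>\<rparr>"

lemma op_simps [simp]:
  "obj (op_cat E) = obj E" "arr (op_cat E) = arr E" "src (op_cat E) = tgt E"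
  "tgt (op_cat E) = src E" "ident (op_cat E) = ident E" "cmp (op_cat E) g f = cmp E f g"
  "add (op_cat E) = add E" "zero (op_cat E) A B = zero E B A"
  "conflations (op_cat E) = (conflations E)\<inverse>"
  by (simp_all add: op_cat_def)

lemma op_Hom [simp]: "Hom (op_cat E) A B = Hom E B A"
  by (auto simp: Hom_def)

lemma op_is_kernel: "is_kernel (op_cat E) p i \<longleftrightarrow> is_cokernel E p i"
  unfolding is_kernel_def is_cokernel_def by (simp, blast)

lemma op_is_cokernel: "is_cokernel (op_cat E) i p \<longleftrightarrow> is_kernel E i p"
  unfolding is_kernel_def is_cokernel_def by (simp, blast)

lemma op_is_pushout: "is_pushout (op_cat E) p f p' f' \<longleftrightarrow> is_pullback E p f p' f'"
  unfolding is_pushout_def is_pullback_def by (simp, blast)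

lemma op_is_pullback: "is_pullback (op_cat E) p f p' f' \<longleftrightarrow> is_pushout E p f p' f'"
  unfolding is_pushout_def is_pullback_def by (simp, blast)

lemma op_biproduct: "biproduct (op_cat E) A B P i1 i2 p1 p2 \<longleftrightarrow> biproduct E A B P p1 p2 i1 i2"
  by (auto simp: biproduct_def)

lemma op_zero_object: "zero_object (op_cat E) Z \<longleftrightarrow> zero_object E Z"
  by (auto simp: zero_object_def)

lemma op_inflation: "inflation (op_cat E) f \<longleftrightarrow> deflation E f"
  and op_deflation: "deflation (op_cat E) f \<longleftrightarrow> inflation E f"
  by (auto simp: inflation_def deflation_def)

lemma op_iso_arr: "iso_arr (op_cat E) A B f \<longleftrightarrow> iso_arr E B A f"
  by (auto simp: iso_arr_def)

lemma op_hom_group: "hom_group (op_cat E) A B = hom_group E B A"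
  by (simp add: hom_group_def)

lemma op_neg [simp]: "neg (op_cat E) f = neg E f"
  by (simp add: neg_def op_hom_group)

lemma op_op [simp]: "op_cat (op_cat E) = (E :: ('o, 'm) exact_cat)"
  by (cases E) (simp add: op_cat_def)

context exact_category
begin

lemma conflation_Hom:
  assumes "(i, p) \<in> conflations E"
  shows "i \<in> Hom E (src E i) (src E p)" "p \<in> Hom E (src E p) (tgt E p)"
    "tgt E i = src E p" "p \<cdot> i = zero E (src E i) (tgt E p)"
  using conflation_kernel_cokernel[OF assms] by (auto simp: is_kernel_def Hom_def)

lemma iso_arr_inverse:
  assumes "iso_arr E A B f"
  obtains g where "iso_arr E B A g" "g \<cdot> f = ident E A" "f \<cdot> g = ident E B"
  using assms by (auto simp: iso_arr_def)

lemma exact_category_op: "exact_category (op_cat E)"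
proof (intro exact_category.intro additive_category.intro exact_category_axioms.intro)
  show "src (op_cat E) f \<in> obj (op_cat E)" if "f \<in> arr (op_cat E)" for f
    using that tgt_obj by simp
  show "tgt (op_cat E) f \<in> obj (op_cat E)" if "f \<in> arr (op_cat E)" for f
    using that src_obj by simp
  show "ident (op_cat E) A \<in> Hom (op_cat E) A A" if "A \<in> obj (op_cat E)" for A
    using that ident_Hom by simp
  show "cmp (op_cat E) g f \<in> Hom (op_cat E) A D"
    if "f \<in> Hom (op_cat E) A B" "g \<in> Hom (op_cat E) B D" for f g A B D
    using that comp_Hom by simp
  show "cmp (op_cat E) f (ident (op_cat E) A) = f" if "f \<in> Hom (op_cat E) A B" for f A B
    using that comp_ident_left by simp
  show "cmp (op_cat E) (ident (op_cat E) B) f = f" if "f \<in> Hom (op_cat E) A B" for f A B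
    using that comp_ident_right by simp
  show "cmp (op_cat E) h (cmp (op_cat E) g f) = cmp (op_cat E) (cmp (op_cat E) h g) f"
    if "f \<in> Hom (op_cat E) A B" "g \<in> Hom (op_cat E) B D" "h \<in> Hom (op_cat E) D F"
    for f g h A B D F
    using that comp_assoc by simp
  show "comm_group (hom_group (op_cat E) A B)"
    if "A \<in> obj (op_cat E)" "B \<in> obj (op_cat E)" for A B
    using that hom_group by (simp add: op_hom_group)
  show "cmp (op_cat E) (add (op_cat E) g g') f =
      add (op_cat E) (cmp (op_cat E) g f) (cmp (op_cat E) g' f)"
    if "f \<in> Hom (op_cat E) A B" "g \<in> Hom (op_cat E) B D" "g' \<in> Hom (op_cat E) B D"
    for f g g' A B D
    using that comp_add_right by simp
  show "cmp (op_cat E) g (add (op_cat E) f f') =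
      add (op_cat E) (cmp (op_cat E) g f) (cmp (op_cat E) g f')"
    if "f \<in> Hom (op_cat E) A B" "f' \<in> Hom (op_cat E) A B" "g \<in> Hom (op_cat E) B D"
    for f f' g A B D
    using that comp_add_left by simp
  show "\<exists>Z. zero_object (op_cat E) Z"
    using ex_zero_object by (simp add: op_zero_object)
  show "\<exists>P i1 i2 p1 p2. biproduct (op_cat E) A B P i1 i2 p1 p2"
    if "A \<in> obj (op_cat E)" "B \<in> obj (op_cat E)" for A B
    using that ex_biproduct[of A B] by (simp add: op_biproduct) blast
  show "is_kernel (op_cat E) i p \<and> is_cokernel (op_cat E) p i"
    if "(i, p) \<in> conflations (op_cat E)" for i p
    using that conflation_kernel_cokernel by (simp add: op_is_kernel op_is_cokernel)
  show "(i', p') \<in> conflations (op_cat E)"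
    if "(i, p) \<in> conflations (op_cat E)" "i \<in> Hom (op_cat E) A B" "p \<in> Hom (op_cat E) B D"
      "i' \<in> Hom (op_cat E) A' B'" "p' \<in> Hom (op_cat E) B' D'"
      "iso_arr (op_cat E) A A' a" "iso_arr (op_cat E) B B' b" "iso_arr (op_cat E) D D' d"
      "cmp (op_cat E) b i = cmp (op_cat E) i' a" "cmp (op_cat E) d p = cmp (op_cat E) p' b"
    for i p A B D i' p' A' B' D' a b d
  proof -
    have ip: "i \<in> Hom E B A" "p \<in> Hom E D B" "i' \<in> Hom E B' A'" "p' \<in> Hom E D' B'"
      "iso_arr E A' A a" "iso_arr E B' B b" "iso_arr E D' D d"
      "i \<cdot> b = a \<cdot> i'" "p \<cdot> d = b \<cdot> p'" "(p, i) \<in> conflations E"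
      using that by (auto simp: op_iso_arr)
    have "iso_arr E A' A a" "iso_arr E B' B b" "iso_arr E D' D d" by fact+
    then obtain a' b' d' where
      a': "iso_arr E A A' a'" "a' \<cdot> a = ident E A'" "a \<cdot> a' = ident E A" and
      b': "iso_arr E B B' b'" "b' \<cdot> b = ident E B'" "b \<cdot> b' = ident E B" and
      d': "iso_arr E D D' d'" "d' \<cdot> d = ident E D'" "d \<cdot> d' = ident E D"
      by (metis iso_arr_inverse)
    have H: "a' \<in> Hom E A A'" "b' \<in> Hom E B B'" "d' \<in> Hom E D D'"
      "a \<in> Hom E A' A" "b \<in> Hom E B' B" "d \<in> Hom E D' D"
      using a' b' d' ip by (auto simp: iso_arr_def)
    have "b' \<cdot> p = p' \<cdot> d'"
    proof -
      have "b' \<cdot> p = b' \<cdot> (p \<cdot> (d \<cdot> d'))" using d' ip comp_ident_right by simp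
      also have "\<dots> = b' \<cdot> (b \<cdot> p' \<cdot> d')"
        using comp_assoc[OF H(3) H(6) ip(2)] ip by simp
      also have "\<dots> = (b' \<cdot> b) \<cdot> (p' \<cdot> d')"
        using comp_assoc[OF H(3) ip(4) H(5)] comp_assoc[OF comp_Hom[OF H(3) ip(4)] H(5) H(2)]
        by simp
      also have "\<dots> = p' \<cdot> d'" using b' comp_ident_left comp_Hom[OF H(3) ip(4)] by simp
      finally show ?thesis .
    qed
    moreover have "a' \<cdot> i = i' \<cdot> b'"
    proof -
      have "a' \<cdot> i = a' \<cdot> (i \<cdot> (b \<cdot> b'))" using b' ip comp_ident_right by simp
      also have "\<dots> = a' \<cdot> (a \<cdot> i' \<cdot> b')"
        using comp_assoc[OF H(2) H(5) ip(1)] ip by simp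
      also have "\<dots> = (a' \<cdot> a) \<cdot> (i' \<cdot> b')"
        using comp_assoc[OF H(2) ip(3) H(4)] comp_assoc[OF comp_Hom[OF H(2) ip(3)] H(4) H(1)]
        by simp
      also have "\<dots> = i' \<cdot> b'" using a' comp_ident_left comp_Hom[OF H(2) ip(3)] by simp
      finally show ?thesis .
    qed
    ultimately have "(p', i') \<in> conflations E"
      using conflation_iso[OF ip(10) ip(2) ip(1) ip(4) ip(3) d'(1) b'(1) a'(1)] by simp
    then show ?thesis by simp
  qed
  show "inflation (op_cat E) (ident (op_cat E) A)" if "A \<in> obj (op_cat E)" for A
    using that ident_deflation by (simp add: op_inflation)
  show "deflation (op_cat E) (ident (op_cat E) A)" if "A \<in> obj (op_cat E)" for A
    using that ident_inflation by (simp add: op_deflation)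
  show "inflation (op_cat E) (cmp (op_cat E) j i)"
    if "inflation (op_cat E) i" "inflation (op_cat E) j" "tgt (op_cat E) i = src (op_cat E) j"
    for i j
    using that deflation_comp by (simp add: op_inflation)
  show "deflation (op_cat E) (cmp (op_cat E) q p)"
    if "deflation (op_cat E) p" "deflation (op_cat E) q" "tgt (op_cat E) p = src (op_cat E) q"
    for p q
    using that inflation_comp by (simp add: op_deflation)
  show "\<exists>i' f'. is_pushout (op_cat E) i f i' f' \<and> inflation (op_cat E) i'"
    if "inflation (op_cat E) i" "i \<in> Hom (op_cat E) A B" "f \<in> Hom (op_cat E) A A'"
    for i f A B A'
    using that pullback_deflation[of i B A f A'] by (simp add: op_inflation op_is_pushout)
  show "\<exists>p' f'. is_pullback (op_cat E) p f p' f' \<and> deflation (op_cat E) p'"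
    if "deflation (op_cat E) p" "p \<in> Hom (op_cat E) B D" "f \<in> Hom (op_cat E) D' D"
    for p f B D D'
    using that pushout_inflation[of p D B f D'] by (simp add: op_deflation op_is_pullback)
qed

end

section \<open>Conflations and their morphisms\<close>

definition conf :: "('o, 'm, 'x) exact_cat_scheme \<Rightarrow> 'o \<Rightarrow> 'o \<Rightarrow> 'o \<Rightarrow> 'm \<Rightarrow> 'm \<Rightarrow> bool"
  where "conf E A B D i p \<longleftrightarrow> (i, p) \<in> conflations E \<and> i \<in> Hom E A B \<and> p \<in> Hom E B D"

definition conf_mor ::
    "('o, 'm, 'x) exact_cat_scheme \<Rightarrow> 'm \<Rightarrow> 'm \<Rightarrow> 'm \<Rightarrow> 'm \<Rightarrow> 'm \<Rightarrow> 'm \<Rightarrow> 'm \<Rightarrow> bool"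
  where "conf_mor E i p i' p' a b c \<longleftrightarrow>
    a \<in> Hom E (src E i) (src E i') \<and> b \<in> Hom E (src E p) (src E p') \<and>
    c \<in> Hom E (tgt E p) (tgt E p') \<and> cmp E b i = cmp E i' a \<and> cmp E c p = cmp E p' b"

lemma op_conf: "conf (op_cat E) D B A p i \<longleftrightarrow> conf E A B D i p"
  by (auto simp: conf_def)

context exact_category
begin

lemma confD:
  assumes "conf E A B D i p"
  shows "(i, p) \<in> conflations E" "i \<in> Hom E A B" "p \<in> Hom E B D" "p \<cdot> i = zero E A D"
    "i \<in> arr E" "src E i = A" "tgt E i = B" "p \<in> arr E" "src E p = B" "tgt E p = D"
    "A \<in> obj E" "B \<in> obj E" "D \<in> obj E" "inflation E i" "deflation E p"
proof -
  show 1: "(i, p) \<in> conflations E" "i \<in> Hom E A B" "p \<in> Hom E B D"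
    using assms by (auto simp: conf_def)
  show "p \<cdot> i = zero E A D" using conflation_Hom(4)[OF 1(1)] HomD[OF 1(2)] HomD[OF 1(3)] by simp
  show "i \<in> arr E" "src E i = A" "tgt E i = B" "p \<in> arr E" "src E p = B" "tgt E p = D"
    "A \<in> obj E" "B \<in> obj E" "D \<in> obj E"
    using HomD[OF 1(2)] HomD[OF 1(3)] by simp_all
  show "inflation E i" "deflation E p" using 1 by (auto simp: inflation_def deflation_def)
qed

lemma conflation_conf:
  assumes "(i, p) \<in> conflations E"
  shows "conf E (src E i) (tgt E i) (tgt E p) i p"
  using conflation_Hom[OF assms] assms by (simp add: conf_def)

lemma inflation_conf:
  assumes "inflation E i" "i \<in> Hom E A B"
  obtains D p where "conf E A B D i p"
  using assms conflation_conf HomD by (metis inflation_def)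

lemma conf_is_cokernel:
  assumes c: "conf E A B D i p" and h: "h \<in> Hom E B T" "h \<cdot> i = zero E A T"
  shows "\<exists>!t. t \<in> Hom E D T \<and> t \<cdot> p = h"
proof -
  have "is_cokernel E p i" using conflation_kernel_cokernel confD(1)[OF c] by blast
  then obtain A0 B0 D0 where *: "i \<in> Hom E A0 B0" "p \<in> Hom E B0 D0"
    "\<forall>T\<in>obj E. \<forall>h\<in>Hom E B0 T. h \<cdot> i = zero E A0 T \<longrightarrow> (\<exists>!t. t \<in> Hom E D0 T \<and> t \<cdot> p = h)"
    unfolding is_cokernel_def by blast
  have "A0 = A" "B0 = B" "D0 = D" using confD[OF c] HomD[OF *(1)] HomD[OF *(2)] by auto
  then show ?thesis using *(3) h HomD(5)[OF h(1)] by blast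
qed

lemma conf_cokernel:
  assumes c: "conf E A B D i p" and h: "h \<in> Hom E B T" "h \<cdot> i = zero E A T"
  obtains t where "t \<in> Hom E D T" "t \<cdot> p = h"
  using conf_is_cokernel[OF assms] by blast

lemma conf_epi:
  assumes c: "conf E A B D i p" and fg: "f \<in> Hom E D T" "g \<in> Hom E D T" "f \<cdot> p = g \<cdot> p"
  shows "f = g"
proof -
  have "g \<cdot> p \<in> Hom E B T" "g \<cdot> p \<cdot> i = zero E A T"
    using confD[OF c] HomD[OF fg(2)] by (simp_all add: Hom_def cat)
  from conf_is_cokernel[OF c this] show ?thesis using fg by blast
qed

end

lemma op_conf_mor:
  "conf_mor (op_cat E) p i p' i' c b a \<longleftrightarrow>
    c \<in> Hom E (tgt E p') (tgt E p) \<and> b \<in> Hom E (tgt E i') (tgt E i) \<and>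
    a \<in> Hom E (src E i') (src E i) \<and> cmp E b i' = cmp E i a \<and> cmp E c p' = cmp E p b"
  by (auto simp: conf_mor_def)

context exact_category
begin

lemma op_conf_mor_conf:
  assumes "conf E A B D i p" "conf E A' B' D' i' p'"
  shows "conf_mor (op_cat E) p' i' p i c b a \<longleftrightarrow> conf_mor E i p i' p' a b c"
  using confD[OF assms(1)] confD[OF assms(2)] by (auto simp: op_conf_mor conf_mor_def)

lemma conf_kernel:
  assumes c: "conf E A B D i p" and h: "h \<in> Hom E T B" "p \<cdot> h = zero E T D"
  obtains t where "t \<in> Hom E T A" "i \<cdot> t = h"
  using exact_category.conf_cokernel[OF exact_category_op, unfolded op_conf, OF c, of h T] h
  by auto

lemma conf_mono:
  assumes c: "conf E A B D i p" and fg: "f \<in> Hom E T A" "g \<in> Hom E T A" "i \<cdot> f = i \<cdot> g"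
  shows "f = g"
  using exact_category.conf_epi[OF exact_category_op, unfolded op_conf, OF c, of f T g] fg
  by auto

lemma conf_morI:
  assumes "conf E A B D i p" "conf E A' B' D' i' p'"
    "a \<in> Hom E A A'" "b \<in> Hom E B B'" "c \<in> Hom E D D'" "b \<cdot> i = i' \<cdot> a" "c \<cdot> p = p' \<cdot> b"
  shows "conf_mor E i p i' p' a b c"
  using assms confD[OF assms(1)] confD[OF assms(2)] by (auto simp: conf_mor_def)

lemma conf_morD:
  assumes "conf_mor E i p i' p' a b c" "conf E A B D i p" "conf E A' B' D' i' p'"
  shows "a \<in> Hom E A A'" "b \<in> Hom E B B'" "c \<in> Hom E D D'" "b \<cdot> i = i' \<cdot> a" "c \<cdot> p = p' \<cdot> b"
  using assms(1) confD[OF assms(2)] confD[OF assms(3)] by (auto simp: conf_mor_def)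

lemma conf_mor_ident:
  assumes "conf E A B D i p"
  shows "conf_mor E i p i p (ident E A) (ident E B) (ident E D)"
  by (rule conf_morI[OF assms assms]) (use confD[OF assms] in \<open>simp_all add: cat Hom_def\<close>)

lemma conf_mor_comp:
  assumes c: "conf E A B D i p" "conf E A' B' D' i' p'" "conf E A'' B'' D'' i'' p''"
    and m: "conf_mor E i p i' p' a b c" and m': "conf_mor E i' p' i'' p'' a' b' c'"
  shows "conf_mor E i p i'' p'' (a' \<cdot> a) (b' \<cdot> b) (c' \<cdot> c)"
proof -
  note M = conf_morD[OF m c(1,2)] and M' = conf_morD[OF m' c(2,3)]
  note T = HomD[OF M(1)] HomD[OF M(2)] HomD[OF M(3)] HomD[OF M'(1)] HomD[OF M'(2)] HomD[OF M'(3)]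
    confD[OF c(1)] confD[OF c(2)] confD[OF c(3)]
  show ?thesis
    by (rule conf_morI[OF c(1,3)])
      (simp_all add: T cat Hom_def M(4,5) M'(4,5) M(4,5)[THEN comp_cong_tail] M'(4,5)[THEN comp_cong_tail])
qed

lemma ident_iso: "X \<in> obj E \<Longrightarrow> iso_arr E X X (ident E X)"
  by (auto simp: iso_arr_def cat intro: ident_Hom intro!: bexI[of _ "ident E X"])

text \<open>
  Cokernels are unique up to isomorphism, and conflations are closed under isomorphism.
\<close>

lemma inflation_cokernel_conf:
  assumes i: "inflation E i" "i \<in> Hom E A B" and p: "p \<in> Hom E B D" "p \<cdot> i = zero E A D"
    and ex: "\<And>T h. h \<in> Hom E B T \<Longrightarrow> h \<cdot> i = zero E A T \<Longrightarrow> \<exists>t. t \<in> Hom E D T \<and> t \<cdot> p = h"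
    and epi: "\<And>T f g. f \<in> Hom E D T \<Longrightarrow> g \<in> Hom E D T \<Longrightarrow> f \<cdot> p = g \<cdot> p \<Longrightarrow> f = g"
  shows "conf E A B D i p"
proof -
  obtain D' p' where c: "conf E A B D' i p'" using inflation_conf[OF i] .
  note C = confD[OF c]
  obtain d where d: "d \<in> Hom E D' D" "d \<cdot> p' = p" using conf_cokernel[OF c p] .
  obtain e where e: "e \<in> Hom E D D'" "e \<cdot> p = p'" using ex[OF C(3,4)] by blast
  note T = C HomD[OF d(1)] HomD[OF e(1)] HomD[OF p(1)]
  have "e \<cdot> d = ident E D'"
    by (rule conf_epi[OF c]) (simp_all add: T cat Hom_def d(2) e(2))
  moreover have "d \<cdot> e = ident E D"
    by (rule epi) (simp_all add: T cat Hom_def d(2) e(2))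
  ultimately have iso: "iso_arr E D' D d" using d e by (auto simp: iso_arr_def)
  have "(i, p) \<in> conflations E"
    by (rule conflation_iso[OF C(1-3) i(2) p(1) ident_iso ident_iso iso]) (use T d in \<open>auto simp: cat\<close>)
  then show ?thesis using i p by (simp add: conf_def)
qed

lemma is_pushoutD:
  assumes po: "is_pushout E i f i' f'" and T: "i \<in> Hom E A B" "f \<in> Hom E A A'"
  shows "i' \<in> Hom E A' (tgt E i')" "f' \<in> Hom E B (tgt E i')" "f' \<cdot> i = i' \<cdot> f"
    "g \<in> Hom E B T \<Longrightarrow> h \<in> Hom E A' T \<Longrightarrow> g \<cdot> i = h \<cdot> f \<Longrightarrow>
      \<exists>t. t \<in> Hom E (tgt E i') T \<and> t \<cdot> f' = g \<and> t \<cdot> i' = h"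
    "x \<in> Hom E (tgt E i') T \<Longrightarrow> y \<in> Hom E (tgt E i') T \<Longrightarrow> x \<cdot> f' = y \<cdot> f' \<Longrightarrow> x \<cdot> i' = y \<cdot> i'
      \<Longrightarrow> x = y"
proof -
  obtain A0 B0 A0' B' where *: "i \<in> Hom E A0 B0" "f \<in> Hom E A0 A0'" "i' \<in> Hom E A0' B'"
    "f' \<in> Hom E B0 B'" "f' \<cdot> i = i' \<cdot> f"
    "\<forall>T\<in>obj E. \<forall>g\<in>Hom E B0 T. \<forall>h\<in>Hom E A0' T. g \<cdot> i = h \<cdot> f \<longrightarrow>
      (\<exists>!t. t \<in> Hom E B' T \<and> t \<cdot> f' = g \<and> t \<cdot> i' = h)"
    using assms(1) unfolding is_pushout_def by blast
  have eq: "A0 = A" "B0 = B" "A0' = A'" "B' = tgt E i'"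
    using HomD[OF T(1)] HomD[OF T(2)] HomD[OF *(1)] HomD[OF *(2)] HomD[OF *(3)] by auto
  note * = *[unfolded eq]
  show "i' \<in> Hom E A' (tgt E i')" "f' \<in> Hom E B (tgt E i')" "f' \<cdot> i = i' \<cdot> f"
    using * by auto
  show "\<exists>t. t \<in> Hom E (tgt E i') T \<and> t \<cdot> f' = g \<and> t \<cdot> i' = h"
    if "g \<in> Hom E B T" "h \<in> Hom E A' T" "g \<cdot> i = h \<cdot> f"
    using *(6) HomD(5)[OF that(1)] that by blast
  show "x = y" if x: "x \<in> Hom E (tgt E i') T" "y \<in> Hom E (tgt E i') T" "x \<cdot> f' = y \<cdot> f'"
    "x \<cdot> i' = y \<cdot> i'"
  proof -
    have "y \<cdot> f' \<cdot> i = y \<cdot> i' \<cdot> f"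
      using HomD[OF x(2)] HomD[OF *(3)] HomD[OF *(4)] HomD[OF T(1)] HomD[OF T(2)]
      by (simp add: cat *(5))
    moreover have "y \<cdot> f' \<in> Hom E B T" "y \<cdot> i' \<in> Hom E A' T" using x * comp_Hom by blast+
    ultimately have "\<exists>!t. t \<in> Hom E (tgt E i') T \<and> t \<cdot> f' = y \<cdot> f' \<and> t \<cdot> i' = y \<cdot> i'"
      using *(6) HomD(5)[OF x(2)] by blast
    then show ?thesis using x by blast
  qed
qed

lemma is_pushoutI:
  assumes "i \<in> Hom E A B" "f \<in> Hom E A A'" "i' \<in> Hom E A' B'" "f' \<in> Hom E B B'" "f' \<cdot> i = i' \<cdot> f"
    and ex: "\<And>T g h. g \<in> Hom E B T \<Longrightarrow> h \<in> Hom E A' T \<Longrightarrow> g \<cdot> i = h \<cdot> f \<Longrightarrow>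
      \<exists>t. t \<in> Hom E B' T \<and> t \<cdot> f' = g \<and> t \<cdot> i' = h"
    and un: "\<And>T s t. s \<in> Hom E B' T \<Longrightarrow> t \<in> Hom E B' T \<Longrightarrow> s \<cdot> f' = t \<cdot> f' \<Longrightarrow> s \<cdot> i' = t \<cdot> i' \<Longrightarrow> s = t"
  shows "is_pushout E i f i' f'"
  unfolding is_pushout_def
proof (intro exI conjI ballI impI)
  show "i \<in> Hom E A B" "f \<in> Hom E A A'" "i' \<in> Hom E A' B'" "f' \<in> Hom E B B'" "f' \<cdot> i = i' \<cdot> f"
    by fact+
  fix T g h assume "g \<in> Hom E B T" "h \<in> Hom E A' T" "g \<cdot> i = h \<cdot> f"
  then have "\<exists>t. t \<in> Hom E B' T \<and> t \<cdot> f' = g \<and> t \<cdot> i' = h" by (rule ex)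
  then show "\<exists>!t. t \<in> Hom E B' T \<and> t \<cdot> f' = g \<and> t \<cdot> i' = h"
    by (rule ex_ex1I) (auto intro: un)
qed

text \<open>
  Some pushout is an inflation by axiom, and any two pushouts are isomorphic.
\<close>

lemma is_pushout_inflation:
  assumes i: "inflation E i" and po: "is_pushout E i f i' f'"
  shows "inflation E i'"
proof -
  obtain A B A' where T: "i \<in> Hom E A B" "f \<in> Hom E A A'"
    using po unfolding is_pushout_def by (elim exE conjE) (rule that)
  obtain j g where jg: "is_pushout E i f j g" "inflation E j" using pushout_inflation[OF i T] by blast
  define P Q where "P = tgt E i'" and "Q = tgt E j"
  note P = is_pushoutD[OF po T, folded P_def] and Q = is_pushoutD[OF jg(1) T, folded Q_def]
  obtain s where s: "s \<in> Hom E P Q" "s \<cdot> f' = g" "s \<cdot> i' = j" using P(4)[OF Q(2,1,3)] by blast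
  obtain t where t: "t \<in> Hom E Q P" "t \<cdot> g = f'" "t \<cdot> j = i'" using Q(4)[OF P(2,1,3)] by blast
  obtain D q where c: "conf E A' Q D j q" using inflation_conf[OF jg(2) Q(1)] .
  note H = HomD[OF P(1)] HomD[OF P(2)] HomD[OF Q(1)] HomD[OF Q(2)] HomD[OF s(1)] HomD[OF t(1)]
    confD[OF c]
  have ts: "t \<cdot> s = ident E P" by (rule P(5)) (simp_all add: H cat Hom_def s t)
  have st: "s \<cdot> t = ident E Q" by (rule Q(5)) (simp_all add: H cat Hom_def s t)
  have iso: "iso_arr E Q P t" using s t ts st by (auto simp: iso_arr_def)
  have "(i', q \<cdot> s) \<in> conflations E"
    by (rule conflation_iso[OF confD(1-3)[OF c] P(1) _ ident_iso iso ident_iso])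
      (simp_all add: H cat Hom_def st t(3) comp_cong_tail[OF st])
  then show ?thesis by (auto simp: inflation_def)
qed

text \<open>
  A pushout of a morphism has the same cokernel.
\<close>

lemma is_pushout_conf:
  assumes c: "conf E A B D i p" and f: "f \<in> Hom E A A'" and po: "is_pushout E i f i' f'"
    and e: "e \<in> Hom E (tgt E i') D" "e \<cdot> f' = p" "e \<cdot> i' = zero E A' D"
  shows "conf E A' (tgt E i') D i' e" "conf_mor E i p i' e f f' (ident E D)"
proof -
  note C = confD[OF c]
  define P where "P = tgt E i'"
  note P = is_pushoutD[OF po C(2) f, folded P_def]
  have P': "tgt E i' = P" by (simp add: P_def)
  note H = C HomD[OF P(1)] HomD[OF P(2)] HomD[OF e(1)] HomD[OF f]
  have "conf E A' P D i' e"
  proof (rule inflation_cokernel_conf[OF is_pushout_inflation[OF C(14) po] P(1)])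
    show "e \<in> Hom E P D" "e \<cdot> i' = zero E A' D" using e P' by auto
  next
    fix T h assume h: "h \<in> Hom E P T" "h \<cdot> i' = zero E A' T"
    note H = H HomD[OF h(1)]
    have "h \<cdot> f' \<cdot> i = zero E A T"
      using h(2) by (simp add: H cat P(3) comp_cong_tail[OF h(2)])
    moreover have "h \<cdot> f' \<in> Hom E B T" by (simp add: H cat Hom_def)
    ultimately obtain t where t: "t \<in> Hom E D T" "t \<cdot> p = h \<cdot> f'" using conf_cokernel[OF c] by blast
    have "t \<cdot> e = h"
      by (rule P(5)) (use HomD[OF t(1)] h t e in \<open>simp_all add: H cat Hom_def P'\<close>)
    then show "\<exists>t. t \<in> Hom E D T \<and> t \<cdot> e = h" using t by blast
  next
    fix T x y assume h: "x \<in> Hom E D T" "y \<in> Hom E D T" "x \<cdot> e = y \<cdot> e"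
    note H = H HomD[OF h(1)] HomD[OF h(2)]
    have "x \<cdot> p = x \<cdot> e \<cdot> f'" by (simp add: H cat e P')
    also have "\<dots> = y \<cdot> p" unfolding h(3) by (simp add: H cat e P')
    finally show "x = y" using conf_epi[OF c h(1,2)] by blast
  qed
  then show c': "conf E A' (tgt E i') D i' e" by (simp add: P')
  show "conf_mor E i p i' e f f' (ident E D)"
    by (rule conf_morI[OF c c']) (use f P(2,3) e in \<open>simp_all add: P' H ident_Hom cat\<close>)
qed

lemma push_conf:
  assumes c: "conf E A B D i p" and f: "f \<in> Hom E A A'"
  obtains B' i' p' b where "conf E A' B' D i' p'" "conf_mor E i p i' p' f b (ident E D)"
    "is_pushout E i f i' b"
proof -
  note C = confD[OF c]
  obtain i' b where po: "is_pushout E i f i' b" using pushout_inflation[OF C(14) C(2) f] by blast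
  define P where "P = tgt E i'"
  note P = is_pushoutD[OF po C(2) f, folded P_def]
  have "\<exists>t. t \<in> Hom E P D \<and> t \<cdot> b = p \<and> t \<cdot> i' = zero E A' D"
    by (rule P(4)) (use C HomD[OF f] in \<open>auto simp: cat Hom_def\<close>)
  then obtain t where t: "t \<in> Hom E P D" "t \<cdot> b = p" "t \<cdot> i' = zero E A' D" by blast
  show ?thesis
    by (rule that[OF is_pushout_conf(1)[OF c f po _ t(2,3)] is_pushout_conf(2)[OF c f po _ t(2,3)] po])
      (use t(1) P(1) in \<open>auto simp: Hom_def\<close>)
qed

lemma pull_conf:
  assumes c: "conf E A B D i p" and f: "f \<in> Hom E D' D"
  obtains B' i' p' b where "conf E A B' D' i' p'" "conf_mor E i' p' i p (ident E A) b f"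
    "is_pullback E p f p' b"
proof -
  have "conf (op_cat E) D B A p i" using c by (simp add: op_conf)
  moreover have "f \<in> Hom (op_cat E) D D'" using f by simp
  ultimately obtain B' p' i' b where
    "conf (op_cat E) D' B' A p' i'" "conf_mor (op_cat E) p i p' i' f b (ident (op_cat E) A)"
    "is_pushout (op_cat E) p f p' b"
    by (rule exact_category.push_conf[OF exact_category_op])
  then have *: "conf E A B' D' i' p'" "conf_mor (op_cat E) p i p' i' f b (ident E A)"
    "is_pullback E p f p' b"
    by (simp_all add: op_conf op_is_pushout)
  then show ?thesis using that op_conf_mor_conf[OF *(1) c] by blast
qed

text \<open>
  The universal property of the pushout turns a morphism of conflations with first component
  \<open>f\<close> into one whose first component is an identity. The independence of
  \<open>Ext\<close> from the choice of pushouts rests on this.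
\<close>

lemma push_conf_factor:
  assumes c: "conf E A B D i p" and c1: "conf E A1 B1 D1 i1 p1" and c2: "conf E A1 B2 D2 i2 p2"
    and m1: "conf_mor E i p i1 p1 f b (ident E D)" and D1: "D1 = D" and po: "is_pushout E i f i1 b"
    and m2: "conf_mor E i p i2 p2 f b2 d"
  obtains t where "conf_mor E i1 p1 i2 p2 (ident E A1) t d"
proof -
  note M1 = conf_morD[OF m1 c c1] and M2 = conf_morD[OF m2 c c2]
  note H = confD[OF c] confD[OF c1] confD[OF c2] HomD[OF M1(1)] HomD[OF M1(2)] HomD[OF M2(2)]
    HomD[OF M2(3)]
  have P': "tgt E i1 = B1" using confD[OF c1] by simp
  note P = is_pushoutD[OF po confD(2)[OF c] M1(1), unfolded P']
  obtain t where t: "t \<in> Hom E B1 B2" "t \<cdot> b = b2" "t \<cdot> i1 = i2"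
    using P(4)[OF M2(2) confD(2)[OF c2] M2(4)] by blast
  note H = H HomD[OF t(1)]
  have "d \<cdot> p1 = p2 \<cdot> t"
  proof (rule P(5))
    show "d \<cdot> p1 \<in> Hom E B1 D2" "p2 \<cdot> t \<in> Hom E B1 D2" by (simp_all add: H cat Hom_def D1)
    have "d \<cdot> p1 \<cdot> b = d \<cdot> p" using M1(5) by (simp add: H cat D1)
    also have "\<dots> = p2 \<cdot> t \<cdot> b" using M2(5) by (simp add: H cat t)
    finally show "d \<cdot> p1 \<cdot> b = p2 \<cdot> t \<cdot> b" .
    show "d \<cdot> p1 \<cdot> i1 = p2 \<cdot> t \<cdot> i1" by (simp add: H cat t D1)
  qed
  then show ?thesis
    using that[of t] conf_morI[OF c1 c2, of "ident E A1" t d] t M2(3) H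
    by (simp add: ident_Hom cat D1)
qed

section \<open>Sums of conflations\<close>

text \<open>
  The kernel of an identity is \<open>0 \<rightarrow> D\<close>, and the injection of
  \<open>A\<close> is its pushout along \<open>0 \<rightarrow> A\<close>.
\<close>

lemma biproduct_conf:
  assumes bp: "biproduct E A D P i1 i2 p1 p2"
  shows "conf E A P D i1 p2"
proof -
  note b = biproductD[OF bp]
  note H = HomD[OF b(1)] HomD[OF b(2)] HomD[OF b(3)] HomD[OF b(4)]
  obtain z where z0: "(z, ident E D) \<in> conflations E"
    using ident_deflation[of D] H by (auto simp: deflation_def)
  define Z where "Z = src E z"
  have z: "conf E Z D D z (ident E D)"
    using conflation_conf[OF z0] conflation_Hom[OF z0] H by (simp add: Z_def cat)
  note Zt = confD[OF z]
  have zz: "z = zero E Z D" using Zt(4) ident_comp[of z D] Zt(5,7) by simp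
  have Hom_Z: "f = zero E T Z" if f: "f \<in> Hom E T Z" for f T
    by (rule conf_mono[OF z f]) (use HomD[OF f] in \<open>auto simp: zz zero_Hom Zt cat\<close>)
  have from_Z: "f = g" if f: "f \<in> Hom E Z T" "g \<in> Hom E Z T" for f g T
  proof -
    note X = HomD[OF f(1)] HomD[OF f(2)] Zt
    have "ident E Z = zero E Z Z" using Hom_Z ident_Hom Zt by blast
    moreover have "f = f \<cdot> ident E Z" "g = g \<cdot> ident E Z" using X by (simp_all add: comp_ident)
    ultimately have "f = f \<cdot> zero E Z Z" "g = g \<cdot> zero E Z Z" by simp_all
    moreover have "f \<cdot> zero E Z Z = g \<cdot> zero E Z Z" using X by (simp add: comp_zero)
    ultimately show ?thesis by simp
  qed
  have "is_pushout E z (zero E Z A) i1 i2"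
  proof (rule is_pushoutI[of _ Z D _ A _ P])
    show "z \<in> Hom E Z D" "zero E Z A \<in> Hom E Z A" "i1 \<in> Hom E A P" "i2 \<in> Hom E D P"
      "i2 \<cdot> z = i1 \<cdot> zero E Z A"
      using Zt b H by (auto simp: zero_Hom zz cat)
    show "\<exists>t. t \<in> Hom E P T \<and> t \<cdot> i2 = g \<and> t \<cdot> i1 = h"
      if "g \<in> Hom E D T" "h \<in> Hom E A T" for T g h
      using biproduct_copair[OF bp that(2,1)] by metis
    show "s = t" if "s \<in> Hom E P T" "t \<in> Hom E P T" "s \<cdot> i2 = t \<cdot> i2" "s \<cdot> i1 = t \<cdot> i1" for T s t
      using biproduct_epi[OF bp that(1,2)] that by simp
  qed
  then have inf: "inflation E i1" using is_pushout_inflation[OF Zt(14)] by blast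
  show ?thesis
  proof (rule inflation_cokernel_conf[OF inf b(1) b(4) b(7)])
    fix T h assume h: "h \<in> Hom E P T" "h \<cdot> i1 = zero E A T"
    have "h \<cdot> i2 \<cdot> p2 = h"
      by (rule biproduct_epi[OF bp, of _ T])
        (use HomD[OF h(1)] in \<open>simp_all add: H cat Hom_def h(2) b(5-8) b(5-8)[THEN comp_cong_tail]\<close>)
    then show "\<exists>t. t \<in> Hom E D T \<and> t \<cdot> p2 = h"
      using HomD[OF h(1)] H by (intro exI[of _ "h \<cdot> i2"]) (simp add: cat Hom_def)
  next
    fix T f g assume f: "f \<in> Hom E D T" "g \<in> Hom E D T" "f \<cdot> p2 = g \<cdot> p2"
    note X = HomD[OF f(1)] HomD[OF f(2)] H
    have "f = f \<cdot> p2 \<cdot> i2" by (simp add: X cat b)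
    also have "\<dots> = g" unfolding f(3) by (simp add: X cat b)
    finally show "f = g" .
  qed
qed

text \<open>
  The morphism \<open>i \<oplus> 1\<close> is the pushout of \<open>i\<close> along the
  injection of \<open>A\<close> into \<open>A \<oplus> T\<close>.
\<close>

lemma sum_ident_inflation:
  assumes i: "inflation E i" "i \<in> Hom E A B"
    and P: "biproduct E A T P a1 a2 pa1 pa2" and Q: "biproduct E B T Q b1 b2 pb1 pb2"
    and j: "j \<in> Hom E P Q" "j \<cdot> a1 = b1 \<cdot> i" "j \<cdot> a2 = b2"
  shows "inflation E j"
proof -
  note P' = biproductD[OF P] and Q' = biproductD[OF Q]
  note H = HomD[OF i(2)] P'(1-4)[THEN HomD(1)] P'(1-4)[THEN HomD(2)] P'(1-4)[THEN HomD(3)]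
    Q'(1-4)[THEN HomD(1)] Q'(1-4)[THEN HomD(2)] Q'(1-4)[THEN HomD(3)] HomD[OF j(1)]
  have "is_pushout E i a1 j b1"
  proof (rule is_pushoutI[OF i(2) P'(1) j(1) Q'(1) j(2)[symmetric]])
    fix S g h assume g: "g \<in> Hom E B S" and h: "h \<in> Hom E P S" and gh: "g \<cdot> i = h \<cdot> a1"
    note H = H HomD[OF g] HomD[OF h]
    obtain t where t: "t \<in> Hom E Q S" "t \<cdot> b1 = g" "t \<cdot> b2 = h \<cdot> a2"
      using biproduct_copair[OF Q g comp_Hom[OF P'(2) h]] by blast
    have "t \<cdot> j = h"
      by (rule biproduct_epi[OF P, of _ S])
        (use HomD[OF t(1)] in \<open>simp_all add: H cat Hom_def j t gh t(2)[THEN comp_cong_tail]\<close>)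
    then show "\<exists>t. t \<in> Hom E Q S \<and> t \<cdot> b1 = g \<and> t \<cdot> j = h" using t by blast
  next
    fix S s t assume s: "s \<in> Hom E Q S" "t \<in> Hom E Q S" "s \<cdot> b1 = t \<cdot> b1" "s \<cdot> j = t \<cdot> j"
    note H = H HomD[OF s(1)] HomD[OF s(2)]
    have "s \<cdot> b2 = s \<cdot> j \<cdot> a2" by (simp add: H cat j)
    also have "\<dots> = t \<cdot> b2" unfolding s(4) by (simp add: H cat j)
    finally show "s = t" using biproduct_epi[OF Q s(1-3)] by blast
  qed
  then show ?thesis using is_pushout_inflation[OF i(1)] by blast
qed

text \<open>
  The sum of two inflations is an inflation because \<open>i \<oplus> i' = (1 \<oplus> i') (i
  \<oplus> 1)\<close>.
\<close>

lemma conf_sum: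
  assumes c: "conf E A B D i p" and c': "conf E A' B' D' i' p'"
    and P: "biproduct E A A' P a1 a2 pa1 pa2" and R: "biproduct E D D' R d1 d2 pd1 pd2"
  obtains Q j q b1 b2 y1 y2 where "conf E P Q R j q" "biproduct E B B' Q b1 b2 y1 y2"
    "conf_mor E j q i p pa1 y1 pd1" "conf_mor E j q i' p' pa2 y2 pd2"
proof -
  obtain Q b1 b2 y1 y2 where Q: "biproduct E B B' Q b1 b2 y1 y2"
    using ex_biproduct confD(12)[OF c] confD(12)[OF c'] by blast
  \<comment> \<open>\<open>S\<close> is the middle object of the factorization of \<open>i \<oplus> i'\<close>\<close>
  obtain S s1 s2 z1 z2 where S: "biproduct E B A' S s1 s2 z1 z2"
    using ex_biproduct confD(12)[OF c] confD(11)[OF c'] by blast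
  note b = biproductD[OF P] biproductD[OF Q] biproductD[OF R] biproductD[OF S]
  note H = confD[OF c] confD[OF c'] HomD[OF b(1)] HomD[OF b(2)] HomD[OF b(3)] HomD[OF b(4)]
    HomD[OF b(10)] HomD[OF b(11)] HomD[OF b(12)] HomD[OF b(13)]
    HomD[OF b(19)] HomD[OF b(20)] HomD[OF b(21)] HomD[OF b(22)]
    HomD[OF b(28)] HomD[OF b(29)] HomD[OF b(30)] HomD[OF b(31)]
  have "s1 \<cdot> i \<in> Hom E A S" by (simp add: H cat Hom_def)
  then obtain j1 where j1: "j1 \<in> Hom E P S" "j1 \<cdot> a1 = s1 \<cdot> i" "j1 \<cdot> a2 = s2"
    using biproduct_copair[OF P _ b(29)] by blast
  have "b2 \<cdot> i' \<in> Hom E A' Q" by (simp add: H cat Hom_def)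
  then obtain j2 where j2: "j2 \<in> Hom E S Q" "j2 \<cdot> s1 = b1" "j2 \<cdot> s2 = b2 \<cdot> i'"
    using biproduct_copair[OF S b(10)] by blast
  have "inflation E j1" using sum_ident_inflation[OF confD(14)[OF c] confD(2)[OF c] P S j1] .
  moreover have "inflation E j2"
    using sum_ident_inflation[OF confD(14)[OF c'] confD(2)[OF c'] biproduct_swap[OF S]
        biproduct_swap[OF Q] j2(1,3,2)] .
  ultimately have inf: "inflation E (j2 \<cdot> j1)" using inflation_comp HomD[OF j1(1)] HomD[OF j2(1)] by simp
  define j where "j = j2 \<cdot> j1"
  note H = H HomD[OF j1(1)] HomD[OF j2(1)]
  have j: "j \<in> Hom E P Q" "j \<cdot> a1 = b1 \<cdot> i" "j \<cdot> a2 = b2 \<cdot> i'"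
    by (simp_all add: j_def H cat Hom_def j1 j2 j2(2,3)[THEN comp_cong_tail])
  have "d1 \<cdot> p \<in> Hom E B R" "d2 \<cdot> p' \<in> Hom E B' R" by (simp_all add: H cat Hom_def)
  then obtain q where q: "q \<in> Hom E Q R" "q \<cdot> b1 = d1 \<cdot> p" "q \<cdot> b2 = d2 \<cdot> p'"
    using biproduct_copair[OF Q] by blast
  note H = H HomD[OF j(1)] HomD[OF q(1)]
  note e = j(2,3) q(2,3) j(2,3)[THEN comp_cong_tail] q(2,3)[THEN comp_cong_tail]
    b(5-8,14-17,23-26) b(5-8,14-17,23-26)[THEN comp_cong_tail]
  have qj: "q \<cdot> j = zero E P R"
    by (rule biproduct_epi[OF P, of _ R]) (simp_all add: H cat Hom_def e)
  have cc: "conf E P Q R j q"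
  proof (rule inflation_cokernel_conf[OF inf[folded j_def] j(1) q(1) qj])
    fix T h assume h: "h \<in> Hom E Q T" "h \<cdot> j = zero E P T"
    note H = H HomD[OF h(1)]
    have "h \<cdot> b1 \<cdot> i = h \<cdot> j \<cdot> a1" by (simp add: H cat e)
    then have 1: "h \<cdot> b1 \<cdot> i = zero E A T" unfolding h(2) by (simp add: H cat)
    have "h \<cdot> b2 \<cdot> i' = h \<cdot> j \<cdot> a2" by (simp add: H cat e)
    then have 2: "h \<cdot> b2 \<cdot> i' = zero E A' T" unfolding h(2) by (simp add: H cat)
    obtain t1 where t1: "t1 \<in> Hom E D T" "t1 \<cdot> p = h \<cdot> b1"
      using conf_cokernel[OF c comp_Hom[OF b(10) h(1)] 1] .
    obtain t2 where t2: "t2 \<in> Hom E D' T" "t2 \<cdot> p' = h \<cdot> b2"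
      using conf_cokernel[OF c' comp_Hom[OF b(11) h(1)] 2] .
    obtain t where t: "t \<in> Hom E R T" "t \<cdot> d1 = t1" "t \<cdot> d2 = t2"
      using biproduct_copair[OF R t1(1) t2(1)] by blast
    note H = H HomD[OF t1(1)] HomD[OF t2(1)] HomD[OF t(1)]
    have "t \<cdot> q = h"
      by (rule biproduct_epi[OF Q, of _ T])
        (simp_all add: H cat Hom_def e t1 t2 t t(2,3)[THEN comp_cong_tail])
    then show "\<exists>t. t \<in> Hom E R T \<and> t \<cdot> q = h" using t by blast
  next
    fix T f g assume f: "f \<in> Hom E R T" "g \<in> Hom E R T" "f \<cdot> q = g \<cdot> q"
    note H = H HomD[OF f(1)] HomD[OF f(2)]
    have "f \<cdot> d1 \<cdot> p = f \<cdot> q \<cdot> b1" by (simp add: H cat e)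
    also have "\<dots> = g \<cdot> d1 \<cdot> p" unfolding f(3) by (simp add: H cat e)
    finally have 1: "f \<cdot> d1 = g \<cdot> d1"
      by (rule conf_epi[OF c, rotated 2]) (simp_all add: H cat Hom_def)
    have "f \<cdot> d2 \<cdot> p' = f \<cdot> q \<cdot> b2" by (simp add: H cat e)
    also have "\<dots> = g \<cdot> d2 \<cdot> p'" unfolding f(3) by (simp add: H cat e)
    finally have 2: "f \<cdot> d2 = g \<cdot> d2"
      by (rule conf_epi[OF c', rotated 2]) (simp_all add: H cat Hom_def)
    show "f = g" using biproduct_epi[OF R f(1,2) 1 2] .
  qed
  have m1: "conf_mor E j q i p pa1 y1 pd1"
  proof (rule conf_morI[OF cc c b(3) b(12) b(21)])
    show "y1 \<cdot> j = i \<cdot> pa1" by (rule biproduct_epi[OF P, of _ B]) (simp_all add: H cat Hom_def e)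
    show "pd1 \<cdot> q = p \<cdot> y1" by (rule biproduct_epi[OF Q, of _ D]) (simp_all add: H cat Hom_def e)
  qed
  have m2: "conf_mor E j q i' p' pa2 y2 pd2"
  proof (rule conf_morI[OF cc c' b(4) b(13) b(22)])
    show "y2 \<cdot> j = i' \<cdot> pa2" by (rule biproduct_epi[OF P, of _ B']) (simp_all add: H cat Hom_def e)
    show "pd2 \<cdot> q = p' \<cdot> y2" by (rule biproduct_epi[OF Q, of _ D']) (simp_all add: H cat Hom_def e)
  qed
  show ?thesis using that[OF cc Q m1 m2] .
qed

lemma conf_sum_mor:
  assumes c0: "conf E A0 B0 D0 i0 p0" and c: "conf E A B D i p" and c': "conf E A' B' D' i' p'"
    and P: "biproduct E A A' P a1 a2 pa1 pa2" and R: "biproduct E D D' R d1 d2 pd1 pd2"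
    and cs: "conf E P Q R j q" and Q: "biproduct E B B' Q b1 b2 y1 y2"
    and s1: "conf_mor E j q i p pa1 y1 pd1" and s2: "conf_mor E j q i' p' pa2 y2 pd2"
    and x: "x \<in> Hom E A0 P" "z \<in> Hom E D0 R"
    and m1: "conf_mor E i0 p0 i p (pa1 \<cdot> x) t1 (pd1 \<cdot> z)"
    and m2: "conf_mor E i0 p0 i' p' (pa2 \<cdot> x) t2 (pd2 \<cdot> z)"
  obtains t where "conf_mor E i0 p0 j q x t z"
proof -
  note S1 = conf_morD[OF s1 cs c] and S2 = conf_morD[OF s2 cs c']
  note M1 = conf_morD[OF m1 c0 c] and M2 = conf_morD[OF m2 c0 c']
  obtain t where t: "t \<in> Hom E B0 Q" "y1 \<cdot> t = t1" "y2 \<cdot> t = t2"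
    using biproduct_pair[OF Q M1(2) M2(2)] by blast
  note H = confD[OF c0] confD[OF c] confD[OF c'] confD[OF cs] HomD[OF S1(1)] HomD[OF S1(2)]
    HomD[OF S1(3)] HomD[OF S2(1)] HomD[OF S2(2)] HomD[OF S2(3)] HomD[OF M1(2)] HomD[OF M2(2)]
    HomD[OF x(1)] HomD[OF x(2)] HomD[OF t(1)]
  note e = S1(4) S2(4) M1(4) M2(4) t(2,3) S1(4)[THEN comp_cong_tail] S2(4)[THEN comp_cong_tail]
    t(2,3)[THEN comp_cong_tail]
  note e' = S1(5) S2(5) S1(5)[THEN comp_cong_tail] S2(5)[THEN comp_cong_tail] t(2,3)
  show ?thesis
  proof (rule that, rule conf_morI[OF c0 cs x(1) t(1) x(2)])
    show "t \<cdot> i0 = j \<cdot> x"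
      by (rule biproduct_mono[OF Q, of _ A0]) (simp_all add: H cat Hom_def e)
    have "pd1 \<cdot> (z \<cdot> p0) = p \<cdot> t1" using M1(5) by (simp add: H cat)
    moreover have "pd2 \<cdot> (z \<cdot> p0) = p' \<cdot> t2" using M2(5) by (simp add: H cat)
    ultimately show "z \<cdot> p0 = q \<cdot> t"
      using e' by (subst biproduct_mono[OF R, of _ B0 "q \<cdot> t"]) (simp_all add: H cat Hom_def)
  qed
qed

text \<open>
  The morphism \<open>(i, t) : A \<rightarrow> B \<oplus> B'\<close> is the graph \<open>(1, t)
  : A \<rightarrow> A \<oplus> B'\<close>, a split monomorphism, followed by the inflation
  \<open>i \<oplus> 1\<close>; the universal property of the pushout says that \<open>F\<close>
  is its cokernel.
\<close>

lemma pushout_sum_conf: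
  assumes i: "inflation E i" "i \<in> Hom E A B" and t: "t \<in> Hom E A B'"
    and Q: "biproduct E B B' Q b1 b2 y1 y2"
    and d: "d1 \<in> Hom E B F" "d2 \<in> Hom E B' F" and po: "is_pushout E i t d2 d1"
    and j: "j \<in> Hom E A Q" "y1 \<cdot> j = i" "y2 \<cdot> j = t"
    and q: "q \<in> Hom E Q F" "q \<cdot> b1 = d1" "q \<cdot> b2 = neg E d2"
  shows "conf E A Q F j q"
proof -
  obtain P a1 a2 z1 z2 where P: "biproduct E A B' P a1 a2 z1 z2"
    using ex_biproduct HomD[OF t] by blast
  note b = biproductD[OF P] biproductD[OF Q]
  note H = HomD[OF i(2)] HomD[OF t] HomD[OF b(1)] HomD[OF b(2)] HomD[OF b(3)] HomD[OF b(4)]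
    HomD[OF b(10)] HomD[OF b(11)] HomD[OF b(12)] HomD[OF b(13)] HomD[OF d(1)] HomD[OF d(2)]
    HomD[OF j(1)] HomD[OF q(1)]
  note be = b(5-8,14-17) b(5-8,14-17)[THEN comp_cong_tail]
  have F': "tgt E d2 = F" using d by (simp add: Hom_def)
  note po' = is_pushoutD(3-5)[OF po i(2) t, unfolded F']
  note dt = po'(1) po'(1)[THEN comp_cong_tail]
  obtain s where s: "s \<in> Hom E A P" "z1 \<cdot> s = ident E A" "z2 \<cdot> s = t"
    using biproduct_pair[OF P ident_Hom t] H by blast
  note H = H HomD[OF s(1)]
  \<comment> \<open>the graph of \<open>t\<close> is a direct summand of \<open>A \<oplus> B'\<close>\<close>
  have "biproduct E A B' P s a2 z1 (add E z2 (neg E (t \<cdot> z1)))"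
    unfolding biproduct_def
  proof (intro conjI)
    show "s \<in> Hom E A P" "a2 \<in> Hom E B' P" "z1 \<in> Hom E P A"
      "add E z2 (neg E (t \<cdot> z1)) \<in> Hom E P B'" "z1 \<cdot> s = ident E A"
      "add E z2 (neg E (t \<cdot> z1)) \<cdot> a2 = ident E B'" "z1 \<cdot> a2 = zero E B' A"
      "add E z2 (neg E (t \<cdot> z1)) \<cdot> s = zero E A B'"
      by (simp_all add: H cat Hom_def s be)
    show "add E (s \<cdot> z1) (a2 \<cdot> add E z2 (neg E (t \<cdot> z1))) = ident E P"
    proof (rule biproduct_mono[OF P, of _ P])
      have "add E (t \<cdot> z1) (add E z2 (neg E (t \<cdot> z1))) = z2"
        by (rule add_diff[OF comp_Hom[OF b(3) t] b(4)])
      then show "z2 \<cdot> add E (s \<cdot> z1) (a2 \<cdot> add E z2 (neg E (t \<cdot> z1))) = z2 \<cdot> ident E P"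
        by (simp add: H cat Hom_def be s s(2,3)[THEN comp_cong_tail])
    qed (simp_all add: H cat Hom_def be s s(2,3)[THEN comp_cong_tail])
  qed
  then have inf_s: "inflation E s" using biproduct_conf confD(14) by blast
  have "b1 \<cdot> i \<in> Hom E A Q" by (simp add: H cat Hom_def)
  then obtain k where k: "k \<in> Hom E P Q" "k \<cdot> a1 = b1 \<cdot> i" "k \<cdot> a2 = b2"
    using biproduct_copair[OF P _ b(11)] by blast
  note H = H HomD[OF k(1)]
  have k1: "y1 \<cdot> k = i \<cdot> z1"
    by (rule biproduct_epi[OF P, of _ B]) (simp_all add: H cat Hom_def be k)
  have k2: "y2 \<cdot> k = z2"
    by (rule biproduct_epi[OF P, of _ B']) (simp_all add: H cat Hom_def be k)
  have "j = k \<cdot> s"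
    by (rule biproduct_mono[OF Q, of _ A])
      (simp_all add: H cat Hom_def j s k1[THEN comp_cong_tail] k2[THEN comp_cong_tail])
  moreover have "inflation E k" using sum_ident_inflation[OF i P Q k] .
  ultimately have inf: "inflation E j" using inflation_comp[OF inf_s] H by simp
  have jd: "j = add E (b1 \<cdot> i) (b2 \<cdot> t)"
    by (rule biproduct_mono[OF Q, of _ A]) (simp_all add: H cat Hom_def be j)
  show ?thesis
  proof (rule inflation_cokernel_conf[OF inf j(1) q(1)])
    show "q \<cdot> j = zero E A F"
      unfolding jd by (simp add: H cat q q(2,3)[THEN comp_cong_tail] dt)
  next
    fix T h assume h: "h \<in> Hom E Q T" "h \<cdot> j = zero E A T"
    note H = H HomD[OF h(1)]
    have "add E (h \<cdot> b2 \<cdot> t) (h \<cdot> b1 \<cdot> i) = add E (h \<cdot> b1 \<cdot> i) (h \<cdot> b2 \<cdot> t)"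
      by (rule add_comm_Hom[of A T]) (simp_all add: H cat Hom_def)
    also have "\<dots> = zero E A T" using h(2) unfolding jd by (simp add: H cat)
    finally have "h \<cdot> b1 \<cdot> i = neg E (h \<cdot> b2 \<cdot> t)"
      by (intro neg_unique) (simp_all add: H cat)
    then have eq: "h \<cdot> b1 \<cdot> i = neg E (h \<cdot> b2) \<cdot> t" by (simp add: H cat)
    obtain u where u: "u \<in> Hom E F T" "u \<cdot> d1 = h \<cdot> b1" "u \<cdot> d2 = neg E (h \<cdot> b2)"
      using po'(2)[OF _ _ eq, of T] by (auto simp: H cat Hom_def)
    have "u \<cdot> q = h"
      by (rule biproduct_epi[OF Q, of _ T])
        (use HomD[OF u(1)] in \<open>simp_all add: H cat Hom_def q u\<close>)
    then show "\<exists>u. u \<in> Hom E F T \<and> u \<cdot> q = h" using u by blast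
  next
    fix T f g assume f: "f \<in> Hom E F T" "g \<in> Hom E F T" "f \<cdot> q = g \<cdot> q"
    note H = H HomD[OF f(1)] HomD[OF f(2)]
    have "f \<cdot> d1 = f \<cdot> q \<cdot> b1" by (simp add: H cat q)
    also have "\<dots> = g \<cdot> d1" unfolding f(3) by (simp add: H cat q)
    finally have 1: "f \<cdot> d1 = g \<cdot> d1" .
    have "neg E (f \<cdot> d2) = f \<cdot> q \<cdot> b2" by (simp add: H cat q)
    also have "\<dots> = neg E (g \<cdot> d2)" unfolding f(3) by (simp add: H cat q)
    finally have "neg E (neg E (f \<cdot> d2)) = neg E (neg E (g \<cdot> d2))" by simp
    then have 2: "f \<cdot> d2 = g \<cdot> d2" by (simp add: H cat)
    show "f = g" using po'(3)[OF f(1,2) 1 2] .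
  qed
qed

section \<open>Squares and filtrations\<close>

lemma is_pullbackI:
  assumes "p \<in> Hom E B D" "f \<in> Hom E D' D" "p' \<in> Hom E B' D'" "f' \<in> Hom E B' B" "p \<cdot> f' = f \<cdot> p'"
    and "\<And>T g h. g \<in> Hom E T B \<Longrightarrow> h \<in> Hom E T D' \<Longrightarrow> p \<cdot> g = f \<cdot> h \<Longrightarrow>
      \<exists>t. t \<in> Hom E T B' \<and> f' \<cdot> t = g \<and> p' \<cdot> t = h"
    and "\<And>T s t. s \<in> Hom E T B' \<Longrightarrow> t \<in> Hom E T B' \<Longrightarrow> f' \<cdot> s = f' \<cdot> t \<Longrightarrow> p' \<cdot> s = p' \<cdot> t \<Longrightarrow> s = t"
  shows "is_pullback E p f p' f'"
  using exact_category.is_pushoutI[OF exact_category_op, of p D B f D' p' B' f'] assms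
  by (simp add: op_is_pushout)

text \<open>
  A pair \<open>g, h\<close> over \<open>D'\<close> can be lifted after pulling \<open>p\<close>
  back along \<open>h\<close>, where the error of a first lift is a morphism into
  \<open>A\<close>; the corrected lift vanishes on the kernel of the pulled back deflation and
  descends.
\<close>

lemma conf_mor_is_pullback:
  assumes c: "conf E A B D i p" and c': "conf E A B' D' i' p'"
    and m: "conf_mor E i p i' p' (ident E A) b d"
  shows "is_pullback E p' d p b"
proof -
  note M = conf_morD[OF m c c']
  note H0 = confD[OF c] confD[OF c'] HomD[OF M(2)] HomD[OF M(3)]
  have bi: "b \<cdot> i = i'" using M(4) by (simp add: H0 cat)
  note eqs = bi M(5) confD(4)[OF c] confD(4)[OF c'] bi[THEN comp_cong_tail] M(5)[THEN comp_cong_tail]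
    confD(4)[OF c, THEN comp_cong_tail] confD(4)[OF c', THEN comp_cong_tail]
  note eqs' = bi M(5)[symmetric] confD(4)[OF c] confD(4)[OF c'] bi[THEN comp_cong_tail]
    M(5)[symmetric, THEN comp_cong_tail]
    confD(4)[OF c, THEN comp_cong_tail] confD(4)[OF c', THEN comp_cong_tail]
  show ?thesis
  proof (rule is_pullbackI[OF confD(3)[OF c'] M(3) confD(3)[OF c] M(2) M(5)[symmetric]])
    fix T g h assume g: "g \<in> Hom E T B'" and h: "h \<in> Hom E T D" and gh: "p' \<cdot> g = d \<cdot> h"
    \<comment> \<open>\<open>x\<close> lifts \<open>h p\<^sub>0\<close>, but \<open>b x\<close> agrees with \<open>g p\<^sub>0\<close> only up to a morphism \<open>a\<close> into \<open>A\<close>\<close>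
    obtain T' i0 p0 x where c0: "conf E A T' T i0 p0"
      and m0: "conf_mor E i0 p0 i p (ident E A) x h"
      by (rule pull_conf[OF c h]) (rule that)
    note M0 = conf_morD[OF m0 c0 c]
    note H = H0 confD[OF c0] HomD[OF M0(2)] HomD[OF g] HomD[OF h]
    have d: "add E (g \<cdot> p0) (neg E (b \<cdot> x)) \<in> Hom E T' B'" by (simp add: H cat Hom_def)
    have "p' \<cdot> (g \<cdot> p0) = d \<cdot> (h \<cdot> p0)" using gh[THEN comp_cong_tail, of p0] by (simp add: H cat)
    also have "\<dots> = p' \<cdot> (b \<cdot> x)"
      unfolding M0(5) by (simp add: H cat eqs')
    finally have "p' \<cdot> add E (g \<cdot> p0) (neg E (b \<cdot> x)) = zero E T' D'"
      by (simp add: H cat)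
    then obtain a where a: "a \<in> Hom E T' A" "i' \<cdot> a = add E (g \<cdot> p0) (neg E (b \<cdot> x))"
      using conf_kernel[OF c' d] by blast
    define y where "y = add E x (i \<cdot> a)"
    note H = H HomD[OF a(1)]
    have y: "y \<in> Hom E T' B" by (simp add: y_def H cat Hom_def)
    have py: "p \<cdot> y = h \<cdot> p0" by (simp add: y_def H cat eqs M0(5))
    have bxH: "b \<cdot> x \<in> Hom E T' B'" "g \<cdot> p0 \<in> Hom E T' B'" by (simp_all add: H cat Hom_def)
    have "b \<cdot> y = add E (b \<cdot> x) (i' \<cdot> a)" by (simp add: y_def H cat eqs)
    also have "\<dots> = g \<cdot> p0" unfolding a(2) by (rule add_diff[OF bxH])
    finally have by': "b \<cdot> y = g \<cdot> p0" .
    note H = H HomD[OF y]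
    have "p \<cdot> (y \<cdot> i0) = zero E A D" by (simp add: H cat py[THEN comp_cong_tail])
    then obtain z where z: "z \<in> Hom E A A" "i \<cdot> z = y \<cdot> i0"
      using conf_kernel[OF c, of "y \<cdot> i0" A] H by (auto simp: cat Hom_def)
    note H = H HomD[OF z(1)]
    have "i' \<cdot> z = b \<cdot> (i \<cdot> z)" by (simp add: H cat eqs)
    also have "\<dots> = g \<cdot> (p0 \<cdot> i0)" unfolding z(2) by (simp add: H cat by'[THEN comp_cong_tail])
    also have "\<dots> = i' \<cdot> zero E A A" by (simp add: H cat)
    finally have "z = zero E A A" using conf_mono[OF c' z(1)] H zero_Hom by metis
    then have "y \<cdot> i0 = zero E A B" using z(2) by (simp add: H cat)
    then obtain t where t: "t \<in> Hom E T B" "t \<cdot> p0 = y" using conf_cokernel[OF c0 y] by blast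
    note H = H HomD[OF t(1)]
    have "b \<cdot> t = g" by (rule conf_epi[OF c0 _ g]) (simp_all add: H cat Hom_def t by')
    moreover have "p \<cdot> t = h" by (rule conf_epi[OF c0 _ h]) (simp_all add: H cat Hom_def t py)
    ultimately show "\<exists>t. t \<in> Hom E T B \<and> b \<cdot> t = g \<and> p \<cdot> t = h" using t by blast
  next
    fix T f g assume f: "f \<in> Hom E T B" "g \<in> Hom E T B" "b \<cdot> f = b \<cdot> g" "p \<cdot> f = p \<cdot> g"
    note H = H0 HomD[OF f(1)] HomD[OF f(2)]
    have d: "add E f (neg E g) \<in> Hom E T B" by (simp add: H cat Hom_def)
    have "p \<cdot> add E f (neg E g) = zero E T D" by (simp add: H cat f(4))
    then obtain y where y: "y \<in> Hom E T A" "i \<cdot> y = add E f (neg E g)"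
      using conf_kernel[OF c d] by blast
    note H = H HomD[OF y(1)]
    have "i' \<cdot> y = b \<cdot> (i \<cdot> y)" by (simp add: H cat eqs)
    also have "\<dots> = i' \<cdot> zero E T A" unfolding y(2) by (simp add: H cat f(3))
    finally have "y = zero E T A" using conf_mono[OF c' y(1)] H zero_Hom by metis
    then show "f = g" using y(2) diff_zero[OF f(1,2)] by (simp add: H cat)
  qed
qed

text \<open>
  The dual of \<open>pushout_sum_conf\<close> for the pullback square formed by \<open>b\<close>
  and \<open>d\<close>. It turns the question whether an element of \<open>Ext(X, D)\<close>
  lifts to \<open>B\<close> into one about exactness at \<open>Ext(X, B' \<oplus> D)\<close>.
\<close>

lemma conf_pullback_sum:
  assumes c: "conf E A B D i p" and c': "conf E A B' D' i' p'"
    and m: "conf_mor E i p i' p' (ident E A) b d"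
    and Q: "biproduct E B' D Q b1 b2 y1 y2"
  obtains j e where "conf E B Q D' j e" "y1 \<cdot> j = b" "y2 \<cdot> j = neg E p" "e \<cdot> b1 = p'" "e \<cdot> b2 = d"
proof -
  note M = conf_morD[OF m c c']
  note C = confD[OF c] and C' = confD[OF c']
  obtain e where e: "e \<in> Hom E Q D'" "e \<cdot> b1 = p'" "e \<cdot> b2 = d"
    using biproduct_copair[OF Q C'(3) M(3)] by blast
  have "neg E p \<in> Hom E B D" using C by (simp add: cat Hom_def)
  then obtain j where j: "j \<in> Hom E B Q" "y1 \<cdot> j = b" "y2 \<cdot> j = neg E p"
    using biproduct_pair[OF Q M(2)] by blast
  have "conf (op_cat E) D' Q B e j"
    by (rule exact_category.pushout_sum_conf[OF exact_category_op, of p' D' B' d D Q y1 y2 b1 b2 b B p])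
      (use C C' M Q e j conf_mor_is_pullback[OF c c' m] in
        \<open>simp_all add: op_inflation op_biproduct op_is_pushout\<close>)
  then show ?thesis using that e j by (simp add: op_conf)
qed

text \<open>
  Two conflations that start in \<open>A\<close> are compared through a third one, \<open>A
  \<rightarrow> B' \<oplus> B \<rightarrow> F\<close>, which maps to both by a morphism that is
  the identity on \<open>A\<close>. Here \<open>F\<close> is the pushout of \<open>B
  \<leftarrow> A \<rightarrow> B'\<close>.
\<close>

lemma pushout_roof:
  assumes c: "conf E A B D i p" and c': "conf E A B' D' t u"
  obtains F d1 q b Q j e y z d where "conf E B F D' d1 q" "conf_mor E t u d1 q i b (ident E D')"
    "conf E A Q F j e" "conf_mor E j e t u (ident E A) y q" "conf_mor E j e i p (ident E A) z d"
proof -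
  note C = confD[OF c] and C' = confD[OF c']
  obtain F d1 q b where c1: "conf E B F D' d1 q" and m1: "conf_mor E t u d1 q i b (ident E D')"
    and po: "is_pushout E t i d1 b"
    using push_conf[OF c' C(2)] by blast
  note M1 = conf_morD[OF m1 c' c1]
  obtain Q b1 b2 y1 y2 where Q: "biproduct E B' B Q b1 b2 y1 y2" using ex_biproduct C C' by blast
  note b = biproductD[OF Q]
  note H = C C' confD[OF c1] HomD[OF M1(2)] HomD[OF b(1)] HomD[OF b(2)] HomD[OF b(3)] HomD[OF b(4)]
  obtain j where j: "j \<in> Hom E A Q" "y1 \<cdot> j = t" "y2 \<cdot> j = i"
    using biproduct_pair[OF Q C'(2) C(2)] by blast
  have "neg E d1 \<in> Hom E B F" by (simp add: H cat Hom_def)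
  then obtain e where e: "e \<in> Hom E Q F" "e \<cdot> b1 = b" "e \<cdot> b2 = neg E d1"
    using biproduct_copair[OF Q M1(2)] by blast
  have ce: "conf E A Q F j e"
    by (rule pushout_sum_conf[OF C'(14) C'(2) C(2) Q M1(2) _ po j e]) (simp add: H Hom_def)
  note H = H confD[OF ce]
  have qb: "q \<cdot> b = u" using M1(5) by (simp add: H cat)
  have "zero E B' D \<cdot> t = neg E p \<cdot> i" by (simp add: H cat)
  moreover have "zero E B' D \<in> Hom E B' D" "neg E p \<in> Hom E B D" by (simp_all add: H cat Hom_def)
  ultimately obtain d where d: "d \<in> Hom E F D" "d \<cdot> b = zero E B' D" "d \<cdot> d1 = neg E p"
    using is_pushoutD(4)[OF po C'(2) C(2)] H by metis
  note H = H HomD[OF d(1)]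
  note eqs = qb d(2,3) e(2,3) b(5-8) confD(4)[OF c1]
  have "conf_mor E j e t u (ident E A) y1 q"
  proof (rule conf_morI[OF ce c' _ b(3) confD(3)[OF c1]])
    show "q \<cdot> e = u \<cdot> y1"
      by (rule biproduct_epi[OF Q, of _ D']) (simp_all add: H cat Hom_def eqs)
  qed (simp_all add: H cat Hom_def j)
  moreover have "conf_mor E j e i p (ident E A) y2 d"
  proof (rule conf_morI[OF ce c _ b(4) d(1)])
    show "d \<cdot> e = p \<cdot> y2"
      by (rule biproduct_epi[OF Q, of _ D]) (simp_all add: H cat Hom_def eqs)
  qed (simp_all add: H cat Hom_def j)
  ultimately show ?thesis using that[OF c1 m1 ce] by blast
qed

text \<open>
  Noether's isomorphism: with \<open>D = B/A\<close>, \<open>L = F/B\<close> and \<open>D' =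
  F/A\<close>, the object \<open>F/A\<close> is an extension of \<open>F/B\<close> by
  \<open>B/A\<close>. It is constructed as the pushout of \<open>b\<close> along
  \<open>p\<close>.
\<close>

lemma noether:
  assumes c: "conf E A B D i p" and c': "conf E B F L b l"
  obtains D' d q r where "conf E D D' L d q" "conf E A F D' (b \<cdot> i) r"
    "conf_mor E b l d q p r (ident E L)" "conf_mor E (b \<cdot> i) r b l i (ident E F) q"
proof -
  note C = confD[OF c] and C' = confD[OF c']
  obtain D' d q r where c1: "conf E D D' L d q" and m1: "conf_mor E b l d q p r (ident E L)"
    and po: "is_pushout E b p d r"
    using push_conf[OF c' C(3)] by blast
  note M1 = conf_morD[OF m1 c' c1]
  note H = C C' confD[OF c1] HomD[OF M1(2)]
  have D': "tgt E d = D'" by (simp add: H)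
  note po' = is_pushoutD(4,5)[OF po C'(2) C(3), unfolded D']
  have inf: "inflation E (b \<cdot> i)" using inflation_comp[OF C(14) C'(14)] H by simp
  have rb: "r \<cdot> b = d \<cdot> p" by (fact M1(4))
  note eqs = rb[THEN comp_cong_tail] rb
  have cc: "conf E A F D' (b \<cdot> i) r"
  proof (rule inflation_cokernel_conf[OF inf comp_Hom[OF C(2) C'(2)] M1(2)])
    show "r \<cdot> (b \<cdot> i) = zero E A D'" by (simp add: H cat eqs)
  next
    fix T h assume h: "h \<in> Hom E F T" "h \<cdot> (b \<cdot> i) = zero E A T"
    note H = H HomD[OF h(1)]
    have "h \<cdot> b \<cdot> i = zero E A T" using h(2) by (simp add: H cat)
    then obtain s where s: "s \<in> Hom E D T" "s \<cdot> p = h \<cdot> b"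
      using conf_cokernel[OF c comp_Hom[OF C'(2) h(1)]] by blast
    then show "\<exists>t. t \<in> Hom E D' T \<and> t \<cdot> r = h" using po'(1)[OF h(1) s(1)] by auto
  next
    fix T f g assume f: "f \<in> Hom E D' T" "g \<in> Hom E D' T" "f \<cdot> r = g \<cdot> r"
    note H = H HomD[OF f(1)] HomD[OF f(2)]
    have "f \<cdot> d \<cdot> p = f \<cdot> r \<cdot> b" by (simp add: H cat eqs)
    also have "\<dots> = g \<cdot> d \<cdot> p" unfolding f(3) by (simp add: H cat eqs)
    finally have "f \<cdot> d = g \<cdot> d"
      by (rule conf_epi[OF c, rotated 2]) (simp_all add: H cat Hom_def)
    then show "f = g" using po'(2)[OF f(1,2)] f(3) by blast
  qed
  moreover have "conf_mor E (b \<cdot> i) r b l i (ident E F) q"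
    by (rule conf_morI[OF cc c' C(2) _ confD(3)[OF c1]])
      (use M1(5) in \<open>simp_all add: H cat Hom_def\<close>)
  ultimately show ?thesis using that[OF c1 _ m1] by blast
qed

text \<open>
  The pullback of a conflation along its own deflation splits. This is why the composite of
  \<open>Ext(X, B) \<rightarrow> Ext(X, D)\<close> with the connecting map is zero, as
  \<open>conf_to_split\<close> is for the other composite with the connecting map.
\<close>

lemma conf_split_over:
  assumes c: "conf E A B D i p"
  obtains R j1 j2 q1 q2 y where "biproduct E A B R j1 j2 q1 q2"
    "conf_mor E j1 q2 i p (ident E A) y p"
proof -
  note C = confD[OF c]
  obtain R j1 j2 q1 q2 where R: "biproduct E A B R j1 j2 q1 q2" using ex_biproduct C by blast
  note b = biproductD[OF R]
  obtain y where y: "y \<in> Hom E R B" "y \<cdot> j1 = i" "y \<cdot> j2 = ident E B"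
    using biproduct_copair[OF R C(2) ident_Hom] C by blast
  note H = C HomD[OF y(1)] HomD[OF b(1)] HomD[OF b(2)] HomD[OF b(3)] HomD[OF b(4)]
  have "conf_mor E j1 q2 i p (ident E A) y p"
  proof (rule conf_morI[OF biproduct_conf[OF R] c _ y(1) C(3)])
    show "p \<cdot> q2 = p \<cdot> y"
      by (rule biproduct_epi[OF R, of _ D]) (simp_all add: H cat Hom_def y b)
  qed (simp_all add: H cat Hom_def y)
  then show ?thesis using that[OF R] by blast
qed

lemma split_conf_mor:
  assumes R: "biproduct E A D R j1 j2 q1 q2"
  shows "conf_mor E j1 q2 j1 q2 (zero E A A) (j2 \<cdot> q2) (ident E D)"
proof -
  note b = biproductD[OF R]
  note H = HomD[OF b(1)] HomD[OF b(2)] HomD[OF b(3)] HomD[OF b(4)]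
  show ?thesis
    by (rule conf_morI[OF biproduct_conf[OF R] biproduct_conf[OF R]])
      (simp_all add: H cat Hom_def b b(5-8)[THEN comp_cong_tail])
qed

lemma conf_to_split:
  assumes c: "conf E A B D i p"
  obtains R j1 j2 q1 q2 y where "biproduct E B D R j1 j2 q1 q2"
    "conf_mor E i p j1 q2 i y (ident E D)"
proof -
  note C = confD[OF c]
  obtain R j1 j2 q1 q2 where R: "biproduct E B D R j1 j2 q1 q2" using ex_biproduct C by blast
  note b = biproductD[OF R]
  obtain y where y: "y \<in> Hom E B R" "q1 \<cdot> y = ident E B" "q2 \<cdot> y = p"
    using biproduct_pair[OF R ident_Hom C(3)] C by blast
  note H = C HomD[OF y(1)] HomD[OF b(1)] HomD[OF b(2)] HomD[OF b(3)] HomD[OF b(4)]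
  have "conf_mor E i p j1 q2 i y (ident E D)"
  proof (rule conf_morI[OF c biproduct_conf[OF R] C(2) y(1)])
    show "y \<cdot> i = j1 \<cdot> i"
      by (rule biproduct_mono[OF R, of _ A])
        (simp_all add: H cat Hom_def y(2,3)[THEN comp_cong_tail] b(5-8)[THEN comp_cong_tail])
  qed (simp_all add: H cat Hom_def y)
  then show ?thesis using that[OF R] by blast
qed

end

section \<open>Extensions and chain maps\<close>

fun path :: "('o, 'm, 'x) additive_cat_scheme \<Rightarrow> 'm list \<Rightarrow> bool" where
  "path C [] \<longleftrightarrow> False"
| "path C [x] \<longleftrightarrow> x \<in> arr C"
| "path C (x # y # zs) \<longleftrightarrow> x \<in> arr C \<and> tgt C x = src C y \<and> path C (y # zs)"

text \<open>
  Only the first component \<open>a\<close> and the last component \<open>z\<close> of a chain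
  map matter for extensions. The recursion lets the other components be chosen one at a time.
\<close>

fun chain_map :: "('o, 'm, 'x) additive_cat_scheme \<Rightarrow> 'm list \<Rightarrow> 'm list \<Rightarrow> 'm \<Rightarrow> 'm \<Rightarrow> bool" where
  "chain_map C [x] [y] a z \<longleftrightarrow> a \<in> Hom C (src C x) (src C y) \<and> z \<in> Hom C (tgt C x) (tgt C y) \<and>
    cmp C z x = cmp C y a"
| "chain_map C (x # x' # xs) (y # y' # ys) a z \<longleftrightarrow> a \<in> Hom C (src C x) (src C y) \<and>
    (\<exists>b. cmp C b x = cmp C y a \<and> chain_map C (x' # xs) (y' # ys) b z)"
| "chain_map C xs ys a z \<longleftrightarrow> False"

lemma chain_map_length: "chain_map C xs ys a z \<Longrightarrow> length xs = length ys \<and> xs \<noteq> [] \<and> ys \<noteq> []"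
  by (induction C xs ys a z rule: chain_map.induct) auto

lemma chain_map_first: "chain_map C xs ys a z \<Longrightarrow> a \<in> Hom C (src C (hd xs)) (src C (hd ys))"
  by (induction C xs ys a z rule: chain_map.induct) auto

lemma seq_obj_simps [simp]:
  "seq_obj C (x # xs) 0 = src C x"
  "seq_obj C (x # y # xs) (Suc j) = seq_obj C (y # xs) j"
  "seq_obj C [x] (Suc 0) = tgt C x"
  by (auto simp: seq_obj_def)

lemma chain_map_iff:
  assumes "length xs = length ys" "xs \<noteq> []"
  shows "chain_map C xs ys a z \<longleftrightarrow>
    (\<exists>f. (\<forall>j\<le>length xs. f j \<in> Hom C (seq_obj C xs j) (seq_obj C ys j)) \<and>
      (\<forall>j<length xs. cmp C (f (Suc j)) (xs ! j) = cmp C (ys ! j) (f j)) \<and>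
      f 0 = a \<and> f (length xs) = z)"
  using assms
proof (induction C xs ys a z rule: chain_map.induct)
  case (1 C x y a z)
  show ?case
  proof
    assume "chain_map C [x] [y] a z"
    then show "\<exists>f. (\<forall>j\<le>length [x]. f j \<in> Hom C (seq_obj C [x] j) (seq_obj C [y] j)) \<and>
      (\<forall>j<length [x]. cmp C (f (Suc j)) ([x] ! j) = cmp C ([y] ! j) (f j)) \<and>
      f 0 = a \<and> f (length [x]) = z"
      by (intro exI[of _ "\<lambda>j. if j = 0 then a else z"]) (auto simp: le_Suc_eq)
  next
    assume "\<exists>f. (\<forall>j\<le>length [x]. f j \<in> Hom C (seq_obj C [x] j) (seq_obj C [y] j)) \<and>
      (\<forall>j<length [x]. cmp C (f (Suc j)) ([x] ! j) = cmp C ([y] ! j) (f j)) \<and>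
      f 0 = a \<and> f (length [x]) = z"
    then obtain f where f: "\<forall>j\<le>1. f j \<in> Hom C (seq_obj C [x] j) (seq_obj C [y] j)"
      "cmp C (f 1) x = cmp C y (f 0)" "f 0 = a" "f 1 = z" by auto
    show "chain_map C [x] [y] a z" using f(1)[rule_format, of 0] f(1)[rule_format, of 1] f(2-4) by simp
  qed
next
  case (2 C x x' xs y y' ys a z)
  let ?P = "\<lambda>f. (\<forall>j\<le>length (x # x' # xs).
        f j \<in> Hom C (seq_obj C (x # x' # xs) j) (seq_obj C (y # y' # ys) j)) \<and>
      (\<forall>j<length (x # x' # xs).
        cmp C (f (Suc j)) ((x # x' # xs) ! j) = cmp C ((y # y' # ys) ! j) (f j)) \<and>
      f 0 = a \<and> f (length (x # x' # xs)) = z"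
  have IH: "chain_map C (x' # xs) (y' # ys) b z \<longleftrightarrow>
    (\<exists>f. (\<forall>j\<le>length (x' # xs). f j \<in> Hom C (seq_obj C (x' # xs) j) (seq_obj C (y' # ys) j)) \<and>
      (\<forall>j<length (x' # xs). cmp C (f (Suc j)) ((x' # xs) ! j) = cmp C ((y' # ys) ! j) (f j)) \<and>
      f 0 = b \<and> f (length (x' # xs)) = z)" for b
    using 2 by simp
  show ?case
  proof
    assume "chain_map C (x # x' # xs) (y # y' # ys) a z"
    then obtain b where b: "a \<in> Hom C (src C x) (src C y)" "cmp C b x = cmp C y a"
      "chain_map C (x' # xs) (y' # ys) b z" by auto
    from b(3)[unfolded IH] obtain f where
      f: "\<forall>j\<le>length (x' # xs). f j \<in> Hom C (seq_obj C (x' # xs) j) (seq_obj C (y' # ys) j)"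
        "\<forall>j<length (x' # xs). cmp C (f (Suc j)) ((x' # xs) ! j) = cmp C ((y' # ys) ! j) (f j)"
        "f 0 = b" "f (length (x' # xs)) = z" by blast
    have "?P (case_nat a f)"
    proof (intro conjI allI impI)
      fix j
      show "case_nat a f j \<in> Hom C (seq_obj C (x # x' # xs) j) (seq_obj C (y # y' # ys) j)"
        if "j \<le> length (x # x' # xs)" using that f(1) b(1) by (cases j) auto
      show "cmp C (case_nat a f (Suc j)) ((x # x' # xs) ! j)
          = cmp C ((y # y' # ys) ! j) (case_nat a f j)"
        if "j < length (x # x' # xs)" using that f(2) f(3) b(2) by (cases j) auto
    qed (use f(4) in auto)
    then show "\<exists>f. ?P f" by blast
  next
    assume "\<exists>f. ?P f"
    then obtain f where f: "?P f" by blast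
    have "\<exists>g. (\<forall>j\<le>length (x' # xs). g j \<in> Hom C (seq_obj C (x' # xs) j) (seq_obj C (y' # ys) j)) \<and>
      (\<forall>j<length (x' # xs). cmp C (g (Suc j)) ((x' # xs) ! j) = cmp C ((y' # ys) ! j) (g j)) \<and>
      g 0 = f 1 \<and> g (length (x' # xs)) = z"
    proof (intro exI[of _ "\<lambda>j. f (Suc j)"] conjI allI impI)
      fix j
      show "f (Suc j) \<in> Hom C (seq_obj C (x' # xs) j) (seq_obj C (y' # ys) j)"
        if "j \<le> length (x' # xs)"
        using f that by (auto dest!: spec[where x = "Suc j"])
      show "cmp C (f (Suc (Suc j))) ((x' # xs) ! j) = cmp C ((y' # ys) ! j) (f (Suc j))"
        if "j < length (x' # xs)"
        using f that by (auto dest!: spec[where x = "Suc j"])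
    qed (use f in auto)
    then have "chain_map C (x' # xs) (y' # ys) (f 1) z" using IH by blast
    moreover have "a \<in> Hom C (src C x) (src C y)"
      using f by (auto dest!: spec[where x = 0])
    moreover have "cmp C (f 1) x = cmp C y a"
      using f by (auto dest!: spec[where x = 0])
    ultimately show "chain_map C (x # x' # xs) (y # y' # ys) a z" by auto
  qed
qed auto

lemma path_nth:
  "path C xs \<Longrightarrow> j < length xs \<Longrightarrow> xs ! j \<in> Hom C (seq_obj C xs j) (seq_obj C xs (Suc j))"
proof (induction xs arbitrary: j rule: induct_list012)
  case (2 x)
  then show ?case by (simp add: Hom_def)
next
  case (3 x y zs)
  then show ?case by (cases j) (auto simp: Hom_def)
qed simp

lemma splice_cons: "splice C [i, p] xs = i # cmp C (hd xs) p # tl xs"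
  by (simp add: splice_def)

lemma splice_assoc:
  assumes "length ys \<ge> 2" "zs \<noteq> []"
  shows "splice C (splice C xs ys) zs = splice C xs (splice C ys zs)"
  using assms by (cases ys) (auto simp: splice_def butlast_append)

lemma acyclic_length: "acyclic_seq E xs \<Longrightarrow> length xs \<ge> 2"
  by (induction rule: acyclic_seq.induct) (auto simp: splice_def)

lemma acyclic_splice_left:
  assumes "(i, p) \<in> conflations E" "acyclic_seq E xs" "tgt E p = src E (hd xs)"
  shows "acyclic_seq E (splice E [i, p] xs)"
  using assms(2,3)
proof (induction rule: acyclic_seq.induct)
  case (conflation j q)
  then show ?case using acyclic_seq.splice[OF acyclic_seq.conflation[OF assms(1)], of j q] by simp
next
  case (splice xs j q)
  have l: "length xs \<ge> 2" using acyclic_length splice(1) .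
  then have "hd (splice E xs [j, q]) = hd xs" by (cases xs) (auto simp: splice_def)
  then have "acyclic_seq E (splice E [i, p] xs)" using splice by simp
  moreover have "last (splice E [i, p] xs) = last xs" using l by (cases xs) (auto simp: splice_def)
  ultimately have "acyclic_seq E (splice E (splice E [i, p] xs) [j, q])"
    using acyclic_seq.splice splice(2,3) by metis
  then show ?case using splice_assoc[OF l, of "[j, q]" E "[i, p]"] by simp
qed

text \<open>
  Acyclic sequences are generated by splicing conflations on the right. Splicing is associative,
  so the first conflation can be split off as well; all inductions on extensions proceed this
  way.
\<close>

lemma acyclic_cases_left:
  assumes "acyclic_seq E xs"
  shows "(\<exists>i p. (i, p) \<in> conflations E \<and> xs = [i, p]) \<or>
    (\<exists>i p ys. (i, p) \<in> conflations E \<and> acyclic_seq E ys \<and> tgt E p = src E (hd ys) \<and>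
      xs = splice E [i, p] ys)"
  using assms
proof (induction rule: acyclic_seq.induct)
  case (splice xs j q)
  from splice.IH show ?case
  proof (elim disjE exE conjE)
    fix i p assume *: "(i, p) \<in> conflations E" "xs = [i, p]"
    have "acyclic_seq E [j, q]" using acyclic_seq.conflation splice(2) .
    moreover have "tgt E p = src E (hd [j, q])" using splice(3) * by simp
    ultimately show ?thesis using * by blast
  next
    fix i p ys assume *: "(i, p) \<in> conflations E" "acyclic_seq E ys" "tgt E p = src E (hd ys)"
      "xs = splice E [i, p] ys"
    have l: "length ys \<ge> 2" using acyclic_length *(2) .
    then have "last xs = last ys" "hd (splice E ys [j, q]) = hd ys"
      using *(4) by (cases ys; auto simp: splice_def)+
    then have "acyclic_seq E (splice E ys [j, q])" "tgt E p = src E (hd (splice E ys [j, q]))"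
      using acyclic_seq.splice[OF *(2) splice(2)] splice(3) *(3) by auto
    moreover have "splice E xs [j, q] = splice E [i, p] (splice E ys [j, q])"
      using splice_assoc[OF l, of "[j, q]" E "[i, p]"] *(4) by simp
    ultimately show ?thesis using *(1) by blast
  qed
qed auto

context exact_category
begin

lemma extensions_0: "extensions E 0 D A = {}"
  by (auto simp: extensions_def dest: acyclic_length)

lemma extensions_conf: "conf E A B D i p \<Longrightarrow> [i, p] \<in> extensions E 1 D A"
  using confD[of A B D i p] by (auto simp: extensions_def intro: acyclic_seq.conflation)

lemma extensions_splice:
  assumes "conf E A B C i p" "xs \<in> extensions E k D C"
  shows "splice E [i, p] xs \<in> extensions E (Suc k) D A"
proof -
  have xs: "acyclic_seq E xs" "length xs = Suc k" "src E (hd xs) = C" "tgt E (last xs) = D"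
    using assms(2) by (auto simp: extensions_def)
  obtain x y zs where "xs = x # y # zs" using acyclic_length[OF xs(1)] by (cases xs; cases "tl xs") auto
  then show ?thesis
    using acyclic_splice_left[of i p E xs] xs confD[OF assms(1)]
    by (auto simp: extensions_def splice_cons)
qed

lemma extensions_cases [consumes 1, case_names conf splice]:
  assumes "xs \<in> extensions E k D A"
  obtains B i p where "k = 1" "conf E A B D i p" "xs = [i, p]"
  | l B C i p ys where "k = Suc l" "conf E A B C i p" "ys \<in> extensions E l D C"
    "xs = splice E [i, p] ys"
proof -
  have xs: "acyclic_seq E xs" "length xs = Suc k" "src E (hd xs) = A" "tgt E (last xs) = D"
    using assms(1) by (auto simp: extensions_def)
  from acyclic_cases_left[OF xs(1)] show ?thesis
  proof (elim disjE exE conjE)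
    fix i p assume c: "(i, p) \<in> conflations E" "xs = [i, p]"
    then show ?thesis using that(1)[of "src E p" i p] xs conflation_Hom[OF c(1)] by (auto simp: conf_def)
  next
    fix i p ys assume *: "(i, p) \<in> conflations E" "acyclic_seq E ys" "tgt E p = src E (hd ys)"
      "xs = splice E [i, p] ys"
    obtain x y zs where ys: "ys = x # y # zs"
      using acyclic_length[OF *(2)] by (cases ys; cases "tl ys") auto
    have "ys \<in> extensions E (length ys - 1) D (tgt E p)" "k = Suc (length ys - 1)"
      using xs * ys by (auto simp: extensions_def splice_cons)
    moreover have "conf E A (src E p) (tgt E p) i p"
      using conflation_Hom[OF *(1)] *(1) xs(3) *(4) by (simp add: conf_def splice_cons)
    ultimately show ?thesis using that(2) *(4) by blast
  qed
qed

lemma extensions_induct [consumes 1, case_names conf splice]: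
  assumes "xs \<in> extensions E k D A"
    and "\<And>A B i p. conf E A B D i p \<Longrightarrow> P 1 A [i, p]"
    and "\<And>k A B C i p ys. conf E A B C i p \<Longrightarrow> ys \<in> extensions E k D C \<Longrightarrow> P k C ys \<Longrightarrow>
      P (Suc k) A (splice E [i, p] ys)"
  shows "P k A xs"
  using assms(1)
proof (induction k arbitrary: xs A)
  case 0
  then show ?case by (simp add: extensions_0)
next
  case (Suc k)
  from Suc.prems show ?case
    by (cases rule: extensions_cases) (use assms(2,3) Suc.IH in auto)
qed

lemma extensions_obj: "xs \<in> extensions E k D A \<Longrightarrow> A \<in> obj E \<and> D \<in> obj E"
  by (induction rule: extensions_induct) (auto dest: confD)

lemma extensions_hd_last: "xs \<in> extensions E k D A \<Longrightarrow> src E (hd xs) = A \<and> tgt E (last xs) = D"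
  by (auto simp: extensions_def)

lemma extensions_path: "xs \<in> extensions E k D A \<Longrightarrow> path E xs"
proof (induction rule: extensions_induct)
  case (conf A B i p)
  then show ?case using confD by auto
next
  case (splice k A B C i p ys)
  obtain x y zs where ys: "ys = x # y # zs"
    using splice(2) acyclic_length[of E ys] by (cases ys; cases "tl ys") (auto simp: extensions_def)
  then have "src E x = C" using splice(2) by (auto simp: extensions_def)
  then show ?case using splice(3) confD[OF splice(1)] ys by (auto simp: splice_cons cat)
qed

lemma extensions_Cons:
  assumes "xs \<in> extensions E k D A"
  obtains x y zs where "xs = x # y # zs" "x \<in> arr E" "y \<in> arr E" "src E x = A" "tgt E x = src E y"
    "zs = [] \<longrightarrow> tgt E y = D"
proof -
  obtain x y zs where xs: "xs = x # y # zs"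
    using assms acyclic_length[of E xs] by (cases xs; cases "tl xs") (auto simp: extensions_def)
  moreover have "path E xs" using extensions_path[OF assms] .
  then have "x \<in> arr E" "y \<in> arr E" "tgt E x = src E y" using xs by (cases zs; auto)+
  ultimately show ?thesis using that assms by (auto simp: extensions_def)
qed

lemma chain_map_ident:
  "path E xs \<Longrightarrow> chain_map E xs xs (ident E (src E (hd xs))) (ident E (tgt E (last xs)))"
proof (induction xs rule: induct_list012)
  case (2 x)
  then show ?case using ident_Hom[of "src E x"] ident_Hom[of "tgt E x"] src_obj tgt_obj
    by (auto simp: cat)
next
  case (3 x y zs)
  then show ?case using ident_Hom[of "src E x"] src_obj tgt_obj
    by (auto simp: cat intro!: exI[of _ "ident E (src E y)"])
qed auto

lemma chain_map_comp:
  assumes "chain_map E xs ys a z" "chain_map E ys ws b w" "path E xs" "path E ys" "path E ws"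
  shows "chain_map E xs ws (b \<cdot> a) (w \<cdot> z)"
  using assms
proof (induction xs arbitrary: ys ws a b)
  case Nil
  then show ?case by simp
next
  case (Cons x xs)
  obtain y ys' where ys: "ys = y # ys'" using chain_map_length[OF Cons.prems(1)] by (cases ys) auto
  obtain u us where ws: "ws = u # us" using chain_map_length[OF Cons.prems(2)] by (cases ws) auto
  have l: "length ys' = length xs" "length us = length xs"
    using chain_map_length[OF Cons.prems(1)] chain_map_length[OF Cons.prems(2)] ys ws by auto
  have ab: "a \<in> Hom E (src E x) (src E y)" "b \<in> Hom E (src E y) (src E u)"
    using chain_map_first[OF Cons.prems(1)] chain_map_first[OF Cons.prems(2)] ys ws by auto
  note H = HomD[OF ab(1)] HomD[OF ab(2)]
  show ?case
  proof (cases xs)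
    case Nil
    then have e: "xs = []" "ys' = []" "us = []" using l by auto
    have z: "z \<in> Hom E (tgt E x) (tgt E y)" "z \<cdot> x = y \<cdot> a" and
      w: "w \<in> Hom E (tgt E y) (tgt E u)" "w \<cdot> y = u \<cdot> b" and arr: "x \<in> arr E" "y \<in> arr E" "u \<in> arr E"
      using Cons.prems ys ws e by auto
    note H = H HomD[OF z(1)] HomD[OF w(1)] arr
    have "w \<cdot> z \<cdot> x = u \<cdot> (b \<cdot> a)" by (simp add: H cat z(2) w(2)[THEN comp_cong_tail])
    then show ?thesis unfolding ys ws e by (simp add: H cat Hom_def)
  next
    case (Cons x' xs')
    obtain y' ys'' where y': "ys' = y' # ys''" using l Cons by (cases ys') auto
    obtain u' us' where u': "us = u' # us'" using l Cons by (cases us) auto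
    obtain a' where a': "a' \<cdot> x = y \<cdot> a" "chain_map E xs ys' a' z"
      using Cons.prems(1) Cons y' ys by auto
    obtain b' where b': "b' \<cdot> y = u \<cdot> b" "chain_map E ys' us b' w"
      using Cons.prems(2) y' u' ys ws by auto
    have arr: "x \<in> arr E" "y \<in> arr E" "u \<in> arr E" "tgt E x = src E x'" "tgt E y = src E y'"
      "tgt E u = src E u'" "path E xs" "path E ys'" "path E us"
      using Cons.prems Cons y' u' ys ws by auto
    have ab': "a' \<in> Hom E (src E x') (src E y')" "b' \<in> Hom E (src E y') (src E u')"
      using chain_map_first[OF a'(2)] chain_map_first[OF b'(2)] Cons y' u' by auto
    note H = H HomD[OF ab'(1)] HomD[OF ab'(2)] arr
    have "b' \<cdot> a' \<cdot> x = u \<cdot> (b \<cdot> a)" by (simp add: H cat a'(1) b'(1)[THEN comp_cong_tail])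
    moreover have "chain_map E xs us (b' \<cdot> a') (w \<cdot> z)" using Cons.IH[OF a'(2) b'(2)] arr by blast
    moreover have "b \<cdot> a \<in> Hom E (src E x) (src E u)" by (simp add: H cat Hom_def)
    ultimately show ?thesis unfolding ys ws Cons y' u' chain_map.simps by blast
  qed
qed

lemma chain_map_conf:
  assumes "conf E A B D i p" "conf E A' B' D' i' p'"
  shows "chain_map E [i, p] [i', p'] a c \<longleftrightarrow> (\<exists>b. conf_mor E i p i' p' a b c)"
  using confD[OF assms(1)] confD[OF assms(2)] by (auto simp: conf_mor_def)

text \<open>
  The first arrow of each sequence is the kernel of the deflation onto the object of splicing. A
  chain map therefore induces a morphism between these objects, and splits there into two chain
  maps.
\<close>

lemma chain_map_splice:
  assumes c: "conf E A B C i p" and c': "conf E A' B' C' i' p'"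
    and xs: "xs \<in> extensions E k D C" and ys: "ys \<in> extensions E k' D' C'"
  shows "chain_map E (splice E [i, p] xs) (splice E [i', p'] ys) a z \<longleftrightarrow>
    (\<exists>b m. conf_mor E i p i' p' a b m \<and> chain_map E xs ys m z)"
proof -
  obtain x x' xr where X: "xs = x # x' # xr" "x \<in> arr E" "src E x = C" "tgt E x = src E x'"
    using extensions_Cons[OF xs] by metis
  obtain y y' yr where Y: "ys = y # y' # yr" "y \<in> arr E" "src E y = C'" "tgt E y = src E y'"
    using extensions_Cons[OF ys] by metis
  note H = confD[OF c] confD[OF c'] X(2-) Y(2-)
  show ?thesis
  proof
    assume "chain_map E (splice E [i, p] xs) (splice E [i', p'] ys) a z"
    then obtain b b2 where b: "a \<in> Hom E A A'" "b \<cdot> i = i' \<cdot> a" "b \<in> Hom E B B'"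
        "b2 \<cdot> (x \<cdot> p) = y \<cdot> p' \<cdot> b" "chain_map E (x' # xr) (y' # yr) b2 z"
      by (auto simp: splice_cons X(1) Y(1) H cat)
    have b2: "b2 \<in> Hom E (src E x') (src E y')" using chain_map_first[OF b(5)] by simp
    note H = H HomD[OF b(1)] HomD[OF b(3)] HomD[OF b2]
    have "p' \<cdot> b \<cdot> i = zero E A C'" by (simp add: H cat b(2) confD(4)[OF c', THEN comp_cong_tail])
    moreover have "p' \<cdot> b \<in> Hom E B C'" by (simp add: H cat Hom_def)
    ultimately obtain m where m: "m \<in> Hom E C C'" "m \<cdot> p = p' \<cdot> b" using conf_cokernel[OF c] by blast
    note H = H HomD[OF m(1)]
    have "b2 \<cdot> x \<cdot> p = y \<cdot> m \<cdot> p" using b(4) by (simp add: H cat m(2))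
    then have "b2 \<cdot> x = y \<cdot> m"
      by (rule conf_epi[OF c, rotated 2]) (simp_all add: H cat Hom_def)
    then have "chain_map E xs ys m z" using b(5) m H unfolding X(1) Y(1) by auto
    moreover have "conf_mor E i p i' p' a b m" using conf_morI[OF c c' b(1,3) m(1) b(2) m(2)] .
    ultimately show "\<exists>b m. conf_mor E i p i' p' a b m \<and> chain_map E xs ys m z" by blast
  next
    assume "\<exists>b m. conf_mor E i p i' p' a b m \<and> chain_map E xs ys m z"
    then obtain b m where m: "conf_mor E i p i' p' a b m" "chain_map E xs ys m z" by blast
    then obtain b2 where b2: "m \<in> Hom E C C'" "b2 \<cdot> x = y \<cdot> m" "chain_map E (x' # xr) (y' # yr) b2 z"
      using X Y by auto
    note M = conf_morD[OF m(1) c c']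
    have b2': "b2 \<in> Hom E (src E x') (src E y')" using chain_map_first[OF b2(3)] by simp
    note H = H HomD[OF M(1)] HomD[OF M(2)] HomD[OF M(3)] HomD[OF b2']
    have "b2 \<cdot> (x \<cdot> p) = y \<cdot> p' \<cdot> b"
      by (simp add: H cat b2(2)[THEN comp_cong_tail] M(5))
    moreover have "src E (x \<cdot> p) = B" "src E (y \<cdot> p') = B'" "src E i = A" "src E i' = A'"
      by (simp_all add: H cat)
    ultimately show "chain_map E (splice E [i, p] xs) (splice E [i', p'] ys) a z"
      unfolding splice_cons X(1) Y(1) list.sel chain_map.simps using b2(3) M by auto
  qed
qed

section \<open>Yoneda equivalence\<close>

lemma yoneda_stepD:
  assumes "yoneda_step E xs ys"
  obtains k A D where "xs \<in> extensions E k D A" "ys \<in> extensions E k D A"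
    "chain_map E xs ys (ident E A) (ident E D)"
proof -
  obtain k A D f where f: "xs \<in> extensions E k D A" "ys \<in> extensions E k D A"
    "\<forall>j\<le>Suc k. f j \<in> Hom E (seq_obj E xs j) (seq_obj E ys j)"
    "\<forall>j<Suc k. f (Suc j) \<cdot> xs ! j = ys ! j \<cdot> f j" "f 0 = ident E A" "f (Suc k) = ident E D"
    using assms unfolding yoneda_step_def by (elim exE conjE) (rule that)
  have l: "length xs = Suc k" "length ys = Suc k" using f(1,2) by (auto simp: extensions_def)
  show ?thesis
    by (rule that[OF f(1,2)], subst chain_map_iff)
      (use f l in \<open>auto intro!: exI[of _ f]\<close>)
qed

lemma yoneda_stepI:
  assumes "xs \<in> extensions E k D A" "ys \<in> extensions E k D A"
    "chain_map E xs ys (ident E A) (ident E D)"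
  shows "yoneda_step E xs ys"
proof -
  have l: "length xs = Suc k" "length ys = Suc k" using assms by (auto simp: extensions_def)
  have "xs \<noteq> []" using l by auto
  then obtain f where f: "\<forall>j\<le>length xs. f j \<in> Hom E (seq_obj E xs j) (seq_obj E ys j)"
      "\<forall>j<length xs. f (Suc j) \<cdot> xs ! j = ys ! j \<cdot> f j" "f 0 = ident E A"
      "f (length xs) = ident E D"
    using assms(3) chain_map_iff[of xs ys E "ident E A" "ident E D"] l by auto
  show ?thesis
    unfolding yoneda_step_def
    by (rule exI[of _ k], rule exI[of _ A], rule exI[of _ D], rule exI[of _ f])
      (use assms(1,2) f in \<open>simp add: l\<close>)
qed

lemma extensions_unique:
  assumes "xs \<in> extensions E k D A" "xs \<in> extensions E k' D' A'"
  shows "k' = k" "D' = D" "A' = A"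
  using assms by (auto simp: extensions_def)

lemma yoneda_step_ident: "xs \<in> extensions E k D A \<Longrightarrow> yoneda_step E xs xs"
  using chain_map_ident[OF extensions_path, of xs k D A] extensions_hd_last[of xs k D A]
  by (auto intro: yoneda_stepI)

lemma ext_class_eq_iff: "ext_class E xs = ext_class E ys \<longleftrightarrow> equivclp (yoneda_step E) xs ys"
proof -
  have "equiv UNIV (yoneda_rel E)"
    unfolding yoneda_rel_def
    by (auto simp: equiv_def refl_on_def sym_def trans_def intro: equivclp_sym equivclp_trans)
  then show ?thesis
    unfolding ext_class_def by (subst eq_equiv_class_iff) (auto simp: yoneda_rel_def)
qed

lemma mem_ext_class: "ys \<in> ext_class E xs \<longleftrightarrow> ext_class E ys = ext_class E xs"
proof -
  have "ys \<in> ext_class E xs \<longleftrightarrow> equivclp (yoneda_step E) xs ys"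
    by (simp add: ext_class_def yoneda_rel_def)
  then show ?thesis using ext_class_eq_iff by metis
qed

lemma yoneda_step_class: "yoneda_step E xs ys \<Longrightarrow> ext_class E xs = ext_class E ys"
  by (simp add: ext_class_eq_iff r_into_equivclp)

lemma ext_class_invariant:
  assumes "ext_class E xs = ext_class E ys" "\<And>xs ys. yoneda_step E xs ys \<Longrightarrow> F xs = F ys"
  shows "F xs = F ys"
  using assms(1)[unfolded ext_class_eq_iff]
  by (induction rule: equivclp_induct) (use assms(2) in force)+

lemma ext_class_extensions:
  assumes "ext_class E xs = ext_class E ys"
  shows "xs \<in> extensions E k D A \<longleftrightarrow> ys \<in> extensions E k D A"
  by (rule ext_class_invariant[OF assms, of "\<lambda>xs. xs \<in> extensions E k D A"])
    (auto elim!: yoneda_stepD dest: extensions_unique)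

lemma Ext_carrier_Suc: "Ext_carrier E (Suc k) D A = ext_class E ` extensions E (Suc k) D A"
  by (auto simp: Ext_carrier_def quotient_def ext_class_def)

lemma Ext_carrier_pos: "k > 0 \<Longrightarrow> Ext_carrier E k D A = ext_class E ` extensions E k D A"
  by (cases k) (simp_all add: Ext_carrier_Suc)

section \<open>Pushouts of extensions\<close>

text \<open>
  The arrow that follows the pushout in \<open>pushout_extension\<close> is determined by its
  two composites; hence it is the new deflation followed by \<open>x\<close>. So pushing out an
  extension amounts to pushing out its first conflation.
\<close>

lemma pushout_extension_conf:
  assumes c: "conf E A B D i p" and f: "f \<in> Hom E A A'"
    and x: "x \<in> Hom E D T"
  shows "is_pushout E i f i' f' \<and> e' \<in> Hom E (tgt E i') T \<and> e' \<cdot> f' = x \<cdot> p \<and>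
      e' \<cdot> i' = zero E A' T \<longleftrightarrow>
    (\<exists>B' p'. conf E A' B' D i' p' \<and> conf_mor E i p i' p' f f' (ident E D) \<and>
      is_pushout E i f i' f' \<and> e' = x \<cdot> p')" (is "?L \<longleftrightarrow> ?R")
proof
  note C = confD[OF c]
  note H = C HomD[OF f] HomD[OF x]
  assume L: ?L
  then have L': "is_pushout E i f i' f'" "e' \<in> Hom E (tgt E i') T" "e' \<cdot> f' = x \<cdot> p"
    "e' \<cdot> i' = zero E A' T" by blast+
  note P = is_pushoutD[OF L'(1) C(2) f]
  have "p \<cdot> i = zero E A' D \<cdot> f" by (simp add: H cat)
  then obtain p' where p': "p' \<in> Hom E (tgt E i') D" "p' \<cdot> f' = p" "p' \<cdot> i' = zero E A' D"
    using P(4)[OF C(3) zero_Hom] H by blast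
  note H = H HomD[OF p'(1)] HomD[OF P(1)] HomD[OF P(2)]
  have "e' = x \<cdot> p'"
  proof (rule P(5)[OF L'(2)])
    show "x \<cdot> p' \<in> Hom E (tgt E i') T" using comp_Hom[OF p'(1) x] .
    show "e' \<cdot> f' = x \<cdot> p' \<cdot> f'"
      using comp_assoc[OF P(2) p'(1) x] p'(2) L'(3) by simp
    show "e' \<cdot> i' = x \<cdot> p' \<cdot> i'"
      using comp_assoc[OF P(1) p'(1) x] p'(3) L'(4) H by (simp add: comp_zero)
  qed
  then show ?R using is_pushout_conf[OF c f L'(1) p'] L'(1) by blast
next
  note C = confD[OF c]
  assume ?R
  then obtain B' p' where R: "conf E A' B' D i' p'" "conf_mor E i p i' p' f f' (ident E D)"
    "is_pushout E i f i' f'" "e' = x \<cdot> p'" by blast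
  note M = conf_morD[OF R(2) c R(1)]
  note H = C confD[OF R(1)] HomD[OF x] HomD[OF M(2)]
  have "p' \<cdot> f' = p" using M(5) by (simp add: H cat)
  then show ?L using R(3) by (simp add: R(4) H cat Hom_def)
qed

lemma pushout_extension_base:
  assumes c: "conf E A B D i p" and f: "f \<in> Hom E A A'"
  shows "pushout_extension E f [i, p] ys \<longleftrightarrow>
    (\<exists>B' i' p' b. conf E A' B' D i' p' \<and> conf_mor E i p i' p' f b (ident E D) \<and>
      is_pushout E i f i' b \<and> ys = [i', p'])"
proof -
  note H = confD[OF c] HomD[OF f]
  have id: "ident E D \<in> Hom E D D" using ident_Hom H by blast
  have "pushout_extension E f [i, p] ys \<longleftrightarrow> (\<exists>i' f' e'. ys = [i', e'] \<and> is_pushout E i f i' f' \<and>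
      e' \<in> Hom E (tgt E i') D \<and> e' \<cdot> f' = ident E D \<cdot> p \<and> e' \<cdot> i' = zero E A' D)"
    by (auto simp: pushout_extension_def H cat)
  also have "\<dots> \<longleftrightarrow> (\<exists>i' f' e'. ys = [i', e'] \<and> (\<exists>B' p'. conf E A' B' D i' p' \<and>
      conf_mor E i p i' p' f f' (ident E D) \<and> is_pushout E i f i' f' \<and> e' = ident E D \<cdot> p'))"
    by (simp only: pushout_extension_conf[OF c f id])
  also have "\<dots> \<longleftrightarrow> (\<exists>B' i' p' b. conf E A' B' D i' p' \<and> conf_mor E i p i' p' f b (ident E D) \<and>
      is_pushout E i f i' b \<and> ys = [i', p'])"
  proof -
    have "(\<exists>B' p'. conf E A' B' D i' p' \<and> conf_mor E i p i' p' f f' (ident E D) \<and>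
        is_pushout E i f i' f' \<and> e' = ident E D \<cdot> p') \<longleftrightarrow>
      (\<exists>B'. conf E A' B' D i' e' \<and> conf_mor E i p i' e' f f' (ident E D) \<and> is_pushout E i f i' f')"
      for i' f' e' by (auto simp: confD ident_comp) (metis confD(8,10) ident_comp)
    then show ?thesis by blast
  qed
  finally show ?thesis .
qed

lemma pushout_extension_splice:
  assumes c: "conf E A B C i p" and f: "f \<in> Hom E A A'" and xs: "xs \<in> extensions E k D C"
  shows "pushout_extension E f (splice E [i, p] xs) ys \<longleftrightarrow>
    (\<exists>B' i' p' b. conf E A' B' C i' p' \<and> conf_mor E i p i' p' f b (ident E C) \<and>
      is_pushout E i f i' b \<and> ys = splice E [i', p'] xs)"
proof -
  obtain x y zs where X: "xs = x # y # zs" "x \<in> arr E" "src E x = C"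
    using extensions_Cons[OF xs] by metis
  note H = confD[OF c] HomD[OF f] X(2,3)
  have x: "x \<in> Hom E C (tgt E x)" using X by (simp add: Hom_def)
  have "pushout_extension E f (splice E [i, p] xs) ys \<longleftrightarrow>
      (\<exists>i' f' e'. ys = i' # e' # y # zs \<and> is_pushout E i f i' f' \<and>
      e' \<in> Hom E (tgt E i') (tgt E x) \<and> e' \<cdot> f' = x \<cdot> p \<and> e' \<cdot> i' = zero E A' (tgt E x))"
    by (auto simp: pushout_extension_def H cat X(1) splice_cons)
  also have "\<dots> \<longleftrightarrow> (\<exists>i' f' e'. ys = i' # e' # y # zs \<and> (\<exists>B' p'. conf E A' B' C i' p' \<and>
      conf_mor E i p i' p' f f' (ident E C) \<and> is_pushout E i f i' f' \<and> e' = x \<cdot> p'))"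
    by (simp only: pushout_extension_conf[OF c f x])
  also have "\<dots> \<longleftrightarrow> (\<exists>B' i' p' b. conf E A' B' C i' p' \<and> conf_mor E i p i' p' f b (ident E C) \<and>
      is_pushout E i f i' b \<and> ys = splice E [i', p'] xs)"
    unfolding splice_cons X(1) list.sel by blast
  finally show ?thesis .
qed

lemma pushout_extension_exists:
  assumes "xs \<in> extensions E k D A" "f \<in> Hom E A A'"
  shows "\<exists>ys. pushout_extension E f xs ys"
  using assms(1)
proof (cases rule: extensions_cases)
  case (conf B i p)
  show ?thesis
    unfolding conf(3) pushout_extension_base[OF conf(2) assms(2)]
    by (rule push_conf[OF conf(2) assms(2)]) blast
next
  case (splice l B C i p ys)
  show ?thesis
    unfolding splice(4) pushout_extension_splice[OF splice(2) assms(2) splice(3)]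
    by (rule push_conf[OF splice(2) assms(2)]) blast
qed

lemma pushout_extensionD:
  assumes xs: "xs \<in> extensions E k D A" and f: "f \<in> Hom E A A'" and p: "pushout_extension E f xs ys"
  shows "ys \<in> extensions E k D A'" "chain_map E xs ys f (ident E D)"
    "ws \<in> extensions E k D' A' \<Longrightarrow> chain_map E xs ws f z \<Longrightarrow> chain_map E ys ws (ident E A') z"
proof -
  have "ys \<in> extensions E k D A' \<and> chain_map E xs ys f (ident E D) \<and>
    (ws \<in> extensions E k D' A' \<longrightarrow> chain_map E xs ws f z \<longrightarrow> chain_map E ys ws (ident E A') z)"
    using xs
  proof (cases rule: extensions_cases)
    case (conf B i p0)
    obtain B' i' p' b where ys: "conf E A' B' D i' p'" "conf_mor E i p0 i' p' f b (ident E D)"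
      "is_pushout E i f i' b" "ys = [i', p']"
      using p unfolding conf(3) pushout_extension_base[OF conf(2) f] by blast
    have "chain_map E ys ws (ident E A') z"
      if w: "ws \<in> extensions E k D' A'" "chain_map E xs ws f z"
      using w(1)
    proof (cases rule: extensions_cases)
      case (conf B2 i2 p2)
      obtain b2 where "conf_mor E i p0 i2 p2 f b2 z"
        using w(2) chain_map_conf[OF \<open>conf E A B D i p0\<close> conf(2)] \<open>xs = [i, p0]\<close> conf(3) by auto
      from push_conf_factor[OF \<open>conf E A B D i p0\<close> ys(1) conf(2) ys(2) refl ys(3) this]
      obtain t where "conf_mor E i' p' i2 p2 (ident E A') t z" .
      then show ?thesis using chain_map_conf[OF ys(1) conf(2)] ys(4) conf(3) by auto
    next
      case (splice l)
      then show ?thesis using conf(1) by (simp add: extensions_0)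
    qed
    moreover have "ys \<in> extensions E k D A'" using extensions_conf[OF ys(1)] ys(4) conf(1) by simp
    moreover have "chain_map E xs ys f (ident E D)"
      using chain_map_conf[OF conf(2) ys(1)] ys conf(3) by auto
    ultimately show ?thesis by blast
  next
    case (splice l B C i p0 us)
    obtain B' i' p' b where ys: "conf E A' B' C i' p'" "conf_mor E i p0 i' p' f b (ident E C)"
      "is_pushout E i f i' b" "ys = splice E [i', p'] us"
      using p unfolding splice(4) pushout_extension_splice[OF splice(2) f splice(3)] by blast
    have "chain_map E ys ws (ident E A') z"
      if w: "ws \<in> extensions E k D' A'" "chain_map E xs ws f z"
      using w(1)
    proof (cases rule: extensions_cases)
      case conf
      then show ?thesis using splice(1,3) by (simp add: extensions_0)
    next
      case (splice l2 B2 C2 i2 p2 us2)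
      obtain b2 d where b2: "conf_mor E i p0 i2 p2 f b2 d" "chain_map E us us2 d z"
        using w(2) chain_map_splice[OF \<open>conf E A B C i p0\<close> splice(2) \<open>us \<in> _\<close> splice(3)]
          \<open>xs = splice E [i, p0] us\<close> splice(4) by auto
      from push_conf_factor[OF \<open>conf E A B C i p0\<close> ys(1) splice(2) ys(2) refl ys(3) b2(1)]
      obtain t where "conf_mor E i' p' i2 p2 (ident E A') t d" .
      then show ?thesis
        using chain_map_splice[OF ys(1) splice(2) \<open>us \<in> _\<close> splice(3)] ys(4) splice(4) b2(2) by auto
    qed
    moreover have "ys \<in> extensions E k D A'"
      using extensions_splice[OF ys(1) splice(3)] ys(4) splice(1) by simp
    moreover have "chain_map E us us (ident E C) (ident E D)"
      using chain_map_ident[OF extensions_path[OF splice(3)]] extensions_hd_last[OF splice(3)] by simp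
    then have "chain_map E xs ys f (ident E D)"
      using chain_map_splice[OF splice(2) ys(1) splice(3) splice(3)] ys splice(4) by auto
    ultimately show ?thesis by blast
  qed
  then show "ys \<in> extensions E k D A'" "chain_map E xs ys f (ident E D)"
    "ws \<in> extensions E k D' A' \<Longrightarrow> chain_map E xs ws f z \<Longrightarrow> chain_map E ys ws (ident E A') z"
    by blast+
qed

end

section \<open>Ext as a functor with connecting maps\<close>

text \<open>
  The connecting map \<open>Ext\<^sup>k(X, D) \<rightarrow> Ext\<^sup>k\<^sup>+\<^sup>1(X,
  A)\<close> of the conflation \<open>A \<rightarrow> B \<rightarrow> D\<close>, that is, the
  Yoneda product with its class. The pullback that defines it in degree zero is described by the
  morphism from the pulled back conflation, because such morphisms compose.
\<close>

definition con ::
    "('o, 'm, 'x) exact_cat_scheme \<Rightarrow> nat \<Rightarrow> 'm \<Rightarrow> 'm \<Rightarrow> 'm list set \<Rightarrow> 'm list set"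
  where "con E k i p a =
    (if k = 0 then \<Union>{ext_class E [i', p'] |B' i' p' b.
        conf E (src E i) B' (src E (elem_hom a)) i' p' \<and>
        conf_mor E i' p' i p (ident E (src E i)) b (elem_hom a)}
     else \<Union>{ext_class E (splice E [i, p] xs) |xs. xs \<in> a})"

lemma Union_const: "c \<in> S \<Longrightarrow> (\<And>x. x \<in> S \<Longrightarrow> x = c) \<Longrightarrow> \<Union>S = c"
  by blast

lemma elem_hom_hom_elem [simp]: "elem_hom (hom_elem f) = f"
  by (simp add: elem_hom_def hom_elem_def)

lemma hom_elem_inject [simp]: "hom_elem f = hom_elem g \<longleftrightarrow> f = g"
  by (simp add: hom_elem_def)

lemma Ext_carrier_0: "Ext_carrier E 0 X A = hom_elem ` Hom E X A"
  by (simp add: Ext_carrier_def)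

lemma Ext_push_0 [simp]: "Ext_push E 0 f (hom_elem g) = hom_elem (cmp E f g)"
  by (simp add: Ext_push_def)

context exact_category
begin

lemma Ext_carrier_cases [consumes 1, case_names Hom ext]:
  assumes "a \<in> Ext_carrier E k X A"
  obtains g where "k = 0" "g \<in> Hom E X A" "a = hom_elem g"
  | xs where "k > 0" "xs \<in> extensions E k X A" "a = ext_class E xs"
  using assms Ext_carrier_0[of E X A] Ext_carrier_pos[of k X A] by (cases "k = 0") auto

lemma Ext_carrier_obj: "a \<in> Ext_carrier E k X A \<Longrightarrow> X \<in> obj E \<and> A \<in> obj E"
  by (cases rule: Ext_carrier_cases) (auto dest: HomD extensions_obj)

lemma ext_class_carrier: "xs \<in> extensions E k X A \<Longrightarrow> ext_class E xs \<in> Ext_carrier E k X A"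
  by (cases k) (auto simp: Ext_carrier_Suc extensions_0)

text \<open>
  The operations on \<open>Ext\<close> are unions over all representatives and all choices. They
  are single classes if any two choices, for the source and for the target of a Yoneda step,
  have the same result.
\<close>

lemma Union_ext_class:
  assumes xs: "xs \<in> extensions E k D A" and c: "R xs c"
    and ex: "\<And>us. us \<in> extensions E k D A \<Longrightarrow> \<exists>c. R us c"
    and step: "\<And>us vs c d. us \<in> extensions E k D A \<Longrightarrow> vs \<in> extensions E k D A \<Longrightarrow>
      chain_map E us vs (ident E A) (ident E D) \<Longrightarrow> R us c \<Longrightarrow> R vs d \<Longrightarrow> c = d"
  shows "\<Union>{c. \<exists>us. us \<in> ext_class E xs \<and> R us c} = c"
proof -
  let ?X = "extensions E k D A"
  have st: "c = d" if s: "yoneda_step E us vs" and us: "us \<in> ?X" and vs: "vs \<in> ?X"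
    and R: "R us c" "R vs d" for us vs c d
  proof -
    obtain k' D' A' where "us \<in> extensions E k' D' A'" "chain_map E us vs (ident E A') (ident E D')"
      using s by (rule yoneda_stepD)
    then have "chain_map E us vs (ident E A) (ident E D)" using extensions_unique[OF us] by metis
    then show ?thesis using step[OF us vs] R by blast
  qed
  define G where "G us = (if us \<in> ?X then {c. R us c} else {})" for us
  have "G us = G vs" if s: "yoneda_step E us vs" for us vs
  proof (cases "us \<in> ?X")
    case True
    then have vs: "vs \<in> ?X" using ext_class_extensions[OF yoneda_step_class[OF s]] by blast
    obtain c d where "R us c" "R vs d" using ex[OF True] ex[OF vs] by blast
    then have "{c. R us c} = {d}" "{c. R vs c} = {d}"
      using st[OF s True vs] st[OF yoneda_step_ident[OF vs] vs vs] by blast+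
    then show ?thesis using True vs by (simp add: G_def)
  next
    case False
    then show ?thesis using ext_class_extensions[OF yoneda_step_class[OF s]] by (simp add: G_def)
  qed
  then have inv: "G us = G xs" if "us \<in> ext_class E xs" for us
    using ext_class_invariant that mem_ext_class by metis
  have "d = c" if d: "us \<in> ext_class E xs" "R us d" for us d
  proof -
    have "us \<in> ?X" using d(1) xs ext_class_extensions mem_ext_class by metis
    then have "d \<in> G xs" using inv[OF d(1), symmetric] d(2) by (simp add: G_def)
    then show ?thesis using xs c st[OF yoneda_step_ident[OF xs] xs xs] by (auto simp: G_def)
  qed
  then show ?thesis using c mem_ext_class by (intro Union_const) blast+
qed

lemma Ext_push_pushout:
  assumes k: "k > 0" and xs: "xs \<in> extensions E k X A" and f: "f \<in> Hom E A A'"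
    and ys: "pushout_extension E f xs ys"
  shows "Ext_push E k f (ext_class E xs) = ext_class E ys"
proof -
  let ?R = "\<lambda>us c. \<exists>vs. pushout_extension E f us vs \<and> c = ext_class E vs"
  have "\<Union>{c. \<exists>us. us \<in> ext_class E xs \<and> ?R us c} = ext_class E ys"
  proof (rule Union_ext_class[OF xs])
    show "?R xs (ext_class E ys)" using ys by blast
    show "\<exists>c. ?R us c" if "us \<in> extensions E k X A" for us
      using pushout_extension_exists[OF that f] by blast
    fix us vs c d
    assume us: "us \<in> extensions E k X A" and vs: "vs \<in> extensions E k X A"
      and m: "chain_map E us vs (ident E A) (ident E X)" and "?R us c" "?R vs d"
    then obtain us' vs' where u: "pushout_extension E f us us'" "c = ext_class E us'"
      and v: "pushout_extension E f vs vs'" "d = ext_class E vs'" by blast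
    note U = pushout_extensionD[OF us f u(1)] and V = pushout_extensionD[OF vs f v(1)]
    have "chain_map E us vs' (f \<cdot> ident E A) (ident E X \<cdot> ident E X)"
      by (rule chain_map_comp[OF m V(2)]) (use us vs V(1) extensions_path in blast)+
    then have "chain_map E us vs' f (ident E X)"
      using HomD[OF f] extensions_obj[OF us] by (simp add: cat)
    then have "yoneda_step E us' vs'" using yoneda_stepI[OF U(1) V(1)] U(3)[OF V(1)] by blast
    then show "c = d" using yoneda_step_class u(2) v(2) by simp
  qed
  moreover have "{c. \<exists>us. us \<in> ext_class E xs \<and> ?R us c}
      = {ext_class E vs |us vs. us \<in> ext_class E xs \<and> pushout_extension E f us vs}" by blast
  ultimately show ?thesis using k by (simp add: Ext_push_def)
qed

text \<open>
  The chain map factors through the pushout of \<open>xs\<close> along \<open>f\<close>, and the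
  second factor is a Yoneda step. From here on the action of \<open>f\<close> is computed by
  exhibiting chain maps.
\<close>

lemma Ext_push_chain_map:
  assumes xs: "xs \<in> extensions E k X A" and ws: "ws \<in> extensions E k X A'"
    and f: "f \<in> Hom E A A'" and m: "chain_map E xs ws f (ident E X)"
  shows "Ext_push E k f (ext_class E xs) = ext_class E ws"
proof -
  have k: "k > 0" using xs by (cases k) (auto simp: extensions_0)
  obtain ys where ys: "pushout_extension E f xs ys" using pushout_extension_exists[OF xs f] by blast
  note Y = pushout_extensionD[OF xs f ys]
  have "yoneda_step E ys ws" using yoneda_stepI[OF Y(1) ws] Y(3)[OF ws m] by blast
  then show ?thesis using Ext_push_pushout[OF k xs f ys] yoneda_step_class by metis
qed

lemma Ext_push_ext:
  assumes xs: "xs \<in> extensions E k X A" and f: "f \<in> Hom E A A'"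
  obtains ys where "ys \<in> extensions E k X A'" "chain_map E xs ys f (ident E X)"
    "Ext_push E k f (ext_class E xs) = ext_class E ys"
proof -
  obtain ys where ys: "pushout_extension E f xs ys" using pushout_extension_exists[OF xs f] by blast
  note Y = pushout_extensionD[OF xs f ys]
  show ?thesis using that[OF Y(1,2) Ext_push_chain_map[OF xs Y(1) f Y(2)]] .
qed

lemma Ext_push_closed:
  assumes "f \<in> Hom E A A'" "a \<in> Ext_carrier E k X A"
  shows "Ext_push E k f a \<in> Ext_carrier E k X A'"
  using assms(2)
proof (cases rule: Ext_carrier_cases)
  case (Hom g)
  then show ?thesis using assms(1) by (auto simp: Ext_carrier_0 intro: comp_Hom)
next
  case (ext xs)
  obtain ys where "ys \<in> extensions E k X A'" "Ext_push E k f (ext_class E xs) = ext_class E ys"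
    by (rule Ext_push_ext[OF ext(2) assms(1)]) (rule that)
  then show ?thesis using ext ext_class_carrier by simp
qed

lemma Ext_push_ident:
  assumes "a \<in> Ext_carrier E k X A"
  shows "Ext_push E k (ident E A) a = a"
  using assms
proof (cases rule: Ext_carrier_cases)
  case (Hom g)
  then show ?thesis using comp_ident_left by simp
next
  case (ext xs)
  show ?thesis unfolding ext(3)
    by (rule Ext_push_chain_map[OF ext(2) ext(2)])
      (use chain_map_ident[OF extensions_path[OF ext(2)]] extensions_hd_last[OF ext(2)]
        extensions_obj[OF ext(2)] ident_Hom in auto)
qed

lemma Ext_push_comp:
  assumes f: "f \<in> Hom E A A'" and g: "g \<in> Hom E A' A''" and a: "a \<in> Ext_carrier E k X A"
  shows "Ext_push E k (g \<cdot> f) a = Ext_push E k g (Ext_push E k f a)"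
  using a
proof (cases rule: Ext_carrier_cases)
  case (Hom h)
  then show ?thesis using comp_assoc[OF Hom(2) f g] by simp
next
  case (ext xs)
  obtain ys where ys: "ys \<in> extensions E k X A'" "chain_map E xs ys f (ident E X)"
    "Ext_push E k f (ext_class E xs) = ext_class E ys"
    by (rule Ext_push_ext[OF ext(2) f]) (rule that)
  obtain zs where zs: "zs \<in> extensions E k X A''" "chain_map E ys zs g (ident E X)"
    "Ext_push E k g (ext_class E ys) = ext_class E zs"
    by (rule Ext_push_ext[OF ys(1) g]) (rule that)
  have "chain_map E xs zs (g \<cdot> f) (ident E X \<cdot> ident E X)"
    by (rule chain_map_comp[OF ys(2) zs(2)])
      (use ext(2) ys(1) zs(1) extensions_path in blast)+
  then have "chain_map E xs zs (g \<cdot> f) (ident E X)"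
    using extensions_obj[OF ext(2)] by (simp add: cat)
  then show ?thesis
    using Ext_push_chain_map[OF ext(2) zs(1) comp_Hom[OF f g]] ys(3) zs(3) ext(3) by simp
qed

lemma pull_conf_factor:
  assumes c: "conf E A B D i p" and c1: "conf E A B1 D1 i1 p1" and c2: "conf E A2 B2 D1 i2 p2"
    and m1: "conf_mor E i1 p1 i p (ident E A) b f" and po: "is_pullback E p f p1 b"
    and m2: "conf_mor E i2 p2 i p a b2 f"
  obtains t where "conf_mor E i2 p2 i1 p1 a t (ident E D1)"
proof -
  have "conf_mor (op_cat E) p i p1 i1 f b (ident (op_cat E) A)"
    "conf_mor (op_cat E) p i p2 i2 f b2 a" "is_pushout (op_cat E) p f p1 b"
    using m1 m2 po by (simp_all add: op_conf_mor_conf[OF c1 c] op_conf_mor_conf[OF c2 c] op_is_pushout)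
  from exact_category.push_conf_factor[OF exact_category_op, unfolded op_conf, OF c c1 c2 this(1) refl
      this(3,2)]
  obtain t where "conf_mor (op_cat E) p1 i1 p2 i2 (ident (op_cat E) D1) t a" .
  then show ?thesis using that by (simp add: op_conf_mor_conf[OF c2 c1])
qed

lemma con_Hom:
  assumes c: "conf E A B D i p" and c': "conf E A B' X i' p'"
    and m: "conf_mor E i' p' i p (ident E A) b g"
  shows "con E 0 i p (hom_elem g) = ext_class E [i', p']"
proof -
  note C = confD[OF c]
  have g: "g \<in> Hom E X D" using conf_morD[OF m c' c] by blast
  obtain B0 i0 p0 b0 where c0: "conf E A B0 X i0 p0" and m0: "conf_mor E i0 p0 i p (ident E A) b0 g"
    and po: "is_pullback E p g p0 b0"
    by (rule pull_conf[OF c g]) (rule that)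
  have all: "ext_class E [i1, p1] = ext_class E [i0, p0]"
    if c1: "conf E A B1 X i1 p1" and m1: "conf_mor E i1 p1 i p (ident E A) b1 g" for B1 i1 p1 b1
  proof -
    obtain t where "conf_mor E i1 p1 i0 p0 (ident E A) t (ident E X)"
      using pull_conf_factor[OF c c0 c1 m0 po m1] .
    then have "chain_map E [i1, p1] [i0, p0] (ident E A) (ident E X)"
      using chain_map_conf[OF c1 c0] by blast
    then show ?thesis
      using yoneda_step_class yoneda_stepI extensions_conf[OF c1] extensions_conf[OF c0] by blast
  qed
  have sg: "src E g = X" using HomD[OF g] by blast
  have "\<Union>{ext_class E [i', p'] |B' i' p' b. conf E A B' X i' p' \<and> conf_mor E i' p' i p (ident E A) b g}
      = ext_class E [i', p']"
  proof (rule Union_const)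
    show "ext_class E [i', p'] \<in>
      {ext_class E [i', p'] |B' i' p' b. conf E A B' X i' p' \<and> conf_mor E i' p' i p (ident E A) b g}"
      using c' m by blast
    fix x assume "x \<in> {ext_class E [i', p'] |B' i' p' b. conf E A B' X i' p' \<and>
      conf_mor E i' p' i p (ident E A) b g}"
    then obtain B1 i1 p1 b1 where "x = ext_class E [i1, p1]" "conf E A B1 X i1 p1"
      "conf_mor E i1 p1 i p (ident E A) b1 g" by blast
    then show "x = ext_class E [i', p']" using all[OF c' m] all by simp
  qed
  then show ?thesis by (simp add: con_def sg C)
qed

lemma con_Hom_ex:
  assumes c: "conf E A B D i p" and g: "g \<in> Hom E X D"
  obtains B' i' p' b where "conf E A B' X i' p'" "conf_mor E i' p' i p (ident E A) b g"
    "con E 0 i p (hom_elem g) = ext_class E [i', p']"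
proof -
  obtain B0 i0 p0 b0 where c0: "conf E A B0 X i0 p0" and m0: "conf_mor E i0 p0 i p (ident E A) b0 g"
    by (rule pull_conf[OF c g]) (rule that)
  show ?thesis using that[OF c0 m0 con_Hom[OF c c0 m0]] .
qed

lemma con_ext:
  assumes c: "conf E A B D i p" and xs: "xs \<in> extensions E k X D"
  shows "con E k i p (ext_class E xs) = ext_class E (splice E [i, p] xs)"
proof -
  have k: "k > 0" using xs by (cases k) (auto simp: extensions_0)
  let ?R = "\<lambda>us c. c = ext_class E (splice E [i, p] us)"
  have "\<Union>{c. \<exists>us. us \<in> ext_class E xs \<and> ?R us c} = ext_class E (splice E [i, p] xs)"
  proof (rule Union_ext_class[OF xs])
    fix us vs c' d
    assume us: "us \<in> extensions E k X D" and vs: "vs \<in> extensions E k X D"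
      and m: "chain_map E us vs (ident E D) (ident E X)" and R: "?R us c'" "?R vs d"
    have "chain_map E (splice E [i, p] us) (splice E [i, p] vs) (ident E A) (ident E X)"
      using chain_map_splice[OF c c us vs] conf_mor_ident[OF c] m by blast
    then show "c' = d"
      using yoneda_step_class[OF yoneda_stepI[OF extensions_splice[OF c us] extensions_splice[OF c vs]]] R
      by simp
  qed blast+
  moreover have "{c. \<exists>us. us \<in> ext_class E xs \<and> ?R us c}
      = {ext_class E (splice E [i, p] us) |us. us \<in> ext_class E xs}" by blast
  ultimately show ?thesis using k by (simp add: con_def)
qed

lemma con_closed:
  assumes c: "conf E A B D i p" and a: "a \<in> Ext_carrier E k X D"
  shows "con E k i p a \<in> Ext_carrier E (Suc k) X A"
  using a
proof (cases rule: Ext_carrier_cases)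
  case (Hom g)
  obtain B' i' p' b where "conf E A B' X i' p'" "con E 0 i p (hom_elem g) = ext_class E [i', p']"
    by (rule con_Hom_ex[OF c Hom(2)]) (rule that)
  then show ?thesis using Hom ext_class_carrier extensions_conf by simp
next
  case (ext xs)
  then show ?thesis using con_ext[OF c ext(2)] ext_class_carrier extensions_splice[OF c ext(2)] by simp
qed

lemma con_surj:
  assumes "a \<in> Ext_carrier E (Suc k) X A"
  obtains B D i p g where "conf E A B D i p" "g \<in> Ext_carrier E k X D" "a = con E k i p g"
proof -
  obtain xs where xs: "xs \<in> extensions E (Suc k) X A" "a = ext_class E xs"
    using assms by (auto simp: Ext_carrier_Suc)
  from xs(1) show ?thesis
  proof (cases rule: extensions_cases)
    case (conf B i p)
    have "con E 0 i p (hom_elem (ident E X)) = ext_class E [i, p]"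
      using con_Hom[OF conf(2) conf(2)] conf_mor_ident[OF conf(2)] by blast
    moreover have "hom_elem (ident E X) \<in> Ext_carrier E 0 X X"
      using ident_Hom confD[OF conf(2)] by (simp add: Ext_carrier_0)
    ultimately show ?thesis using that[OF conf(2)] conf(1,3) xs(2) by simp
  next
    case (splice l B C i p ys)
    then have "l = k" by simp
    then show ?thesis
      using that[OF splice(2) ext_class_carrier] con_ext[OF splice(2,3)] splice(3,4) xs(2) by simp
  qed
qed

text \<open>
  The given morphism of conflations, followed in positive degrees by a chain map that computes
  the action of its last component, is a chain map with first component \<open>a\<close>.
\<close>

lemma con_natural:
  assumes c: "conf E A B D i p" and c': "conf E A' B' D' i' p'"
    and m: "conf_mor E i p i' p' a b d" and g: "g \<in> Ext_carrier E k X D"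
  shows "Ext_push E (Suc k) a (con E k i p g) = con E k i' p' (Ext_push E k d g)"
proof -
  note M = conf_morD[OF m c c']
  from g show ?thesis
  proof (cases rule: Ext_carrier_cases)
    case (Hom h)
    obtain B0 i0 p0 b0 where c0: "conf E A B0 X i0 p0" "conf_mor E i0 p0 i p (ident E A) b0 h"
      "con E 0 i p (hom_elem h) = ext_class E [i0, p0]"
      by (rule con_Hom_ex[OF c Hom(2)]) (rule that)
    obtain B1 i1 p1 b1 where c1: "conf E A' B1 X i1 p1" "conf_mor E i1 p1 i' p' (ident E A') b1 (d \<cdot> h)"
      "con E 0 i' p' (hom_elem (d \<cdot> h)) = ext_class E [i1, p1]" "is_pullback E p' (d \<cdot> h) p1 b1"
    proof -
      obtain B1 i1 p1 b1 where *: "conf E A' B1 X i1 p1" "conf_mor E i1 p1 i' p' (ident E A') b1 (d \<cdot> h)"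
        "is_pullback E p' (d \<cdot> h) p1 b1"
        by (rule pull_conf[OF c' comp_Hom[OF Hom(2) M(3)]]) (rule that)
      show thesis using that[OF *(1,2) con_Hom[OF c' *(1,2)] *(3)] .
    qed
    have "conf_mor E i0 p0 i' p' (a \<cdot> ident E A) (b \<cdot> b0) (d \<cdot> h)"
      by (rule conf_mor_comp[OF c0(1) c c' c0(2) m])
    then have "conf_mor E i0 p0 i' p' a (b \<cdot> b0) (d \<cdot> h)" using comp_ident_right[OF M(1)] by simp
    from pull_conf_factor[OF c' c1(1) c0(1) c1(2) c1(4) this]
    obtain t where "conf_mor E i0 p0 i1 p1 a t (ident E X)" .
    then have "chain_map E [i0, p0] [i1, p1] a (ident E X)" using chain_map_conf[OF c0(1) c1(1)] by blast
    from Ext_push_chain_map[OF extensions_conf[OF c0(1)] extensions_conf[OF c1(1)] M(1) this]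
    show ?thesis using Hom c0(3) c1(3) by simp
  next
    case (ext xs)
    obtain ys where ys: "ys \<in> extensions E k X D'" "chain_map E xs ys d (ident E X)"
      "Ext_push E k d (ext_class E xs) = ext_class E ys"
      by (rule Ext_push_ext[OF ext(2) M(3)]) (rule that)
    have "chain_map E (splice E [i, p] xs) (splice E [i', p'] ys) a (ident E X)"
      using chain_map_splice[OF c c' ext(2) ys(1)] m ys(2) by blast
    from Ext_push_chain_map[OF extensions_splice[OF c ext(2)] extensions_splice[OF c' ys(1)] M(1) this]
    show ?thesis using con_ext[OF c ext(2)] con_ext[OF c' ys(1)] ext(3) ys(3) by simp
  qed
qed

lemma con_natural_ident:
  assumes "conf E A B D i p" "conf E A B' D' i' p'" "conf_mor E i p i' p' (ident E A) b d"
    "g \<in> Ext_carrier E k X D"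
  shows "con E k i p g = con E k i' p' (Ext_push E k d g)"
  using con_natural[OF assms] Ext_push_ident[OF con_closed[OF assms(1,4)]] by simp

text \<open>
  This is the coend description of \<open>Ext\<^sup>k\<^sup>+\<^sup>1(X, A)\<close>: pairs of a
  conflation starting in \<open>A\<close> and an element of \<open>Ext\<^sup>k\<close>, modulo
  the equivalence relation generated by the morphisms of conflations that are the identity on
  \<open>A\<close>. It holds because a Yoneda step between spliced sequences splits into such a
  morphism and a chain map that computes \<open>Ext_push\<close>. The uniqueness of pairs and
  the exactness statements rest on it.
\<close>

lemma con_eq_invariant:
  assumes inv: "\<And>B D i p B' D' i' p' b d g. conf E A B D i p \<Longrightarrow> conf E A B' D' i' p' \<Longrightarrow>
      conf_mor E i p i' p' (ident E A) b d \<Longrightarrow> g \<in> Ext_carrier E k X D \<Longrightarrow>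
      P i p g \<longleftrightarrow> P i' p' (Ext_push E k d g)"
    and c1: "conf E A B1 D1 i1 p1" and g1: "g1 \<in> Ext_carrier E k X D1"
    and c2: "conf E A B2 D2 i2 p2" and g2: "g2 \<in> Ext_carrier E k X D2"
    and eq: "con E k i1 p1 g1 = con E k i2 p2 g2"
  shows "P i1 p1 g1 \<longleftrightarrow> P i2 p2 g2"
proof (cases "k = 0")
  case True
  have X: "X \<in> obj E" using Ext_carrier_obj[OF g1] by blast
  \<comment> \<open>in degree zero every pair \<open>(\<sigma>, g)\<close> is equivalent to the pair of the pullback of \<open>\<sigma>\<close> along \<open>g\<close> and an identity\<close>
  define Q where "Q xs \<longleftrightarrow> (if xs \<in> extensions E 1 X A
    then P (xs ! 0) (xs ! 1) (hom_elem (ident E X)) else False)" for xs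
  have "Q xs = Q ys" if s: "yoneda_step E xs ys" for xs ys
  proof (cases "xs \<in> extensions E 1 X A")
    case xs: True
    then have ys: "ys \<in> extensions E 1 X A"
      using ext_class_extensions[OF yoneda_step_class[OF s]] by blast
    obtain B i p where c: "conf E A B X i p" "xs = [i, p]"
      using xs by (cases rule: extensions_cases) (auto simp: extensions_0)
    obtain B' i' p' where c': "conf E A B' X i' p'" "ys = [i', p']"
      using ys by (cases rule: extensions_cases) (auto simp: extensions_0)
    obtain k' X' A' where st: "xs \<in> extensions E k' X' A'"
      "chain_map E xs ys (ident E A') (ident E X')" using s by (rule yoneda_stepD)
    then have "chain_map E xs ys (ident E A) (ident E X)" using extensions_unique[OF xs st(1)] by simp
    then obtain b where m: "conf_mor E i p i' p' (ident E A) b (ident E X)"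
      using chain_map_conf[OF c(1) c'(1)] c c' by auto
    have "hom_elem (ident E X) \<in> Ext_carrier E k X X"
      using ident_Hom[OF X] True by (simp add: Ext_carrier_0)
    from inv[OF c(1) c'(1) m this] show ?thesis
      using xs ys c(2) c'(2) True comp_ident_left[OF ident_Hom[OF X]] by (simp add: Q_def)
  next
    case False
    then show ?thesis using ext_class_extensions[OF yoneda_step_class[OF s]] by (simp add: Q_def)
  qed
  note Qinv = this
  have red: "\<exists>xs. xs \<in> extensions E 1 X A \<and> con E k i p g = ext_class E xs \<and> (P i p g \<longleftrightarrow> Q xs)"
    if c: "conf E A B D i p" and g: "g \<in> Ext_carrier E k X D" for B D i p g
  proof -
    obtain h where h: "h \<in> Hom E X D" "g = hom_elem h" using g True by (auto simp: Ext_carrier_0)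
    obtain B' i' p' b where c': "conf E A B' X i' p'" and m: "conf_mor E i' p' i p (ident E A) b h"
      and e: "con E 0 i p (hom_elem h) = ext_class E [i', p']"
      by (rule con_Hom_ex[OF c h(1)]) (rule that)
    have "hom_elem (ident E X) \<in> Ext_carrier E k X X"
      using ident_Hom[OF X] True by (simp add: Ext_carrier_0)
    from inv[OF c' c m this] have "P i' p' (hom_elem (ident E X)) \<longleftrightarrow> P i p g"
      using True h comp_ident_right[OF h(1)] by simp
    then have "P i p g \<longleftrightarrow> Q [i', p']" using extensions_conf[OF c'] by (simp add: Q_def)
    then show ?thesis using extensions_conf[OF c'] e True h by auto
  qed
  obtain xs ys where "con E k i1 p1 g1 = ext_class E xs" "P i1 p1 g1 \<longleftrightarrow> Q xs"
    "con E k i2 p2 g2 = ext_class E ys" "P i2 p2 g2 \<longleftrightarrow> Q ys"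
    using red[OF c1 g1] red[OF c2 g2] by blast
  then show ?thesis using ext_class_invariant[of xs ys Q] Qinv eq by simp
next
  case False
  then have k: "k > 0" by simp
  \<comment> \<open>the decomposition of an extension is not unique, so the step is analysed for all decompositions\<close>
  have one: "P i p (ext_class E us) \<longleftrightarrow> P i' p' (ext_class E vs)"
    if c: "conf E A B D i p" and c': "conf E A B' D' i' p'"
      and us: "us \<in> extensions E k X D" and vs: "vs \<in> extensions E k X D'"
      and s: "yoneda_step E (splice E [i, p] us) (splice E [i', p'] vs)" for B D i p us B' D' i' p' vs
  proof -
    obtain k' X' A' where st: "splice E [i, p] us \<in> extensions E k' X' A'"
      "chain_map E (splice E [i, p] us) (splice E [i', p'] vs) (ident E A') (ident E X')"
      using s by (rule yoneda_stepD)
    then have "chain_map E (splice E [i, p] us) (splice E [i', p'] vs) (ident E A) (ident E X)"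
      using extensions_unique[OF extensions_splice[OF c us] st(1)] by simp
    then obtain b d where m: "conf_mor E i p i' p' (ident E A) b d" "chain_map E us vs d (ident E X)"
      using chain_map_splice[OF c c' us vs] by blast
    have "d \<in> Hom E D D'" using conf_morD[OF m(1) c c'] by blast
    from Ext_push_chain_map[OF us vs this m(2)] show ?thesis
      using inv[OF c c' m(1) ext_class_carrier[OF us]] by simp
  qed
  define Q where "Q xs \<longleftrightarrow> (\<exists>B D i p us. conf E A B D i p \<and> us \<in> extensions E k X D \<and>
    xs = splice E [i, p] us \<and> P i p (ext_class E us))" for xs
  have Qiff: "Q (splice E [i, p] us) \<longleftrightarrow> P i p (ext_class E us)"
    if c: "conf E A B D i p" and us: "us \<in> extensions E k X D" for B D i p us
  proof
    assume "Q (splice E [i, p] us)"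
    then obtain B' D' i' p' vs where v: "conf E A B' D' i' p'" "vs \<in> extensions E k X D'"
      "splice E [i, p] us = splice E [i', p'] vs" "P i' p' (ext_class E vs)"
      unfolding Q_def by (elim exE conjE) (rule that)
    have "yoneda_step E (splice E [i, p] us) (splice E [i', p'] vs)"
      using yoneda_step_ident[OF extensions_splice[OF c us]] v(3) by simp
    from one[OF c v(1) us v(2) this] show "P i p (ext_class E us)" using v(4) by simp
  next
    assume "P i p (ext_class E us)"
    then show "Q (splice E [i, p] us)" unfolding Q_def using c us by blast
  qed
  have Qinv: "Q xs = Q ys" if s: "yoneda_step E xs ys" for xs ys
  proof (cases "xs \<in> extensions E (Suc k) X A")
    case xs: True
    then have ys: "ys \<in> extensions E (Suc k) X A"
      using ext_class_extensions[OF yoneda_step_class[OF s]] by blast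
    obtain B D i p us where x: "conf E A B D i p" "us \<in> extensions E k X D" "xs = splice E [i, p] us"
      using xs k by (cases rule: extensions_cases) auto
    obtain B' D' i' p' vs where y: "conf E A B' D' i' p'" "vs \<in> extensions E k X D'"
      "ys = splice E [i', p'] vs"
      using ys k by (cases rule: extensions_cases) auto
    show ?thesis using Qiff[OF x(1,2)] Qiff[OF y(1,2)] one[OF x(1) y(1) x(2) y(2)] s x(3) y(3) by simp
  next
    case False
    then have "ys \<notin> extensions E (Suc k) X A"
      using ext_class_extensions[OF yoneda_step_class[OF s]] by blast
    then show ?thesis using False extensions_splice unfolding Q_def by blast
  qed
  obtain us where us: "us \<in> extensions E k X D1" "g1 = ext_class E us"
    using g1 Ext_carrier_pos[OF k] by auto
  obtain vs where vs: "vs \<in> extensions E k X D2" "g2 = ext_class E vs"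
    using g2 Ext_carrier_pos[OF k] by auto
  have "ext_class E (splice E [i1, p1] us) = ext_class E (splice E [i2, p2] vs)"
    using eq con_ext[OF c1 us(1)] con_ext[OF c2 vs(1)] us vs by simp
  from ext_class_invariant[OF this, of Q] show ?thesis
    using Qinv Qiff[OF c1 us(1)] Qiff[OF c2 vs(1)] us vs by simp
qed

section \<open>The zero element\<close>

lemma zero_conf:
  assumes "A \<in> obj E" "zero_object E Z"
  shows "conf E A A Z (ident E A) (zero E A Z)"
proof -
  have Z: "Z \<in> obj E" using assms by (simp add: zero_object_def)
  note H = assms(1) Z
  show ?thesis
  proof (rule inflation_cokernel_conf[OF ident_inflation[OF assms(1)] ident_Hom[OF assms(1)]
        zero_Hom[OF H]])
    show "zero E A Z \<cdot> ident E A = zero E A Z" by (simp add: cat H)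
    fix T h assume "h \<in> Hom E A T" "h \<cdot> ident E A = zero E A T"
    then have "h = zero E A T" "T \<in> obj E" using comp_ident_right[of h A T] HomD[of h A T] by auto
    then show "\<exists>t. t \<in> Hom E Z T \<and> t \<cdot> zero E A Z = h"
      by (intro exI[of _ "zero E Z T"]) (simp add: cat H zero_Hom)
  next
    fix T f g assume "f \<in> Hom E Z T" "g \<in> Hom E Z T"
    then show "f = g" using zero_object_Hom_from[OF assms(2)] by metis
  qed
qed

lemma zero_conf':
  assumes "A \<in> obj E" "zero_object E Z"
  shows "conf E Z A A (zero E Z A) (ident E A)"
  using exact_category.zero_conf[OF exact_category_op, of A Z] assms by (simp add: op_zero_object op_conf)

text \<open>
  A trivial \<open>m\<close>-fold extension with \<open>m \<ge> 3\<close> is spliced from the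
  conflation \<open>A = A \<rightarrow> 0\<close> and a trivial extension that starts in a zero
  object; for \<open>m = 2\<close> the second factor is \<open>0 \<rightarrow> X = X\<close>.
\<close>

lemma trivial_extension_extensions:
  assumes "k > 0" "X \<in> obj E" "A \<in> obj E" "trivial_extension E k X A xs"
    and "src E (hd xs) = A" "tgt E (last xs) = X"
  shows "xs \<in> extensions E k X A"
  using assms
proof (induction k arbitrary: A xs)
  case 0
  then show ?case by simp
next
  case (Suc k)
  obtain Z where Z: "zero_object E Z" using ex_zero_object by blast
  consider "k = 0" | "k = 1" | "k \<ge> 2" by linarith
  then show ?case
  proof cases
    case 1
    obtain P i1 i2 p1 p2 where "biproduct E A X P i1 i2 p1 p2" "xs = [i1, p2]"
      using Suc.prems(4) 1 by (auto simp: trivial_extension_def)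
    then show ?thesis using extensions_conf[OF biproduct_conf] 1 by simp
  next
    case 2
    then have t: "is_seq E xs" "length xs = 3" "xs ! 0 = ident E A" "xs ! 2 = ident E X"
      "xs ! 1 = zero E (seq_obj E xs 1) (seq_obj E xs 2)"
      using Suc.prems(4) by (auto simp: trivial_extension_def numeral_2_eq_2)
    obtain x y z where xs: "xs = [x, y, z]" using t(2) by (auto simp: length_Suc_conv numeral_3_eq_3)
    have "x = ident E A" "z = ident E X" using t xs by auto
    moreover have "seq_obj E xs 1 = A" "seq_obj E xs 2 = X"
      using t(1) xs \<open>x = ident E A\<close> \<open>z = ident E X\<close> ident_arr Suc.prems(2,3)
      by (auto simp: is_seq_def seq_obj_def numeral_2_eq_2 dest!: spec[where x = 0] HomD(3))
    ultimately have e: "xs = [ident E A, zero E A X, ident E X]" using t(5) xs by simp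
    note c = zero_conf[OF Suc.prems(3) Z] and c' = zero_conf'[OF Suc.prems(2) Z]
    have "splice E [ident E A, zero E A Z] [zero E Z X, ident E X] = xs"
      using confD[OF c] confD[OF c'] by (simp add: splice_cons e cat)
    then show ?thesis using extensions_splice[OF c extensions_conf[OF c']] 2 by simp
  next
    case 3
    then have t: "is_seq E xs" "length xs = Suc (Suc k)" "xs ! 0 = ident E A"
      "xs ! Suc k = ident E X"
      "\<And>j. 1 \<le> j \<Longrightarrow> j < Suc k \<Longrightarrow> xs ! j = zero E (seq_obj E xs j) (seq_obj E xs (Suc j))"
      "\<And>j. 2 \<le> j \<Longrightarrow> j < Suc k \<Longrightarrow> zero_object E (seq_obj E xs j)"
      using Suc.prems(4) by (auto simp: trivial_extension_def)
    obtain x y zs where xs: "xs = x # y # zs" "length zs = k"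
      using t(2) by (cases xs; cases "tl xs") auto
    obtain z zr where zs: "zs = z # zr" using xs 3 by (cases zs) auto
    define Y where "Y = src E z"
    have arr: "xs ! j \<in> Hom E (seq_obj E xs j) (seq_obj E xs (Suc j))" if "j < length xs" for j
      using t(1) that by (simp add: is_seq_def)
    have s1: "seq_obj E xs 1 = A" "seq_obj E xs 2 = Y"
      using arr[of 0] t(3) Suc.prems(3) ident_arr[OF Suc.prems(3)] xs zs
      by (auto simp: Y_def numeral_2_eq_2 Hom_def)
    have Y: "zero_object E Y" "Y \<in> obj E" using t(6)[of 2] s1 3 by (auto simp: zero_object_def)
    have y: "y = zero E A Y" using t(5)[of 1] s1 3 xs by (simp add: numeral_2_eq_2)
    have x: "x = ident E A" using t(3) xs by simp
    define us where "us = ident E Y # zs"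
    have so: "seq_obj E us (Suc j) = seq_obj E xs (Suc (Suc j))" for j
      by (simp add: us_def xs zs)
    have us0: "seq_obj E us 0 = Y" using Y ident_arr by (simp add: us_def)
    have ush: "us ! j \<in> Hom E (seq_obj E us j) (seq_obj E us (Suc j))" if "j < length us" for j
    proof (cases j)
      case 0
      then show ?thesis using so[of 0] us0 s1(2) ident_Hom[OF Y(2)]
        by (simp add: us_def numeral_2_eq_2 xs zs Y_def)
    next
      case (Suc l)
      then show ?thesis using arr[of "Suc (Suc l)"] that so[of l] so[of "Suc l"]
        by (simp add: us_def xs)
    qed
    have "trivial_extension E k X Y us"
    proof -
      have "us ! k = ident E X" using t(4) xs 3 by (cases k) (auto simp: us_def)
      moreover have "us ! j = zero E (seq_obj E us j) (seq_obj E us (Suc j))" if "1 \<le> j" "j < k" for j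
        using that t(5)[of "Suc j"] so[of "j - 1"] so[of j] xs by (cases j) (auto simp: us_def)
      moreover have "zero_object E (seq_obj E us j)" if "2 \<le> j" "j < k" for j
        using that t(6)[of "Suc j"] so[of "j - 1"] by (cases j) auto
      moreover have "is_seq E us" using ush by (simp add: is_seq_def us_def)
      moreover have "length us = Suc k" "us ! 0 = ident E Y" using xs by (simp_all add: us_def)
      ultimately show ?thesis using 3 by (simp add: trivial_extension_def)
    qed
    moreover have "src E (hd us) = Y" "tgt E (last us) = X"
      using ident_arr[OF Y(2)] Suc.prems(6) by (simp_all add: us_def xs zs)
    ultimately have "us \<in> extensions E k X Y" using Suc.IH[OF _ Suc.prems(2) Y(2)] 3 by simp
    from extensions_splice[OF zero_conf[OF Suc.prems(3) Y(1)] this]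
    show ?thesis using Y Suc.prems(3) zero_arr[OF Suc.prems(3) Y(2)]
      by (simp add: splice_cons us_def xs(1) x y ident_comp)
  qed
qed

lemma trivial_extension_ends:
  assumes "k > 0" "X \<in> obj E" "A \<in> obj E" "trivial_extension E k X A xs"
  shows "src E (hd xs) = A" "tgt E (last xs) = X"
proof -
  have "src E (hd xs) = A \<and> tgt E (last xs) = X"
  proof (cases "k = 1")
    case True
    then show ?thesis using assms(4) by (auto simp: trivial_extension_def biproduct_def dest: HomD)
  next
    case False
    then have "length xs = Suc k" "xs ! 0 = ident E A" "xs ! k = ident E X"
      using assms by (auto simp: trivial_extension_def)
    moreover then have "xs \<noteq> []" by auto
    ultimately have "hd xs = ident E A" "last xs = ident E X" by (simp_all add: hd_conv_nth last_conv_nth)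
    then show ?thesis using ident_arr assms by simp
  qed
  then show "src E (hd xs) = A" "tgt E (last xs) = X" by auto
qed

lemma trivial_extension_exists:
  assumes "k > 0" "X \<in> obj E" "A \<in> obj E"
  obtains xs where "trivial_extension E k X A xs"
proof (cases "k = 1")
  case True
  obtain P i1 i2 p1 p2 where "biproduct E A X P i1 i2 p1 p2" using ex_biproduct[OF assms(3,2)] by blast
  then show ?thesis using that[of "[i1, p2]"] True by (auto simp: trivial_extension_def)
next
  case False
  obtain Z where Z: "zero_object E Z" "Z \<in> obj E" using ex_zero_object by (auto simp: zero_object_def)
  define O' where "O' j = (if j \<le> 1 then A else if j < k then Z else X)" for j
  have O: "O' j \<in> obj E" for j using Z assms by (simp add: O'_def)
  define xs where "xs = map (\<lambda>j. if j = 0 then ident E A else if j = k then ident E X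
    else zero E (O' j) (O' (Suc j))) [0..<Suc k]"
  have n: "xs ! j = (if j = 0 then ident E A else if j = k then ident E X
    else zero E (O' j) (O' (Suc j)))" if "j < Suc k" for j
    using that unfolding xs_def by (subst nth_map) (simp_all del: upt_Suc)
  have l: "length xs = Suc k" by (simp add: xs_def)
  have so: "seq_obj E xs j = O' j" if "j \<le> Suc k" for j
  proof (cases "j = Suc k")
    case True
    then have "seq_obj E xs j = tgt E (xs ! k)" using l by (simp add: seq_obj_def last_conv_nth flip: length_0_conv)
    then show ?thesis using n[of k] assms True False by (simp add: O'_def ident_arr)
  next
    case F: False
    then show ?thesis using that n[of j] assms False
      by (auto simp: seq_obj_def l ident_arr zero_arr O O'_def[of 0] O'_def[of k])
  qed
  have h: "xs ! j \<in> Hom E (seq_obj E xs j) (seq_obj E xs (Suc j))" if "j < Suc k" for j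
    using n[OF that] so[of j] so[of "Suc j"] that assms False
    by (auto intro: ident_Hom zero_Hom O simp: O'_def[of 0] O'_def[of "Suc 0"] O'_def[of k] O'_def[of "Suc k"])
  have "trivial_extension E k X A xs"
    using h False assms(1) l so n by (auto simp: trivial_extension_def is_seq_def O'_def[of "_::nat"] Z)
  then show ?thesis using that by blast
qed

lemma extensions_complex:
  assumes "xs \<in> extensions E k D A" "Suc j < length xs"
  shows "xs ! Suc j \<cdot> xs ! j = zero E (src E (xs ! j)) (tgt E (xs ! Suc j))"
  using assms
proof (induction arbitrary: j rule: extensions_induct)
  case (conf A B i p)
  then show ?case using confD[OF conf(1)] by simp
next
  case (splice k A B C i p ys)
  obtain x y zs where ys: "ys = x # y # zs" "x \<in> arr E" "y \<in> arr E" "src E x = C" "tgt E x = src E y"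
    using extensions_Cons[OF splice(2)] by metis
  note H = confD[OF splice(1)] ys(2-)
  have xy: "y \<cdot> x = zero E C (tgt E y)" using splice(3)[of 0] ys by simp
  show ?case
  proof (cases j)
    case 0
    then show ?thesis by (simp add: ys(1) splice_cons H cat tgt_obj)
  next
    case (Suc l)
    show ?thesis
    proof (cases l)
      case 0
      then show ?thesis using Suc
        by (simp add: ys(1) splice_cons H cat xy[THEN comp_cong_tail] tgt_obj)
    next
      case (Suc l')
      then show ?thesis using \<open>j = Suc l\<close> splice(3)[of l] splice(4) by (simp add: ys(1) splice_cons)
    qed
  qed
qed

text \<open>
  If \<open>k = 1\<close>, the middle component is the deflation of \<open>xs\<close> followed
  by the injection of \<open>X\<close>. If \<open>k \<ge> 2\<close>, the component before the
  last is the last arrow of \<open>xs\<close>, and all earlier ones are zero.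
\<close>

lemma chain_map_trivial:
  assumes xs: "xs \<in> extensions E k X B" and A: "A \<in> obj E" and t: "trivial_extension E k X A ts"
  shows "chain_map E xs ts (zero E B A) (ident E X)"
proof -
  have k: "k > 0" using xs by (cases k) (auto simp: extensions_0)
  have X: "X \<in> obj E" "B \<in> obj E" using extensions_obj[OF xs] by auto
  note e = trivial_extension_ends[OF k X(1) A t]
  have te: "ts \<in> extensions E k X A" by (rule trivial_extension_extensions[OF k X(1) A t e])
  show ?thesis
  proof (cases "k = 1")
    case True
    obtain D i p where c: "conf E B D X i p" "xs = [i, p]"
      using xs True by (cases rule: extensions_cases) (auto simp: extensions_0)
    obtain P i1 i2 p1 p2 where b: "biproduct E A X P i1 i2 p1 p2" "ts = [i1, p2]"
      using t True by (auto simp: trivial_extension_def)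
    note b' = biproductD[OF b(1)]
    note H = confD[OF c(1)] HomD[OF b'(1)] HomD[OF b'(2)] HomD[OF b'(4)]
    have "conf_mor E i p i1 p2 (zero E B A) (i2 \<cdot> p) (ident E X)"
      by (rule conf_morI[OF c(1) biproduct_conf[OF b(1)]])
        (simp_all add: H cat Hom_def b'(6)[THEN comp_cong_tail])
    then show ?thesis using chain_map_conf[OF c(1) biproduct_conf[OF b(1)]] c(2) b(2) by auto
  next
    case False
    then have k2: "k \<ge> 2" using k by simp
    have t': "is_seq E ts" "length ts = Suc k" "ts ! k = ident E X"
      "\<And>j. 1 \<le> j \<Longrightarrow> j < k \<Longrightarrow> ts ! j = zero E (seq_obj E ts j) (seq_obj E ts (Suc j))"
      using t False by (auto simp: trivial_extension_def)
    have lx: "length xs = Suc k" "xs \<noteq> []" using xs by (auto simp: extensions_def)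
    have hx: "xs ! j \<in> Hom E (seq_obj E xs j) (seq_obj E xs (Suc j))" if "j < Suc k" for j
      using path_nth[OF extensions_path[OF xs]] that lx by simp
    have ht: "ts ! j \<in> Hom E (seq_obj E ts j) (seq_obj E ts (Suc j))" if "j < Suc k" for j
      using t'(1,2) that by (simp add: is_seq_def)
    have st: "seq_obj E ts k = X" "seq_obj E ts (Suc k) = X" "seq_obj E ts 0 = A"
    proof -
      have i: "ident E X \<in> Hom E (seq_obj E ts k) (seq_obj E ts (Suc k))" using ht[of k] t'(3) by simp
      show "seq_obj E ts k = X" by (rule trans[OF HomD(2)[OF i, symmetric] ident_arr(2)[OF X(1)]])
      show "seq_obj E ts (Suc k) = X" by (rule trans[OF HomD(3)[OF i, symmetric] ident_arr(3)[OF X(1)]])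
      have "ts \<noteq> []" using t'(2) by auto
      then show "seq_obj E ts 0 = A" using e(1) by (simp add: seq_obj_def hd_conv_nth)
    qed
    have sx: "seq_obj E xs (Suc k) = X" "seq_obj E xs 0 = B"
      using xs lx by (auto simp: seq_obj_def extensions_def hd_conv_nth)
    have ob: "seq_obj E xs j \<in> obj E" "seq_obj E ts j \<in> obj E" if "j < Suc k" for j
      using HomD(4)[OF hx[OF that]] HomD(4)[OF ht[OF that]] by auto
    let ?f = "\<lambda>j. if j = Suc k then ident E X else if j = k then xs ! k
      else zero E (seq_obj E xs j) (seq_obj E ts j)"
    have f1: "?f j \<in> Hom E (seq_obj E xs j) (seq_obj E ts j)" if "j \<le> length xs" for j
    proof -
      consider "j = Suc k" | "j = k" | "j < k" using \<open>j \<le> length xs\<close> lx by linarith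
      then show ?thesis
      proof cases
        case 1
        then show ?thesis using st sx ident_Hom[OF X(1)] by simp
      next
        case 2
        then show ?thesis using hx[of k] st sx by simp
      next
        case 3
        then show ?thesis using zero_Hom[OF ob] by simp
      qed
    qed
    have f2: "?f (Suc j) \<cdot> xs ! j = ts ! j \<cdot> ?f j" if "j < length xs" for j
    proof -
      have hj: "xs ! j \<in> Hom E (seq_obj E xs j) (seq_obj E xs (Suc j))"
        "ts ! j \<in> Hom E (seq_obj E ts j) (seq_obj E ts (Suc j))"
        using hx ht that lx by auto
      consider "j = k" | "Suc j = k" | "Suc j < k" using \<open>j < length xs\<close> lx by linarith
      then show ?thesis
      proof cases
        case 1
        then show ?thesis using hx[of k] t'(3) sx HomD[OF hx[of k]] by (simp add: ident_comp)
      next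
        case 2
        have xx: "xs ! Suc j \<cdot> xs ! j = zero E (seq_obj E xs j) (seq_obj E xs (Suc (Suc j)))"
          using extensions_complex[OF xs, of j] 2 lx st sx HomD[OF hx[of "Suc j"]] HomD[OF hj(1)]
          by simp
        show ?thesis using 2 xx hj ob[of j] t'(4)[of j] k2 HomD[OF hj(2)] st sx HomD[OF hj(1)]
          by (simp add: comp_zero)
      next
        case 3
        then show ?thesis using hj ob[of j] HomD[OF hj(1)] HomD[OF hj(2)]
          by (simp add: comp_zero zero_comp)
      qed
    qed
    have "\<exists>f. (\<forall>j\<le>length xs. f j \<in> Hom E (seq_obj E xs j) (seq_obj E ts j)) \<and>
      (\<forall>j<length xs. f (Suc j) \<cdot> xs ! j = ts ! j \<cdot> f j) \<and> f 0 = zero E B A \<and>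
      f (length xs) = ident E X"
    proof (rule exI[of _ ?f], rule conjI[OF _ conjI[OF _ conjI]])
      show "\<forall>j\<le>length xs. ?f j \<in> Hom E (seq_obj E xs j) (seq_obj E ts j)"
        by (rule allI, rule impI, rule f1)
      show "\<forall>j<length xs. ?f (Suc j) \<cdot> xs ! j = ts ! j \<cdot> ?f j"
        by (rule allI, rule impI, rule f2)
    qed (use k st sx lx in simp_all)
    then show ?thesis using chain_map_iff[of xs ts E "zero E B A" "ident E X"] lx t'(2) by simp
  qed
qed

lemma Ext_zero_0: "Ext_zero E 0 X A = hom_elem (zero E X A)"
  by (simp add: Ext_zero_def)

text \<open>
  By \<open>chain_map_trivial\<close> the zero endomorphism of \<open>A\<close> maps the class
  of one trivial extension to the class of any other one, and also to itself.
\<close>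

lemma Ext_zero_trivial:
  assumes k: "k > 0" and X: "X \<in> obj E" "A \<in> obj E" and t: "trivial_extension E k X A ts"
  shows "ts \<in> extensions E k X A" "Ext_zero E k X A = ext_class E ts"
proof -
  have ext: "us \<in> extensions E k X A" if "trivial_extension E k X A us" for us
    using trivial_extension_extensions[OF k X that] trivial_extension_ends[OF k X that] .
  show te: "ts \<in> extensions E k X A" using ext[OF t] .
  have z: "zero E A A \<in> Hom E A A" using zero_Hom X by blast
  have eq: "ext_class E us = ext_class E ts" if u: "trivial_extension E k X A us" for us
    using Ext_push_chain_map[OF te te z chain_map_trivial[OF te X(2) t]]
      Ext_push_chain_map[OF te ext[OF u] z chain_map_trivial[OF te X(2) u]] by simp
  have "\<Union>{ext_class E xs |xs. trivial_extension E k X A xs} = ext_class E ts"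
    by (rule Union_const) (use t eq in blast)+
  then show "Ext_zero E k X A = ext_class E ts" using k by (simp add: Ext_zero_def)
qed

lemma Ext_zero_closed:
  assumes "X \<in> obj E" "A \<in> obj E"
  shows "Ext_zero E k X A \<in> Ext_carrier E k X A"
proof (cases "k = 0")
  case True
  then show ?thesis using zero_Hom[OF assms] by (simp add: Ext_zero_0 Ext_carrier_0)
next
  case False
  then have k: "k > 0" by simp
  obtain ts where "trivial_extension E k X A ts" using trivial_extension_exists[OF k assms] .
  then show ?thesis using Ext_zero_trivial[OF k assms] ext_class_carrier by simp
qed

lemma Ext_push_zero:
  assumes "a \<in> Ext_carrier E k X B" "A \<in> obj E"
  shows "Ext_push E k (zero E B A) a = Ext_zero E k X A"
  using assms(1)
proof (cases rule: Ext_carrier_cases)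
  case (Hom g)
  then show ?thesis using HomD[OF Hom(2)] assms(2) by (simp add: Ext_zero_0 zero_comp)
next
  case (ext xs)
  have X: "X \<in> obj E" "B \<in> obj E" using extensions_obj[OF ext(2)] by auto
  obtain ts where t: "trivial_extension E k X A ts" using trivial_extension_exists[OF ext(1) X(1) assms(2)] .
  note T = Ext_zero_trivial[OF ext(1) X(1) assms(2) t]
  show ?thesis
    using Ext_push_chain_map[OF ext(2) T(1) zero_Hom[OF X(2) assms(2)]
        chain_map_trivial[OF ext(2) assms(2) t]] T(2) ext(3) by simp
qed

lemma Ext_push_Ext_zero:
  assumes "f \<in> Hom E A B" "X \<in> obj E"
  shows "Ext_push E k f (Ext_zero E k X A) = Ext_zero E k X B"
proof -
  note H = HomD[OF assms(1)]
  have z: "Ext_zero E k X A \<in> Ext_carrier E k X A" using Ext_zero_closed assms H by blast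
  have "Ext_zero E k X A = Ext_push E k (zero E A A) (Ext_zero E k X A)"
    using Ext_push_zero[OF z] H by simp
  then have "Ext_push E k f (Ext_zero E k X A) = Ext_push E k (f \<cdot> zero E A A) (Ext_zero E k X A)"
    using Ext_push_comp[OF zero_Hom assms(1) z] H by simp
  also have "\<dots> = Ext_zero E k X B" using Ext_push_zero[OF z] H by (simp add: comp_zero)
  finally show ?thesis .
qed

lemma Ext_push_comp_zero:
  assumes "f \<in> Hom E A B" "g \<in> Hom E B D" "g \<cdot> f = zero E A D" "a \<in> Ext_carrier E k X A"
  shows "Ext_push E k g (Ext_push E k f a) = Ext_zero E k X D"
  using Ext_push_comp[OF assms(1,2,4)] Ext_push_zero[OF assms(4)] HomD[OF assms(2)] assms(3) by simp

lemma con_zero: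
  assumes c: "conf E A B D i p" and X: "X \<in> obj E"
  shows "con E k i p (Ext_zero E k X D) = Ext_zero E (Suc k) X A"
proof -
  note H = confD[OF c]
  have m: "conf_mor E i p i p (zero E A A) (zero E B B) (zero E D D)"
    by (rule conf_morI[OF c c]) (simp_all add: zero_Hom H cat)
  have z: "Ext_zero E k X D \<in> Ext_carrier E k X D" using Ext_zero_closed X H by blast
  have "Ext_push E (Suc k) (zero E A A) (con E k i p (Ext_zero E k X D))
      = con E k i p (Ext_push E k (zero E D D) (Ext_zero E k X D))"
    using con_natural[OF c c m z] .
  then show ?thesis
    using Ext_push_zero[OF con_closed[OF c z]] Ext_push_zero[OF z] H by simp
qed

lemma con_split:
  assumes R: "biproduct E A D R j1 j2 q1 q2" and g: "g \<in> Ext_carrier E k X D"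
  shows "con E k j1 q2 g = Ext_zero E (Suc k) X A"
proof -
  note c = biproduct_conf[OF R]
  have "Ext_push E (Suc k) (zero E A A) (con E k j1 q2 g) = con E k j1 q2 g"
    using con_natural[OF c c split_conf_mor[OF R] g] Ext_push_ident[OF g] by simp
  then show ?thesis using Ext_push_zero[OF con_closed[OF c g]] confD[OF c] by simp
qed

lemma con_push:
  assumes c: "conf E A B D i p" and b: "b \<in> Ext_carrier E k X B"
  shows "con E k i p (Ext_push E k p b) = Ext_zero E (Suc k) X A"
proof -
  obtain R j1 j2 q1 q2 y where R: "biproduct E A B R j1 j2 q1 q2"
    and m: "conf_mor E j1 q2 i p (ident E A) y p" using conf_split_over[OF c] .
  show ?thesis
    using con_natural_ident[OF biproduct_conf[OF R] c m b] con_split[OF R b] by simp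
qed

lemma push_con:
  assumes c: "conf E A B D i p" and g: "g \<in> Ext_carrier E k X D"
  shows "Ext_push E (Suc k) i (con E k i p g) = Ext_zero E (Suc k) X B"
proof -
  obtain R j1 j2 q1 q2 y where R: "biproduct E B D R j1 j2 q1 q2"
    and m: "conf_mor E i p j1 q2 i y (ident E D)" using conf_to_split[OF c] .
  show ?thesis
    using con_natural[OF c biproduct_conf[OF R] m g] Ext_push_ident[OF g] con_split[OF R g] by simp
qed

section \<open>Ext preserves finite sums\<close>

text \<open>
  The element \<open>e\<close> is the product of \<open>\<sigma> \<oplus> \<sigma>'\<close> with
  the pair \<open>(g, g')\<close>, where \<open>\<sigma>\<close> and \<open>\<sigma>'\<close>
  are the conflations given by \<open>i, p\<close> and \<open>i', p'\<close>. It is a relation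
  because the sums \<open>Q\<close> and \<open>R\<close> are determined only up to isomorphism.
\<close>

definition sum_val ::
    "nat \<Rightarrow> 'o \<Rightarrow> 'o \<Rightarrow> 'm \<Rightarrow> 'm \<Rightarrow> 'm \<Rightarrow> 'm \<Rightarrow> 'm list set \<Rightarrow> 'm \<Rightarrow> 'm \<Rightarrow> 'm list set \<Rightarrow> 'm list set \<Rightarrow> bool"
  where "sum_val k X P pa1 pa2 i p g i' p' g' e \<longleftrightarrow>
    (\<exists>B D B' D' Q R j q b1 b2 y1 y2 d1 d2 pd1 pd2 h.
      conf E (tgt E pa1) B D i p \<and> conf E (tgt E pa2) B' D' i' p' \<and>
      biproduct E D D' R d1 d2 pd1 pd2 \<and> conf E P Q R j q \<and> biproduct E B B' Q b1 b2 y1 y2 \<and>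
      conf_mor E j q i p pa1 y1 pd1 \<and> conf_mor E j q i' p' pa2 y2 pd2 \<and>
      h \<in> Ext_carrier E k X R \<and> Ext_push E k pd1 h = g \<and> Ext_push E k pd2 h = g' \<and>
      e = con E k j q h)"

lemma sum_val_swap:
  assumes "sum_val k X P pa1 pa2 i p g i' p' g' e"
  shows "sum_val k X P pa2 pa1 i' p' g' i p g e"
  using assms unfolding sum_val_def
  apply (elim exE conjE)
  subgoal for B D B' D' Q R j q b1 b2 y1 y2 d1 d2 pd1 pd2 h
    by (rule exI[of _ B'], rule exI[of _ D'], rule exI[of _ B], rule exI[of _ D], rule exI[of _ Q],
        rule exI[of _ R], rule exI[of _ j], rule exI[of _ q], rule exI[of _ b2], rule exI[of _ b1],
        rule exI[of _ y2], rule exI[of _ y1], rule exI[of _ d2], rule exI[of _ d1],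
        rule exI[of _ pd2], rule exI[of _ pd1], rule exI[of _ h])
      (simp add: biproduct_swap)
  done

definition Ext_additive :: "nat \<Rightarrow> 'o \<Rightarrow> bool"
  where "Ext_additive k X \<longleftrightarrow> (\<forall>A B P i1 i2 p1 p2. biproduct E A B P i1 i2 p1 p2 \<longrightarrow>
    (\<forall>a\<in>Ext_carrier E k X A. \<forall>b\<in>Ext_carrier E k X B.
      \<exists>!e. e \<in> Ext_carrier E k X P \<and> Ext_push E k p1 e = a \<and> Ext_push E k p2 e = b))"

lemma Ext_pair:
  assumes "Ext_additive k X" "biproduct E A B P i1 i2 p1 p2"
    "a \<in> Ext_carrier E k X A" "b \<in> Ext_carrier E k X B"
  obtains e where "e \<in> Ext_carrier E k X P" "Ext_push E k p1 e = a" "Ext_push E k p2 e = b"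
  using assms(1)[unfolded Ext_additive_def, rule_format, OF assms(2-4)] that by blast

lemma Ext_pair_unique:
  assumes "Ext_additive k X" "biproduct E A B P i1 i2 p1 p2"
    "e \<in> Ext_carrier E k X P" "e' \<in> Ext_carrier E k X P"
    "Ext_push E k p1 e = Ext_push E k p1 e'" "Ext_push E k p2 e = Ext_push E k p2 e'"
  shows "e = e'"
proof -
  note b = biproductD[OF assms(2)]
  have "Ext_push E k p1 e \<in> Ext_carrier E k X A" "Ext_push E k p2 e \<in> Ext_carrier E k X B"
    using Ext_push_closed b assms(3) by blast+
  from ex1_implies_ex[OF assms(1)[unfolded Ext_additive_def, rule_format, OF assms(2) this]]
    assms(1)[unfolded Ext_additive_def, rule_format, OF assms(2) this]
  show ?thesis using assms(3-6) by auto
qed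

lemma sum_val_ex:
  assumes add: "Ext_additive k X" and P: "biproduct E A A' P a1 a2 pa1 pa2"
    and c: "conf E A B D i p" "conf E A' B' D' i' p'"
    and g: "g \<in> Ext_carrier E k X D" "g' \<in> Ext_carrier E k X D'"
  obtains e where "sum_val k X P pa1 pa2 i p g i' p' g' e" "e \<in> Ext_carrier E (Suc k) X P"
    "Ext_push E (Suc k) pa1 e = con E k i p g" "Ext_push E (Suc k) pa2 e = con E k i' p' g'"
proof -
  obtain R d1 d2 pd1 pd2 where R: "biproduct E D D' R d1 d2 pd1 pd2"
    using ex_biproduct confD(13)[OF c(1)] confD(13)[OF c(2)] by blast
  obtain Q j q b1 b2 y1 y2 where Q: "conf E P Q R j q" "biproduct E B B' Q b1 b2 y1 y2"
    "conf_mor E j q i p pa1 y1 pd1" "conf_mor E j q i' p' pa2 y2 pd2"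
    using conf_sum[OF c P R] .
  obtain h where h: "h \<in> Ext_carrier E k X R" "Ext_push E k pd1 h = g" "Ext_push E k pd2 h = g'"
    using Ext_pair[OF add R g] .
  have t: "tgt E pa1 = A" "tgt E pa2 = A'" using biproductD[OF P] by (auto simp: Hom_def)
  have "sum_val k X P pa1 pa2 i p g i' p' g' (con E k j q h)"
    unfolding sum_val_def t
    by (rule exI[of _ B], rule exI[of _ D], rule exI[of _ B'], rule exI[of _ D'], rule exI[of _ Q],
        rule exI[of _ R], rule exI[of _ j], rule exI[of _ q], rule exI[of _ b1], rule exI[of _ b2],
        rule exI[of _ y1], rule exI[of _ y2], rule exI[of _ d1], rule exI[of _ d2],
        rule exI[of _ pd1], rule exI[of _ pd2], rule exI[of _ h]) (simp add: c R Q h)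
  then show ?thesis
    using that con_closed[OF Q(1) h(1)] con_natural[OF Q(1) c(1) Q(3) h(1)]
      con_natural[OF Q(1) c(2) Q(4) h(1)] h(2,3) by simp
qed

text \<open>
  The sum of the given morphism with an identity is a morphism from \<open>\<sigma> \<oplus>
  \<sigma>'\<close> to \<open>\<sigma>\<^sub>2 \<oplus> \<sigma>'\<close>, and it maps the pair
  \<open>(g, g')\<close> to \<open>(d\<^sub>* g, g')\<close> by uniqueness of pairs in degree
  \<open>k\<close>.
\<close>

lemma sum_val_step:
  assumes add: "Ext_additive k X" and P: "biproduct E A A' P a1 a2 pa1 pa2"
    and c: "conf E A B D i p" "conf E A B2 D2 i2 p2" and m: "conf_mor E i p i2 p2 (ident E A) b d"
    and s: "sum_val k X P pa1 pa2 i p g i' p' g' e"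
    and s2: "sum_val k X P pa1 pa2 i2 p2 (Ext_push E k d g) i' p' g' e2"
  shows "e = e2"
proof -
  have t: "tgt E pa1 = A" "tgt E pa2 = A'" using biproductD[OF P] by (auto simp: Hom_def)
  obtain B0 D0 B' D' Q R j q b1 b2 y1 y2 d1 d2 pd1 pd2 h where
    S: "conf E A B0 D0 i p" "conf E A' B' D' i' p'"
      "biproduct E D0 D' R d1 d2 pd1 pd2" "conf E P Q R j q" "biproduct E B0 B' Q b1 b2 y1 y2"
      "conf_mor E j q i p pa1 y1 pd1" "conf_mor E j q i' p' pa2 y2 pd2"
      "h \<in> Ext_carrier E k X R" "Ext_push E k pd1 h = g" "Ext_push E k pd2 h = g'"
      "e = con E k j q h"
    using s unfolding sum_val_def t by (elim exE conjE) (rule that)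
  obtain B0' D0' B'' D'' Q2 R2 j2 q2 b1' b2' y1' y2' d1' d2' pd1' pd2' h2 where
    S2: "conf E A B0' D0' i2 p2" "conf E A' B'' D'' i' p'"
      "biproduct E D0' D'' R2 d1' d2' pd1' pd2'" "conf E P Q2 R2 j2 q2"
      "biproduct E B0' B'' Q2 b1' b2' y1' y2'"
      "conf_mor E j2 q2 i2 p2 pa1 y1' pd1'" "conf_mor E j2 q2 i' p' pa2 y2' pd2'"
      "h2 \<in> Ext_carrier E k X R2" "Ext_push E k pd1' h2 = Ext_push E k d g"
      "Ext_push E k pd2' h2 = g'" "e2 = con E k j2 q2 h2"
    using s2 unfolding sum_val_def t by (elim exE conjE) (rule that)
  have eq: "D0 = D" "D0' = D2" "D'' = D'" "B0 = B" "B0' = B2" "B'' = B'"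
    using confD[OF S(1)] confD[OF c(1)] confD[OF S2(1)] confD[OF c(2)] confD[OF S(2)] confD[OF S2(2)]
    by auto
  note S = S[unfolded eq] and S2 = S2[unfolded eq]
  note M = conf_morD[OF m c]
  note bR = biproductD[OF S(3)] and bR2 = biproductD[OF S2(3)] and bP = biproductD[OF P]
  obtain z where z: "z \<in> Hom E R R2" "pd1' \<cdot> z = d \<cdot> pd1" "pd2' \<cdot> z = pd2"
    using biproduct_pair[OF S2(3) comp_Hom[OF bR(3) M(3)] bR(4)] .
  have P_obj: "P \<in> obj E" using HomD[OF bP(1)] by blast
  have "conf_mor E j q i2 p2 (ident E A \<cdot> pa1) (b \<cdot> y1) (d \<cdot> pd1)"
    using conf_mor_comp[OF S(4,1) c(2) S(6) m] .
  moreover have "ident E A \<cdot> pa1 = pa1 \<cdot> ident E P"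
    using comp_ident_left[OF bP(3)] comp_ident_right[OF bP(3)] by simp
  ultimately have m1: "conf_mor E j q i2 p2 (pa1 \<cdot> ident E P) (b \<cdot> y1) (pd1' \<cdot> z)" using z(2) by simp
  have m2: "conf_mor E j q i' p' (pa2 \<cdot> ident E P) y2 (pd2' \<cdot> z)"
    using S(7) z(3) comp_ident_right[OF bP(4)] by simp
  obtain t where m3: "conf_mor E j q j2 q2 (ident E P) t z"
    using conf_sum_mor[OF S(4) c(2) S(2) P S2(3,4,5,6,7) ident_Hom[OF P_obj] z(1) m1 m2] .
  have "e = con E k j2 q2 (Ext_push E k z h)"
    using con_natural_ident[OF S(4) S2(4) m3 S(8)] S(11) by simp
  moreover have "Ext_push E k z h = h2"
  proof (rule Ext_pair_unique[OF add S2(3) Ext_push_closed[OF z(1) S(8)] S2(8)])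
    show "Ext_push E k pd1' (Ext_push E k z h) = Ext_push E k pd1' h2"
      using Ext_push_comp[OF z(1) bR2(3) S(8)] Ext_push_comp[OF bR(3) M(3) S(8)] z(2) S(9) S2(9) by simp
    show "Ext_push E k pd2' (Ext_push E k z h) = Ext_push E k pd2' h2"
      using Ext_push_comp[OF z(1) bR2(4) S(8)] z(3) S(10) S2(10) by simp
  qed
  ultimately show ?thesis using S2(11) by simp
qed

text \<open>
  By \<open>con_eq_invariant\<close>, \<open>sum_val_step\<close> suffices for the first summand
  to enter only through the product \<open>\<sigma> \<cdot> g\<close>;
  \<open>sum_val_swap\<close> gives the same for the second one.
\<close>

lemma sum_val_unique:
  assumes add: "Ext_additive k X" and P: "biproduct E A A' P a1 a2 pa1 pa2"
    and c: "conf E A B D i p" "conf E A B2 D2 i2 p2" "conf E A' B' D' i' p'"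
    and g: "g \<in> Ext_carrier E k X D" "g2 \<in> Ext_carrier E k X D2" "g' \<in> Ext_carrier E k X D'"
    and eq: "con E k i p g = con E k i2 p2 g2"
    and s: "sum_val k X P pa1 pa2 i p g i' p' g' e" "sum_val k X P pa1 pa2 i2 p2 g2 i' p' g' e2"
  shows "e = e2"
proof -
  \<comment> \<open>any value for \<open>\<sigma>\<close> and \<open>g\<close> equals the given value for \<open>\<sigma>\<^sub>2\<close> and \<open>g\<^sub>2\<close>\<close>
  define W where "W i p g \<longleftrightarrow> (\<forall>e'. sum_val k X P pa1 pa2 i p g i' p' g' e' \<longrightarrow> e' = e2)" for i p g
  have "W i p g \<longleftrightarrow> W i2 p2 g2"
  proof (rule con_eq_invariant[OF _ c(1) g(1) c(2) g(2) eq])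
    fix B D i p B3 D3 i3 p3 b d g
    assume cc: "conf E A B D i p" "conf E A B3 D3 i3 p3" and m: "conf_mor E i p i3 p3 (ident E A) b d"
      and gg: "g \<in> Ext_carrier E k X D"
    have d: "d \<in> Hom E D D3" using conf_morD[OF m cc] by blast
    obtain x where x: "sum_val k X P pa1 pa2 i p g i' p' g' x"
      using sum_val_ex[OF add P cc(1) c(3) gg g(3)] .
    obtain y where y: "sum_val k X P pa1 pa2 i3 p3 (Ext_push E k d g) i' p' g' y"
      using sum_val_ex[OF add P cc(2) c(3) Ext_push_closed[OF d gg] g(3)] .
    note st = sum_val_step[OF add P cc m]
    show "W i p g \<longleftrightarrow> W i3 p3 (Ext_push E k d g)"
      using st[OF x] st[OF _ y] x y unfolding W_def by metis
  qed
  moreover have "W i2 p2 g2"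
  proof -
    have m: "conf_mor E i2 p2 i2 p2 (ident E A) (ident E B2) (ident E D2)" using conf_mor_ident[OF c(2)] .
    show ?thesis
      using sum_val_step[OF add P c(2,2) m _ , of g2 i' p' g' _ e2] s(2) Ext_push_ident[OF g(2)]
      unfolding W_def by simp
  qed
  ultimately show ?thesis using s(1) unfolding W_def by blast
qed

text \<open>
  A pair in degree \<open>k + 1\<close> is the product of a sum of two conflations with a pair
  in degree \<open>k\<close>. For uniqueness, an element \<open>\<tau> \<cdot> h\<close> of
  \<open>Ext\<^sup>k\<^sup>+\<^sup>1(X, A \<oplus> B)\<close> is itself of this form, since
  \<open>\<tau>\<close> maps to the sum of its pushouts along the two projections and
  \<open>h\<close> to the pair \<open>(h, h)\<close>.
\<close>

lemma Ext_additive: "Ext_additive k X"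
proof (induction k)
  case 0
  show ?case unfolding Ext_additive_def
  proof (intro allI impI ballI)
    fix A B P i1 i2 p1 p2 a b
    assume P: "biproduct E A B P i1 i2 p1 p2" and ab: "a \<in> Ext_carrier E 0 X A" "b \<in> Ext_carrier E 0 X B"
    obtain f g where f: "f \<in> Hom E X A" "a = hom_elem f" and g: "g \<in> Hom E X B" "b = hom_elem g"
      using ab by (auto simp: Ext_carrier_0)
    obtain h where h: "h \<in> Hom E X P" "p1 \<cdot> h = f" "p2 \<cdot> h = g" using biproduct_pair[OF P f(1) g(1)] .
    show "\<exists>!e. e \<in> Ext_carrier E 0 X P \<and> Ext_push E 0 p1 e = a \<and> Ext_push E 0 p2 e = b"
    proof (rule ex1I[of _ "hom_elem h"])
      show "hom_elem h \<in> Ext_carrier E 0 X P \<and> Ext_push E 0 p1 (hom_elem h) = a \<and>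
        Ext_push E 0 p2 (hom_elem h) = b"
        using f g h by (simp add: Ext_carrier_0)
      fix e assume "e \<in> Ext_carrier E 0 X P \<and> Ext_push E 0 p1 e = a \<and> Ext_push E 0 p2 e = b"
      then obtain h' where "h' \<in> Hom E X P" "e = hom_elem h'" "p1 \<cdot> h' = f" "p2 \<cdot> h' = g"
        using f g by (auto simp: Ext_carrier_0)
      then show "e = hom_elem h" using biproduct_mono[OF P _ h(1)] h by simp
    qed
  qed
next
  case (Suc k)
  show ?case unfolding Ext_additive_def
  proof (intro allI impI ballI)
    fix A B P i1 i2 p1 p2 a b
    assume P: "biproduct E A B P i1 i2 p1 p2"
      and ab: "a \<in> Ext_carrier E (Suc k) X A" "b \<in> Ext_carrier E (Suc k) X B"
    note bP = biproductD[OF P]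
    obtain B1 D1 i p g where a: "conf E A B1 D1 i p" "g \<in> Ext_carrier E k X D1" "a = con E k i p g"
      using con_surj[OF ab(1)] .
    obtain B2 D2 i' p' g' where b: "conf E B B2 D2 i' p'" "g' \<in> Ext_carrier E k X D2"
      "b = con E k i' p' g'"
      using con_surj[OF ab(2)] .
    obtain e where e: "sum_val k X P p1 p2 i p g i' p' g' e" "e \<in> Ext_carrier E (Suc k) X P"
      "Ext_push E (Suc k) p1 e = a" "Ext_push E (Suc k) p2 e = b"
      using sum_val_ex[OF Suc.IH P a(1) b(1) a(2) b(2)] a(3) b(3) by metis
    show "\<exists>!e. e \<in> Ext_carrier E (Suc k) X P \<and> Ext_push E (Suc k) p1 e = a \<and> Ext_push E (Suc k) p2 e = b"
    proof (rule ex1I[of _ e])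
      show "e \<in> Ext_carrier E (Suc k) X P \<and> Ext_push E (Suc k) p1 e = a \<and> Ext_push E (Suc k) p2 e = b"
        using e by blast
      fix x assume x: "x \<in> Ext_carrier E (Suc k) X P \<and> Ext_push E (Suc k) p1 x = a \<and>
        Ext_push E (Suc k) p2 x = b"
      then obtain Q' S j' q' h where c': "conf E P Q' S j' q'" and h: "h \<in> Ext_carrier E k X S"
        and xe: "x = con E k j' q' h"
        using con_surj by blast
      have S: "S \<in> obj E" "P \<in> obj E" using confD[OF c'] by auto
      \<comment> \<open>\<open>x\<close> is the sum of its two projections along the diagonal of \<open>S\<close>\<close>
      obtain T1 t1 u1 v1 where c1: "conf E A T1 S t1 u1" and m1: "conf_mor E j' q' t1 u1 p1 v1 (ident E S)"
        by (rule push_conf[OF c' bP(3)]) (rule that)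
      obtain T2 t2 u2 v2 where c2: "conf E B T2 S t2 u2" and m2: "conf_mor E j' q' t2 u2 p2 v2 (ident E S)"
        by (rule push_conf[OF c' bP(4)]) (rule that)
      have ea: "con E k t1 u1 h = con E k i p g"
        using con_natural[OF c' c1 m1 h] Ext_push_ident[OF h] x xe a(3) by simp
      have eb: "con E k t2 u2 h = con E k i' p' g'"
        using con_natural[OF c' c2 m2 h] Ext_push_ident[OF h] x xe b(3) by simp
      obtain R d1 d2 pd1 pd2 where R: "biproduct E S S R d1 d2 pd1 pd2" using ex_biproduct[OF S(1,1)] by blast
      note bR = biproductD[OF R]
      obtain Q j q b1 b2 y1 y2 where Q: "conf E P Q R j q" "biproduct E T1 T2 Q b1 b2 y1 y2"
        "conf_mor E j q t1 u1 p1 y1 pd1" "conf_mor E j q t2 u2 p2 y2 pd2"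
        using conf_sum[OF c1 c2 P R] .
      obtain z where z: "z \<in> Hom E S R" "pd1 \<cdot> z = ident E S" "pd2 \<cdot> z = ident E S"
        using biproduct_pair[OF R ident_Hom[OF S(1)] ident_Hom[OF S(1)]] .
      have "conf_mor E j' q' t1 u1 (p1 \<cdot> ident E P) v1 (pd1 \<cdot> z)"
        "conf_mor E j' q' t2 u2 (p2 \<cdot> ident E P) v2 (pd2 \<cdot> z)"
        using m1 m2 z comp_ident_right[OF bP(3)] comp_ident_right[OF bP(4)] by simp_all
      then obtain t where m3: "conf_mor E j' q' j q (ident E P) t z"
        using conf_sum_mor[OF c' c1 c2 P R Q ident_Hom[OF S(2)] z(1)] by blast
      have xe': "x = con E k j q (Ext_push E k z h)"
        using con_natural_ident[OF c' Q(1) m3 h] xe by simp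
      have tp: "tgt E p1 = A" "tgt E p2 = B" using bP by (auto simp: Hom_def)
      have zh: "Ext_push E k z h \<in> Ext_carrier E k X R" "Ext_push E k pd1 (Ext_push E k z h) = h"
        "Ext_push E k pd2 (Ext_push E k z h) = h"
        using Ext_push_closed[OF z(1) h] Ext_push_comp[OF z(1) bR(3) h] Ext_push_comp[OF z(1) bR(4) h]
          z(2,3) Ext_push_ident[OF h] by simp_all
      have sx: "sum_val k X P p1 p2 t1 u1 h t2 u2 h x"
        unfolding sum_val_def tp
        by (rule exI[of _ T1], rule exI[of _ S], rule exI[of _ T2], rule exI[of _ S], rule exI[of _ Q],
            rule exI[of _ R], rule exI[of _ j], rule exI[of _ q], rule exI[of _ b1], rule exI[of _ b2],
            rule exI[of _ y1], rule exI[of _ y2], rule exI[of _ d1], rule exI[of _ d2],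
            rule exI[of _ pd1], rule exI[of _ pd2], rule exI[of _ "Ext_push E k z h"])
          (simp add: c1 c2 R Q zh xe')
      obtain w where w: "sum_val k X P p1 p2 i p g t2 u2 h w"
        using sum_val_ex[OF Suc.IH P a(1) c2 a(2) h] .
      have "x = w" using sum_val_unique[OF Suc.IH P c1 a(1) c2 h a(2) h ea sx w] .
      moreover have "w = e"
        using sum_val_unique[OF Suc.IH biproduct_swap[OF P] c2 b(1) a(1) h b(2) a(2) eb
            sum_val_swap[OF w] sum_val_swap[OF e(1)]] .
      ultimately show "x = e" by simp
    qed
  qed
qed

lemma neg_ident_Hom:
  assumes "A \<in> obj E"
  shows "neg E (ident E A) \<in> Hom E A A"
  using neg_Hom[OF assms assms ident_Hom[OF assms]] .

lemma Ext_push_neg_neg: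
  assumes "a \<in> Ext_carrier E k X A"
  shows "Ext_push E k (neg E (ident E A)) (Ext_push E k (neg E (ident E A)) a) = a"
proof -
  have A: "A \<in> obj E" using Ext_carrier_obj[OF assms] by blast
  note n = neg_ident_Hom[OF A]
  have "neg E (ident E A) \<cdot> neg E (ident E A) = ident E A" using A by (simp add: cat)
  then show ?thesis using Ext_push_comp[OF n n assms] Ext_push_ident[OF assms] by simp
qed

lemma Ext_push_neg:
  assumes "f \<in> Hom E A B" "a \<in> Ext_carrier E k X A"
  shows "Ext_push E k f (Ext_push E k (neg E (ident E A)) a) = Ext_push E k (neg E f) a"
    "Ext_push E k (neg E (ident E B)) (Ext_push E k f a) = Ext_push E k (neg E f) a"
proof -
  note H = HomD[OF assms(1)]
  have "f \<cdot> neg E (ident E A) = neg E f" "neg E (ident E B) \<cdot> f = neg E f"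
    using H by (simp_all add: cat)
  then show "Ext_push E k f (Ext_push E k (neg E (ident E A)) a) = Ext_push E k (neg E f) a"
    "Ext_push E k (neg E (ident E B)) (Ext_push E k f a) = Ext_push E k (neg E f) a"
    using Ext_push_comp[OF neg_ident_Hom[OF H(4)] assms]
      Ext_push_comp[OF assms(1) neg_ident_Hom[OF H(5)] assms(2)] by simp_all
qed

text \<open>
  The morphism \<open>h\<close> is the sum of \<open>h b\<^sub>1\<close> and \<open>h
  b\<^sub>2\<close> followed by the codiagonal \<open>n\<close> of \<open>T\<close>. The former
  maps \<open>e\<close> to a pair \<open>(r, -r)\<close>, which is the image of \<open>r\<close>
  under the antidiagonal \<open>w\<close>, and \<open>n w = 0\<close>.
\<close>

lemma Ext_cancel:
  assumes Q: "biproduct E A B Q b1 b2 y1 y2" and h: "h \<in> Hom E Q T"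
    and e: "e \<in> Ext_carrier E k X Q"
    and eq: "Ext_push E k (h \<cdot> b2) (Ext_push E k y2 e)
      = Ext_push E k (neg E (ident E T)) (Ext_push E k (h \<cdot> b1) (Ext_push E k y1 e))"
  shows "Ext_push E k h e = Ext_zero E k X T"
proof -
  note b = biproductD[OF Q]
  have T: "T \<in> obj E" using HomD[OF h] by blast
  obtain T2 t1 t2 u1 u2 where T2: "biproduct E T T T2 t1 t2 u1 u2" using ex_biproduct[OF T T] by blast
  note t = biproductD[OF T2]
  have hb: "h \<cdot> b1 \<in> Hom E A T" "h \<cdot> b2 \<in> Hom E B T" using comp_Hom b h by blast+
  obtain z where z: "z \<in> Hom E Q T2" "u1 \<cdot> z = h \<cdot> b1 \<cdot> y1" "u2 \<cdot> z = h \<cdot> b2 \<cdot> y2"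
    using biproduct_pair[OF T2 comp_Hom[OF b(3) hb(1)] comp_Hom[OF b(4) hb(2)]] .
  obtain w where w: "w \<in> Hom E T T2" "u1 \<cdot> w = ident E T" "u2 \<cdot> w = neg E (ident E T)"
    using biproduct_pair[OF T2 ident_Hom[OF T] neg_ident_Hom[OF T]] .
  obtain n where n: "n \<in> Hom E T2 T" "n \<cdot> t1 = ident E T" "n \<cdot> t2 = ident E T"
    using biproduct_copair[OF T2 ident_Hom[OF T] ident_Hom[OF T]] .
  note H = T HomD[OF h] HomD[OF b(1)] HomD[OF b(2)] HomD[OF b(3)] HomD[OF b(4)] HomD[OF t(1)]
    HomD[OF t(2)] HomD[OF t(3)] HomD[OF t(4)] HomD[OF z(1)] HomD[OF w(1)] HomD[OF n(1)]
  have zb1: "z \<cdot> b1 = t1 \<cdot> (h \<cdot> b1)"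
    by (rule biproduct_mono[OF T2, of _ A])
      (simp_all add: H cat Hom_def t(5-8) t(5-8)[THEN comp_cong_tail] b(5-8) z(2,3)[THEN comp_cong_tail])
  have zb2: "z \<cdot> b2 = t2 \<cdot> (h \<cdot> b2)"
    by (rule biproduct_mono[OF T2, of _ B])
      (simp_all add: H cat Hom_def t(5-8) t(5-8)[THEN comp_cong_tail] b(5-8) z(2,3)[THEN comp_cong_tail])
  have nz: "n \<cdot> z = h"
    by (rule biproduct_epi[OF Q, of _ T])
      (simp_all add: H cat Hom_def zb1 zb2 n(2,3)[THEN comp_cong_tail])
  have "w = add E t1 (neg E t2)"
    by (rule biproduct_mono[OF T2, of _ T]) (simp_all add: H cat Hom_def t(5-8) w)
  then have nw: "n \<cdot> w = zero E T T" by (simp add: H cat n)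
  define r where "r = Ext_push E k (h \<cdot> b1) (Ext_push E k y1 e)"
  have y: "Ext_push E k y1 e \<in> Ext_carrier E k X A" "Ext_push E k y2 e \<in> Ext_carrier E k X B"
    using Ext_push_closed b e by blast+
  have r: "r \<in> Ext_carrier E k X T" unfolding r_def using Ext_push_closed[OF hb(1) y(1)] .
  have "Ext_push E k z e = Ext_push E k w r"
  proof (rule Ext_pair_unique[OF Ext_additive T2 Ext_push_closed[OF z(1) e] Ext_push_closed[OF w(1) r]])
    show "Ext_push E k u1 (Ext_push E k z e) = Ext_push E k u1 (Ext_push E k w r)"
      using Ext_push_comp[OF z(1) t(3) e] Ext_push_comp[OF w(1) t(3) r]
        Ext_push_comp[OF b(3) hb(1) e] z w Ext_push_ident[OF r] by (simp add: r_def)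
    show "Ext_push E k u2 (Ext_push E k z e) = Ext_push E k u2 (Ext_push E k w r)"
      using Ext_push_comp[OF z(1) t(4) e] Ext_push_comp[OF w(1) t(4) r]
        Ext_push_comp[OF b(4) hb(2) e] z w eq by (simp add: r_def)
  qed
  then have "Ext_push E k h e = Ext_push E k n (Ext_push E k w r)"
    using Ext_push_comp[OF z(1) n(1) e] nz by simp
  also have "\<dots> = Ext_zero E k X T" using Ext_push_comp_zero[OF w(1) n(1) nw r] .
  finally show ?thesis .
qed

text \<open>
  The difference of \<open>a\<close> and \<open>b\<close> is the image of the pair \<open>(a,
  -b)\<close> under the codiagonal. It is killed by \<open>i\<close>, hence zero, and a pair
  whose sum is zero has the form \<open>(a, -a)\<close>.
\<close>

lemma Ext_push_inj:
  assumes i: "i \<in> Hom E A B"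
    and ker: "\<And>x. x \<in> Ext_carrier E k X A \<Longrightarrow> Ext_push E k i x = Ext_zero E k X B \<Longrightarrow>
      x = Ext_zero E k X A"
    and a: "a \<in> Ext_carrier E k X A" and b: "b \<in> Ext_carrier E k X A"
    and eq: "Ext_push E k i a = Ext_push E k i b"
  shows "a = b"
proof -
  have A: "A \<in> obj E" using HomD[OF i] by blast
  obtain Q b1 b2 y1 y2 where Q: "biproduct E A A Q b1 b2 y1 y2" using ex_biproduct[OF A A] by blast
  note bQ = biproductD[OF Q]
  define b' where "b' = Ext_push E k (neg E (ident E A)) b"
  have b': "b' \<in> Ext_carrier E k X A" unfolding b'_def using Ext_push_closed[OF neg_ident_Hom[OF A] b] .
  obtain e where e: "e \<in> Ext_carrier E k X Q" "Ext_push E k y1 e = a" "Ext_push E k y2 e = b'"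
    using Ext_pair[OF Ext_additive Q a b'] .
  obtain s where s: "s \<in> Hom E Q A" "s \<cdot> b1 = ident E A" "s \<cdot> b2 = ident E A"
    using biproduct_copair[OF Q ident_Hom[OF A] ident_Hom[OF A]] .
  note H = A HomD[OF i] HomD[OF bQ(1)] HomD[OF bQ(2)] HomD[OF bQ(3)] HomD[OF bQ(4)] HomD[OF s(1)]
  have "i \<cdot> s \<cdot> b1 = i" "i \<cdot> s \<cdot> b2 = i" by (simp_all add: H cat s)
  then have "Ext_push E k (i \<cdot> s) e = Ext_zero E k X B"
    using Ext_cancel[OF Q comp_Hom[OF s(1) i] e(1)] e Ext_push_neg[OF i b] eq by (simp add: b'_def)
  then have "Ext_push E k i (Ext_push E k s e) = Ext_zero E k X B"
    using Ext_push_comp[OF s(1) i e(1)] by simp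
  then have se: "Ext_push E k s e = Ext_zero E k X A"
    using ker Ext_push_closed[OF s(1) e(1)] by blast
  \<comment> \<open>the automorphism \<open>(x, y) \<mapsto> (x + y, y)\<close> turns \<open>e\<close> into \<open>(0, -b)\<close>\<close>
  obtain v where v: "v \<in> Hom E Q Q" "y1 \<cdot> v = s" "y2 \<cdot> v = y2" using biproduct_pair[OF Q s(1) bQ(4)] .
  obtain w where w: "w \<in> Hom E Q A" "w \<cdot> b1 = ident E A" "w \<cdot> b2 = neg E (ident E A)"
    using biproduct_copair[OF Q ident_Hom[OF A] neg_ident_Hom[OF A]] .
  note H = H HomD[OF v(1)] HomD[OF w(1)]
  have vb1: "v \<cdot> b1 = b1"
    by (rule biproduct_mono[OF Q, of _ A])
      (simp_all add: H cat Hom_def bQ(5-8) v(2,3)[THEN comp_cong_tail] s)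
  have vb2: "v \<cdot> b2 = add E b1 b2"
    by (rule biproduct_mono[OF Q, of _ A])
      (simp_all add: H cat Hom_def bQ(5-8) v(2,3)[THEN comp_cong_tail] s)
  have wv: "w \<cdot> v = y1"
    by (rule biproduct_epi[OF Q, of _ A]) (simp_all add: H cat Hom_def vb1 vb2 w bQ(5-8))
  have "Ext_push E k v e = Ext_push E k b2 b'"
  proof (rule Ext_pair_unique[OF Ext_additive Q Ext_push_closed[OF v(1) e(1)] Ext_push_closed[OF bQ(2) b']])
    show "Ext_push E k y1 (Ext_push E k v e) = Ext_push E k y1 (Ext_push E k b2 b')"
      using Ext_push_comp[OF v(1) bQ(3) e(1)] Ext_push_comp_zero[OF bQ(2,3,8) b'] v(2) se by simp
    show "Ext_push E k y2 (Ext_push E k v e) = Ext_push E k y2 (Ext_push E k b2 b')"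
      using Ext_push_comp[OF v(1) bQ(4) e(1)] Ext_push_comp[OF bQ(2,4) b'] v(3) bQ(6)
        Ext_push_ident[OF b'] e(3) by simp
  qed
  then have "a = Ext_push E k w (Ext_push E k b2 b')"
    using Ext_push_comp[OF v(1) w(1) e(1)] wv e(2) by simp
  also have "\<dots> = Ext_push E k (neg E (ident E A)) b'"
    using Ext_push_comp[OF bQ(2) w(1) b'] w(3) by simp
  also have "\<dots> = b" unfolding b'_def using Ext_push_neg_neg[OF b] .
  finally show ?thesis .
qed

section \<open>The long exact sequence of a conflation\<close>

definition exact_middle :: "nat \<Rightarrow> 'o \<Rightarrow> bool"
  where "exact_middle k X \<longleftrightarrow> (\<forall>A B D i p a. conf E A B D i p \<longrightarrow> a \<in> Ext_carrier E k X B \<longrightarrow>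
    Ext_push E k p a = Ext_zero E k X D \<longrightarrow> (\<exists>c\<in>Ext_carrier E k X A. Ext_push E k i c = a))"

definition exact_right :: "nat \<Rightarrow> 'o \<Rightarrow> bool"
  where "exact_right k X \<longleftrightarrow> (\<forall>A B D i p g. conf E A B D i p \<longrightarrow> g \<in> Ext_carrier E k X D \<longrightarrow>
    con E k i p g = Ext_zero E (Suc k) X A \<longrightarrow> (\<exists>b\<in>Ext_carrier E k X B. Ext_push E k p b = g))"

lemma exact_middle_0: "exact_middle 0 X"
  unfolding exact_middle_def
proof (intro allI impI)
  fix A B D i p a assume c: "conf E A B D i p" and a: "a \<in> Ext_carrier E 0 X B"
    and z: "Ext_push E 0 p a = Ext_zero E 0 X D"
  obtain f where f: "f \<in> Hom E X B" "a = hom_elem f" using a by (auto simp: Ext_carrier_0)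
  then have "p \<cdot> f = zero E X D" using z by (simp add: Ext_zero_0)
  then obtain t where "t \<in> Hom E X A" "i \<cdot> t = f" using conf_kernel[OF c f(1)] by blast
  then show "\<exists>c\<in>Ext_carrier E 0 X A. Ext_push E 0 i c = a" using f by (auto simp: Ext_carrier_0)
qed

text \<open>
  If \<open>\<sigma> \<cdot> g = 0\<close> then \<open>\<sigma> \<cdot> g = \<sigma> \<cdot>
  0\<close>, and \<open>0\<close> lifts along the deflation of \<open>\<sigma>\<close>. By
  \<open>con_eq_invariant\<close> it suffices that liftability is invariant under morphisms of
  conflations that are the identity on \<open>A\<close>. Such a morphism is a pullback square;
  given a lift \<open>x\<close> of \<open>d\<^sub>* g\<close> to \<open>B'\<close>, exactness
  for the conflation \<open>B \<rightarrow> B' \<oplus> D \<rightarrow> D'\<close> of this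
  square lifts the pair \<open>(x, -g)\<close> to \<open>B\<close>.
\<close>

lemma exact_right_if_middle:
  assumes mid: "exact_middle k X"
  shows "exact_right k X"
  unfolding exact_right_def
proof (intro allI impI)
  fix A B D i p g assume c: "conf E A B D i p" and g: "g \<in> Ext_carrier E k X D"
    and z: "con E k i p g = Ext_zero E (Suc k) X A"
  have X: "X \<in> obj E" using Ext_carrier_obj[OF g] by blast
  have zD: "Ext_zero E k X D \<in> Ext_carrier E k X D" "Ext_zero E k X B \<in> Ext_carrier E k X B"
    using Ext_zero_closed[OF X] confD[OF c] by blast+
  define L where "L i p g \<longleftrightarrow> (\<exists>b\<in>Ext_carrier E k X (src E p). Ext_push E k p b = g)" for i p :: 'm and g
  have "L i p g \<longleftrightarrow> L i p (Ext_zero E k X D)"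
  proof (rule con_eq_invariant[OF _ c g c zD(1)])
    show "con E k i p g = con E k i p (Ext_zero E k X D)" using z con_zero[OF c X] by simp
    fix B D i p B' D' i' p' b d g
    assume c: "conf E A B D i p" and c': "conf E A B' D' i' p'"
      and m: "conf_mor E i p i' p' (ident E A) b d" and g: "g \<in> Ext_carrier E k X D"
    note M = conf_morD[OF m c c']
    note C = confD[OF c] and C' = confD[OF c']
    show "L i p g \<longleftrightarrow> L i' p' (Ext_push E k d g)"
    proof
      assume "L i p g"
      then obtain x where x: "x \<in> Ext_carrier E k X B" "Ext_push E k p x = g" using C by (auto simp: L_def)
      have "Ext_push E k p' (Ext_push E k b x) = Ext_push E k d g"
        using Ext_push_comp[OF M(2) C'(3) x(1)] Ext_push_comp[OF C(3) M(3) x(1)] M(5) x(2) by simp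
      then show "L i' p' (Ext_push E k d g)"
        using Ext_push_closed[OF M(2) x(1)] C' by (auto simp: L_def)
    next
      assume "L i' p' (Ext_push E k d g)"
      then obtain x where x: "x \<in> Ext_carrier E k X B'" "Ext_push E k p' x = Ext_push E k d g"
        using C' by (auto simp: L_def)
      obtain Q b1 b2 y1 y2 where Q: "biproduct E B' D Q b1 b2 y1 y2" using ex_biproduct C C' by blast
      note bQ = biproductD[OF Q]
      obtain j e where cj: "conf E B Q D' j e" and j: "y1 \<cdot> j = b" "y2 \<cdot> j = neg E p"
        and e: "e \<cdot> b1 = p'" "e \<cdot> b2 = d"
        using conf_pullback_sum[OF c c' m Q] .
      define g' where "g' = Ext_push E k (neg E (ident E D)) g"
      have g': "g' \<in> Ext_carrier E k X D"
        unfolding g'_def using Ext_push_closed[OF neg_ident_Hom[OF C(13)] g] .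
      obtain v where v: "v \<in> Ext_carrier E k X Q" "Ext_push E k y1 v = x" "Ext_push E k y2 v = g'"
        using Ext_pair[OF Ext_additive Q x(1) g'] .
      have "Ext_push E k e v = Ext_zero E k X D'"
      proof (rule Ext_cancel[OF Q confD(3)[OF cj] v(1)])
        show "Ext_push E k (e \<cdot> b2) (Ext_push E k y2 v)
          = Ext_push E k (neg E (ident E D')) (Ext_push E k (e \<cdot> b1) (Ext_push E k y1 v))"
          using Ext_push_neg[OF M(3) g] by (simp add: e v x g'_def)
      qed
      then obtain u where u: "u \<in> Ext_carrier E k X B" "Ext_push E k j u = v"
        using mid cj v(1) unfolding exact_middle_def by blast
      have "g' = Ext_push E k (neg E p) u"
        using Ext_push_comp[OF confD(2)[OF cj] bQ(4) u(1)] u(2) v(3) j(2) by simp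
      also have "\<dots> = Ext_push E k (neg E (ident E D)) (Ext_push E k p u)"
        using Ext_push_neg[OF C(3) u(1)] by simp
      finally have eq: "g' = Ext_push E k (neg E (ident E D)) (Ext_push E k p u)" .
      have "g = Ext_push E k (neg E (ident E D)) g'" using Ext_push_neg_neg[OF g] by (simp only: g'_def)
      also have "\<dots> = Ext_push E k p u"
        unfolding eq by (rule Ext_push_neg_neg[OF Ext_push_closed[OF C(3) u(1)]])
      finally have "Ext_push E k p u = g" by (rule sym)
      then show "L i p g" using u(1) C by (auto simp: L_def)
    qed
  qed
  moreover have "L i p (Ext_zero E k X D)"
    using zD(2) Ext_push_Ext_zero[OF confD(3)[OF c] X] confD[OF c] by (auto simp: L_def)
  ultimately show "\<exists>b\<in>Ext_carrier E k X B. Ext_push E k p b = g" using confD[OF c] by (simp add: L_def)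
qed

text \<open>
  If \<open>a = \<tau> \<cdot> g\<close> dies in \<open>Ext(X, D)\<close>, then \<open>g\<close>
  lifts along the deflation \<open>q : F/A \<rightarrow> F/B\<close> of the pushout of
  \<open>\<tau>\<close>, and over \<open>F/A\<close> the conflation \<open>\<tau>\<close> comes
  from \<open>A \<rightarrow> F \<rightarrow> F/A\<close>.
\<close>

lemma exact_middle_Suc:
  assumes r: "exact_right k X"
  shows "exact_middle (Suc k) X"
  unfolding exact_middle_def
proof (intro allI impI)
  fix A B D i p a assume c: "conf E A B D i p" and a: "a \<in> Ext_carrier E (Suc k) X B"
    and z: "Ext_push E (Suc k) p a = Ext_zero E (Suc k) X D"
  obtain F L t u g where t: "conf E B F L t u" "g \<in> Ext_carrier E k X L" "a = con E k t u g"
    using con_surj[OF a] .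
  obtain D' d q v where N: "conf E D D' L d q" "conf E A F D' (t \<cdot> i) v"
    "conf_mor E t u d q p v (ident E L)" "conf_mor E (t \<cdot> i) v t u i (ident E F) q"
    using noether[OF c t(1)] .
  have "con E k d q g = Ext_zero E (Suc k) X D"
    using con_natural[OF t(1) N(1,3) t(2)] Ext_push_ident[OF t(2)] t(3) z by simp
  then obtain h where h: "h \<in> Ext_carrier E k X D'" "Ext_push E k q h = g"
    using r N(1) t(2) unfolding exact_right_def by blast
  have "Ext_push E (Suc k) i (con E k (t \<cdot> i) v h) = a"
    using con_natural[OF N(2) t(1) N(4) h(1)] h(2) t(3) by simp
  then show "\<exists>c\<in>Ext_carrier E (Suc k) X A. Ext_push E (Suc k) i c = a"
    using con_closed[OF N(2) h(1)] by blast
qed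

lemma exact_middle: "exact_middle k X"
  by (induction k) (auto intro: exact_middle_0 exact_middle_Suc exact_right_if_middle)

lemma Ext_exact_middle:
  assumes "conf E A B D i p" "a \<in> Ext_carrier E k X B" "Ext_push E k p a = Ext_zero E k X D"
  obtains c where "c \<in> Ext_carrier E k X A" "Ext_push E k i c = a"
  using assms exact_middle unfolding exact_middle_def by blast

lemma Ext_exact_right:
  assumes "conf E A B D i p" "g \<in> Ext_carrier E k X D" "con E k i p g = Ext_zero E (Suc k) X A"
  obtains b where "b \<in> Ext_carrier E k X B" "Ext_push E k p b = g"
  using assms exact_right_if_middle[OF exact_middle] unfolding exact_right_def by blast

text \<open>
  If \<open>a = \<tau> \<cdot> h\<close> dies in \<open>Ext(X, B)\<close>, then \<open>h\<close>
  lifts to some \<open>g\<close> along the deflation of the pushout of \<open>\<tau>\<close>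
  along \<open>i\<close>. Over the pushout \<open>F\<close>, both \<open>\<tau>\<close> and the
  given conflation come from the roof, so \<open>a\<close> is also a product with the given
  conflation.
\<close>

lemma Ext_exact_left:
  assumes c: "conf E A B D i p" and a: "a \<in> Ext_carrier E (Suc k) X A"
    and z: "Ext_push E (Suc k) i a = Ext_zero E (Suc k) X B"
  obtains g where "g \<in> Ext_carrier E k X D" "con E k i p g = a"
proof -
  obtain B' D' t u h where t: "conf E A B' D' t u" "h \<in> Ext_carrier E k X D'" "a = con E k t u h"
    using con_surj[OF a] .
  obtain F d1 q b Q j e y v d where R: "conf E B F D' d1 q" "conf_mor E t u d1 q i b (ident E D')"
    "conf E A Q F j e" "conf_mor E j e t u (ident E A) y q" "conf_mor E j e i p (ident E A) v d"
    using pushout_roof[OF c t(1)] .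
  have "con E k d1 q h = Ext_zero E (Suc k) X B"
    using con_natural[OF t(1) R(1,2) t(2)] Ext_push_ident[OF t(2)] t(3) z by simp
  then obtain g where g: "g \<in> Ext_carrier E k X F" "Ext_push E k q g = h"
    using Ext_exact_right[OF R(1) t(2)] by blast
  have "a = con E k j e g" using con_natural_ident[OF R(3) t(1) R(4) g(1)] g(2) t(3) by simp
  also have "\<dots> = con E k i p (Ext_push E k d g)" using con_natural_ident[OF R(3) c R(5) g(1)] .
  finally have "con E k i p (Ext_push E k d g) = a" by simp
  moreover have "d \<in> Hom E F D" using conf_morD[OF R(5) R(3) c] by blast
  ultimately show ?thesis using that Ext_push_closed g(1) by blast
qed

end

section \<open>Extensions in the opposite category\<close>

lemma path_snoc: "path C (xs @ [x]) \<longleftrightarrow>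
    x \<in> arr C \<and> (xs = [] \<or> path C xs \<and> tgt C (last xs) = src C x)"
  by (induction xs rule: induct_list012) auto

lemma path_rev: "path C xs \<Longrightarrow> path (op_cat C) (rev xs)"
proof (induction xs rule: induct_list012)
  case (3 x y zs)
  then show ?case using path_snoc[of "op_cat C" "rev (y # zs)" x] by simp
qed auto

lemma seq_obj_rev:
  assumes "path C xs" "j \<le> length xs"
  shows "seq_obj (op_cat C) (rev xs) j = seq_obj C xs (length xs - j)"
proof (cases "j < length xs")
  case True
  have "tgt C (xs ! (length xs - Suc j)) = seq_obj C xs (Suc (length xs - Suc j))"
    using path_nth[OF assms(1), of "length xs - Suc j"] True by (simp add: Hom_def)
  then show ?thesis using True by (simp add: seq_obj_def[of "op_cat C"] rev_nth Suc_diff_Suc)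
next
  case False
  then have "j = length xs" "xs \<noteq> []" using assms by auto
  then show ?thesis by (simp add: seq_obj_def last_rev hd_conv_nth)
qed

lemma chain_map_rev:
  assumes m: "chain_map C xs ys a z" and p: "path C xs" "path C ys"
  shows "chain_map (op_cat C) (rev ys) (rev xs) z a"
proof -
  have l: "length ys = length xs" "xs \<noteq> []" "ys \<noteq> []" using chain_map_length[OF m] by auto
  define n where "n = length xs"
  obtain f where f: "\<And>j. j \<le> n \<Longrightarrow> f j \<in> Hom C (seq_obj C xs j) (seq_obj C ys j)"
    "\<And>j. j < n \<Longrightarrow> cmp C (f (Suc j)) (xs ! j) = cmp C (ys ! j) (f j)" "f 0 = a" "f n = z"
    using m chain_map_iff[of xs ys C a z] l unfolding n_def by auto
  have n: "length xs = n" "length ys = n" using l n_def by auto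
  have "\<exists>g. (\<forall>j\<le>n. g j \<in> Hom (op_cat C) (seq_obj (op_cat C) (rev ys) j) (seq_obj (op_cat C) (rev xs) j)) \<and>
      (\<forall>j<n. cmp (op_cat C) (g (Suc j)) (rev ys ! j) = cmp (op_cat C) (rev xs ! j) (g j)) \<and>
      g 0 = z \<and> g n = a"
  proof (intro exI[of _ "\<lambda>j. f (n - j)"] conjI allI impI)
    fix j
    show "f (n - j) \<in> Hom (op_cat C) (seq_obj (op_cat C) (rev ys) j) (seq_obj (op_cat C) (rev xs) j)"
      if "j \<le> n"
      using f(1)[of "n - j"] seq_obj_rev[OF p(1), of j] seq_obj_rev[OF p(2), of j] that n by simp
    show "cmp (op_cat C) (f (n - Suc j)) (rev ys ! j) = cmp (op_cat C) (rev xs ! j) (f (n - j))"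
      if "j < n"
      using f(2)[of "n - Suc j"] that n by (simp add: rev_nth Suc_diff_Suc)
  qed (use f in auto)
  then show ?thesis using chain_map_iff[of "rev ys" "rev xs" "op_cat C" z a] n l by simp
qed

lemma splice_rev:
  assumes "xs \<noteq> []" "ys \<noteq> []"
  shows "rev (splice E xs ys) = splice (op_cat E) (rev ys) (rev xs)"
  using assms by (cases xs rule: rev_cases; cases ys) (auto simp: splice_def)

text \<open>
  Passing to the opposite category forgets the extra fields of the record, so it is an
  involution only if there are none.
\<close>

locale exact_category_without_extra_fields = exact_category E
  for E :: "('o, 'm) exact_cat" (structure)
begin

lemma op_without_extra_fields: "exact_category_without_extra_fields (op_cat E)"
  by (rule exact_category_without_extra_fields.intro[OF exact_category_op])

lemma acyclic_rev:
  assumes "acyclic_seq E xs"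
  shows "acyclic_seq (op_cat E) (rev xs)"
  using assms
proof (induction rule: acyclic_seq.induct)
  case (conflation i p)
  then show ?case using acyclic_seq.conflation[of p i "op_cat E"] by simp
next
  case (splice xs i p)
  have l: "xs \<noteq> []" using acyclic_length[OF splice(1)] by auto
  have "acyclic_seq (op_cat E) (Defs.splice (op_cat E) [p, i] (rev xs))"
    by (rule acyclic_splice_left)
      (use splice l in \<open>simp_all add: hd_rev\<close>)
  then show ?case using splice_rev[OF l, of "[i, p]" E] by simp
qed

lemma extensions_rev:
  assumes "xs \<in> extensions E k D A"
  shows "rev xs \<in> extensions (op_cat E) k A D"
  using assms acyclic_rev acyclic_length[of E xs] by (auto simp: extensions_def hd_rev last_rev)

lemma yoneda_step_rev:
  assumes "yoneda_step E xs ys"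
  shows "yoneda_step (op_cat E) (rev ys) (rev xs)"
proof -
  obtain k A D where s: "xs \<in> extensions E k D A" "ys \<in> extensions E k D A"
    "chain_map E xs ys (ident E A) (ident E D)" using assms by (rule yoneda_stepD)
  have "chain_map (op_cat E) (rev ys) (rev xs) (ident E D) (ident E A)"
    using chain_map_rev[OF s(3)] extensions_path s(1,2) by blast
  then show ?thesis
    using exact_category.yoneda_stepI[OF exact_category_op extensions_rev[OF s(2)] extensions_rev[OF s(1)]]
    by simp
qed

lemma equivclp_rev:
  assumes "equivclp (yoneda_step E) xs ys"
  shows "equivclp (yoneda_step (op_cat E)) (rev xs) (rev ys)"
  using assms
proof (induction rule: equivclp_induct)
  case base
  show ?case by simp
next
  case (step y z)
  have "equivclp (yoneda_step (op_cat E)) (rev y) (rev z)"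
    using step(2) yoneda_step_rev by (metis equivclp_sym r_into_equivclp)
  then show ?case using step(3) equivclp_trans by metis
qed

lemma ext_class_rev: "ext_class (op_cat E) (rev xs) = rev ` ext_class E xs"
proof -
  have m: "zs \<in> ext_class F us \<longleftrightarrow> equivclp (yoneda_step F) us zs" for F :: "('o, 'm) exact_cat" and us zs
    by (simp add: ext_class_def yoneda_rel_def)
  have "zs \<in> ext_class (op_cat E) (rev xs) \<longleftrightarrow> rev zs \<in> ext_class E xs" for zs
    using equivclp_rev[of xs "rev zs"]
      exact_category_without_extra_fields.equivclp_rev[OF op_without_extra_fields, of "rev xs" zs]
    by (auto simp: m)
  then show ?thesis by (force simp: image_iff)
qed

lemma pullback_extension_rev:
  "pullback_extension E f xs ys \<longleftrightarrow> pushout_extension (op_cat E) f (rev xs) (rev ys)"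
proof
  assume "pullback_extension E f xs ys"
  then show "pushout_extension (op_cat E) f (rev xs) (rev ys)"
    unfolding pullback_extension_def pushout_extension_def
    by (elim exE conjE) (simp add: op_is_pushout, blast)
next
  assume "pushout_extension (op_cat E) f (rev xs) (rev ys)"
  then obtain i e zs i' f' e' where *: "rev xs = i # e # zs" "rev ys = i' # e' # zs"
    "is_pullback E i f i' f'" "e' \<in> Hom E (src E e) (src E i')" "f' \<cdot> e' = e"
    "i' \<cdot> e' = zero E (src E e) (src E f)"
    unfolding pushout_extension_def by (auto simp: op_is_pushout)
  have "xs = rev zs @ [e, i]" "ys = rev zs @ [e', i']"
    using arg_cong[OF *(1), of rev] arg_cong[OF *(2), of rev] by simp_all
  then show "pullback_extension E f xs ys" unfolding pullback_extension_def using *(3-6) by blast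
qed

lemma pullback_extension_exists:
  assumes "xs \<in> extensions E k D A" "f \<in> Hom E D' D"
  obtains ys where "pullback_extension E f xs ys"
proof -
  obtain zs where "pushout_extension (op_cat E) f (rev xs) zs"
    using exact_category.pushout_extension_exists[OF exact_category_op extensions_rev[OF assms(1)], of f D']
      assms(2) by auto
  then show ?thesis using that[of "rev zs"] by (simp add: pullback_extension_rev)
qed

lemma extensions_rev_iff: "rev xs \<in> extensions (op_cat E) k A D \<longleftrightarrow> xs \<in> extensions E k D A"
  using extensions_rev[of xs k D A]
    exact_category_without_extra_fields.extensions_rev[OF op_without_extra_fields, of "rev xs" k A D]
  by auto

lemma pullback_extensionD:
  assumes xs: "xs \<in> extensions E k D A" and f: "f \<in> Hom E D' D" and p: "pullback_extension E f xs ys"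
  shows "ys \<in> extensions E k D' A" "chain_map E ys xs (ident E A) f"
proof -
  have f': "f \<in> Hom (op_cat E) D D'" using f by simp
  note P = exact_category.pushout_extensionD[OF exact_category_op extensions_rev[OF xs] f'
      p[unfolded pullback_extension_rev]]
  show ys: "ys \<in> extensions E k D' A" using P(1) extensions_rev_iff by blast
  have "path (op_cat E) (rev xs)" "path (op_cat E) (rev ys)"
    using extensions_path[OF xs] extensions_path[OF ys] path_rev by blast+
  from chain_map_rev[OF P(2) this] show "chain_map E ys xs (ident E A) f" by simp
qed

lemma Ext_pull_rev:
  assumes "k > 0"
  shows "Ext_push (op_cat E) k f (rev ` a) = rev ` Ext_pull E k f a"
proof -
  have "{ext_class (op_cat E) ys |xs ys. xs \<in> rev ` a \<and> pushout_extension (op_cat E) f xs ys}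
    = (\<lambda>c. rev ` c) ` {ext_class E ys |xs ys. xs \<in> a \<and> pullback_extension E f xs ys}" (is "?L = ?R")
  proof (rule Set.set_eqI, rule iffI)
    fix c assume "c \<in> ?L"
    then obtain xs ys where *: "c = ext_class (op_cat E) ys" "xs \<in> a"
      "pushout_extension (op_cat E) f (rev xs) ys" by blast
    then have "c = rev ` ext_class E (rev ys)" "pullback_extension E f xs (rev ys)"
      using ext_class_rev[of "rev ys"] by (simp_all add: pullback_extension_rev)
    then show "c \<in> ?R" using *(2) by blast
  next
    fix c assume "c \<in> ?R"
    then obtain xs ys where "c = rev ` ext_class E ys" "xs \<in> a" "pullback_extension E f xs ys" by blast
    then have "c = ext_class (op_cat E) (rev ys)" "rev xs \<in> rev ` a"
      "pushout_extension (op_cat E) f (rev xs) (rev ys)"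
      using ext_class_rev[of ys] by (simp_all add: pullback_extension_rev)
    then show "c \<in> ?L" by blast
  qed
  then show ?thesis using assms by (simp add: Ext_push_def Ext_pull_def image_Union)
qed

lemma Ext_pull_pullback:
  assumes k: "k > 0" and xs: "xs \<in> extensions E k D A" and f: "f \<in> Hom E D' D"
    and p: "pullback_extension E f xs ys"
  shows "Ext_pull E k f (ext_class E xs) = ext_class E ys"
proof -
  have f': "f \<in> Hom (op_cat E) D D'" using f by simp
  have "rev ` Ext_pull E k f (ext_class E xs) = rev ` ext_class E ys"
    using exact_category.Ext_push_pushout[OF exact_category_op k extensions_rev[OF xs] f'
        p[unfolded pullback_extension_rev]] Ext_pull_rev[OF k, of f "ext_class E xs"]
    by (simp add: ext_class_rev)
  then show ?thesis by (simp add: inj_image_eq_iff)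
qed

end

section \<open>Iterated connecting maps\<close>

text \<open>
  The conflations are numbered from \<open>0\<close> to \<open>n\<close>, so the result is an
  \<open>(n + 1)\<close>-fold extension.
\<close>

fun spliced :: "('o, 'm, 'x) additive_cat_scheme \<Rightarrow> (nat \<Rightarrow> 'm) \<Rightarrow> (nat \<Rightarrow> 'm) \<Rightarrow> nat \<Rightarrow> 'm list" where
  "spliced C i p 0 = [i 0, p 0]"
| "spliced C i p (Suc n) = splice C [i 0, p 0] (spliced C (\<lambda>j. i (Suc j)) (\<lambda>j. p (Suc j)) n)"

text \<open>
  The conflations act in the order \<open>m - 1, \<dots>, 0\<close>, since the last conflation
  of a sequence is the one at the object where the product is formed.
\<close>

fun chain_con ::
    "('o, 'm, 'x) exact_cat_scheme \<Rightarrow> (nat \<Rightarrow> 'm) \<Rightarrow> (nat \<Rightarrow> 'm) \<Rightarrow> nat \<Rightarrow> nat \<Rightarrow> 'm list set \<Rightarrow> 'm list set"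
  where
  "chain_con E i p 0 k a = a"
| "chain_con E i p (Suc m) k a = chain_con E i p m (Suc k) (con E k (i m) (p m) a)"

text \<open>
  In a resolution of an \<open>(n + 1)\<close>-exact sequence, \<open>Y\<^sub>j\<close> is the
  term in position \<open>j + 1\<close>.
\<close>

definition resolution ::
    "('o, 'm, 'x) exact_cat_scheme \<Rightarrow> (nat \<Rightarrow> 'o) \<Rightarrow> (nat \<Rightarrow> 'o) \<Rightarrow> (nat \<Rightarrow> 'm) \<Rightarrow> (nat \<Rightarrow> 'm) \<Rightarrow> nat \<Rightarrow> bool"
  where "resolution E K Y i p n \<longleftrightarrow> (\<forall>j\<le>n. conf E (K j) (Y j) (K (Suc j)) (i j) (p j))"

lemma resolution_shift:
  "resolution E K Y i p (Suc n) \<Longrightarrow>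
    resolution E (\<lambda>j. K (Suc j)) (\<lambda>j. Y (Suc j)) (\<lambda>j. i (Suc j)) (\<lambda>j. p (Suc j)) n"
  by (auto simp: resolution_def)

lemma hd_spliced: "hd (spliced C i p n) = i 0"
  by (cases n) (simp_all add: splice_cons)

lemma length_spliced: "length (spliced C i p n) = Suc (Suc n)"
  by (induction n arbitrary: i p) (simp_all add: splice_cons)

lemma nth_spliced:
  "spliced C i p n ! 0 = i 0"
  "j < n \<Longrightarrow> spliced C i p n ! Suc j = cmp C (i (Suc j)) (p j)"
  "spliced C i p n ! Suc n = p n"
proof -
  show "spliced C i p n ! 0 = i 0" by (cases n) (simp_all add: splice_cons)
  show "j < n \<Longrightarrow> spliced C i p n ! Suc j = cmp C (i (Suc j)) (p j)"
  proof (induction n arbitrary: i p j)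
    case (Suc n)
    let ?s = "spliced C (\<lambda>j. i (Suc j)) (\<lambda>j. p (Suc j)) n"
    obtain x xs where s: "?s = x # xs" using length_spliced[of C "\<lambda>j. i (Suc j)" "\<lambda>j. p (Suc j)" n]
      by (cases ?s) auto
    show ?case
    proof (cases j)
      case 0
      then show ?thesis by (simp add: splice_cons hd_spliced)
    next
      case (Suc l)
      then show ?thesis using Suc.IH[of l "\<lambda>j. i (Suc j)" "\<lambda>j. p (Suc j)"] Suc.prems s
        by (simp add: splice_cons)
    qed
  qed simp
  show "spliced C i p n ! Suc n = p n"
  proof (induction n arbitrary: i p)
    case (Suc n)
    let ?s = "spliced C (\<lambda>j. i (Suc j)) (\<lambda>j. p (Suc j)) n"
    obtain x xs where s: "?s = x # xs" using length_spliced[of C "\<lambda>j. i (Suc j)" "\<lambda>j. p (Suc j)" n]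
      by (cases ?s) auto
    then show ?case using Suc.IH[of "\<lambda>j. i (Suc j)" "\<lambda>j. p (Suc j)"] by (simp add: splice_cons)
  qed simp
qed

lemma chain_con_shift:
  "chain_con E i p (Suc m) k a
    = con E (k + m) (i 0) (p 0) (chain_con E (\<lambda>j. i (Suc j)) (\<lambda>j. p (Suc j)) m k a)"
proof (induction m arbitrary: k a)
  case (Suc m)
  have "chain_con E i p (Suc (Suc m)) k a
      = chain_con E i p (Suc m) (Suc k) (con E k (i (Suc m)) (p (Suc m)) a)" by simp
  then show ?case using Suc by simp
qed simp

context exact_category
begin

lemma spliced_extensions:
  "resolution E K Y i p n \<Longrightarrow> spliced E i p n \<in> extensions E (Suc n) (K (Suc n)) (K 0)"
proof (induction n arbitrary: K Y i p)
  case 0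
  then show ?case using extensions_conf by (auto simp: resolution_def)
next
  case (Suc n)
  have "conf E (K 0) (Y 0) (K 1) (i 0) (p 0)" using Suc.prems by (auto simp: resolution_def)
  from extensions_splice[OF this] show ?case using Suc.IH[OF resolution_shift[OF Suc.prems]] by simp
qed

lemma extensions_spliced:
  "xs \<in> extensions E (Suc n) D A \<Longrightarrow>
    \<exists>K Y i p. resolution E K Y i p n \<and> K 0 = A \<and> K (Suc n) = D \<and> xs = spliced E i p n"
proof (induction n arbitrary: xs A)
  case 0
  then obtain B i p where c: "conf E A B D i p" "xs = [i, p]"
    by (cases rule: extensions_cases) (auto simp: extensions_0)
  show ?case
    by (rule exI[of _ "case_nat A (\<lambda>_. D)"], rule exI[of _ "\<lambda>_. B"], rule exI[of _ "\<lambda>_. i"],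
        rule exI[of _ "\<lambda>_. p"]) (use c in \<open>simp add: resolution_def\<close>)
next
  case (Suc n)
  from Suc.prems obtain B C i p ys where c: "conf E A B C i p" "ys \<in> extensions E (Suc n) D C"
    "xs = splice E [i, p] ys"
    by (cases rule: extensions_cases) auto
  obtain K Y i' p' where r: "resolution E K Y i' p' n" "K 0 = C" "K (Suc n) = D" "ys = spliced E i' p' n"
    using Suc.IH[OF c(2)] by blast
  have "resolution E (case_nat A K) (case_nat B Y) (case_nat i i') (case_nat p p') (Suc n)"
    unfolding resolution_def
  proof (intro allI impI)
    fix j assume "j \<le> Suc n"
    then show "conf E (case_nat A K j) (case_nat B Y j) (case_nat A K (Suc j)) (case_nat i i' j)
        (case_nat p p' j)"
      using r(1,2) c(1) by (cases j) (auto simp: resolution_def)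
  qed
  moreover have "xs = spliced E (case_nat i i') (case_nat p p') (Suc n)" using c(3) r(4) by simp
  ultimately show ?case using r(3)
    by (intro exI[of _ "case_nat A K"] exI[of _ "case_nat B Y"] exI[of _ "case_nat i i'"]
        exI[of _ "case_nat p p'"] conjI) simp_all
qed

lemma seq_obj_spliced:
  assumes r: "resolution E K Y i p n"
  shows "seq_obj E (spliced E i p n) 0 = K 0" "j \<le> n \<Longrightarrow> seq_obj E (spliced E i p n) (Suc j) = Y j"
    "seq_obj E (spliced E i p n) (Suc (Suc n)) = K (Suc n)"
proof -
  note e = spliced_extensions[OF r]
  note h = path_nth[OF extensions_path[OF e], unfolded length_spliced]
  have c: "conf E (K j) (Y j) (K (Suc j)) (i j) (p j)" if "j \<le> n" for j
    using r that by (simp add: resolution_def)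
  note C0 = confD[OF c[OF le0]]
  show "seq_obj E (spliced E i p n) 0 = K 0"
    using h[of 0] C0 by (simp add: nth_spliced Hom_def)
  show "seq_obj E (spliced E i p n) (Suc (Suc n)) = K (Suc n)"
    using h[of "Suc n"] confD[OF c[OF le_refl]] by (simp add: nth_spliced Hom_def)
  show "seq_obj E (spliced E i p n) (Suc j) = Y j" if "j \<le> n"
  proof (cases "j = n")
    case True
    then show ?thesis using h[of "Suc n"] confD[OF c[OF le_refl]] by (simp add: nth_spliced Hom_def)
  next
    case False
    then have j: "j < n" using that by simp
    then show ?thesis
      using h[of "Suc j"] confD[OF c[of j]] confD[OF c[of "Suc j"]]
      by (simp add: nth_spliced Hom_def cat)
  qed
qed

lemma chain_con_closed:
  assumes "resolution E K Y i p n" "m \<le> Suc n" "a \<in> Ext_carrier E k X (K m)"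
  shows "chain_con E i p m k a \<in> Ext_carrier E (k + m) X (K 0)"
  using assms(2,3)
proof (induction m arbitrary: k a)
  case (Suc m)
  have "conf E (K m) (Y m) (K (Suc m)) (i m) (p m)" using assms(1) Suc.prems by (simp add: resolution_def)
  from Suc.IH[OF _ con_closed[OF this Suc.prems(2)]] Suc.prems(1) show ?case by simp
qed simp

lemma chain_con_zero:
  assumes "resolution E K Y i p n" "m \<le> Suc n" "X \<in> obj E"
  shows "chain_con E i p m k (Ext_zero E k X (K m)) = Ext_zero E (k + m) X (K 0)"
  using assms(2)
proof (induction m arbitrary: k)
  case (Suc m)
  have "conf E (K m) (Y m) (K (Suc m)) (i m) (p m)" using assms(1) Suc.prems by (simp add: resolution_def)
  from con_zero[OF this assms(3)] Suc.IH[of "Suc k"] Suc.prems show ?case by simp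
qed simp

lemma extensions_splice_spliced:
  assumes "resolution E K Y i p n" "xs \<in> extensions E k X (K (Suc n))"
  shows "splice E (spliced E i p n) xs \<in> extensions E (Suc (k + n)) X (K 0)"
    "ext_class E (splice E (spliced E i p n) xs) = chain_con E i p (Suc n) k (ext_class E xs)"
proof -
  have "splice E (spliced E i p n) xs \<in> extensions E (Suc (k + n)) X (K 0) \<and>
    ext_class E (splice E (spliced E i p n) xs) = chain_con E i p (Suc n) k (ext_class E xs)"
    using assms
  proof (induction n arbitrary: K Y i p)
    case 0
    then have c: "conf E (K 0) (Y 0) (K 1) (i 0) (p 0)" by (simp add: resolution_def)
    then show ?case using extensions_splice[OF c] con_ext[OF c] 0 by simp
  next
    case (Suc n)
    let ?s = "spliced E (\<lambda>j. i (Suc j)) (\<lambda>j. p (Suc j)) n"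
    have c: "conf E (K 0) (Y 0) (K 1) (i 0) (p 0)" using Suc.prems by (simp add: resolution_def)
    have IH: "splice E ?s xs \<in> extensions E (Suc (k + n)) X (K 1)"
      "ext_class E (splice E ?s xs)
        = chain_con E (\<lambda>j. i (Suc j)) (\<lambda>j. p (Suc j)) (Suc n) k (ext_class E xs)"
      using Suc.IH[OF resolution_shift[OF Suc.prems(1)]] Suc.prems(2) by auto
    have "xs \<noteq> []" using Suc.prems(2) acyclic_length by (auto simp: extensions_def)
    then have "splice E (spliced E i p (Suc n)) xs = splice E [i 0, p 0] (splice E ?s xs)"
      using splice_assoc[of ?s xs E "[i 0, p 0]"] by (simp add: length_spliced)
    then show ?case
      using extensions_splice[OF c IH(1)] con_ext[OF c IH(1)] IH(2)
        chain_con_shift[of E i p "Suc n" k "ext_class E xs"] by simp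
  qed
  then show "splice E (spliced E i p n) xs \<in> extensions E (Suc (k + n)) X (K 0)"
    "ext_class E (splice E (spliced E i p n) xs) = chain_con E i p (Suc n) k (ext_class E xs)" by blast+
qed

text \<open>
  Naturality of the connecting maps, once for each conflation. If \<open>a\<close> is an
  identity, then \<open>zs\<close> is a pullback of the spliced sequence along \<open>g\<close>,
  and its class is the iterated connecting map on \<open>g\<close>.
\<close>

lemma chain_map_chain_con:
  assumes "resolution E K Y i p n" "zs \<in> extensions E (Suc n) X A'" "a \<in> Hom E A' (K 0)"
    "g \<in> Hom E X (K (Suc n))" "chain_map E zs (spliced E i p n) a g"
  shows "Ext_push E (Suc n) a (ext_class E zs) = chain_con E i p (Suc n) 0 (hom_elem g)"
  using assms
proof (induction n arbitrary: K Y i p zs A' a)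
  case 0
  then have c: "conf E (K 0) (Y 0) (K 1) (i 0) (p 0)" by (simp add: resolution_def)
  obtain B j q where z: "conf E A' B X j q" "zs = [j, q]"
    using 0(2) by (cases rule: extensions_cases) (auto simp: extensions_0)
  obtain b where m: "conf_mor E j q (i 0) (p 0) a b g"
    using 0(5) z(2) chain_map_conf[OF z(1) c] by auto
  have X: "X \<in> obj E" using confD[OF z(1)] by blast
  have id: "hom_elem (ident E X) \<in> Ext_carrier E 0 X X" using ident_Hom[OF X] by (simp add: Ext_carrier_0)
  have "con E 0 j q (hom_elem (ident E X)) = ext_class E [j, q]"
    using con_Hom[OF z(1) z(1) conf_mor_ident[OF z(1)]] .
  then show ?case using con_natural[OF z(1) c m id] z(2) comp_ident_right[OF 0(4)] by simp
next
  case (Suc n)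
  let ?s = "spliced E (\<lambda>j. i (Suc j)) (\<lambda>j. p (Suc j)) n"
  have c: "conf E (K 0) (Y 0) (K 1) (i 0) (p 0)" using Suc.prems by (simp add: resolution_def)
  note r = resolution_shift[OF Suc.prems(1)]
  have s: "?s \<in> extensions E (Suc n) (K (Suc (Suc n))) (K 1)" using spliced_extensions[OF r] by simp
  obtain B C j q us where z: "conf E A' B C j q" "us \<in> extensions E (Suc n) X C" "zs = splice E [j, q] us"
    using Suc.prems(2) by (cases rule: extensions_cases) auto
  obtain b m where m: "conf_mor E j q (i 0) (p 0) a b m" "chain_map E us ?s m g"
    using Suc.prems(5) chain_map_splice[OF z(1) c z(2) s] z(3) by auto
  have mH: "m \<in> Hom E C (K 1)" using conf_morD[OF m(1) z(1) c] by blast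
  have IH: "Ext_push E (Suc n) m (ext_class E us)
      = chain_con E (\<lambda>j. i (Suc j)) (\<lambda>j. p (Suc j)) (Suc n) 0 (hom_elem g)"
    using Suc.IH[OF r z(2) _ _ m(2)] mH Suc.prems(4) by simp
  have "Ext_push E (Suc (Suc n)) a (ext_class E zs) = con E (Suc n) (i 0) (p 0)
      (Ext_push E (Suc n) m (ext_class E us))"
    using con_natural[OF z(1) c m(1) ext_class_carrier[OF z(2)]] con_ext[OF z(1,2)] z(3) by simp
  then show ?case using IH chain_con_shift[of E i p "Suc n" 0 "hom_elem g"] by simp
qed

lemma chain_map_splice_both:
  assumes "xs \<in> extensions E l D A" "ys \<in> extensions E l D' A'"
    "us \<in> extensions E k X D" "vs \<in> extensions E k X' D'"
    "chain_map E xs ys a m" "chain_map E us vs m z"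
  shows "chain_map E (splice E xs us) (splice E ys vs) a z"
  using assms(1,2,5)
proof (induction l arbitrary: xs ys A A' a)
  case 0
  then show ?case by (simp add: extensions_0)
next
  case (Suc l)
  have ne: "us \<noteq> []" "vs \<noteq> []" using assms(3,4) acyclic_length by (auto simp: extensions_def)
  show ?case
  proof (cases "l = 0")
    case True
    obtain B i p where c: "conf E A B D i p" "xs = [i, p]"
      using Suc.prems(1) True by (cases rule: extensions_cases) (auto simp: extensions_0)
    obtain B' i' p' where c': "conf E A' B' D' i' p'" "ys = [i', p']"
      using Suc.prems(2) True by (cases rule: extensions_cases) (auto simp: extensions_0)
    obtain b where "conf_mor E i p i' p' a b m"
      using Suc.prems(3) chain_map_conf[OF c(1) c'(1)] c(2) c'(2) by auto
    then show ?thesis using chain_map_splice[OF c(1) c'(1) assms(3,4)] assms(6) c(2) c'(2) by auto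
  next
    case False
    obtain B C i p xs' where c: "conf E A B C i p" "xs' \<in> extensions E l D C" "xs = splice E [i, p] xs'"
      using Suc.prems(1) False by (cases rule: extensions_cases) auto
    obtain B' C' i' p' ys' where c': "conf E A' B' C' i' p'" "ys' \<in> extensions E l D' C'"
      "ys = splice E [i', p'] ys'"
      using Suc.prems(2) False by (cases rule: extensions_cases) auto
    obtain b m' where m': "conf_mor E i p i' p' a b m'" "chain_map E xs' ys' m' m"
      using Suc.prems(3) chain_map_splice[OF c(1) c'(1) c(2) c'(2)] c(3) c'(3) by auto
    note IH = Suc.IH[OF c(2) c'(2) m'(2)]
    have sp: "splice E xs us = splice E [i, p] (splice E xs' us)"
      "splice E ys vs = splice E [i', p'] (splice E ys' vs)"
      using splice_assoc[of xs' us E "[i, p]"] splice_assoc[of ys' vs E "[i', p']"] c c' ne False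
      by (auto simp: extensions_def)
    obtain l' where l': "l = Suc l'" using False by (cases l) auto
    obtain K Y ii pp where R: "resolution E K Y ii pp l'" "K 0 = C" "K (Suc l') = D" "xs' = spliced E ii pp l'"
      using extensions_spliced c(2) unfolding l' by blast
    obtain K' Y' ii' pp' where R': "resolution E K' Y' ii' pp' l'" "K' 0 = C'" "K' (Suc l') = D'"
      "ys' = spliced E ii' pp' l'"
      using extensions_spliced c'(2) unfolding l' by blast
    have "splice E xs' us \<in> extensions E (Suc (k + l')) X C"
      using extensions_splice_spliced(1)[OF R(1)] assms(3) R by simp
    moreover have "splice E ys' vs \<in> extensions E (Suc (k + l')) X' C'"
      using extensions_splice_spliced(1)[OF R'(1)] assms(4) R' by simp
    ultimately show ?thesis using chain_map_splice[OF c(1) c'(1)] m'(1) IH unfolding sp by blast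
  qed
qed

end

context exact_category_without_extra_fields
begin

text \<open>
  In degree zero the product is a pullback, to which \<open>chain_map_chain_con\<close> applies;
  in positive degrees splicing respects Yoneda steps in both factors.
\<close>

lemma yoneda_product_chain_con:
  assumes r: "resolution E K Y i p n" and a: "a \<in> Ext_carrier E k X (K (Suc n))"
  shows "yoneda_product E (Suc n) k (ext_class E (spliced E i p n)) a = chain_con E i p (Suc n) k a"
  using a
proof (cases rule: Ext_carrier_cases)
  case (Hom g)
  note s = spliced_extensions[OF r]
  obtain zs where p: "pullback_extension E g (spliced E i p n) zs"
    using pullback_extension_exists[OF s Hom(2)] .
  note Z = pullback_extensionD[OF s Hom(2) p]
  have K0: "K 0 \<in> obj E" using extensions_obj[OF s] by blast
  have "Ext_pull E (Suc n) g (ext_class E (spliced E i p n)) = ext_class E zs"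
    using Ext_pull_pullback[OF _ s Hom(2) p] by simp
  also have "\<dots> = Ext_push E (Suc n) (ident E (K 0)) (ext_class E zs)"
    using Ext_push_ident[OF ext_class_carrier[OF Z(1)]] by simp
  also have "\<dots> = chain_con E i p (Suc n) 0 (hom_elem g)"
    using chain_map_chain_con[OF r Z(1) ident_Hom[OF K0] Hom(2) Z(2)] .
  finally show ?thesis using Hom by (simp add: yoneda_product_def)
next
  case (ext xs)
  note s = spliced_extensions[OF r]
  let ?R = "\<lambda>ys c. \<exists>us. us \<in> a \<and> c = ext_class E (splice E ys us)"
  have same: "splice E ys xs \<in> extensions E (Suc (k + n)) X (K 0)"
    "?R ys c \<Longrightarrow> c = ext_class E (splice E ys xs)"
    if ys: "ys \<in> extensions E (Suc n) (K (Suc n)) (K 0)" for ys c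
  proof -
    obtain K' Y' i' p' where R: "resolution E K' Y' i' p' n" "K' 0 = K 0" "K' (Suc n) = K (Suc n)"
      "ys = spliced E i' p' n" using extensions_spliced[OF ys] by blast
    show "splice E ys xs \<in> extensions E (Suc (k + n)) X (K 0)"
      using extensions_splice_spliced(1)[OF R(1)] ext(2) R by simp
    assume "?R ys c"
    then obtain us where us: "us \<in> a" "c = ext_class E (splice E ys us)" by blast
    then have e: "ext_class E us = ext_class E xs" using ext(3) mem_ext_class by simp
    then have "us \<in> extensions E k X (K (Suc n))" using ext_class_extensions[OF e] ext(2) by blast
    then show "c = ext_class E (splice E ys xs)"
      using extensions_splice_spliced(2)[OF R(1)] ext(2) R us(2) e by simp
  qed
  have "\<Union>{c. \<exists>ys. ys \<in> ext_class E (spliced E i p n) \<and> ?R ys c}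
      = ext_class E (splice E (spliced E i p n) xs)"
  proof (rule Union_ext_class[OF s])
    have xa: "xs \<in> a" using ext(3) mem_ext_class by simp
    then show "?R (spliced E i p n) (ext_class E (splice E (spliced E i p n) xs))" by blast
    show "\<exists>c. ?R ys c" for ys using xa by blast
    fix ys vs c d
    assume y: "ys \<in> extensions E (Suc n) (K (Suc n)) (K 0)" "vs \<in> extensions E (Suc n) (K (Suc n)) (K 0)"
      and m: "chain_map E ys vs (ident E (K 0)) (ident E (K (Suc n)))" and R: "?R ys c" "?R vs d"
    have "chain_map E xs xs (ident E (K (Suc n))) (ident E X)"
      using chain_map_ident[OF extensions_path[OF ext(2)]] extensions_hd_last[OF ext(2)] by simp
    from chain_map_splice_both[OF y ext(2) ext(2) m this]
    have "ext_class E (splice E ys xs) = ext_class E (splice E vs xs)"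
      using yoneda_step_class yoneda_stepI same(1)[OF y(1)] same(1)[OF y(2)] by blast
    then show "c = d" using same(2)[OF y(1) R(1)] same(2)[OF y(2) R(2)] by simp
  qed
  moreover have "{c. \<exists>ys. ys \<in> ext_class E (spliced E i p n) \<and> ?R ys c}
      = {ext_class E (splice E ys us) |ys us. ys \<in> ext_class E (spliced E i p n) \<and> us \<in> a}" by blast
  ultimately have "\<Union>{ext_class E (splice E ys us) |ys us. ys \<in> ext_class E (spliced E i p n) \<and> us \<in> a}
      = ext_class E (splice E (spliced E i p n) xs)" by simp
  then show ?thesis
    using ext(1,3) extensions_splice_spliced(2)[OF r ext(2)] by (simp add: yoneda_product_def)
qed

end

section \<open>Dimension shifting along a resolution\<close>

lemma Ext_simps [simp]:
  "carrier (Ext E k X A) = Ext_carrier E k X A" "one (Ext E k X A) = Ext_zero E k X A"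
  by (simp_all add: Ext_def)

context exact_category
begin

lemma Ext_vanishesI:
  assumes "X \<in> obj E" "A \<in> obj E"
    "\<And>a. a \<in> Ext_carrier E k X A \<Longrightarrow> a = Ext_zero E k X A"
  shows "Ext_vanishes E k X A"
  using assms(3) Ext_zero_closed[OF assms(1,2)] by (auto simp: Ext_vanishes_def)

lemma Ext_vanishesD: "Ext_vanishes E k X A \<Longrightarrow> a \<in> Ext_carrier E k X A \<Longrightarrow> a = Ext_zero E k X A"
  by (auto simp: Ext_vanishes_def)

text \<open>
  Every element of \<open>Ext\<^sup>k\<^sup>+\<^sup>1(X, A)\<close> is the image of some
  \<open>g\<close> under the connecting map, which vanishes on the elements that lift to
  \<open>B\<close>.
\<close>

lemma Ext_vanishes_kernel:
  assumes c: "conf E A B D i p" and X: "X \<in> obj E"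
    and surj: "\<And>g. g \<in> Ext_carrier E k X D \<Longrightarrow> \<exists>b\<in>Ext_carrier E k X B. Ext_push E k p b = g"
    and B: "Ext_vanishes E (Suc k) X B"
  shows "Ext_vanishes E (Suc k) X A"
proof (rule Ext_vanishesI[OF X])
  show "A \<in> obj E" using confD[OF c] by blast
  fix a assume a: "a \<in> Ext_carrier E (Suc k) X A"
  have "Ext_push E (Suc k) i a = Ext_zero E (Suc k) X B"
    using Ext_vanishesD[OF B Ext_push_closed[OF confD(2)[OF c] a]] .
  then obtain g where g: "g \<in> Ext_carrier E k X D" "con E k i p g = a" using Ext_exact_left[OF c a] by blast
  then obtain b where "b \<in> Ext_carrier E k X B" "Ext_push E k p b = g" using surj by blast
  then show "a = Ext_zero E (Suc k) X A" using con_push[OF c] g(2) by blast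
qed

lemma Ext_vanishes_down:
  assumes c: "conf E A B D i p" and X: "X \<in> obj E"
    and D: "Ext_vanishes E k X D" and B: "Ext_vanishes E (Suc k) X B"
  shows "Ext_vanishes E (Suc k) X A"
proof (rule Ext_vanishes_kernel[OF c X _ B])
  fix g assume "g \<in> Ext_carrier E k X D"
  then have "g = Ext_zero E k X D" using Ext_vanishesD[OF D] by blast
  then have "Ext_push E k p (Ext_zero E k X B) = g"
    using Ext_push_Ext_zero[OF confD(3)[OF c] X] by simp
  then show "\<exists>b\<in>Ext_carrier E k X B. Ext_push E k p b = g"
    using Ext_zero_closed[OF X] confD[OF c] by blast
qed

lemma Ext_vanishes_up:
  assumes c: "conf E A B D i p" and X: "X \<in> obj E"
    and A: "Ext_vanishes E (Suc k) X A" and B: "Ext_vanishes E k X B"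
  shows "Ext_vanishes E k X D"
proof (rule Ext_vanishesI[OF X])
  show "D \<in> obj E" using confD[OF c] by blast
  fix g assume g: "g \<in> Ext_carrier E k X D"
  have "con E k i p g = Ext_zero E (Suc k) X A" using Ext_vanishesD[OF A con_closed[OF c g]] .
  then obtain b where b: "b \<in> Ext_carrier E k X B" "Ext_push E k p b = g" using Ext_exact_right[OF c g] by blast
  then show "g = Ext_zero E k X D"
    using Ext_vanishesD[OF B b(1)] Ext_push_Ext_zero[OF confD(3)[OF c] X] by simp
qed

lemma resolutionD: "resolution E K Y i p n \<Longrightarrow> j \<le> n \<Longrightarrow> conf E (K j) (Y j) (K (Suc j)) (i j) (p j)"
  by (simp add: resolution_def)

text \<open>
  As long as \<open>m\<close> is not a multiple of \<open>n + 1\<close>, \<open>Ext\<^sup>m(X,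
  K\<^sub>j)\<close> is a quotient of \<open>Ext\<^sup>m\<^sup>-\<^sup>1(X,
  K\<^sub>j\<^sub>+\<^sub>1)\<close>. The bound on the residue of \<open>m\<close> allows
  \<open>n + 1 - j\<close> such steps, which end at the last object of the sequence. Vanishing
  is assumed only below \<open>L\<close> so that the lemma applies inside an induction on the
  degree.
\<close>

lemma resolution_vanishes_from_right:
  assumes r: "resolution E K Y i p n" and X: "X \<in> obj E"
    and V: "\<And>m. m < L \<Longrightarrow> \<not> Suc n dvd m \<Longrightarrow> Ext_vanishes E m X (K (Suc n))"
      "\<And>m j. m < L \<Longrightarrow> \<not> Suc n dvd m \<Longrightarrow> j \<le> n \<Longrightarrow> Ext_vanishes E m X (Y j)"
    and "m < L" "j \<le> Suc n" "Suc n - j < m mod Suc n"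
  shows "Ext_vanishes E m X (K j)"
  using assms(5-7)
proof (induction "Suc n - j" arbitrary: j m)
  case 0
  then have "j = Suc n" "\<not> Suc n dvd m" by (auto simp: dvd_eq_mod_eq_0)
  then show ?case using V(1) 0 by blast
next
  case (Suc d)
  then have j: "j \<le> n" "d = Suc n - Suc j" by auto
  have m0: "m mod Suc n \<noteq> 0" using Suc.prems by linarith
  then obtain l where l: "m = Suc l" by (cases m) auto
  have lm: "l mod Suc n = m mod Suc n - 1" using m0 unfolding l by (simp add: mod_Suc split: if_splits)
  have "Ext_vanishes E l X (K (Suc j))"
    by (rule Suc.hyps(1)[OF j(2)]) (use Suc.prems Suc.hyps(2) l lm j in auto)
  moreover have "Ext_vanishes E (Suc l) X (Y j)"
    using V(2)[of m j] Suc.prems m0 l j by (simp add: dvd_eq_mod_eq_0)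
  ultimately show ?case using Ext_vanishes_down[OF resolutionD[OF r j(1)] X] l by simp
qed

text \<open>
  As long as \<open>m\<close> is not a multiple of \<open>n + 1\<close>, \<open>Ext\<^sup>m(X,
  K\<^sub>j\<^sub>+\<^sub>1)\<close> embeds into \<open>Ext\<^sup>m\<^sup>+\<^sup>1(X,
  K\<^sub>j)\<close>; after \<open>j\<close> steps the first object of the sequence is reached.
\<close>

lemma resolution_vanishes_from_left:
  assumes r: "resolution E K Y i p n" and X: "X \<in> obj E"
    and V: "\<And>m. \<not> Suc n dvd m \<Longrightarrow> Ext_vanishes E m X (K 0)"
      "\<And>m j. \<not> Suc n dvd m \<Longrightarrow> j \<le> n \<Longrightarrow> Ext_vanishes E m X (Y j)"
    and "1 \<le> m mod Suc n" "m mod Suc n + j < Suc n"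
  shows "Ext_vanishes E m X (K j)"
  using assms(5,6)
proof (induction j arbitrary: m)
  case 0
  then have "\<not> Suc n dvd m" by (auto simp: dvd_eq_mod_eq_0)
  then show ?case using V(1) by blast
next
  case (Suc j)
  have "Suc m mod Suc n = Suc (m mod Suc n)" using Suc.prems by (simp add: mod_Suc)
  then have "Ext_vanishes E (Suc m) X (K j)" using Suc by simp
  moreover have "Ext_vanishes E m X (Y j)" using V(2)[of m j] Suc.prems by (auto simp: dvd_eq_mod_eq_0)
  ultimately show ?case using Ext_vanishes_up[OF resolutionD[OF r] X] Suc.prems by simp
qed

lemma inflation_push_trivial_kernel:
  assumes c: "conf E A B D i p" and x: "x \<in> Ext_carrier E k X A"
    and z: "Ext_push E k i x = Ext_zero E k X B"
    and V: "k > 0 \<Longrightarrow> Ext_vanishes E (k - 1) X D"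
  shows "x = Ext_zero E k X A"
proof -
  have X: "X \<in> obj E" using Ext_carrier_obj[OF x] by blast
  show ?thesis
  proof (cases k)
    case 0
    obtain f where f: "f \<in> Hom E X A" "x = hom_elem f" using x 0 by (auto simp: Ext_carrier_0)
    have "i \<cdot> f = zero E X B" using z f 0 by (simp add: Ext_zero_0)
    also have "\<dots> = i \<cdot> zero E X A" using confD[OF c] X by (simp add: comp_zero)
    finally have "f = zero E X A" using conf_mono[OF c f(1)] zero_Hom X confD[OF c] by blast
    then show ?thesis using f 0 by (simp add: Ext_zero_0)
  next
    case (Suc l)
    obtain g where g: "g \<in> Ext_carrier E l X D" "con E l i p g = x"
      using Ext_exact_left[OF c] x z Suc by blast
    then show ?thesis using Ext_vanishesD[OF _ g(1)] V con_zero[OF c X] Suc by auto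
  qed
qed

lemma spliced_nth_le: "j \<le> n \<Longrightarrow> spliced E i p n ! j = (if j = 0 then i 0 else i j \<cdot> p (j - 1))"
  using nth_spliced(1)[of E i p n] nth_spliced(2)[of "j - 1" n E i p] by (cases j) auto

text \<open>
  The spliced maps factor through the objects \<open>K\<^sub>j\<close>, so exactness at
  \<open>Ext\<^sup>k(X, Y\<^sub>j)\<close> follows from exactness for the conflations up to two
  obstructions: the kernel of \<open>Ext\<^sup>k(X, K\<^sub>j\<^sub>+\<^sub>1) \<rightarrow>
  Ext\<^sup>k(X, Y\<^sub>j\<^sub>+\<^sub>1)\<close> and the cokernel of \<open>Ext\<^sup>k(X,
  Y\<^sub>j\<^sub>-\<^sub>1) \<rightarrow> Ext\<^sup>k(X, K\<^sub>j)\<close>.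
\<close>

lemma resolution_row_exact:
  assumes r: "resolution E K Y i p n" and X: "X \<in> obj E" and j: "j \<le> n"
    and V1: "j < n \<Longrightarrow> k > 0 \<Longrightarrow> Ext_vanishes E (k - 1) X (K (Suc (Suc j)))"
    and V2: "j > 0 \<Longrightarrow> Ext_vanishes E (Suc k) X (K (j - 1))"
  shows "Ext_push E k (spliced E i p n ! j) ` Ext_carrier E k X (seq_obj E (spliced E i p n) j)
    = {x \<in> Ext_carrier E k X (seq_obj E (spliced E i p n) (Suc j)).
        Ext_push E k (spliced E i p n ! Suc j) x = Ext_zero E k X (seq_obj E (spliced E i p n) (Suc (Suc j)))}"
    (is "?I = ?Z")
proof -
  let ?ys = "spliced E i p n"
  note e = spliced_extensions[OF r]
  note h = path_nth[OF extensions_path[OF e], unfolded length_spliced]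
  note so = seq_obj_spliced[OF r]
  note c = resolutionD[OF r]
  have h1: "?ys ! j \<in> Hom E (seq_obj E ?ys j) (seq_obj E ?ys (Suc j))" using h[of j] j by simp
  have h2: "?ys ! Suc j \<in> Hom E (seq_obj E ?ys (Suc j)) (seq_obj E ?ys (Suc (Suc j)))"
    using h[of "Suc j"] j by simp
  have comp0: "?ys ! Suc j \<cdot> ?ys ! j = zero E (seq_obj E ?ys j) (seq_obj E ?ys (Suc (Suc j)))"
    using extensions_complex[OF e, of j] j length_spliced[of E i p n] HomD[OF h1] HomD[OF h2] by simp
  show ?thesis
  proof (rule subset_antisym)
    show "?I \<subseteq> ?Z" using Ext_push_closed[OF h1] Ext_push_comp_zero[OF h1 h2 comp0] by blast
    show "?Z \<subseteq> ?I"
    proof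
      fix x assume "x \<in> ?Z"
      then have x: "x \<in> Ext_carrier E k X (Y j)"
        "Ext_push E k (?ys ! Suc j) x = Ext_zero E k X (seq_obj E ?ys (Suc (Suc j)))"
        using so(2)[OF j] by auto
      have "Ext_push E k (p j) x = Ext_zero E k X (K (Suc j))"
      proof (cases "j = n")
        case True
        then show ?thesis using x(2) nth_spliced(3)[of E i p n] so(3) by simp
      next
        case False
        then have jn: "j < n" using j by simp
        have ci: "conf E (K (Suc j)) (Y (Suc j)) (K (Suc (Suc j))) (i (Suc j)) (p (Suc j))"
          using c[of "Suc j"] jn by simp
        have "Ext_push E k (i (Suc j)) (Ext_push E k (p j) x) = Ext_zero E k X (Y (Suc j))"
          using x(2) nth_spliced(2)[OF jn, of E i p] so(2)[of "Suc j"] jn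
            Ext_push_comp[OF confD(3)[OF c[OF j]] confD(2)[OF ci] x(1)] by simp
        then show ?thesis
          using inflation_push_trivial_kernel[OF ci Ext_push_closed[OF confD(3)[OF c[OF j]] x(1)]]
            V1[OF jn] by blast
      qed
      then obtain y where y: "y \<in> Ext_carrier E k X (K j)" "Ext_push E k (i j) y = x"
        using Ext_exact_middle[OF c[OF j] x(1)] by blast
      show "x \<in> ?I"
      proof (cases j)
        case 0
        then show ?thesis using y so(1) nth_spliced(1)[of E i p n] by auto
      next
        case (Suc l)
        have cl: "conf E (K l) (Y l) (K j) (i l) (p l)" using c[of l] j Suc by simp
        have "con E k (i l) (p l) y = Ext_zero E (Suc k) X (K l)"
          using Ext_vanishesD[OF _ con_closed[OF cl y(1)]] V2 Suc by simp
        then obtain b where b: "b \<in> Ext_carrier E k X (Y l)" "Ext_push E k (p l) b = y"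
          using Ext_exact_right[OF cl y(1)] by blast
        have "Ext_push E k (i j \<cdot> p l) b = x"
          using Ext_push_comp[OF confD(3)[OF cl] confD(2)[OF c[OF j]] b(1)] b(2) y(2) by simp
        moreover have "?ys ! j = i j \<cdot> p l" using spliced_nth_le[OF j, of i p] Suc by simp
        moreover have "seq_obj E ?ys j = Y l" using so(2)[of l] j Suc by simp
        ultimately show ?thesis using b(1) by auto
      qed
    qed
  qed
qed

lemma chain_con_trivial_kernel:
  assumes r: "resolution E K Y i p n" and m: "m \<le> Suc n" and a: "a \<in> Ext_carrier E k X (K m)"
    and z: "chain_con E i p m k a = Ext_zero E (k + m) X (K 0)"
    and V: "\<And>j. j < m \<Longrightarrow> Ext_vanishes E (k + (m - Suc j)) X (Y j)"
  shows "a = Ext_zero E k X (K m)"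
  using m a z V
proof (induction m arbitrary: k a)
  case (Suc m)
  have X: "X \<in> obj E" using Ext_carrier_obj[OF Suc.prems(2)] by blast
  have c: "conf E (K m) (Y m) (K (Suc m)) (i m) (p m)" using resolutionD[OF r] Suc.prems(1) by simp
  have "con E k (i m) (p m) a = Ext_zero E (Suc k) X (K m)"
  proof (rule Suc.IH[OF _ con_closed[OF c Suc.prems(2)]])
    show "m \<le> Suc n" using Suc.prems(1) by simp
    show "chain_con E i p m (Suc k) (con E k (i m) (p m) a) = Ext_zero E (Suc k + m) X (K 0)"
      using Suc.prems(3) by simp
    fix j assume "j < m"
    then show "Ext_vanishes E (Suc k + (m - Suc j)) X (Y j)"
      using Suc.prems(4)[of j] by (simp add: Suc_diff_Suc)
  qed
  then obtain b where b: "b \<in> Ext_carrier E k X (Y m)" "Ext_push E k (p m) b = a"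
    using Ext_exact_right[OF c Suc.prems(2)] by blast
  have "Ext_vanishes E k X (Y m)" using Suc.prems(4)[of m] by simp
  then show ?case using Ext_vanishesD[OF _ b(1)] Ext_push_Ext_zero[OF confD(3)[OF c] X] b(2) by auto
qed simp

lemma chain_con_surj:
  assumes r: "resolution E K Y i p n"
    and a: "a \<in> Ext_carrier E (k + Suc s) X (K 0)" "Ext_push E (k + Suc s) (i 0) a = Ext_zero E (k + Suc s) X (Y 0)"
    and s: "s \<le> n" and V: "\<And>t. t < s \<Longrightarrow> Ext_vanishes E (k + (s - t)) X (Y (Suc t))"
  obtains b where "b \<in> Ext_carrier E k X (K (Suc s))" "chain_con E i p (Suc s) k b = a"
proof -
  have "t \<le> s \<Longrightarrow> \<exists>b\<in>Ext_carrier E (k + (s - t)) X (K (Suc t)).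
    chain_con E i p (Suc t) (k + (s - t)) b = a" for t
  proof (induction t)
    case 0
    have c: "conf E (K 0) (Y 0) (K (Suc 0)) (i 0) (p 0)" using resolutionD[OF r] by simp
    obtain g where "g \<in> Ext_carrier E (k + s) X (K (Suc 0))" "con E (k + s) (i 0) (p 0) g = a"
      using Ext_exact_left[OF c, of a "k + s" X] a by auto
    then show ?case by auto
  next
    case (Suc t)
    then obtain b where b: "b \<in> Ext_carrier E (k + (s - t)) X (K (Suc t))"
      "chain_con E i p (Suc t) (k + (s - t)) b = a" by auto
    have d: "k + (s - t) = Suc (k + (s - Suc t))" using Suc.prems by simp
    have c: "conf E (K (Suc t)) (Y (Suc t)) (K (Suc (Suc t))) (i (Suc t)) (p (Suc t))"
      using resolutionD[OF r, of "Suc t"] Suc.prems s by simp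
    have "Ext_push E (k + (s - t)) (i (Suc t)) b = Ext_zero E (k + (s - t)) X (Y (Suc t))"
      using Ext_vanishesD[OF V Ext_push_closed[OF confD(2)[OF c] b(1)]] Suc.prems by simp
    then obtain g where g: "g \<in> Ext_carrier E (k + (s - Suc t)) X (K (Suc (Suc t)))"
      "con E (k + (s - Suc t)) (i (Suc t)) (p (Suc t)) g = b"
      using Ext_exact_left[OF c] b(1) unfolding d by blast
    have "chain_con E i p (Suc (Suc t)) (k + (s - Suc t)) g = a"
      using b(2) g(2) unfolding d by simp
    then show ?case using g(1) by blast
  qed
  from this[of s] show ?thesis using that by auto
qed

lemma push_chain_con:
  assumes r: "resolution E K Y i p n" and a: "a \<in> Ext_carrier E k X (K (Suc n))"
  shows "Ext_push E (k + Suc n) (i 0) (chain_con E i p (Suc n) k a) = Ext_zero E (k + Suc n) X (Y 0)"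
proof -
  let ?b = "chain_con E (\<lambda>j. i (Suc j)) (\<lambda>j. p (Suc j)) n k a"
  have c: "conf E (K 0) (Y 0) (K 1) (i 0) (p 0)" using resolutionD[OF r, of 0] by simp
  have "?b \<in> Ext_carrier E (k + n) X (K 1)"
  proof (cases n)
    case 0
    then show ?thesis using a by simp
  next
    case (Suc m)
    then show ?thesis using chain_con_closed[OF resolution_shift, of K Y i p m n a k X] r a by simp
  qed
  from push_con[OF c this] show ?thesis using chain_con_shift[of E i p n k a] by simp
qed

end

section \<open>The long sequence of an admissible sequence\<close>

lemma kernel_Ext: "kernel (Ext E k X A) (Ext E l X B) f = {x \<in> Ext_carrier E k X A. f x = Ext_zero E l X B}"
  by (simp add: kernel_def)

definition cov_pos :: "nat \<Rightarrow> nat \<Rightarrow> nat \<Rightarrow> nat"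
  where "cov_pos n q j = q * (n + 2) + j"

lemma cov_pos_Suc: "Suc (cov_pos n q j) = cov_pos n q (Suc j)"
    and cov_pos_next: "cov_pos n q (Suc (Suc n)) = cov_pos n (Suc q) 0"
  by (simp_all add: cov_pos_def)

lemma mod_add_mult: "a < b \<Longrightarrow> (a + c * b) mod b = a" for a b c :: nat
  by simp

lemma cov_pos_div_mod:
  assumes "j < n + 2"
  shows "cov_pos n q j div (n + 2) = q" "cov_pos n q j mod (n + 2) = j"
proof -
  have "(q * b + j) div b = q \<and> (q * b + j) mod b = j" if "j < b" for b using that by simp
  from this[OF assms] show "cov_pos n q j div (n + 2) = q" "cov_pos n q j mod (n + 2) = j"
    by (simp_all only: cov_pos_def)
qed

lemma cov_pos_cases:
  obtains q j where "m = cov_pos n q j" "j < n + 2"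
proof
  show "m = cov_pos n (m div (n + 2)) (m mod (n + 2))" by (simp only: cov_pos_def div_mult_mod_eq)
  show "m mod (n + 2) < n + 2" by simp
qed

lemma cov_at:
  assumes "j < n + 2"
  shows cov_group_at: "cov_group E n X ys (cov_pos n q j) = Ext E (q * n) X (seq_obj E ys j)"
    and cov_map_row: "j \<le> n \<Longrightarrow> cov_map E n ys (cov_pos n q j) = Ext_push E (q * n) (ys ! j)"
    and cov_map_end: "j = Suc n \<Longrightarrow>
      cov_map E n ys (cov_pos n q j) = yoneda_product E n (q * n) (ext_class E ys)"
  unfolding cov_group_def cov_map_def Let_def cov_pos_div_mod[OF assms] by auto

definition cov_exact_row :: "('o, 'm, 'x) exact_cat_scheme \<Rightarrow> 'o \<Rightarrow> 'm list \<Rightarrow> nat \<Rightarrow> nat \<Rightarrow> bool"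
  where "cov_exact_row E X ys k j \<longleftrightarrow>
    Ext_push E k (ys ! j) ` Ext_carrier E k X (seq_obj E ys j)
    = {x \<in> Ext_carrier E k X (seq_obj E ys (Suc j)).
        Ext_push E k (ys ! Suc j) x = Ext_zero E k X (seq_obj E ys (Suc (Suc j)))}"

lemma long_exact_cov_iff:
  assumes n: "n \<ge> 1"
  shows "long_exact (cov_group E n X ys) (cov_map E n ys) \<longleftrightarrow>
    {x \<in> Ext_carrier E 0 X (seq_obj E ys 0). Ext_push E 0 (ys ! 0) x = Ext_zero E 0 X (seq_obj E ys 1)}
      = {Ext_zero E 0 X (seq_obj E ys 0)} \<and>
    (\<forall>q. (\<forall>j<n. cov_exact_row E X ys (q * n) j) \<and>
      Ext_push E (q * n) (ys ! n) ` Ext_carrier E (q * n) X (seq_obj E ys n) =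
        {x \<in> Ext_carrier E (q * n) X (seq_obj E ys (Suc n)).
          yoneda_product E n (q * n) (ext_class E ys) x = Ext_zero E (q * n + n) X (seq_obj E ys 0)} \<and>
      yoneda_product E n (q * n) (ext_class E ys) ` Ext_carrier E (q * n) X (seq_obj E ys (Suc n)) =
        {x \<in> Ext_carrier E (q * n + n) X (seq_obj E ys 0).
          Ext_push E (q * n + n) (ys ! 0) x = Ext_zero E (q * n + n) X (seq_obj E ys 1)})"
    (is "?L \<longleftrightarrow> ?K \<and> (\<forall>q. (\<forall>j<n. ?A q j) \<and> ?B q \<and> ?C q)")
proof -
  let ?G = "cov_group E n X ys" and ?f = "cov_map E n ys"
  have Sq: "Suc q * n = q * n + n" for q by simp
  define ex where "ex m \<longleftrightarrow> ?f m ` carrier (?G m) = kernel (?G (Suc m)) (?G (Suc (Suc m))) (?f (Suc m))" for m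
  have A: "ex (cov_pos n q j) \<longleftrightarrow> ?A q j" if j: "j < n" for q j
  proof -
    have *: "j < n + 2" "Suc j < n + 2" "Suc (Suc j) < n + 2" "j \<le> n" "Suc j \<le> n" using j by auto
    show ?thesis
      unfolding ex_def cov_pos_Suc cov_group_at[OF *(1)] cov_group_at[OF *(2)] cov_group_at[OF *(3)]
        cov_map_row[OF *(1,4)] cov_map_row[OF *(2,5)] kernel_Ext Ext_simps cov_exact_row_def ..
  qed
  have l: "0 < n + 2" "Suc 0 < n + 2" "n < n + 2" "Suc n < n + 2" "0 \<le> n" "Suc 0 \<le> n" using n by auto
  have B: "ex (cov_pos n q n) \<longleftrightarrow> ?B q" for q
    unfolding ex_def cov_pos_Suc cov_pos_next cov_group_at[OF l(1)] cov_group_at[OF l(3)]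
      cov_group_at[OF l(4)] cov_map_row[OF l(3) order_refl] cov_map_end[OF l(4) refl] kernel_Ext
      Ext_simps Sq ..
  have C: "ex (cov_pos n q (Suc n)) \<longleftrightarrow> ?C q" for q
    unfolding ex_def cov_pos_Suc cov_pos_next cov_group_at[OF l(1)] cov_group_at[OF l(2)]
      cov_group_at[OF l(4)] cov_map_row[OF l(1,5)] cov_map_end[OF l(4) refl] kernel_Ext
      Ext_simps Sq One_nat_def ..
  have K: "kernel (?G 0) (?G 1) (?f 0) = {\<one>\<^bsub>?G 0\<^esub>} \<longleftrightarrow> ?K"
    using cov_group_at[OF l(1), where q = 0, of E X ys] cov_group_at[OF l(2), where q = 0, of E X ys]
      cov_map_row[OF l(1,5), where q = 0, of E ys]
    by (simp add: kernel_Ext cov_pos_def)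
  have "(\<forall>m. ex m) \<longleftrightarrow> (\<forall>q. (\<forall>j<n. ?A q j) \<and> ?B q \<and> ?C q)"
  proof
    assume all: "\<forall>m. ex m"
    show "\<forall>q. (\<forall>j<n. ?A q j) \<and> ?B q \<and> ?C q"
    proof (intro allI conjI impI)
      fix q
      show "?A q j" if "j < n" for j using A[OF that, of q] all by blast
      show "?B q" using B[of q] spec[OF all, of "cov_pos n q n"] by (rule iffD1)
      show "?C q" using C[of q] spec[OF all, of "cov_pos n q (Suc n)"] by (rule iffD1)
    qed
  next
    assume all: "\<forall>q. (\<forall>j<n. ?A q j) \<and> ?B q \<and> ?C q"
    show "\<forall>m. ex m"
    proof
      fix m
      obtain q j where m: "m = cov_pos n q j" and j: "j < n + 2" by (rule cov_pos_cases)
      from j consider "j < n" | "j = n" | "j = Suc n" by linarith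
      then show "ex m"
      proof cases
        case 1
        show ?thesis unfolding m A[OF 1] using spec[OF all, of q] 1 by blast
      next
        case 2
        show ?thesis unfolding m 2 B using spec[OF all, of q] by (elim conjE)
      next
        case 3
        show ?thesis unfolding m 3 C using spec[OF all, of q] by (elim conjE)
      qed
    qed
  qed
  then show ?thesis using K unfolding long_exact_def ex_def One_nat_def by (intro conj_cong) simp_all
qed

context exact_category_without_extra_fields
begin

text \<open>
  At the middle terms of a row in degree \<open>q n\<close>, the obstructions lie in
  \<open>Ext\<close> groups of the \<open>K\<^sub>j\<close> in degrees \<open>q n - 1\<close>
  and \<open>q n + 1\<close>, which vanish by shifting to the right and to the left end. Between
  two rows, the connecting map passes through the degrees strictly between \<open>q n\<close>
  and \<open>(q + 1) n\<close>, where the middle terms contribute nothing; so only its first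
  factor affects the kernel and only its last factor the image.
\<close>

lemma long_exact_cov_if_vanishing:
  assumes n: "n \<ge> 1" and ys: "acyclic_seq E ys" "length ys = n + 1" and X: "X \<in> obj E"
    and V: "\<And>m j. \<not> n dvd m \<Longrightarrow> j \<le> n + 1 \<Longrightarrow> Ext_vanishes E m X (seq_obj E ys j)"
  shows "long_exact (cov_group E n X ys) (cov_map E n ys)"
proof -
  obtain n' where n': "n = Suc n'" using n by (cases n) auto
  have "ys \<in> extensions E (Suc n') (tgt E (last ys)) (src E (hd ys))"
    using ys n' by (simp add: extensions_def)
  then obtain K Y i p where r: "resolution E K Y i p n'" and e: "ys = spliced E i p n'"
    using extensions_spliced by blast
  note so = seq_obj_spliced[OF r, folded e]
  note c = resolutionD[OF r]
  have VK: "Ext_vanishes E m X (K 0)" "Ext_vanishes E m X (K n)" if "\<not> n dvd m" for m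
    using V[OF that, of 0] V[OF that, of "n + 1"] so(1,3) n' by simp_all
  have VY: "Ext_vanishes E m X (Y j)" if "\<not> n dvd m" "j \<le> n'" for m j
    using V[OF that(1), of "Suc j"] so(2)[OF that(2)] that n' by simp
  have row: "cov_exact_row E X ys (q * n) j" if j: "j < n" for q j
    unfolding cov_exact_row_def e
  proof (rule resolution_row_exact[OF r X])
    show "j \<le> n'" using j n' by simp
    show "Ext_vanishes E (q * n - 1) X (K (Suc (Suc j)))" if "j < n'" "q * n > 0"
    proof (rule resolution_vanishes_from_right[OF r X, of "q * n"])
      have "(q * n - 1) mod n = n - 1"
      proof -
        obtain q' where "q = Suc q'" using \<open>q * n > 0\<close> by (cases q) auto
        then have "q * n - 1 = n' + q' * n" using n' by simp
        then show ?thesis using mod_add_mult[of n' n q'] n' by (simp del: mult_Suc_right)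
      qed
      then show "Suc n' - Suc (Suc j) < (q * n - 1) mod Suc n'" using n' that by simp
    qed (use VK VY n' that in auto)
    show "Ext_vanishes E (Suc (q * n)) X (K (j - 1))" if "j > 0"
    proof (rule resolution_vanishes_from_left[OF r X])
      have "Suc (q * n) mod n = 1" using mod_add_mult[of 1 n q] j that by simp
      then show "1 \<le> Suc (q * n) mod Suc n'" "Suc (q * n) mod Suc n' + (j - 1) < Suc n'"
        using n' j that by simp_all
    qed (use VK VY n' in auto)
  qed
  have nd: "\<not> n dvd q * n + t" if "0 < t" "t < n" for q t
    using that by (simp add: dvd_eq_mod_eq_0)
  have yp: "yoneda_product E n k (ext_class E ys) a = chain_con E i p n k a"
    if "a \<in> Ext_carrier E k X (K n)" for k a
    using yoneda_product_chain_con[OF r] that unfolding e n' by blast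
  have soe: "seq_obj E ys (Suc n) = K n" "seq_obj E ys n = Y n'" "seq_obj E ys 0 = K 0" "seq_obj E ys 1 = Y 0"
    using so(1) so(2)[of n'] so(2)[of 0] so(3) n' by simp_all
  have y0: "ys ! 0 = i 0" "ys ! n = p n'" unfolding e n' by (simp_all add: nth_spliced)
  have cn: "conf E (K n') (Y n') (K n) (i n') (p n')" using c[of n'] n' by simp
  have c0: "conf E (K 0) (Y 0) (K 1) (i 0) (p 0)" using c[of 0] by simp
  have obK: "K 0 \<in> obj E" "Y 0 \<in> obj E" "Y n' \<in> obj E" "K n \<in> obj E" using confD[OF c0] confD[OF cn] by auto
  have B: "Ext_push E k (p n') ` Ext_carrier E k X (Y n') =
      {x \<in> Ext_carrier E k X (K n). chain_con E i p n k x = Ext_zero E (k + n) X (K 0)}"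
    if k: "k = q * n" for k q
  proof (rule Set.set_eqI, rule iffI)
    fix x assume "x \<in> Ext_push E k (p n') ` Ext_carrier E k X (Y n')"
    then obtain b where b: "b \<in> Ext_carrier E k X (Y n')" "x = Ext_push E k (p n') b" by blast
    have "con E k (i n') (p n') x = Ext_zero E (Suc k) X (K n')" using con_push[OF cn b(1)] b(2) by simp
    then have "chain_con E i p n k x = Ext_zero E (k + n) X (K 0)"
      using chain_con_zero[OF r _ X, of n' "Suc k"] n' by simp
    then show "x \<in> {x \<in> Ext_carrier E k X (K n). chain_con E i p n k x = Ext_zero E (k + n) X (K 0)}"
      using Ext_push_closed[OF confD(3)[OF cn] b(1)] b(2) by simp
  next
    fix x assume "x \<in> {x \<in> Ext_carrier E k X (K n). chain_con E i p n k x = Ext_zero E (k + n) X (K 0)}"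
    then have x: "x \<in> Ext_carrier E k X (K n)" "chain_con E i p n k x = Ext_zero E (k + n) X (K 0)" by auto
    have "con E k (i n') (p n') x = Ext_zero E (Suc k) X (K n')"
    proof (rule chain_con_trivial_kernel[OF r])
      show "con E k (i n') (p n') x \<in> Ext_carrier E (Suc k) X (K n')" using con_closed[OF cn x(1)] .
      show "chain_con E i p n' (Suc k) (con E k (i n') (p n') x) = Ext_zero E (Suc k + n') X (K 0)"
        using x(2) n' by simp
      fix j assume j: "j < n'"
      have "Suc k + (n' - Suc j) = q * n + (n' - j)" using j k by simp
      then show "Ext_vanishes E (Suc k + (n' - Suc j)) X (Y j)"
        using VY[OF nd[of "n' - j" q], of j] j n' by simp
    qed simp
    then show "x \<in> Ext_push E k (p n') ` Ext_carrier E k X (Y n')"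
      using Ext_exact_right[OF cn x(1)] by blast
  qed
  have C: "chain_con E i p n k ` Ext_carrier E k X (K n) =
      {x \<in> Ext_carrier E (k + n) X (K 0). Ext_push E (k + n) (i 0) x = Ext_zero E (k + n) X (Y 0)}"
    if k: "k = q * n" for k q
  proof (rule Set.set_eqI, rule iffI)
    fix x assume "x \<in> chain_con E i p n k ` Ext_carrier E k X (K n)"
    then obtain b where b: "b \<in> Ext_carrier E k X (K n)" "x = chain_con E i p n k b" by blast
    then show "x \<in> {x \<in> Ext_carrier E (k + n) X (K 0). Ext_push E (k + n) (i 0) x = Ext_zero E (k + n) X (Y 0)}"
      using push_chain_con[OF r] chain_con_closed[OF r, of n b k X] n' by simp
  next
    fix x assume x: "x \<in> {x \<in> Ext_carrier E (k + n) X (K 0). Ext_push E (k + n) (i 0) x = Ext_zero E (k + n) X (Y 0)}"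
    have V': "Ext_vanishes E (k + (n' - t)) X (Y (Suc t))" if "t < n'" for t
      using VY[OF nd[of "n' - t" q], of "Suc t"] that n' k by simp
    have x': "x \<in> Ext_carrier E (k + Suc n') X (K 0)"
      "Ext_push E (k + Suc n') (i 0) x = Ext_zero E (k + Suc n') X (Y 0)"
      using x n' by auto
    obtain b where "b \<in> Ext_carrier E k X (K (Suc n'))" "chain_con E i p (Suc n') k b = x"
      by (rule chain_con_surj[OF r x' order_refl V']) (assumption | rule that)+
    then show "x \<in> chain_con E i p n k ` Ext_carrier E k X (K n)" using n' by blast
  qed
  have "{x \<in> Ext_carrier E 0 X (K 0). Ext_push E 0 (i 0) x = Ext_zero E 0 X (Y 0)} = {Ext_zero E 0 X (K 0)}"
    (is "?S = _")
  proof (rule Set.set_eqI, rule iffI)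
    fix x assume "x \<in> ?S"
    then show "x \<in> {Ext_zero E 0 X (K 0)}" using inflation_push_trivial_kernel[OF c0, of x 0 X] by simp
  next
    fix x assume "x \<in> {Ext_zero E 0 X (K 0)}"
    then show "x \<in> ?S"
      using Ext_zero_closed[OF X obK(1), of 0] Ext_push_Ext_zero[OF confD(2)[OF c0] X, of 0] by simp
  qed
  moreover have "{x \<in> Ext_carrier E k X (K n). yoneda_product E n k (ext_class E ys) x = z}
      = {x \<in> Ext_carrier E k X (K n). chain_con E i p n k x = z}" for k z
    using yp by auto
  moreover have "yoneda_product E n k (ext_class E ys) ` Ext_carrier E k X (K n)
      = chain_con E i p n k ` Ext_carrier E k X (K n)" for k
    using yp by auto
  ultimately show ?thesis
    unfolding long_exact_cov_iff[OF n] soe y0 using row B[OF refl] C[OF refl] by simp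
qed

end

section \<open>Duality for Ext and for the long sequences\<close>

lemma long_exact_transfer:
  assumes h: "inj h" and car: "\<And>m. carrier (G' m) = h ` carrier (G m)"
    and one: "\<And>m. one (G' m) = h (one (G m))"
    and map: "\<And>m a. a \<in> carrier (G m) \<Longrightarrow> \<phi>' m (h a) = h (\<phi> m a)"
  shows "long_exact G' \<phi>' \<longleftrightarrow> long_exact G \<phi>"
proof -
  have ker: "kernel (G' m) (G' m') (\<phi>' m) = h ` kernel (G m) (G m') (\<phi> m)" for m m'
    using map by (auto simp: kernel_def car one inj_eq[OF h])
  have im: "\<phi>' m ` carrier (G' m) = h ` (\<phi> m ` carrier (G m))" for m
    using map by (force simp: car image_image)
  have s: "{h x} = h ` {x}" for x by simp
  show ?thesis unfolding long_exact_def ker im one s inj_image_eq_iff[OF h] ..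
qed

context exact_category_without_extra_fields
begin

lemma Ext_carrier_rev: "Ext_carrier (op_cat E) k A X = (\<lambda>a. rev ` a) ` Ext_carrier E k X A"
proof (cases "k = 0")
  case True
  then show ?thesis by (simp add: Ext_carrier_0 image_image hom_elem_def)
next
  case False
  then have k: "k > 0" by simp
  have "extensions (op_cat E) k A X = rev ` extensions E k X A"
  proof (rule Set.set_eqI)
    fix xs
    show "xs \<in> extensions (op_cat E) k A X \<longleftrightarrow> xs \<in> rev ` extensions E k X A"
      using extensions_rev_iff[of "rev xs" k A X] by (force simp: image_iff)
  qed
  then show ?thesis by (simp add: Ext_carrier_pos[OF k] exact_category.Ext_carrier_pos[OF exact_category_op k]
    image_image ext_class_rev)
qed

lemma trivial_extension_rev:
  assumes k: "k > 0" and X: "X \<in> obj E" "A \<in> obj E" and t: "trivial_extension E k X A ts"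
  shows "trivial_extension (op_cat E) k A X (rev ts)"
proof (cases "k = 1")
  case True
  obtain P i1 i2 p1 p2 where b: "biproduct E A X P i1 i2 p1 p2" "ts = [i1, p2]"
    using t True by (auto simp: trivial_extension_def)
  have "biproduct (op_cat E) X A P p2 p1 i2 i1" using biproduct_swap[OF b(1)] by (simp add: op_biproduct)
  then show ?thesis using True b(2) by (auto simp: trivial_extension_def)
next
  case False
  then have t': "length ts = Suc k" "ts ! 0 = ident E A" "ts ! k = ident E X"
    "\<And>j. 1 \<le> j \<Longrightarrow> j < k \<Longrightarrow> ts ! j = zero E (seq_obj E ts j) (seq_obj E ts (Suc j))"
    "\<And>j. 2 \<le> j \<Longrightarrow> j < k \<Longrightarrow> zero_object E (seq_obj E ts j)"
    using t by (auto simp: trivial_extension_def)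
  have p: "path E ts" using extensions_path[OF Ext_zero_trivial(1)[OF k X t]] .
  have so: "seq_obj (op_cat E) (rev ts) j = seq_obj E ts (Suc k - j)" if "j \<le> Suc k" for j
    using seq_obj_rev[OF p, of j] that t'(1) by simp
  have "is_seq (op_cat E) (rev ts)"
    unfolding is_seq_def using path_nth[OF path_rev[OF p]] t'(1) by auto
  moreover have "rev ts ! 0 = ident E X" "rev ts ! k = ident E A"
    using t' by (simp_all add: rev_nth)
  moreover have "rev ts ! j = zero E (seq_obj (op_cat E) (rev ts) (Suc j)) (seq_obj (op_cat E) (rev ts) j)"
    if "1 \<le> j" "j < k" for j
    using t'(1) t'(4)[of "k - j"] so[of j] so[of "Suc j"] that by (simp add: rev_nth Suc_diff_le)
  moreover have "zero_object E (seq_obj (op_cat E) (rev ts) j)" if "2 \<le> j" "j < k" for j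
    using t'(5)[of "Suc k - j"] so[of j] that by simp
  ultimately show ?thesis using False t'(1) by (simp add: trivial_extension_def op_zero_object)
qed

lemma Ext_zero_rev:
  assumes X: "X \<in> obj E" "A \<in> obj E"
  shows "Ext_zero (op_cat E) k A X = rev ` Ext_zero E k X A"
proof (cases "k = 0")
  case True
  then show ?thesis
    by (simp add: Ext_zero_0 exact_category.Ext_zero_0[OF exact_category_op] hom_elem_def)
next
  case False
  then have k: "k > 0" by simp
  obtain ts where t: "trivial_extension E k X A ts" using trivial_extension_exists[OF k X] .
  show ?thesis
    using Ext_zero_trivial(2)[OF k X t] ext_class_rev[of ts]
      exact_category.Ext_zero_trivial(2)[OF exact_category_op k _ _ trivial_extension_rev[OF k X t]] X
    by simp
qed

lemma Ext_vanishes_rev: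
  assumes X: "X \<in> obj E" "A \<in> obj E"
  shows "Ext_vanishes (op_cat E) k A X \<longleftrightarrow> Ext_vanishes E k X A"
proof -
  have inj: "inj (\<lambda>a :: 'm list set. rev ` a)" by (auto intro!: injI simp: inj_image_eq_iff)
  have "{rev ` Ext_zero E k X A} = (\<lambda>a. rev ` a) ` {Ext_zero E k X A}" by simp
  then show ?thesis
    unfolding Ext_vanishes_def Ext_simps Ext_carrier_rev Ext_zero_rev[OF X]
    by (simp only: inj_image_eq_iff[OF inj])
qed

lemma Ext_push_rev:
  assumes "k > 0"
  shows "Ext_pull (op_cat E) k f (rev ` a) = rev ` Ext_push E k f a"
  using exact_category_without_extra_fields.Ext_pull_rev[OF op_without_extra_fields assms, of f "rev ` a"]
  by (simp add: image_image)

lemma yoneda_product_rev: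
  assumes n: "n > 0" and ys: "ys \<in> extensions E n D K" and b: "b \<in> Ext_carrier E k K A"
  shows "yoneda_product (op_cat E) n k (ext_class (op_cat E) (rev ys)) (rev ` b)
    = rev ` yoneda_product E k n b (ext_class E ys)"
  using b
proof (cases rule: Ext_carrier_cases)
  case (Hom g)
  have "rev ` b = hom_elem g" using Hom(3) by (simp add: hom_elem_def)
  then show ?thesis using Hom n Ext_push_rev[OF n, of g "ext_class E ys"]
    by (simp add: yoneda_product_def ext_class_rev)
next
  case (ext xs)
  have ne: "us \<noteq> []" if "us \<in> b" for us
    using that ext ext_class_extensions[of us xs k K A] mem_ext_class[of us xs] by (auto simp: extensions_def)
  have ne': "us \<noteq> []" if "us \<in> ext_class E ys" for us
    using that ys ext_class_extensions[of us ys n D K] mem_ext_class[of us ys] by (auto simp: extensions_def)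
  have "{ext_class (op_cat E) (Defs.splice (op_cat E) us vs) |us vs. us \<in> rev ` ext_class E ys \<and> vs \<in> rev ` b}
    = (\<lambda>c. rev ` c) ` {ext_class E (Defs.splice E vs us) |vs us. vs \<in> b \<and> us \<in> ext_class E ys}"
    (is "?L = ?R")
  proof (rule Set.set_eqI, rule iffI)
    fix c assume "c \<in> ?L"
    then obtain us vs where *: "c = ext_class (op_cat E) (Defs.splice (op_cat E) (rev us) (rev vs))"
      "us \<in> ext_class E ys" "vs \<in> b" by auto
    then have "c = rev ` ext_class E (Defs.splice E vs us)"
      using splice_rev[OF ne[OF *(3)] ne'[OF *(2)], of E] ext_class_rev by metis
    then show "c \<in> ?R" using * by blast
  next
    fix c assume "c \<in> ?R"
    then obtain us vs where *: "c = rev ` ext_class E (Defs.splice E vs us)"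
      "us \<in> ext_class E ys" "vs \<in> b" by auto
    then have "c = ext_class (op_cat E) (Defs.splice (op_cat E) (rev us) (rev vs))"
      using splice_rev[OF ne[OF *(3)] ne'[OF *(2)], of E] ext_class_rev by metis
    then show "c \<in> ?L" using * by blast
  qed
  then show ?thesis using ext(1) n by (simp add: yoneda_product_def ext_class_rev image_Union)
qed

lemma long_exact_contra_iff_op:
  assumes n: "n \<ge> 1" and ys: "acyclic_seq E ys" "length ys = n + 1" and Y: "Y \<in> obj E"
  shows "long_exact (cov_group (op_cat E) n Y (rev ys)) (cov_map (op_cat E) n (rev ys))
    \<longleftrightarrow> long_exact (contra_group E n ys Y) (contra_map E n ys)"
proof (rule long_exact_transfer[where h = "\<lambda>a. rev ` a"])
  show "inj (\<lambda>a :: 'm list set. rev ` a)" by (auto intro!: injI simp: inj_image_eq_iff)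
  have e: "ys \<in> extensions E n (tgt E (last ys)) (src E (hd ys))" using ys by (simp add: extensions_def)
  note p = extensions_path[OF e]
  have so: "seq_obj (op_cat E) (rev ys) j = seq_obj E ys (n + 1 - j)" if "j \<le> n + 1" for j
    using seq_obj_rev[OF p, of j] that ys(2) by simp
  have ob: "seq_obj E ys j \<in> obj E" if "j \<le> n + 1" for j
  proof (cases "j = n + 1")
    case True
    then show ?thesis using HomD(5)[OF path_nth[OF p, of n]] ys(2) by simp
  next
    case False
    then show ?thesis using HomD(4)[OF path_nth[OF p, of j]] ys(2) that by simp
  qed
  fix m
  define k j where "k = m div (n + 2)" and "j = m mod (n + 2)"
  have jn: "j < n + 2" by (simp add: j_def)
  have g: "cov_group (op_cat E) n Y (rev ys) m = Ext (op_cat E) (k * n) Y (seq_obj E ys (n + 1 - j))"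
    "contra_group E n ys Y m = Ext E (k * n) (seq_obj E ys (n + 1 - j)) Y"
    using so[of j] jn by (simp_all add: cov_group_def contra_group_def Let_def k_def j_def)
  show "carrier (cov_group (op_cat E) n Y (rev ys) m) = (\<lambda>a. rev ` a) ` carrier (contra_group E n ys Y m)"
    unfolding g Ext_simps by (rule Ext_carrier_rev)
  show "\<one>\<^bsub>cov_group (op_cat E) n Y (rev ys) m\<^esub> = rev ` \<one>\<^bsub>contra_group E n ys Y m\<^esub>"
    unfolding g Ext_simps by (rule Ext_zero_rev) (use ob jn Y in auto)
  fix a assume "a \<in> carrier (contra_group E n ys Y m)"
  then have a: "a \<in> Ext_carrier E (k * n) (seq_obj E ys (n + 1 - j)) Y" unfolding g by simp
  show "cov_map (op_cat E) n (rev ys) m (rev ` a) = rev ` contra_map E n ys m a"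
  proof (cases "j \<le> n")
    case True
    have f: "cov_map (op_cat E) n (rev ys) m = Ext_push (op_cat E) (k * n) (ys ! (n - j))"
      "contra_map E n ys m = Ext_pull E (k * n) (ys ! (n - j))"
      unfolding cov_map_def contra_map_def Let_def k_def[symmetric] j_def[symmetric]
      using True ys(2) by (simp_all add: rev_nth)
    show ?thesis
    proof (cases "k * n = 0")
      case True
      then obtain h where "a = hom_elem h" using a by (auto simp: Ext_carrier_def)
      then show ?thesis using f True by (simp add: Ext_push_def Ext_pull_def hom_elem_def elem_hom_def)
    next
      case False
      then show ?thesis using f Ext_pull_rev[of "k * n"] by simp
    qed
  next
    case False
    then have "j = n + 1" using jn by simp
    then have a': "a \<in> Ext_carrier E (k * n) (src E (hd ys)) Y"
      using a ys hd_conv_nth[of ys] by (cases ys) (auto simp: seq_obj_def)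
    show ?thesis
      unfolding cov_map_def contra_map_def Let_def k_def[symmetric] j_def[symmetric]
      using False yoneda_product_rev[OF _ e a'] n by simp
  qed
qed

section \<open>Cluster tilting subcategories\<close>

lemma Ext_vanishes_cokernel:
  assumes c: "conf E A B D i p" and N: "N \<in> obj E"
    and v: "Ext_vanishes E k A N" "Ext_vanishes E (Suc k) B N"
  shows "Ext_vanishes E (Suc k) D N"
proof -
  have "conf (op_cat E) D B A p i" using c by (simp add: op_conf)
  from exact_category.Ext_vanishes_down[OF exact_category_op this, of N k]
  show ?thesis using v N confD[OF c] by (simp add: Ext_vanishes_rev)
qed

lemma Ext_vanishes_cokernel_approximation:
  assumes c: "conf E A B D i p" and N: "N \<in> obj E"
    and ext: "\<And>g. g \<in> Hom E A N \<Longrightarrow> \<exists>h\<in>Hom E B N. h \<cdot> i = g" and v: "Ext_vanishes E 1 B N"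
  shows "Ext_vanishes E 1 D N"
proof -
  have c': "conf (op_cat E) D B A p i" using c by (simp add: op_conf)
  have "Ext_vanishes (op_cat E) (Suc 0) N D"
  proof (rule exact_category.Ext_vanishes_kernel[OF exact_category_op c'])
    show "N \<in> obj (op_cat E)" using N by simp
    show "Ext_vanishes (op_cat E) (Suc 0) N B" using v N confD[OF c] by (simp add: Ext_vanishes_rev)
    fix g assume "g \<in> Ext_carrier (op_cat E) 0 N A"
    then obtain g' where g': "g' \<in> Hom E A N" "g = hom_elem g'" by (auto simp: Ext_carrier_0)
    then obtain h where "h \<in> Hom E B N" "h \<cdot> i = g'" using ext by blast
    then show "\<exists>b\<in>Ext_carrier (op_cat E) 0 N B. Ext_push (op_cat E) 0 i b = g"
      using g'(2) by (intro bexI[of _ "hom_elem h"]) (simp_all add: Ext_carrier_0)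
  qed
  then show ?thesis using N confD[OF c] by (simp add: Ext_vanishes_rev)
qed

lemma cluster_tilting_op:
  assumes ct: "cluster_tilting E n M"
  shows "cluster_tilting (op_cat E) n M"
proof -
  have M: "M \<subseteq> obj E" using ct by (simp add: cluster_tilting_def additive_subcategory_def)
  have inv: "iso_arr E B A f \<Longrightarrow> \<exists>g. iso_arr E A B g" for A B f by (metis iso_arr_inverse)
  have s: "\<And>A B f. A \<in> M \<Longrightarrow> iso_arr E A B f \<Longrightarrow> B \<in> M" "\<exists>Z\<in>M. zero_object E Z"
    "\<And>A B P i1 i2 p1 p2. A \<in> M \<Longrightarrow> B \<in> M \<Longrightarrow> biproduct E A B P i1 i2 p1 p2 \<Longrightarrow> P \<in> M"
    using ct unfolding cluster_tilting_def additive_subcategory_def by blast+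
  have "additive_subcategory (op_cat E) M"
    unfolding additive_subcategory_def op_iso_arr op_zero_object op_biproduct op_simps
    using M s(1)[OF _ ] s(2) s(3) inv by (intro conjI allI impI) (blast, blast, blast, blast)
  moreover have "left_approximation (op_cat E) M X f \<longleftrightarrow> right_approximation E M X f"
    "right_approximation (op_cat E) M X f \<longleftrightarrow> left_approximation E M X f" for X f
    by (simp_all add: left_approximation_def right_approximation_def)
  moreover have "{X \<in> obj E. \<forall>i. 1 \<le> i \<and> i \<le> n - 1 \<longrightarrow> (\<forall>N\<in>M. Ext_vanishes (op_cat E) i X N)}
      = {X \<in> obj E. \<forall>i. 1 \<le> i \<and> i \<le> n - 1 \<longrightarrow> (\<forall>N\<in>M. Ext_vanishes E i N X)}"
    using M Ext_vanishes_rev by blast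
  moreover have "{X \<in> obj E. \<forall>i. 1 \<le> i \<and> i \<le> n - 1 \<longrightarrow> (\<forall>N\<in>M. Ext_vanishes (op_cat E) i N X)}
      = {X \<in> obj E. \<forall>i. 1 \<le> i \<and> i \<le> n - 1 \<longrightarrow> (\<forall>N\<in>M. Ext_vanishes E i X N)}"
    using M Ext_vanishes_rev by blast
  ultimately show ?thesis
    using ct unfolding cluster_tilting_def by (simp add: op_inflation op_deflation)
qed

lemma Z_cluster_tilting_op:
  assumes ct: "cluster_tilting E n M"
  shows "Z_cluster_tilting (op_cat E) n M \<longleftrightarrow> Z_cluster_tilting E n M"
proof -
  have M: "M \<subseteq> obj E" using ct by (simp add: cluster_tilting_def additive_subcategory_def)
  then have "(\<exists>N\<in>M. \<exists>N'\<in>M. \<not> Ext_vanishes (op_cat E) k N N') \<longleftrightarrow>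
    (\<exists>N\<in>M. \<exists>N'\<in>M. \<not> Ext_vanishes E k N N')" for k
    using Ext_vanishes_rev by blast
  then show ?thesis using ct cluster_tilting_op[OF ct] by (simp add: Z_cluster_tilting_def)
qed

lemma admissible_n_exact_op:
  "admissible_n_exact E n M ys \<Longrightarrow> admissible_n_exact (op_cat E) n M (rev ys)"
proof -
  assume a: "admissible_n_exact E n M ys"
  then have ys: "acyclic_seq E ys" "length ys = n + 1" "\<And>j. j \<le> n + 1 \<Longrightarrow> seq_obj E ys j \<in> M"
    by (auto simp: admissible_n_exact_def)
  have "ys \<in> extensions E n (tgt E (last ys)) (src E (hd ys))" using ys by (simp add: extensions_def)
  note p = extensions_path[OF this]
  show ?thesis
    using acyclic_rev[OF ys(1)] ys(2,3) seq_obj_rev[OF p] by (simp add: admissible_n_exact_def)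
qed

lemma cluster_tilting_mem:
  assumes "cluster_tilting E n M" "X \<in> obj E"
    "\<And>k N. 1 \<le> k \<Longrightarrow> k \<le> n - 1 \<Longrightarrow> N \<in> M \<Longrightarrow> Ext_vanishes E k X N"
  shows "X \<in> M"
proof -
  have "M = {X \<in> obj E. \<forall>i. 1 \<le> i \<and> i \<le> n - 1 \<longrightarrow> (\<forall>N\<in>M. Ext_vanishes E i X N)}"
    using assms(1) by (simp add: cluster_tilting_def)
  then show ?thesis using assms(2,3) by blast
qed

lemma cluster_tilting_vanishes:
  assumes "cluster_tilting E n M" "X \<in> M" "N \<in> M" "1 \<le> k" "k \<le> n - 1"
  shows "Ext_vanishes E k X N"
proof -
  have "M = {X \<in> obj E. \<forall>i. 1 \<le> i \<and> i \<le> n - 1 \<longrightarrow> (\<forall>N\<in>M. Ext_vanishes E i X N)}"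
    using assms(1) by (simp add: cluster_tilting_def)
  then show ?thesis using assms(2-5) by blast
qed

lemma cluster_tilting_obj: "cluster_tilting E n M \<Longrightarrow> X \<in> M \<Longrightarrow> X \<in> obj E"
  unfolding cluster_tilting_def additive_subcategory_def by blast

lemma cluster_tilting_left_approximation:
  assumes "cluster_tilting E n M" "X \<in> obj E"
  obtains Y D i p where "conf E X Y D i p" "Y \<in> M"
    "\<forall>N\<in>M. \<forall>g\<in>Hom E X N. \<exists>h\<in>Hom E Y N. h \<cdot> i = g"
proof -
  have "\<forall>X\<in>obj E. \<exists>f. left_approximation E M X f \<and> inflation E f"
    using assms(1) by (simp add: cluster_tilting_def)
  then obtain f where f: "left_approximation E M X f" "inflation E f" using assms(2) by blast
  then obtain Y where Y: "Y \<in> M" "f \<in> Hom E X Y"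
    "\<forall>N\<in>M. (\<lambda>h. h \<cdot> f) ` Hom E Y N = Hom E X N"
    unfolding left_approximation_def by blast
  obtain D p where c: "conf E X Y D f p" using inflation_conf[OF f(2) Y(2)] .
  have "\<exists>h\<in>Hom E Y N. h \<cdot> f = g" if "N \<in> M" "g \<in> Hom E X N" for N g
    using bspec[OF Y(3) that(1)] that(2) by (metis (no_types, lifting) imageE)
  then show ?thesis using that[OF c Y(1)] by blast
qed

text \<open>
  The cokernel \<open>K\<^sub>1\<close> of an inflation \<open>N \<rightarrow> Y\<^sub>0\<close>
  between objects of \<open>M\<close> may have \<open>Ext\<^sup>1(K\<^sub>1, M) \<noteq>
  0\<close>, but higher \<open>Ext\<close> vanishes in the range that is tested for membership
  in \<open>M\<close>. Each left approximation kills \<open>Ext\<^sup>1\<close> of the next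
  cokernel and moves the obstruction one degree up, until it has left this range.
\<close>

lemma cluster_tilting_resolution:
  assumes ct: "cluster_tilting E (Suc n) M" and n: "n \<ge> 1" and N: "N \<in> M"
    and c0: "conf E N Y0 D0 f q" and Y0: "Y0 \<in> M"
  obtains K Y i p where "resolution E K Y i p n" "K 0 = N" "i 0 = f" "Y 0 = Y0" "K (Suc n) \<in> M"
    "\<And>j. j \<le> n \<Longrightarrow> Y j \<in> M"
proof -
  note ob = cluster_tilting_obj[OF ct]
  define P where "P X t \<longleftrightarrow> (case t of (Y, D, i, p) \<Rightarrow> conf E X Y D i p \<and> Y \<in> M \<and>
    (\<forall>N\<in>M. \<forall>g\<in>Hom E X N. \<exists>h\<in>Hom E Y N. h \<cdot> i = g))" for X t
  have "\<exists>t. P X t" if X: "X \<in> obj E" for X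
  proof -
    obtain Y D i p where "conf E X Y D i p" "Y \<in> M"
      "\<forall>N\<in>M. \<forall>g\<in>Hom E X N. \<exists>h\<in>Hom E Y N. h \<cdot> i = g"
      using cluster_tilting_left_approximation[OF ct X] .
    then have "P X (Y, D, i, p)" by (simp add: P_def)
    then show ?thesis by blast
  qed
  then obtain F where F: "\<And>X. X \<in> obj E \<Longrightarrow> P X (F X)" by metis
  define K where "K = rec_nat D0 (\<lambda>_ X. fst (snd (F X)))"
  define Y where "Y j = fst (F (K j))" for j
  define i where "i j = fst (snd (snd (F (K j))))" for j
  define p where "p j = snd (snd (snd (F (K j))))" for j
  have K: "K 0 = D0" "K (Suc j) = fst (snd (F (K j)))" for j by (simp_all add: K_def)
  have step: "conf E (K j) (Y j) (K (Suc j)) (i j) (p j) \<and> Y j \<in> M \<and>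
    (\<forall>N\<in>M. \<forall>g\<in>Hom E (K j) N. \<exists>h\<in>Hom E (Y j) N. h \<cdot> i j = g)" if "K j \<in> obj E" for j
    using F[OF that] by (simp add: P_def K Y_def i_def p_def split: prod.splits)
  have Kob: "K j \<in> obj E" for j
  proof (induction j)
    case 0
    then show ?case using confD[OF c0] K(1) by simp
  next
    case (Suc j)
    then show ?case using confD(13)[OF conjunct1[OF step[OF Suc]]] by blast
  qed
  note S = step[OF Kob]
  have van: "Ext_vanishes E s (K j) N'" if "1 \<le> s" "s \<le> n" "s \<noteq> Suc j" "N' \<in> M" for j s N'
    using that
  proof (induction j arbitrary: s)
    case 0
    then obtain s' where s': "s = Suc s'" "1 \<le> s'" by (cases s) auto
    have "Ext_vanishes E s' N N'" "Ext_vanishes E s Y0 N'"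
      using cluster_tilting_vanishes[OF ct] N Y0 0 s' by auto
    then show ?case using Ext_vanishes_cokernel[OF c0 ob[OF 0(4)]] s' K(1) by simp
  next
    case (Suc j)
    have Yv: "Ext_vanishes E s (Y j) N'" using cluster_tilting_vanishes[OF ct] S Suc.prems by simp
    show ?case
    proof (cases "s = 1")
      case True
      then show ?thesis
        using Ext_vanishes_cokernel_approximation[of "K j" "Y j" "K (Suc j)" "i j" "p j" N'] S[of j] Yv
          ob[OF Suc.prems(4)] Suc.prems(4) by blast
    next
      case False
      then obtain s' where s': "s = Suc s'" "1 \<le> s'" using Suc.prems(1) by (cases s) auto
      then have "Ext_vanishes E s' (K j) N'" using Suc.IH[of s'] Suc.prems by simp
      then show ?thesis using Ext_vanishes_cokernel ob[OF Suc.prems(4)] S[of j] Yv s' by blast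
    qed
  qed
  have KM: "K n \<in> M"
    by (rule cluster_tilting_mem[OF ct Kob]) (use van in simp)
  show ?thesis
  proof (rule that[of "case_nat N K" "case_nat Y0 Y" "case_nat f i" "case_nat q p"])
    show "resolution E (case_nat N K) (case_nat Y0 Y) (case_nat f i) (case_nat q p) n"
      unfolding resolution_def
    proof (intro allI impI)
      fix j
      show "conf E (case_nat N K j) (case_nat Y0 Y j) (case_nat N K (Suc j)) (case_nat f i j) (case_nat q p j)"
        using c0 K(1) S by (cases j) auto
    qed
    show "case_nat N K (Suc n) \<in> M" using KM by simp
    show "case_nat Y0 Y j \<in> M" for j using Y0 S by (cases j) auto
  qed simp_all
qed

text \<open>
  The resolution is chosen such that \<open>a \<in> Ext\<^sup>k(X, N)\<close> dies in
  \<open>Ext\<^sup>k(X, Y\<^sub>0)\<close>. Then \<open>a\<close> comes from some \<open>b \<in>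
  Ext\<^sup>l(X, K\<^sub>r)\<close>, where \<open>k = l + r\<close> and \<open>l\<close> is the
  largest multiple of \<open>n + 1\<close> below \<open>k\<close>. Exactness of the long
  sequence at \<open>Ext\<^sup>l(X, Y\<^sub>r)\<close> makes \<open>b\<close> liftable to
  \<open>Ext\<^sup>l(X, Y\<^sub>r\<^sub>-\<^sub>1)\<close>, hence \<open>a = 0\<close>.
\<close>

lemma vanishing_if_cov_exact_row:
  assumes ct: "cluster_tilting E (Suc n) M" and n: "n \<ge> 1"
    and ex: "\<And>X ys q j. X \<in> M \<Longrightarrow> admissible_n_exact E (Suc n) M ys \<Longrightarrow> j < Suc n \<Longrightarrow>
      cov_exact_row E X ys (q * Suc n) j"
    and "\<not> Suc n dvd k" "X \<in> M" "N \<in> M"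
  shows "Ext_vanishes E k X N"
  using assms(4-6)
proof (induction k arbitrary: X N rule: less_induct)
  case (less k)
  note ob = cluster_tilting_obj[OF ct]
  have X: "X \<in> obj E" using ob[OF less.prems(2)] .
  define q r where "q = k div Suc n" and "r = k mod Suc n"
  have k: "k = q * Suc n + r" unfolding q_def r_def by (simp only: div_mult_mod_eq)
  have r: "1 \<le> r" "r \<le> n"
    using less.prems(1) by (auto simp: r_def dvd_eq_mod_eq_0 less_Suc_eq_le[symmetric] Suc_le_eq simp del: mod_less_eq_dividend)
  show ?case
  proof (cases "q = 0")
    case True
    then show ?thesis using cluster_tilting_vanishes[OF ct less.prems(2,3)] k r by simp
  next
    case False
    then obtain q' where q': "q = Suc q'" by (cases q) auto
    define l where "l = q * Suc n"
    have l0: "l > 0" "l < k" "k = l + r" using q' k r by (simp_all add: l_def)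
    show ?thesis
    proof (rule Ext_vanishesI[OF X ob[OF less.prems(3)]])
      fix a assume a: "a \<in> Ext_carrier E k X N"
      have "k > 0" using l0(2) by simp
      then obtain k' where k': "k = Suc k'" using gr0_implies_Suc by blast
      \<comment> \<open>the first inflation of an extension representing \<open>a\<close> kills \<open>a\<close>, and so does its composite with an approximation\<close>
      obtain B L t u g where t: "conf E N B L t u" "g \<in> Ext_carrier E k' X L" "a = con E k' t u g"
        using con_surj a unfolding k' by blast
      obtain Y0 D h w where h: "conf E B Y0 D h w" "Y0 \<in> M"
        using cluster_tilting_left_approximation[OF ct confD(12)[OF t(1)]] by metis
      have "inflation E (h \<cdot> t)"
        using inflation_comp[OF confD(14)[OF t(1)] confD(14)[OF h(1)]] confD[OF t(1)] confD[OF h(1)] by simp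
      then obtain D0 w0 where c0: "conf E N Y0 D0 (h \<cdot> t) w0"
        using inflation_conf comp_Hom[OF confD(2)[OF t(1)] confD(2)[OF h(1)]] by blast
      have "Ext_push E k (h \<cdot> t) a = Ext_push E k h (Ext_push E k t a)"
        using Ext_push_comp[OF confD(2)[OF t(1)] confD(2)[OF h(1)] a] .
      also have "\<dots> = Ext_zero E k X Y0"
        using push_con[OF t(1,2)] t(3) k' Ext_push_Ext_zero[OF confD(2)[OF h(1)] X] by simp
      finally have az: "Ext_push E k (h \<cdot> t) a = Ext_zero E k X Y0" .
      obtain K Y i p where R: "resolution E K Y i p n" "K 0 = N" "i 0 = h \<cdot> t" "Y 0 = Y0" "K (Suc n) \<in> M"
        "\<And>j. j \<le> n \<Longrightarrow> Y j \<in> M"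
        using cluster_tilting_resolution[OF ct n less.prems(3) c0 h(2)] by blast
      note so = seq_obj_spliced[OF R(1)] and c = resolutionD[OF R(1)]
      let ?ys = "spliced E i p n"
      have adm: "admissible_n_exact E (Suc n) M ?ys"
      proof -
        have "seq_obj E ?ys j \<in> M" if jn: "j \<le> Suc n + 1" for j
        proof -
          consider "j = 0" | "j = Suc (j - 1)" "j - 1 \<le> n" | "j = Suc (Suc n)"
            using jn by linarith
          then show ?thesis
          proof cases
            case 1
            then show ?thesis using so(1) R(2) less.prems(3) by simp
          next
            case 2
            then show ?thesis using so(2)[of "j - 1"] R(6)[of "j - 1"] by simp
          next
            case 3
            then show ?thesis using so(3) R(5) by simp
          qed
        qed
        then show ?thesis
          using spliced_extensions[OF R(1)] by (simp add: admissible_n_exact_def extensions_def)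
      qed
      have IH: "Ext_vanishes E m X (K (Suc n))" "j \<le> n \<Longrightarrow> Ext_vanishes E m X (Y j)"
        if "m < k" "\<not> Suc n dvd m" for m j
        using less.IH[OF that less.prems(2)] R(5,6) by blast+
      obtain r' where r': "r = Suc r'" "r' \<le> n" using r by (cases r) auto
      have V: "Ext_vanishes E (l + (r' - s)) X (Y (Suc s))" if "s < r'" for s
      proof (rule IH(2))
        show "l + (r' - s) < k" "Suc s \<le> n" using l0 r' that by auto
        have "(r' - s + q * Suc n) mod Suc n = r' - s" using that r' by (intro mod_add_mult) simp
        then show "\<not> Suc n dvd l + (r' - s)" using that by (simp add: dvd_eq_mod_eq_0 l_def add.commute)
      qed
      have "a \<in> Ext_carrier E (l + Suc r') X (K 0)"
        "Ext_push E (l + Suc r') (i 0) a = Ext_zero E (l + Suc r') X (Y 0)"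
        using a az R l0 r' by simp_all
      then obtain b where b: "b \<in> Ext_carrier E l X (K (Suc r'))" "chain_con E i p (Suc r') l b = a"
        by (rule chain_con_surj[OF R(1) _ _ r'(2) V]) (assumption | rule that)+
      have r'n: "Suc r' \<le> n" "r' \<le> n" using r r' by simp_all
      have cr: "conf E (K r') (Y r') (K (Suc r')) (i r') (p r')" using c r'n by simp
      have cr1: "conf E (K (Suc r')) (Y (Suc r')) (K (Suc (Suc r'))) (i (Suc r')) (p (Suc r'))"
        using c[OF r'n(1)] .
      define x where "x = Ext_push E l (i (Suc r')) b"
      have x: "x \<in> Ext_carrier E l X (Y (Suc r'))"
        unfolding x_def using Ext_push_closed[OF confD(2)[OF cr1] b(1)] .
      have px: "Ext_push E l (p (Suc r')) x = Ext_zero E l X (K (Suc (Suc r')))"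
        unfolding x_def using Ext_push_comp_zero[OF confD(2,3,4)[OF cr1] b(1)] .
      have "Ext_push E l (?ys ! Suc (Suc r')) x = Ext_zero E l X (seq_obj E ?ys (Suc (Suc (Suc r'))))"
      proof (cases "Suc r' = n")
        case True
        then show ?thesis using px nth_spliced(3)[of E i p n] so(3) by simp
      next
        case False
        then have lt: "Suc r' < n" using r'n by simp
        have cr2: "conf E (K (Suc (Suc r'))) (Y (Suc (Suc r'))) (K (Suc (Suc (Suc r'))))
          (i (Suc (Suc r'))) (p (Suc (Suc r')))" using c[of "Suc (Suc r')"] lt by simp
        show ?thesis
          using px nth_spliced(2)[OF lt, of E i p] so(2)[of "Suc (Suc r')"] lt
            Ext_push_comp[OF confD(3)[OF cr1] confD(2)[OF cr2] x] Ext_push_Ext_zero[OF confD(2)[OF cr2] X]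
          by simp
      qed
      moreover have "cov_exact_row E X ?ys l (Suc r')"
        unfolding l_def using ex[OF less.prems(2) adm] r'n by simp
      moreover have "seq_obj E ?ys (Suc (Suc r')) = Y (Suc r')" "seq_obj E ?ys (Suc r') = Y r'"
        "?ys ! Suc r' = i (Suc r') \<cdot> p r'"
        using so(2) r'n spliced_nth_le[OF r'n(1), of i p] by simp_all
      ultimately have "x \<in> Ext_push E l (i (Suc r') \<cdot> p r') ` Ext_carrier E l X (Y r')"
        using x unfolding cov_exact_row_def by auto
      then obtain e where e: "e \<in> Ext_carrier E l X (Y r')" "Ext_push E l (i (Suc r') \<cdot> p r') e = x" by blast
      \<comment> \<open>the kernel of \<open>Ext\<^sup>l(X, K\<^sub>r) \<rightarrow> Ext\<^sup>l(X, Y\<^sub>r)\<close> is a quotient of this group\<close>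
      have VK: "Ext_vanishes E (l - 1) X (K (Suc (Suc r')))"
      proof (rule resolution_vanishes_from_right[OF R(1) X, of k])
        have "l - 1 = n + q' * Suc n" using q' by (simp add: l_def)
        then have "(l - 1) mod Suc n = n" using mod_add_mult[of n "Suc n" q'] by simp
        then show "Suc n - Suc (Suc r') < (l - 1) mod Suc n" using r'n by simp
        show "l - 1 < k" "Suc (Suc r') \<le> Suc n" using l0 r'n by simp_all
      qed (use IH in blast)+
      have "Ext_push E l (p r') e = b"
      proof (rule Ext_push_inj[OF confD(2)[OF cr1] _ Ext_push_closed[OF confD(3)[OF cr] e(1)] b(1)])
        show "Ext_push E l (i (Suc r')) (Ext_push E l (p r') e) = Ext_push E l (i (Suc r')) b"
          using Ext_push_comp[OF confD(3)[OF cr] confD(2)[OF cr1] e(1)] e(2) by (simp add: x_def)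
        show "y = Ext_zero E l X (K (Suc r'))"
          if "y \<in> Ext_carrier E l X (K (Suc r'))" "Ext_push E l (i (Suc r')) y = Ext_zero E l X (Y (Suc r'))" for y
          using inflation_push_trivial_kernel[OF cr1 that] VK by blast
      qed
      then have "con E l (i r') (p r') b = Ext_zero E (Suc l) X (K r')" using con_push[OF cr e(1)] by simp
      then have "a = Ext_zero E (Suc l + r') X (K 0)"
        using b(2) chain_con_zero[OF R(1) _ X, of r' "Suc l"] r'n by simp
      then show "a = Ext_zero E k X N" using R(2) l0(3) r'(1) by simp
    qed
  qed
qed

lemma Z_cluster_tilting_iff_cov:
  assumes n: "n \<ge> 1" and ct: "cluster_tilting E n M"
  shows "Z_cluster_tilting E n M \<longleftrightarrow>
    (\<forall>X\<in>M. \<forall>ys. admissible_n_exact E n M ys \<longrightarrow> long_exact (cov_group E n X ys) (cov_map E n ys))"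
proof
  assume Z: "Z_cluster_tilting E n M"
  show "\<forall>X\<in>M. \<forall>ys. admissible_n_exact E n M ys \<longrightarrow> long_exact (cov_group E n X ys) (cov_map E n ys)"
  proof (intro ballI allI impI)
    fix X ys assume X: "X \<in> M" and a: "admissible_n_exact E n M ys"
    show "long_exact (cov_group E n X ys) (cov_map E n ys)"
    proof (rule long_exact_cov_if_vanishing[OF n])
      show "acyclic_seq E ys" "length ys = n + 1" using a by (auto simp: admissible_n_exact_def)
      show "X \<in> obj E" using cluster_tilting_obj[OF ct X] .
      show "Ext_vanishes E m X (seq_obj E ys j)" if "\<not> n dvd m" "j \<le> n + 1" for m j
        using Z a X that unfolding Z_cluster_tilting_def admissible_n_exact_def by blast
    qed
  qed
next
  assume ex: "\<forall>X\<in>M. \<forall>ys. admissible_n_exact E n M ys \<longrightarrow> long_exact (cov_group E n X ys) (cov_map E n ys)"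
  show "Z_cluster_tilting E n M"
  proof (cases "n = 1")
    case True
    then show ?thesis using ct by (simp add: Z_cluster_tilting_def)
  next
    case False
    then obtain n' where n': "n = Suc n'" "n' \<ge> 1" using n by (cases n) auto
    have "cov_exact_row E X ys (q * Suc n') j"
      if "X \<in> M" "admissible_n_exact E (Suc n') M ys" "j < Suc n'" for X ys q j
    proof -
      have "long_exact (cov_group E n X ys) (cov_map E n ys)" using ex that n' by blast
      from iffD1[OF long_exact_cov_iff[OF n] this, THEN conjunct2, THEN spec[where x = q], THEN conjunct1]
      show ?thesis using that(3) n' by simp
    qed
    then have "Ext_vanishes E k X N" if "\<not> n dvd k" "X \<in> M" "N \<in> M" for k X N
      using vanishing_if_cov_exact_row[OF ct[unfolded n'(1)] n'(2)] that n'(1) by blast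
    then show ?thesis using ct unfolding Z_cluster_tilting_def by blast
  qed
qed

end

theorem theorem1p1:
  fixes E :: "('o, 'm) exact_cat" and n :: nat and M :: "'o set"
  assumes "exact_category E"
    and "n \<ge> 1"
    and "cluster_tilting E n M"
  shows "(Z_cluster_tilting E n M \<longleftrightarrow>
      (\<forall>X\<in>M. \<forall>ys. admissible_n_exact E n M ys \<longrightarrow>
        long_exact (cov_group E n X ys) (cov_map E n ys)))
    \<and> (Z_cluster_tilting E n M \<longleftrightarrow>
      (\<forall>Y\<in>M. \<forall>xs. admissible_n_exact E n M xs \<longrightarrow>
        long_exact (contra_group E n xs Y) (contra_map E n xs)))"
proof -
  interpret exact_category_without_extra_fields E
    by (rule exact_category_without_extra_fields.intro) fact
  note n = assms(2) and ct = assms(3)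
  have op: "long_exact (cov_group (op_cat E) n Y (rev xs)) (cov_map (op_cat E) n (rev xs))
      \<longleftrightarrow> long_exact (contra_group E n xs Y) (contra_map E n xs)"
    if "Y \<in> M" "admissible_n_exact E n M xs" for Y xs
    using long_exact_contra_iff_op[OF n] cluster_tilting_obj[OF ct that(1)] that(2)
    by (simp add: admissible_n_exact_def)
  have adm: "admissible_n_exact E n M (rev xs)" if "admissible_n_exact (op_cat E) n M xs" for xs
    using exact_category_without_extra_fields.admissible_n_exact_op[OF op_without_extra_fields that] by simp
  have "Z_cluster_tilting E n M \<longleftrightarrow> Z_cluster_tilting (op_cat E) n M"
    using Z_cluster_tilting_op[OF ct] by simp
  also have "\<dots> \<longleftrightarrow> (\<forall>Y\<in>M. \<forall>xs. admissible_n_exact (op_cat E) n M xs \<longrightarrow>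
      long_exact (cov_group (op_cat E) n Y xs) (cov_map (op_cat E) n xs))"
    by (rule exact_category_without_extra_fields.Z_cluster_tilting_iff_cov[OF op_without_extra_fields n
          cluster_tilting_op[OF ct]])
  also have "\<dots> \<longleftrightarrow> (\<forall>Y\<in>M. \<forall>xs. admissible_n_exact E n M xs \<longrightarrow>
      long_exact (contra_group E n xs Y) (contra_map E n xs))"
    using op admissible_n_exact_op adm by (metis rev_rev_ident)
  finally show ?thesis using Z_cluster_tilting_iff_cov[OF n ct] by blast
qed

end
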